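(* Let $d\in\mathbb N$, let $\Omega\subset\mathbb R^d$ be a bounded domain with boundary of class $C^{1,1}$, and let $0<T<\infty$. Let $K:\mathbb R^d\to\mathbb R$ be measurable with $K(x)=K(-x)$ for a.a. $x\in\mathbb R^d$; $\sup_{x\in\Omega}\int_\Omega|K(x-y)|\,dy<\infty$; for every $p\in[1,\infty]$ there is $r_p>0$ such that $\|K*\rho\|_{W^{1,p}(\Omega)}\le r_p\|\rho\|_{L^p(\Omega)}$ for all $\rho\in L^p(\Omega)$; and there is $C_K>0$ such that $\|K*\rho\|_{W^{2,2}(\Omega)}\le C_K\|\rho\|_{W^{1,2}(\Omega)}$ for all $\rho\in W^{1,2}(\Omega)$. Let $g:\Omega\times[0,\infty)\times[0,1]\to\mathbb R$ be continuous, such that for some $L>0$, $|g(x,t,s_1)-g(x,t,s_2)|\le L|s_1-s_2|$ for all $x\in\Omega$, $t\ge0$, $s_1,s_2\in[0,1]$, and such that $g(x,t,0)\ge0\ge g(x,t,1)$ for all $x\in\Omega$, $t\ge0$. Let $u_0:\Omega\to\mathbb R$ be measurable with $0\le u_0\le1$ a.e. in $\Omega$ and $0<\bar u_0<1$. Assume moreover that $f'(u_0)\in L^2(\Omega)$, where $f(s)=s\log s+(1-s)\log(1-s)$. Let $u$ be the weak solution on $[0,T]$ (in the sense of the context) with initial datum $u_0$. Then $v:=f'(u)+K*(1-2u)$ satisfies $$v\in L^\infty(0,T,L^2(\Omega)),\qquad \nabla v\in L^2(0,T,L^2(\Omega)).$$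
   Context: Notation: $Q=\Omega\times(0,T)$; $(\cdot,\cdot)$ is the $L^2(\Omega)$ inner product; $\langle\cdot,\cdot\rangle$ is the duality pairing between $(H^1(\Omega))^*$ and $H^1(\Omega)$; $\bar z=\langle z,1/|\Omega|\rangle$ (the mean value, for integrable $z$); $K*\rho(x)=\int_\Omega K(x-y)\rho(y)\,dy$; $\mu(s)=s(1-s)$; $g(u)$ denotes $(x,t)\mapsto g(x,t,u(x,t))$. Here $f'(s)=\log\frac{s}{1-s}$ for $s\in(0,1)$ and $|f'|=+\infty$ at $s=0,1$, so that a statement that $f'(u_0)$ or $v$ belongs to an $L^p$-type space includes that $u_0$, respectively $u$, takes values in $(0,1)$ almost everywhere. For a Banach space $X$, $H^1(0,T,X,X^* )=\{z\in L^2(0,T,X): z_t\in L^2(0,T,X^* )\}$; $H^1(0,T,H^1(\Omega),(H^1(\Omega))^* )$ embeds in $C([0,T],L^2(\Omega))$. Weak solution (of the nonlocal Cahn–Hilliard problem with reaction $\partial_t u-\nabla\cdot(\mu(u)\nabla v)=g(u)$, $v=f'(u)+w$, $w=K*(1-2u)$, no-flux boundary condition, $u(0)=u_0$): $u$ is a weak solution on $[0,T]$ with initial datum $u_0$ if $u\in H^1(0,T,H^1(\Omega),(H^1(\Omega))^* )$; $0\le u\le1$ a.e. in $Q$; $w:=K*(1-2u)$ belongs to $C([0,T],W^{1,\infty}(\Omega))$; $u(0)=u_0$ in $L^2(\Omega)$; and for a.e. $t\in(0,T)$ and every $\psi\in H^1(\Omega)$, $$\langle u_t,\psi\rangle+(\mu(u)\nabla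 w,\nabla\psi)+(\nabla u,\nabla\psi)=(g(u),\psi).$$ Under the stated hypotheses on $\Omega,T,K,g,u_0$ such a weak solution exists and is unique. *)

theory Defs
  imports "HOL-Analysis.Analysis" "HOL-Probability.Essential_Supremum"
begin

text \<open>A space of functions (elements are representatives, identified when their difference has
  seminorm 0). Since functionals on such a space are again functions, its dual is of the same kind.\<close>

record ('c, 'e) fspace =
  vecs :: "('c \<Rightarrow> 'e) set"
  nrm  :: "('c \<Rightarrow> 'e) \<Rightarrow> real"

definition dual_space :: "('c, 'e::real_vector) fspace \<Rightarrow> ('c \<Rightarrow> 'e, real) fspace" where
  "dual_space X = \<lparr>
     vecs = {\<phi>. (\<forall>f\<in>vecs X. \<forall>h\<in>vecs X. \<forall>a b.
                   \<phi> (\<lambda>x. a *\<^sub>R f x + b *\<^sub>R h x) = a * \<phi> f + b * \<phi> h) \<and>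
                (\<exists>C. \<forall>f\<in>vecs X. \<bar>\<phi> f\<bar> \<le> C * nrm X f)},
     nrm = (\<lambda>\<phi>. SUP f\<in>{f \<in> vecs X. nrm X f \<le> 1}. \<bar>\<phi> f\<bar>) \<rparr>"

definition Lp_space :: "'a measure \<Rightarrow> ennreal \<Rightarrow> ('a, 'e::euclidean_space) fspace" where
  "Lp_space M p = \<lparr>
     vecs = {f \<in> borel_measurable M.
               if p = \<infinity> then esssup M (\<lambda>x. ereal (norm (f x))) < \<infinity>
               else integrable M (\<lambda>x. norm (f x) powr enn2real p)},
     nrm = (\<lambda>f. if p = \<infinity> then real_of_ereal (esssup M (\<lambda>x. ereal (norm (f x))))
               else (\<integral>x. norm (f x) powr enn2real p \<partial>M) powr (1 / enn2real p)) \<rparr>"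

primrec C_k :: "nat \<Rightarrow> ('a::euclidean_space \<Rightarrow> real) \<Rightarrow> bool" where
  "C_k 0 f \<longleftrightarrow> continuous_on UNIV f"
| "C_k (Suc k) f \<longleftrightarrow> (\<forall>x. f differentiable (at x)) \<and>
     (\<forall>b\<in>Basis. C_k k (\<lambda>x. frechet_derivative f (at x) b))"

definition test_functions :: "'a::euclidean_space set \<Rightarrow> ('a \<Rightarrow> real) set" where
  "test_functions \<Omega> = {\<phi>. (\<forall>k. C_k k \<phi>) \<and>
     compact (closure {x. \<phi> x \<noteq> 0}) \<and> closure {x. \<phi> x \<noteq> 0} \<subseteq> \<Omega>}"

definition locally_integrable_on :: "('a::euclidean_space \<Rightarrow> real) \<Rightarrow> 'a set \<Rightarrow> bool" where
  "locally_integrable_on f \<Omega> \<longleftrightarrow>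
     (\<forall>C. compact C \<and> C \<subseteq> \<Omega> \<longrightarrow> f absolutely_integrable_on C)"

definition has_weak_partial ::
  "'a::euclidean_space set \<Rightarrow> 'a \<Rightarrow> ('a \<Rightarrow> real) \<Rightarrow> ('a \<Rightarrow> real) \<Rightarrow> bool" where
  "has_weak_partial \<Omega> b f h \<longleftrightarrow> locally_integrable_on f \<Omega> \<and> locally_integrable_on h \<Omega> \<and>
     (\<forall>\<phi>\<in>test_functions \<Omega>.
        (\<integral>x. f x * frechet_derivative \<phi> (at x) b \<partial>lebesgue_on \<Omega>)
          = - (\<integral>x. h x * \<phi> x \<partial>lebesgue_on \<Omega>))"

definition weakly_differentiable :: "'a::euclidean_space set \<Rightarrow> ('a \<Rightarrow> real) \<Rightarrow> bool" where
  "weakly_differentiable \<Omega> f \<longleftrightarrow> (\<forall>b\<in>Basis. \<exists>h. has_weak_partial \<Omega> b f h)"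

text \<open>Weak partial derivatives are unique only up to null sets; \<open>weak_partial\<close> and \<open>weak_grad\<close>
  pick some representative and are meaningful for weakly differentiable functions only.\<close>

definition weak_partial ::
  "'a::euclidean_space set \<Rightarrow> 'a \<Rightarrow> ('a \<Rightarrow> real) \<Rightarrow> 'a \<Rightarrow> real" where
  "weak_partial \<Omega> b f = (SOME h. has_weak_partial \<Omega> b f h)"

definition weak_grad :: "'a::euclidean_space set \<Rightarrow> ('a \<Rightarrow> real) \<Rightarrow> 'a \<Rightarrow> 'a" where
  "weak_grad \<Omega> f x = (\<Sum>b\<in>Basis. weak_partial \<Omega> b f x *\<^sub>R b)"

primrec Sobolev_vecs ::
  "nat \<Rightarrow> ennreal \<Rightarrow> 'a::euclidean_space set \<Rightarrow> ('a \<Rightarrow> real) set" where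
  "Sobolev_vecs 0 p \<Omega> = vecs (Lp_space (lebesgue_on \<Omega>) p)"
| "Sobolev_vecs (Suc k) p \<Omega> = {f \<in> vecs (Lp_space (lebesgue_on \<Omega>) p).
     \<forall>b\<in>Basis. \<exists>h\<in>Sobolev_vecs k p \<Omega>. has_weak_partial \<Omega> b f h}"

text \<open>This is the sum of the \<open>L\<^sup>p\<close> norms of the iterated weak derivatives, which is
  equivalent to the other usual choices of Sobolev norm.\<close>

primrec Sobolev_nrm ::
  "nat \<Rightarrow> ennreal \<Rightarrow> 'a::euclidean_space set \<Rightarrow> ('a \<Rightarrow> real) \<Rightarrow> real" where
  "Sobolev_nrm 0 p \<Omega> f = nrm (Lp_space (lebesgue_on \<Omega>) p) f"
| "Sobolev_nrm (Suc k) p \<Omega> f = nrm (Lp_space (lebesgue_on \<Omega>) p) f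
     + (\<Sum>b\<in>Basis. Sobolev_nrm k p \<Omega> (weak_partial \<Omega> b f))"

definition Sobolev ::
  "nat \<Rightarrow> ennreal \<Rightarrow> 'a::euclidean_space set \<Rightarrow> ('a, real) fspace" where
  "Sobolev k p \<Omega> = \<lparr> vecs = Sobolev_vecs k p \<Omega>, nrm = Sobolev_nrm k p \<Omega> \<rparr>"

abbreviation H1 :: "'a::euclidean_space set \<Rightarrow> ('a, real) fspace" where
  "H1 \<Omega> \<equiv> Sobolev 1 2 \<Omega>"

definition strongly_measurable ::
  "real \<Rightarrow> ('c, 'e::ab_group_add) fspace \<Rightarrow> (real \<Rightarrow> 'c \<Rightarrow> 'e) \<Rightarrow> bool" where
  "strongly_measurable T X z \<longleftrightarrow>
     (\<exists>s. (\<forall>n. simple_function (lebesgue_on {0<..<T}) (s n)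
                \<and> (\<forall>t\<in>{0<..<T}. s n t \<in> vecs X)) \<and>
          (AE t in lebesgue_on {0<..<T}.
             (\<lambda>n::nat. nrm X (\<lambda>x. s n t x - z t x)) \<longlonglongrightarrow> 0))"

definition Bochner_Lp ::
  "real \<Rightarrow> ennreal \<Rightarrow> ('c, 'e::ab_group_add) fspace \<Rightarrow> (real \<Rightarrow> 'c \<Rightarrow> 'e) set" where
  "Bochner_Lp T p X = {z.
     (AE t in lebesgue_on {0<..<T}. z t \<in> vecs X) \<and> strongly_measurable T X z \<and>
     (\<lambda>t. nrm X (z t)) \<in> vecs (Lp_space (lebesgue_on {0<..<T}) p)}"

definition C_time ::
  "real \<Rightarrow> ('c, 'e::ab_group_add) fspace \<Rightarrow> (real \<Rightarrow> 'c \<Rightarrow> 'e) set" where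
  "C_time T X = {z. (\<forall>t\<in>{0..T}. z t \<in> vecs X) \<and>
     (\<forall>t\<in>{0..T}. ((\<lambda>s. nrm X (\<lambda>x. z s x - z t x)) \<longlongrightarrow> 0) (at t within {0..T}))}"

text \<open>For a function given for almost every time only, both membership in \<open>C([0,T],X)\<close> and
  values at a given time refer to a continuous representative.\<close>

definition continuous_representative ::
  "real \<Rightarrow> ('c, 'e::ab_group_add) fspace \<Rightarrow> (real \<Rightarrow> 'c \<Rightarrow> 'e) \<Rightarrow> (real \<Rightarrow> 'c \<Rightarrow> 'e) \<Rightarrow> bool"
where
  "continuous_representative T X z z' \<longleftrightarrow> z' \<in> C_time T X \<and>
     (AE t in lebesgue_on {0<..<T}. z t \<in> vecs X \<and> nrm X (\<lambda>x. z' t x - z t x) = 0)"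

text \<open>\<open>\<xi>\<close> is the distributional time derivative of \<open>z\<close> as a function with values in the dual of
  \<open>H1 \<Omega>\<close>, where \<open>z t\<close> is identified with its \<open>L\<^sup>2\<close> pairing; the identity between the
  dual-valued Bochner integrals is evaluated at each \<open>\<psi>\<close>.\<close>

definition has_time_derivative ::
  "'a::euclidean_space set \<Rightarrow> real \<Rightarrow> (real \<Rightarrow> 'a \<Rightarrow> real) \<Rightarrow> (real \<Rightarrow> ('a \<Rightarrow> real) \<Rightarrow> real) \<Rightarrow> bool"
where
  "has_time_derivative \<Omega> T z \<xi> \<longleftrightarrow>
     (\<forall>\<phi>\<in>test_functions {0<..<T}. \<forall>\<psi>\<in>vecs (H1 \<Omega>).
        (\<integral>t. (\<integral>x. z t x * \<psi> x \<partial>lebesgue_on \<Omega>) * deriv \<phi> t \<partial>lebesgue_on {0<..<T})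
          = - (\<integral>t. \<xi> t \<psi> * \<phi> t \<partial>lebesgue_on {0<..<T}))"

text \<open>Near each boundary point the set is the strict epigraph, in some direction \<open>e\<close>, of a
  \<open>C\<^sup>1\<^sup>,\<^sup>1\<close> function of the coordinates orthogonal to \<open>e\<close>. Such a function is represented by
  a function \<open>\<gamma>\<close> on the whole space which is constant along \<open>e\<close>.\<close>

definition C11_boundary :: "'a::euclidean_space set \<Rightarrow> bool" where
  "C11_boundary \<Omega> \<longleftrightarrow> (\<forall>x0\<in>frontier \<Omega>. \<exists>r>0. \<exists>e \<gamma> G M.
     norm e = 1 \<and> (\<forall>x s. \<gamma> (x + s *\<^sub>R e) = \<gamma> x) \<and>
     (\<forall>x. (\<gamma> has_derivative (\<lambda>h. G x \<bullet> h)) (at x)) \<and> M-lipschitz_on UNIV G \<and>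
     \<Omega> \<inter> ball x0 r = {x \<in> ball x0 r. \<gamma> x < x \<bullet> e})"

definition convol ::
  "('a::euclidean_space \<Rightarrow> real) \<Rightarrow> 'a set \<Rightarrow> ('a \<Rightarrow> real) \<Rightarrow> 'a \<Rightarrow> real" where
  "convol K \<Omega> \<rho> x = (\<integral>y. K (x - y) * \<rho> y \<partial>lebesgue_on \<Omega>)"

definition mean_value :: "'a::euclidean_space set \<Rightarrow> ('a \<Rightarrow> real) \<Rightarrow> real" where
  "mean_value \<Omega> z = (\<integral>x. z x * (1 / measure lebesgue \<Omega>) \<partial>lebesgue_on \<Omega>)"

definition mobility :: "real \<Rightarrow> real" where
  "mobility s = s * (1 - s)"

definition f_entropy :: "real \<Rightarrow> real" where
  "f_entropy s = s * ln s + (1 - s) * ln (1 - s)"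

text \<open>Only meaningful for \<open>0 < s < 1\<close>: as \<open>ln\<close> and division are total, the value of \<open>f_prime\<close> at
  0 and 1 is finite, so that \<open>0 < u < 1\<close> has to be required separately.\<close>

definition f_prime :: "real \<Rightarrow> real" where
  "f_prime s = ln (s / (1 - s))"

lemma f_entropy_has_derivative:
  assumes "0 < s" "s < 1"
  shows "(f_entropy has_real_derivative f_prime s) (at s)"
proof -
  have "((\<lambda>s. s * ln s + (1 - s) * ln (1 - s)) has_real_derivative f_prime s) (at s)"
    using assms
    by (auto intro!: derivative_eq_intros simp: f_prime_def ln_div)
  then show ?thesis
    by (simp add: f_entropy_def[abs_def])
qed

definition nonlocal_w ::
  "('a::euclidean_space \<Rightarrow> real) \<Rightarrow> 'a set \<Rightarrow> ('a \<times> real \<Rightarrow> real) \<Rightarrow> real \<Rightarrow> 'a \<Rightarrow> real" where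
  "nonlocal_w K \<Omega> u t = convol K \<Omega> (\<lambda>y. 1 - 2 * u (y, t))"

definition potential_v ::
  "('a::euclidean_space \<Rightarrow> real) \<Rightarrow> 'a set \<Rightarrow> ('a \<times> real \<Rightarrow> real) \<Rightarrow> real \<Rightarrow> 'a \<Rightarrow> real" where
  "potential_v K \<Omega> u t x = f_prime (u (x, t)) + nonlocal_w K \<Omega> u t x"

definition weak_solution ::
  "'a::euclidean_space set \<Rightarrow> real \<Rightarrow> ('a \<Rightarrow> real) \<Rightarrow> ('a \<Rightarrow> real \<Rightarrow> real \<Rightarrow> real) \<Rightarrow> ('a \<Rightarrow> real)
     \<Rightarrow> ('a \<times> real \<Rightarrow> real) \<Rightarrow> bool"
where
  "weak_solution \<Omega> T K g u0 u \<longleftrightarrow>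
     u \<in> borel_measurable (lebesgue_on (\<Omega> \<times> {0<..<T})) \<and>
     (\<lambda>t x. u (x, t)) \<in> Bochner_Lp T 2 (H1 \<Omega>) \<and>
     (AE z in lebesgue_on (\<Omega> \<times> {0<..<T}). 0 \<le> u z \<and> u z \<le> 1) \<and>
     (\<exists>w'. continuous_representative T (Sobolev 1 \<infinity> \<Omega>) (nonlocal_w K \<Omega> u) w') \<and>
     (\<exists>u'. continuous_representative T (Lp_space (lebesgue_on \<Omega>) 2) (\<lambda>t x. u (x, t)) u' \<and>
        (AE x in lebesgue_on \<Omega>. u' 0 x = u0 x)) \<and>
     (\<exists>\<xi>\<in>Bochner_Lp T 2 (dual_space (H1 \<Omega>)).
        has_time_derivative \<Omega> T (\<lambda>t x. u (x, t)) \<xi> \<and>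
        (AE t in lebesgue_on {0<..<T}. \<forall>\<psi>\<in>vecs (H1 \<Omega>).
           \<xi> t \<psi>
           + (\<integral>x. (mobility (u (x, t)) *\<^sub>R weak_grad \<Omega> (nonlocal_w K \<Omega> u t) x)
                   \<bullet> weak_grad \<Omega> \<psi> x \<partial>lebesgue_on \<Omega>)
           + (\<integral>x. weak_grad \<Omega> (\<lambda>y. u (y, t)) x \<bullet> weak_grad \<Omega> \<psi> x \<partial>lebesgue_on \<Omega>)
           = (\<integral>x. g x t (u (x, t)) * \<psi> x \<partial>lebesgue_on \<Omega>)))"

end

theory Submission
  imports Defs
begin

text \<open>Write \<open>F(s) = ln ((s + \<delta>) / (1 - s + \<delta>))\<close> for a regularization of \<open>f'\<close>. Testing the equation
  with \<open>F(u) F'(u)\<close> controls \<open>1/2 \<integral> F(u)\<^sup>2\<close>: as \<open>\<mu> f'' = 1\<close>, the drift is absorbed by the diffusion, and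
  as \<open>- L s \<le> g(s) \<le> L (1 - s)\<close>, the reaction term grows at most linearly in \<open>F(u)\<close>. Gronwall's
  inequality bounds \<open>F(u)\<close> and \<open>\<nabla>F(u)\<close> uniformly in \<open>\<delta>\<close>, and Fatou's lemma yields the bounds for
  \<open>f'(u)\<close>, in particular \<open>0 < u < 1\<close>.

  No chain rule for \<open>\<langle>u\<^sub>t, F(u) F'(u)\<rangle>\<close> is used. Since \<open>F\<^sup>2\<close> is convex, \<open>1/2 \<integral> F(u(t))\<^sup>2 - F(u(s))\<^sup>2\<close> is at most the
  integral of \<open>\<langle>u\<^sub>t(\<tau>), F(u(t)) F'(u(t))\<rangle>\<close> over \<open>\<tau>\<close> in \<open>[s, t]\<close>, and the error of replacing \<open>u(\<tau>)\<close> by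
  \<open>u(t)\<close> in the weak equation disappears after averaging over \<open>t\<close> with \<open>t - s\<close> tending to 0.\<close>

subsection \<open>Test functions and locally integrable functions\<close>

text \<open>A priori \<open>u\<close> is only known to lie in [0, 1], so f'(u) might be infinite on
  a set of positive measure. The regularization makes F(u) F'(u) a bounded function in
  \<open>H1\<close> and thus an admissible test function for each fixed \<delta>. Two kinds of
  constants have to be kept apart. Those in front of the energy depend only on \<open>L\<close>, on
  the pointwise bound \<open>R\<close> of \<nabla>w (the kernel hypothesis with p = \<infinity>), on
  the measure of the domain, on \<open>T\<close> and on the L2 norm of f'(u0); they survive the
  limit. Bounds on the multiplier and its derivative blow up as \<delta> tends to 0, but they only
  multiply the distance between u(\<tau>) and u(t), which averaging removes before \<delta> moves.
  The Sobolev chain rule is obtained without mollification: a weak derivative integrates along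
  segments, so the difference quotient of F(u) is that of F along a known increment.\<close>

lemma frechet_derivative_eqI:
  "(f has_derivative f') (at x) \<Longrightarrow> frechet_derivative f (at x) = f'"
  using frechet_derivative_at by metis

lemma C_k_SucI:
  assumes "\<And>x. (f has_derivative f' x) (at x)" "\<And>b. b \<in> Basis \<Longrightarrow> C_k k (\<lambda>x. f' x b)"
  shows "C_k (Suc k) f"
proof -
  have "frechet_derivative f (at x) = f' x" for x
    using assms(1) by (rule frechet_derivative_eqI)
  then show ?thesis using assms by (auto simp: differentiable_def)
qed

lemma C_k_Suc_D: "C_k (Suc k) f \<Longrightarrow> C_k k f"
proof (induction k arbitrary: f)
  case 0
  then show ?case
    by (auto intro!: differentiable_imp_continuous_on simp: differentiable_on_def)
next
  case (Suc k)
  then show ?case by (metis C_k.simps(2))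
qed

lemma C_k_const: "C_k k (\<lambda>x. c)"
proof (induction k arbitrary: c)
  case (Suc k)
  show ?case by (rule C_k_SucI[where f' = "\<lambda>x b. 0"]) (auto intro: Suc)
qed simp

lemma C_k_Suc_has_derivative:
  "C_k (Suc k) f \<Longrightarrow> (f has_derivative frechet_derivative f (at x)) (at x)"
  by (simp add: frechet_derivative_works[symmetric])

lemma C_k_add: "C_k k f \<Longrightarrow> C_k k g \<Longrightarrow> C_k k (\<lambda>x. f x + g x)"
proof (induction k arbitrary: f g)
  case 0 then show ?case by (auto intro: continuous_intros)
next
  case (Suc k)
  show ?case
    by (rule C_k_SucI, rule has_derivative_add[OF Suc.prems[THEN C_k_Suc_has_derivative]])
       (use Suc in auto)
qed

lemma C_k_mult: "C_k k f \<Longrightarrow> C_k k g \<Longrightarrow> C_k k (\<lambda>x. f x * g x)"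
proof (induction k arbitrary: f g)
  case 0 then show ?case by (auto intro: continuous_intros)
next
  case (Suc k)
  show ?case
    by (rule C_k_SucI, rule has_derivative_mult[OF Suc.prems[THEN C_k_Suc_has_derivative]])
       (use Suc Suc.prems[THEN C_k_Suc_D] in \<open>auto intro!: C_k_add Suc.IH\<close>)
qed

lemma C_k_prod: "(\<And>i. i \<in> I \<Longrightarrow> C_k k (f i)) \<Longrightarrow> C_k k (\<lambda>x. \<Prod>i\<in>I. f i x)"
  by (induction I rule: infinite_finite_induct) (auto intro: C_k_const C_k_mult)

text \<open>Taking the whole sequence of successive derivatives as hypothesis lets the induction
  close: a differentiation in direction b raises the index by one and multiplies by the constant b
  \<bullet> a.\<close>

lemma C_k_compose_affine:
  fixes H :: "nat \<Rightarrow> real \<Rightarrow> real"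
  assumes H: "\<And>j x. (H j has_real_derivative H (Suc j) x) (at x)"
  shows "C_k k (\<lambda>x. H j (x \<bullet> a + c))"
proof (induction k arbitrary: j)
  case 0
  have "continuous_on UNIV (H j)" 
    using H by (meson DERIV_isCont continuous_at_imp_continuous_on)
  then show ?case
    by (auto intro!: continuous_intros continuous_on_compose2[of UNIV "H j"])
next
  case (Suc k)
  have "((\<lambda>x. H j (x \<bullet> a + c)) has_derivative (\<lambda>b. H (Suc j) (x \<bullet> a + c) * (b \<bullet> a))) (at x)" for x
  proof -
    have 1: "((\<lambda>x. x \<bullet> a + c) has_derivative (\<lambda>b. b \<bullet> a)) (at x)"
      by (auto intro!: derivative_eq_intros)
    have 2: "(H j has_derivative (*) (H (Suc j) (x \<bullet> a + c))) (at (x \<bullet> a + c))"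
      using H[of j "x \<bullet> a + c"] by (simp add: has_field_derivative_def)
    show ?thesis using has_derivative_compose[OF 1 2] .
  qed
  then show ?case
    by (rule C_k_SucI) (auto intro!: C_k_mult Suc C_k_const)
qed

section \<open>Smooth bump functions approximating indicators of boxes\<close>

definition exp_bump :: "real poly \<Rightarrow> real \<Rightarrow> real" where
  "exp_bump p s = (if s \<le> 0 then 0 else poly p (1 / s) * exp (- (1 / s)))"

lemma tendsto_poly_exp_0: "((\<lambda>y. poly p y * exp (- y)) \<longlongrightarrow> (0::real)) at_top"
proof -
  have "((\<lambda>y. \<Sum>i\<le>degree p. coeff p i * (y ^ i / exp y)) \<longlongrightarrow> (\<Sum>i\<le>degree p. coeff p i * 0)) at_top"
    by (intro tendsto_intros tendsto_power_div_exp_0)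
  then show ?thesis
    by (simp add: poly_altdef sum_distrib_right exp_minus divide_inverse mult.assoc)
qed

lemma glue_has_real_derivative:
  fixes f g :: "real \<Rightarrow> real"
  assumes "(f has_real_derivative D) (at a)" "(g has_real_derivative D) (at a)" "f a = g a"
  shows "((\<lambda>x. if x \<le> a then f x else g x) has_real_derivative D) (at a)"
proof -
  let ?h = "\<lambda>x. if x \<le> a then f x else g x"
  have "((\<lambda>x. (f x - f a) / (x - a)) \<longlongrightarrow> D) (at_left a)"
       "((\<lambda>x. (g x - g a) / (x - a)) \<longlongrightarrow> D) (at_right a)"
    using assms(1,2) by (auto simp: has_field_derivative_iff filterlim_at_split)
  then have "((\<lambda>x. (?h x - ?h a) / (x - a)) \<longlongrightarrow> D) (at_left a) \<and>
       ((\<lambda>x. (?h x - ?h a) / (x - a)) \<longlongrightarrow> D) (at_right a)"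
    by (intro conjI; elim Lim_transform_eventually)
       (auto simp: eventually_at_filter assms(3) intro!: always_eventually)
  then show ?thesis by (simp add: has_field_derivative_iff filterlim_at_split)
qed

text \<open>In the variable y = 1/s, with dy/ds = - y^2, the function is p(y) exp(-y), which
  produces the new polynomial y^2 (p - p'). The family is thus closed under differentiation, the
  reason for the polynomial parameter. At s = 0 both one-sided difference quotients tend to 0, since
  exponential decay beats y p(y).\<close>

lemma exp_bump_deriv:
  "(exp_bump p has_real_derivative exp_bump (monom 1 2 * (p - pderiv p)) s) (at s)"
proof -
  consider "s < 0" | "s = 0" | "s > 0" by linarith
  then show ?thesis
  proof cases
    case 1
    then have "\<forall>\<^sub>F x in nhds s. exp_bump p x = 0"
      using eventually_nhds_in_open[of "{..<0}" s]
      by (auto elim!: eventually_mono simp: exp_bump_def)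
    then show ?thesis using 1
      by (subst DERIV_cong_ev[OF refl _ refl]) (auto simp: exp_bump_def)
  next
    case 2
    have "((\<lambda>s. poly (pCons 0 p) (inverse s) * exp (- inverse s)) \<longlongrightarrow> 0) (at_right 0)"
      by (rule filterlim_compose[OF tendsto_poly_exp_0 filterlim_inverse_at_top_right])
    then have "((\<lambda>s. (exp_bump p s - exp_bump p 0) / (s - 0)) \<longlongrightarrow> 0) (at_right 0)"
      by (rule Lim_transform_eventually)
         (auto simp: eventually_at_filter exp_bump_def field_simps intro!: always_eventually)
    moreover have "((\<lambda>s. (exp_bump p s - exp_bump p 0) / (s - 0)) \<longlongrightarrow> 0) (at_left 0)"
      by (rule Lim_transform_eventually[OF tendsto_const])
         (auto simp: eventually_at_filter exp_bump_def field_simps intro!: always_eventually)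
    ultimately show ?thesis
      using 2 by (simp add: has_field_derivative_iff filterlim_at_split exp_bump_def)
  next
    case 3
    have "((\<lambda>s. poly p (1 / s) * exp (- (1 / s))) has_real_derivative
            exp_bump (monom 1 2 * (p - pderiv p)) s) (at s)"
      using 3 by (auto intro!: derivative_eq_intros
          simp: exp_bump_def poly_monom power2_eq_square field_simps)
    moreover have "\<forall>\<^sub>F x in nhds s. exp_bump p x = poly p (1 / x) * exp (- (1 / x))"
      using eventually_nhds_in_open[of "{0<..}" s] 3
      by (auto elim!: eventually_mono simp: exp_bump_def)
    ultimately show ?thesis
      by (subst DERIV_cong_ev[OF refl _ refl]) auto
  qed
qed

primrec bump_poly :: "nat \<Rightarrow> real poly" where
  "bump_poly 0 = 1"
| "bump_poly (Suc j) = monom 1 2 * (bump_poly j - pderiv (bump_poly j))"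

text \<open>Each factor vanishes beyond one face of the box, and since exp(-1/(n s)) increases to 1
  for s > 0, the product tends to the indicator of the open box. The arguments are written as affine
  forms in x so that smoothness follows from the composition lemma.\<close>

definition box_bump :: "'a::euclidean_space \<Rightarrow> 'a \<Rightarrow> nat \<Rightarrow> 'a \<Rightarrow> real" where
  "box_bump a c n x = (\<Prod>b\<in>Basis. exp_bump 1 (x \<bullet> (real n *\<^sub>R b) + (- real n * (a \<bullet> b)))
      * exp_bump 1 (x \<bullet> (- real n *\<^sub>R b) + real n * (c \<bullet> b)))"

lemma exp_bump_bounds: "0 \<le> exp_bump 1 s" "exp_bump 1 s \<le> 1"
  by (auto simp: exp_bump_def)

lemma C_k_box_bump: "C_k k (box_bump a c n)"
proof -
  have "C_k k (\<lambda>x. exp_bump 1 (x \<bullet> v + d))" for v :: 'a and d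
    using C_k_compose_affine[of "\<lambda>j. exp_bump (bump_poly j)" k 0 v d] exp_bump_deriv by simp
  then show ?thesis
    unfolding box_bump_def[abs_def] by (intro C_k_prod C_k_mult)
qed

lemma box_bump_bounds: "0 \<le> box_bump a c n x" "box_bump a c n x \<le> 1"
  unfolding box_bump_def using exp_bump_bounds
  by (auto intro!: prod_nonneg prod_le_1 mult_nonneg_nonneg mult_le_one)

lemma box_bump_eq_0:
  assumes "x \<notin> box a c"
  shows "box_bump a c n x = 0"
proof -
  obtain b where "b \<in> Basis" "x \<bullet> b \<le> a \<bullet> b \<or> c \<bullet> b \<le> x \<bullet> b"
    using assms by (auto simp: mem_box not_less)
  then have "exp_bump 1 (x \<bullet> (real n *\<^sub>R b) + (- real n * (a \<bullet> b)))
      * exp_bump 1 (x \<bullet> (- real n *\<^sub>R b) + real n * (c \<bullet> b)) = 0"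
    by (auto simp: exp_bump_def mult_left_mono zero_less_mult_iff algebra_simps)
  with \<open>b \<in> Basis\<close> show ?thesis
    unfolding box_bump_def by (meson finite_Basis prod_zero)
qed

lemma exp_bump_scale_tendsto:
  assumes "s > 0"
  shows "(\<lambda>n. exp_bump 1 (real n * s)) \<longlonglongrightarrow> 1"
proof -
  have "(\<lambda>n. 1 / (real n * s)) \<longlonglongrightarrow> 0"
    using tendsto_mult[OF lim_1_over_n tendsto_const[of "1 / s"]] by simp
  then have "(\<lambda>n. exp (- (1 / (real n * s)))) \<longlonglongrightarrow> exp (- 0)"
    by (intro tendsto_intros)
  then show ?thesis
    using assms
    by (rule_tac Lim_transform_eventually[where f = "\<lambda>n. exp (- (1 / (real n * s)))"])
       (auto simp: exp_bump_def eventually_sequentially mult_le_0_iff intro!: exI[of _ 1])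
qed

lemma box_bump_tendsto: "(\<lambda>n. box_bump a c n x) \<longlonglongrightarrow> indicator (box a c) x"
proof (cases "x \<in> box a c")
  case True
  have "(\<lambda>n. \<Prod>b\<in>Basis. exp_bump 1 (real n * (x \<bullet> b - a \<bullet> b)) * exp_bump 1 (real n * (c \<bullet> b - x \<bullet> b)))
      \<longlonglongrightarrow> (\<Prod>b\<in>(Basis::'a set). 1 * 1)"
    by (intro tendsto_intros exp_bump_scale_tendsto) (use True in \<open>auto simp: mem_box\<close>)
  then show ?thesis using True by (simp add: box_bump_def algebra_simps)
qed (simp add: box_bump_eq_0)

lemma box_bump_test_function:
  assumes "cbox a c \<subseteq> S"
  shows "box_bump a c n \<in> test_functions S"
proof -
  have "closure {x. box_bump a c n x \<noteq> 0} \<subseteq> cbox a c"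
  proof (rule closure_minimal)
    show "{x. box_bump a c n x \<noteq> 0} \<subseteq> cbox a c"
      using box_bump_eq_0 box_subset_cbox[of a c] by blast
  qed (rule closed_cbox)
  then show ?thesis
    using assms C_k_box_bump bounded_subset[OF bounded_cbox, of "closure {x. box_bump a c n x \<noteq> 0}" a c]
    by (auto simp: test_functions_def compact_eq_bounded_closed)
qed

lemma test_function_zero: "\<phi> \<in> test_functions S \<Longrightarrow> x \<notin> closure {x. \<phi> x \<noteq> 0} \<Longrightarrow> \<phi> x = 0"
  using closure_subset[of "{x. \<phi> x \<noteq> 0}"] by auto

section \<open>The fundamental lemma of the calculus of variations\<close>

lemma AE_zero_if_box_integrals_zero:
  fixes f :: "'a::euclidean_space \<Rightarrow> real"
  assumes f: "integrable lborel f" and z: "\<And>c d. (LINT x|lborel. indicator (box c d) x * f x) = 0"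
  shows "AE x in lborel. f x = 0"
proof -
  have [measurable]: "f \<in> borel_measurable borel" using f by auto
  have fin: "(\<integral>\<^sup>+x. ennreal (f x) \<partial>lborel) < \<infinity>" "(\<integral>\<^sup>+x. ennreal (- f x) \<partial>lborel) < \<infinity>"
    using integrableD(2,3)[OF f] by (auto simp: top.not_eq_extremum)
  have eq: "(\<integral>\<^sup>+x. ennreal (f x) * indicator (box c d) x \<partial>lborel)
          = (\<integral>\<^sup>+x. ennreal (- f x) * indicator (box c d) x \<partial>lborel)" for c d
  proof -
    let ?g = "\<lambda>x. indicator (box c d) x * f x"
    have g: "integrable lborel ?g"
      using f integrable_mult_indicator[of "box c d" lborel f] by simp
    have "0 = enn2real (\<integral>\<^sup>+x. ennreal (?g x) \<partial>lborel) - enn2real (\<integral>\<^sup>+x. ennreal (- ?g x) \<partial>lborel)"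
      using z[of c d] real_lebesgue_integral_def[OF g] by simp
    moreover have "(\<integral>\<^sup>+x. ennreal (?g x) \<partial>lborel) \<noteq> \<infinity>" "(\<integral>\<^sup>+x. ennreal (- ?g x) \<partial>lborel) \<noteq> \<infinity>"
      using integrableD(2,3)[OF g] by auto
    ultimately have "(\<integral>\<^sup>+x. ennreal (?g x) \<partial>lborel) = (\<integral>\<^sup>+x. ennreal (- ?g x) \<partial>lborel)"
      by (cases "\<integral>\<^sup>+x. ennreal (?g x) \<partial>lborel"; cases "\<integral>\<^sup>+x. ennreal (- ?g x) \<partial>lborel") auto
    moreover have "ennreal (?g x) = ennreal (f x) * indicator (box c d) x"
      "ennreal (- ?g x) = ennreal (- f x) * indicator (box c d) x" for x
      by (auto split: split_indicator)
    ultimately show ?thesis by simp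
  qed
  \<comment> \<open>The positive and negative parts of f, taken as densities, define measures that
    agree on boxes, an intersection-stable generator of the Borel sets; hence the measures and then
    the densities coincide.\<close>
  have "density lborel (\<lambda>x. ennreal (f x)) = density lborel (\<lambda>x. ennreal (- f x))" (is "?M = ?N")
  proof (rule measure_eqI_generator_eq)
    let ?E = "range (\<lambda>(a, b). box a b :: 'a set)"
    show "Int_stable ?E" by (auto simp: Int_stable_def box_Int_box)
    show "sets ?M = sigma_sets UNIV ?E" "sets ?N = sigma_sets UNIV ?E" 
      by (simp_all add: borel_eq_box)
    show "emeasure ?M X = emeasure ?N X" if "X \<in> ?E" for X
      using that eq by (auto simp: emeasure_density)
    show "range (\<lambda>n. box (- (real n *\<^sub>R One)) (real n *\<^sub>R One)) \<subseteq> ?E" by auto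
    show "(\<Union>i. box (- (real i *\<^sub>R One)) (real i *\<^sub>R One)) = (UNIV::'a set)"
      by (rule UN_box_eq_UNIV)
    show "emeasure ?M (box (- (real i *\<^sub>R One)) (real i *\<^sub>R One)) \<noteq> \<infinity>" for i
    proof -
      have "emeasure ?M (box (- (real i *\<^sub>R One)) (real i *\<^sub>R One)) \<le> (\<integral>\<^sup>+x. ennreal (f x) \<partial>lborel)"
        by (auto simp: emeasure_density intro!: nn_integral_mono split: split_indicator)
      then show ?thesis using fin(1) by (auto simp: top_unique)
    qed
  qed auto
  then have "AE x in lborel. ennreal (f x) = ennreal (- f x)"
    using fin(1) by (subst (asm) finite_density_unique) auto
  then show ?thesis
  proof eventually_elim
    case (elim x)
    then show ?case by (cases "0 \<le> f x") (auto simp: ennreal_neg ennreal_eq_0_iff)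
  qed
qed

lemma borel_measurable_lebesgueI: "f \<in> borel_measurable borel \<Longrightarrow> f \<in> borel_measurable lebesgue"
  by (rule measurable_completion) simp

text \<open>An open set is a countable union of closed boxes, and a countable union of null sets is
  null.\<close>

lemma open_locally_AE:
  fixes S :: "'a::euclidean_space set"
  assumes "open S" and "\<And>a c. cbox a c \<subseteq> S \<Longrightarrow> AE x in lebesgue. x \<in> cbox a c \<longrightarrow> P x"
  shows "AE x in lebesgue_on S. P x"
proof -
  obtain D :: "'a set set" where D: "countable D" "D \<subseteq> Pow S" "\<And>X. X \<in> D \<Longrightarrow> \<exists>a b. X = cbox a b" "\<Union>D = S"
    using open_countable_Union_open_cbox[OF assms(1)] by metis
  have "AE x in lebesgue. \<forall>X\<in>D. x \<in> X \<longrightarrow> P x"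
    using D assms(2) by (subst AE_ball_countable) (auto, metis Pow_iff subsetD)
  then have "AE x in lebesgue. x \<in> S \<longrightarrow> P x"
    by eventually_elim (use D(4) in auto)
  then show ?thesis
    using assms(1) by (subst AE_restrict_space_iff) auto
qed

text \<open>Translation and Fubini arguments are carried out for Borel functions on
  \<open>lborel\<close>, whereas elements of L2 and weak derivatives are only Lebesgue measurable;
  this representative mediates between the two.\<close>

lemma integrable_lebesgue_borel_rep:
  fixes f :: "'a::euclidean_space \<Rightarrow> real"
  assumes "integrable lebesgue f"
  obtains f' where "integrable lborel f'" "AE x in lebesgue. f x = f' x"
proof -
  obtain f' where f': "f' \<in> borel_measurable lborel" "AE x in lborel. f x = f' x"
    using completion_ex_borel_measurable_real[of f lborel] assms by auto
  then have ae: "AE x in lebesgue. f x = f' x" by (simp add: AE_completion)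
  have m: "f' \<in> borel_measurable lebesgue" using f'(1) by (rule measurable_completion)
  have "integrable lebesgue f'"
    using assms ae m by (subst integrable_cong_AE[where g = f]) auto
  then have "integrable lborel f'" using f'(1) by (simp add: integrable_completion)
  with ae show ?thesis using that by blast
qed

lemma integrable_lebesgue_on_indicator:
  fixes f :: "'a::euclidean_space \<Rightarrow> real"
  assumes "S \<in> sets lebesgue"
  shows "integrable (lebesgue_on S) f \<longleftrightarrow> integrable lebesgue (\<lambda>x. indicator S x * f x)"
  using assms by (subst integrable_restrict_space) auto

lemma locally_integrable_on_integrable:
  assumes "locally_integrable_on f S" "compact C" "C \<subseteq> S"
  shows "integrable lebesgue (\<lambda>x. indicator C x * f x)"
  using assms by (auto simp: locally_integrable_on_def set_integrable_def)

lemma integrable_mult_bounded: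
  fixes f p :: "'a \<Rightarrow> real"
  assumes f: "integrable M f" and p: "p \<in> borel_measurable M" "\<And>x. \<bar>p x\<bar> \<le> c"
  shows "integrable M (\<lambda>x. f x * p x)"
proof (rule Bochner_Integration.integrable_bound)
  show "integrable M (\<lambda>x. c * f x)" using f by simp
  show "(\<lambda>x. f x * p x) \<in> borel_measurable M" using borel_measurable_integrable[OF f] p(1) by (rule borel_measurable_times)
  show "AE x in M. norm (f x * p x) \<le> norm (c * f x)"
  proof (rule AE_I2)
    fix x
    have "\<bar>p x\<bar> \<le> \<bar>c\<bar>" using p(2)[of x] by simp
    from mult_right_mono[OF this abs_ge_zero[of "f x"]]
    show "norm (f x * p x) \<le> norm (c * f x)" by (simp add: abs_mult mult.commute)
  qed
qed

lemma integrable_indicator_mult: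
  fixes f :: "'a::euclidean_space \<Rightarrow> real"
  assumes f: "integrable (lebesgue_on S) f" and A: "A \<in> sets borel"
  shows "integrable (lebesgue_on S) (\<lambda>x. indicator A x * f x)"
proof -
  have "(indicator A :: 'a \<Rightarrow> real) \<in> borel_measurable (lebesgue_on S)"
    by (intro measurable_restrict_space1 borel_measurable_lebesgueI borel_measurable_indicator A)
  from integrable_mult_bounded[OF f this, of 1] show ?thesis by (simp add: mult.commute)
qed

text \<open>Smooth bumps converge boundedly to the indicator of a box, so the integral of
  \<open>f\<close> over every box inside \<open>S\<close> vanishes. The claim is local, hence it
  suffices to apply the lemma on box integrals to \<open>f\<close> cut off to one box.\<close>

lemma AE_zero_if_test_integrals_zero:
  fixes f :: "'a::euclidean_space \<Rightarrow> real"
  assumes "open S" and li: "locally_integrable_on f S"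
    and z: "\<And>\<phi>. \<phi> \<in> test_functions S \<Longrightarrow> (LINT x|lebesgue_on S. f x * \<phi> x) = 0"
  shows "AE x in lebesgue_on S. f x = 0"
proof (rule open_locally_AE[OF \<open>open S\<close>])
  fix a c assume ac: "cbox a c \<subseteq> S"
  have box0: "(LINT x|lebesgue. indicator (box p q) x * f x) = 0" if "cbox p q \<subseteq> S" for p q
  proof -
    let ?F = "\<lambda>x. indicator (cbox p q) x * f x"
    have F: "integrable lebesgue ?F"
      using locally_integrable_on_integrable[OF li compact_cbox that] .
    have [measurable]: "box_bump p q n \<in> borel_measurable lebesgue" for n
      using C_k_box_bump[of 0 p q n] by (intro borel_measurable_lebesgueI borel_measurable_continuous_onI) simp
    have "(\<lambda>n. \<integral>x. ?F x * box_bump p q n x \<partial>lebesgue) \<longlonglongrightarrow> (LINT x|lebesgue. ?F x * indicator (box p q) x)"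
    proof (rule integral_dominated_convergence)
      show "integrable lebesgue (\<lambda>x. \<bar>?F x\<bar>)" using F by simp
      have Fm: "?F \<in> borel_measurable lebesgue" using F by auto
      show "(\<lambda>x. ?F x * box_bump p q n x) \<in> borel_measurable lebesgue" for n
        by (rule borel_measurable_times[OF Fm]) simp
      show "(\<lambda>x. ?F x * indicator (box p q) x) \<in> borel_measurable lebesgue"
        by (rule borel_measurable_times[OF Fm]) (simp add: borel_measurable_lebesgueI)
      show "AE x in lebesgue. (\<lambda>n. ?F x * box_bump p q n x) \<longlonglongrightarrow> ?F x * indicator (box p q) x"
        by (intro AE_I2 tendsto_intros box_bump_tendsto)
      show "AE x in lebesgue. norm (?F x * box_bump p q n x) \<le> \<bar>?F x\<bar>" for n
        using box_bump_bounds[of p q n] by (auto simp: abs_mult intro!: mult_left_le)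
    qed
    moreover have "(LINT x|lebesgue. ?F x * box_bump p q n x) = 0" for n
    proof -
      have "(LINT x|lebesgue. ?F x * box_bump p q n x) = (LINT x|lebesgue. indicator S x * (f x * box_bump p q n x))"
        using that box_bump_eq_0[of _ p q n] box_subset_cbox[of p q]
        by (intro Bochner_Integration.integral_cong) (auto split: split_indicator)
      also have "\<dots> = 0"
        using z[OF box_bump_test_function[OF that, of n]] \<open>open S\<close>
        by (subst (asm) integral_restrict_space) auto
      finally show ?thesis .
    qed
    ultimately have "(LINT x|lebesgue. ?F x * indicator (box p q) x) = 0"
      by (simp add: LIMSEQ_const_iff)
    moreover have "?F x * indicator (box p q) x = indicator (box p q) x * f x" for x
      using box_subset_cbox[of p q] by (auto split: split_indicator)
    ultimately show ?thesis by simp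
  qed
  let ?G = "\<lambda>x. indicator (box a c) x * f x"
  have "integrable lebesgue (\<lambda>x. indicator (box a c) x * (indicator (cbox a c) x * f x))"
    using integrable_mult_indicator[OF _ locally_integrable_on_integrable[OF li compact_cbox ac]]
    by simp
  moreover have "indicator (box a c) x * (indicator (cbox a c) x * f x) = ?G x" for x
    using box_subset_cbox[of a c] by (auto split: split_indicator)
  ultimately have "integrable lebesgue ?G" by simp
  then obtain g where g: "integrable lborel g" and fg: "AE x in lebesgue. ?G x = g x"
    by (rule integrable_lebesgue_borel_rep)
  have "AE x in lborel. g x = 0"
  proof (rule AE_zero_if_box_integrals_zero[OF g])
    fix p q
    obtain p' q' where pq: "box p q \<inter> box a c = box p' q'"
      unfolding box_Int_box by blast
    \<comment> \<open>The closure of a nonempty intersection lies in \<open>cbox a c\<close> and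
      therefore in \<open>S\<close>. If the intersection is empty, its corners \<open>p'\<close> and
      \<open>q'\<close> are arbitrary, but the integral is 0 anyway.\<close>
    have sub: "cbox p' q' \<subseteq> S \<or> box p' q' = {}"
    proof (cases "box p' q' = {}")
      case False
      then have "cbox p' q' = closure (box p' q')" by simp
      also have "\<dots> \<subseteq> closure (box a c)" using pq by (intro closure_mono) auto
      also have "\<dots> \<subseteq> cbox a c" by (rule closure_minimal) (auto simp: box_subset_cbox closed_cbox)
      finally show ?thesis using ac by auto
    qed simp
    have [measurable]: "g \<in> borel_measurable borel" using g by auto
    have "(LINT x|lborel. indicator (box p q) x * g x) = (LINT x|lebesgue. indicator (box p q) x * g x)"
      by (rule integral_completion[symmetric]) simp
    also have "\<dots> = (LINT x|lebesgue. indicator (box p' q') x * f x)"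
    proof (rule integral_cong_AE)
      show "AE x in lebesgue. indicator (box p q) x * g x = indicator (box p' q') x * f x"
        using fg by eventually_elim (simp add: pq[symmetric] indicator_inter_arith mult.assoc)
      show "(\<lambda>x. indicator (box p q) x * g x) \<in> borel_measurable lebesgue"
        by (rule borel_measurable_lebesgueI) simp
      have "(\<lambda>x. indicator (box p q) x * ?G x) \<in> borel_measurable lebesgue"
        by (rule borel_measurable_times[OF _ borel_measurable_integrable[OF \<open>integrable lebesgue ?G\<close>]])
          (simp add: borel_measurable_lebesgueI)
      moreover have "indicator (box p q) x * ?G x = indicator (box p' q') x * f x" for x
        by (simp add: pq[symmetric] indicator_inter_arith mult.assoc)
      ultimately show "(\<lambda>x. indicator (box p' q') x * f x) \<in> borel_measurable lebesgue" by simp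
    qed
    also have "\<dots> = 0" using box0 sub by auto
    finally show "(LINT x|lborel. indicator (box p q) x * g x) = 0" .
  qed
  then have "AE x in lebesgue. g x = 0" by (rule AE_completion)
  \<comment> \<open>The cut-off was made with the open box while the claim concerns the closed one;
    the boundary is a null set.\<close>
  moreover have "AE x in lebesgue. x \<notin> cbox a c - box a c"
  proof (rule AE_not_in)
    show "cbox a c - box a c \<in> null_sets lebesgue"
      using negligible_frontier_interval[of a c] by (simp add: negligible_iff_null_sets)
  qed
  ultimately show "AE x in lebesgue. x \<in> cbox a c \<longrightarrow> f x = 0"
    using fg by eventually_elim (auto split: split_indicator_asm)
qed

subsection \<open>Weak partial derivatives and difference quotients\<close>

lemma
  fixes f :: "'a::euclidean_space \<Rightarrow> real"
  assumes "integrable lborel f"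
  shows integrable_lborel_translate: "integrable lborel (\<lambda>x. f (x + a))"
    and integral_lborel_translate: "(LINT x|lborel. f (x + a)) = (LINT x|lborel. f x)"
proof -
  have [measurable]: "f \<in> borel_measurable borel" using assms by auto
  have "integrable (distr lborel borel ((+) a)) f" using assms by (simp add: lborel_distr_plus)
  then show "integrable lborel (\<lambda>x. f (x + a))"
    by (subst (asm) integrable_distr_eq) (auto simp: add.commute)
  have "(LINT x|lborel. f x) = (LINT x|distr lborel borel ((+) a). f x)" by (simp add: lborel_distr_plus)
  also have "\<dots> = (LINT x|lborel. f (x + a))" by (subst integral_distr) (auto simp: add.commute)
  finally show "(LINT x|lborel. f (x + a)) = (LINT x|lborel. f x)" ..
qed

text \<open>\<open>A\<close> is cut to a ball, the result is enclosed between a closed and an open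
  set, each of these three changes costing measure less than e/3, and Urysohn's lemma
  interpolates.\<close>

lemma lborel_indicator_approx:
  fixes A :: "'a::euclidean_space set"
  assumes A: "A \<in> sets lborel" "emeasure lborel A < \<infinity>" and "e > 0"
  obtains \<phi> :: "'a \<Rightarrow> real" and R :: real where "continuous_on UNIV \<phi>" "\<And>x. 0 \<le> \<phi> x" "\<And>x. \<phi> x \<le> 1"
    "\<And>x. norm x > R \<Longrightarrow> \<phi> x = 0" "(LINT x|lborel. \<bar>indicator A x - \<phi> x\<bar>) < e"
proof -
  have iA: "integrable lborel (indicator A :: 'a \<Rightarrow> real)" using A by simp
  have [measurable]: "A \<in> sets borel" using A by simp
  have "(\<lambda>n. \<integral>x. indicator (A \<inter> cball 0 (real n)) x \<partial>lborel) \<longlonglongrightarrow> (LINT x|lborel. (indicator A x::real))"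
  proof (rule integral_dominated_convergence[OF _ _ iA])
    show "AE x in lborel. (\<lambda>n. indicator (A \<inter> cball 0 (real n)) x::real) \<longlonglongrightarrow> indicator A x"
    proof (rule AE_I2)
      fix x :: 'a
      obtain N where "norm x \<le> real N" using real_arch_simple by blast
      then have "\<forall>\<^sub>F n in sequentially. indicator A x = (indicator (A \<inter> cball 0 (real n)) x :: real)"
        by (auto simp: eventually_sequentially indicator_def intro!: exI[of _ N])
      then show "(\<lambda>n. indicator (A \<inter> cball 0 (real n)) x::real) \<longlonglongrightarrow> indicator A x"
        by (rule Lim_transform_eventually[OF tendsto_const])
    qed
  qed (auto intro!: borel_measurable_indicator split: split_indicator)
  then have "\<forall>\<^sub>F n in sequentially. \<bar>measure lborel (A \<inter> cball 0 (real n)) - measure lborel A\<bar> < e / 3"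
    using \<open>e > 0\<close> by (auto dest!: tendstoD[of _ _ _ "e/3"] simp: dist_real_def)
  then obtain n where n: "\<bar>measure lborel (A \<inter> cball 0 (real n)) - measure lborel A\<bar> < e / 3"
    by (auto simp: eventually_sequentially)
  define B where "B = A \<inter> cball 0 (real n)"
  have [measurable]: "B \<in> sets borel" by (simp add: B_def)
  have B: "B \<subseteq> A" "B \<in> sets lebesgue" by (auto simp: B_def)
  have AB: "measure lborel (A - B) < e / 3"
    using n[unfolded abs_less_iff] measure_Diff[of lborel A B] A B by (simp add: B_def less_top)
  have e3: "e / 3 > 0" using \<open>e > 0\<close> by simp
  obtain U where U: "open U" "B \<subseteq> U" "U - B \<in> lmeasurable" "emeasure lebesgue (U - B) < ennreal (e/3)"
    by (rule sets_lebesgue_outer_open[OF B(2) e3])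
  obtain C where C: "closed C" "C \<subseteq> B" "B - C \<in> lmeasurable" "emeasure lebesgue (B - C) < ennreal (e/3)"
    by (rule sets_lebesgue_inner_closed[OF B(2) e3])
  have [measurable]: "U \<in> sets borel" "C \<in> sets borel" using U C by auto
  have mU: "emeasure lborel (U - B) < ennreal (e/3)" "emeasure lborel (B - C) < ennreal (e/3)"
    using U C by auto
  \<comment> \<open>The ball of radius n + 1 contains the closed ball of radius n and hence
    \<open>C\<close>, and it forces bounded support.\<close>
  define U' where "U' = U \<inter> ball 0 (real n + 1)"
  have CU: "C \<inter> - U' = {}" using C U by (auto simp: U'_def B_def)
  have cU: "closed (- U')" using U(1) by (auto simp: U'_def)
  obtain \<phi> :: "'a \<Rightarrow> real" where \<phi>: "continuous_on UNIV \<phi>" "\<And>x. \<phi> x \<in> closed_segment 1 0"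
      "\<And>x. x \<in> C \<Longrightarrow> \<phi> x = 1" "\<And>x. x \<in> - U' \<Longrightarrow> \<phi> x = 0"
    using Urysohn[OF C(1) cU CU, where a = "1::real" and b = 0] by metis
  have \<phi>01: "0 \<le> \<phi> x" "\<phi> x \<le> 1" for x
    using \<phi>(2)[of x] by (auto simp: closed_segment_eq_real_ivl)
  have [measurable]: "\<phi> \<in> borel_measurable borel" using \<phi>(1) by (rule borel_measurable_continuous_onI)
  have fin: "emeasure lborel (A - B) < \<infinity>"
    using A emeasure_mono[of "A - B" A lborel] by (auto simp: top.not_eq_extremum[symmetric] top_unique)
  have fin2: "emeasure lborel (U - B) < \<infinity>" "emeasure lborel (B - C) < \<infinity>"
    using less_trans[OF mU(1) ennreal_less_top] less_trans[OF mU(2) ennreal_less_top] by auto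
  have i: "integrable lborel (indicator (A - B) :: 'a \<Rightarrow> real)" "integrable lborel (indicator (U - B) :: 'a \<Rightarrow> real)"
     "integrable lborel (indicator (B - C) :: 'a \<Rightarrow> real)"
    using fin fin2 by auto
  have "(LINT x|lborel. \<bar>indicator A x - \<phi> x\<bar>)
      \<le> (LINT x|lborel. indicator (A - B) x + indicator (U - B) x + indicator (B - C) x)"
  proof (rule integral_mono')
    show "integrable lborel (\<lambda>x. indicator (A - B) x + indicator (U - B) x + indicator (B - C) x :: real)"
      using i by auto
    show "\<bar>indicator A x - \<phi> x\<bar> \<le> indicator (A - B) x + indicator (U - B) x + indicator (B - C) x" for x
      using \<phi>01[of x] \<phi>(3,4)[of x] B(1) C(2) U(2) by (auto simp: indicator_def U'_def)
  qed (auto split: split_indicator)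
  also have "\<dots> = measure lborel (A - B) + measure lborel (U - B) + measure lborel (B - C)"
    using i by simp
  also have "\<dots> < e"
  proof -
    have "measure lborel (U - B) < e / 3" "measure lborel (B - C) < e / 3"
      using mU fin2 \<open>e > 0\<close> by (simp_all add: emeasure_eq_ennreal_measure ennreal_less_iff)
    then show ?thesis using AB by linarith
  qed
  finally show ?thesis
    using that[of \<phi> "real n + 1"] \<phi>(1,4) \<phi>01 by (auto simp: U'_def)
qed

text \<open>The functions whose translates converge in L1 form a closed class: by translation
  invariance the shifted approximation error equals the unshifted one. This serves both the
  indicator case and the limit case of the induction below.\<close>

lemma L1_translation_approx:
  fixes f :: "'a::euclidean_space \<Rightarrow> real" and a :: "nat \<Rightarrow> 'a"
  assumes f: "integrable lborel f"
    and ap: "\<And>e. e > 0 \<Longrightarrow> \<exists>g. integrable lborel g \<and> (LINT x|lborel. \<bar>f x - g x\<bar>) < e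
        \<and> (\<lambda>k. \<integral>x. \<bar>g (x + a k) - g x\<bar> \<partial>lborel) \<longlonglongrightarrow> 0"
  shows "(\<lambda>k. \<integral>x. \<bar>f (x + a k) - f x\<bar> \<partial>lborel) \<longlonglongrightarrow> 0"
proof (rule LIMSEQ_I)
  fix r :: real assume "r > 0"
  then obtain g where g: "integrable lborel g" "(LINT x|lborel. \<bar>f x - g x\<bar>) < r / 4"
    "(\<lambda>k. \<integral>x. \<bar>g (x + a k) - g x\<bar> \<partial>lborel) \<longlonglongrightarrow> 0"
    using ap[of "r/4"] by auto
  obtain N where N: "\<And>k. k \<ge> N \<Longrightarrow> norm ((LINT x|lborel. \<bar>g (x + a k) - g x\<bar>) - 0) < r / 4"
    using LIMSEQ_D[OF g(3), of "r/4"] \<open>r > 0\<close> by auto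
  have "norm ((LINT x|lborel. \<bar>f (x + a k) - f x\<bar>) - 0) < r" if "k \<ge> N" for k
  proof -
    have i: "integrable lborel (\<lambda>x. \<bar>f x - g x\<bar>)" using f g by auto
    have i': "integrable lborel (\<lambda>x. \<bar>f (x + a k) - g (x + a k)\<bar>)"
      using integrable_lborel_translate[OF i] .
    have i2: "integrable lborel (\<lambda>x. \<bar>g (x + a k) - g x\<bar>)"
      using g(1) integrable_lborel_translate[OF g(1)] by auto
    have "(LINT x|lborel. \<bar>f (x + a k) - f x\<bar>)
      \<le> (LINT x|lborel. \<bar>f (x + a k) - g (x + a k)\<bar> + \<bar>g (x + a k) - g x\<bar> + \<bar>f x - g x\<bar>)"
      by (rule integral_mono') (use i i' i2 in auto)
    also have "\<dots> = (LINT x|lborel. \<bar>f (x + a k) - g (x + a k)\<bar>) + (LINT x|lborel. \<bar>g (x + a k) - g x\<bar>)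
        + (LINT x|lborel. \<bar>f x - g x\<bar>)"
      using i i' i2 by simp
    also have "(LINT x|lborel. \<bar>f (x + a k) - g (x + a k)\<bar>) = (LINT x|lborel. \<bar>f x - g x\<bar>)"
      using integral_lborel_translate[OF i] .
    finally show ?thesis using N[OF that] g(2) \<open>r > 0\<close> by simp
  qed
  then show "\<exists>N. \<forall>k\<ge>N. norm ((LINT x|lborel. \<bar>f (x + a k) - f x\<bar>) - 0) < r" by blast
qed

lemma L1_translation_tendsto:
  fixes f :: "'a::euclidean_space \<Rightarrow> real"
  assumes f: "integrable lborel f" and a: "a \<longlonglongrightarrow> 0"
  shows "(\<lambda>k. \<integral>x. \<bar>f (x + a k) - f x\<bar> \<partial>lborel) \<longlonglongrightarrow> 0"
  using f
proof (induction rule: integrable_induct)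
  case (base A c)
  show ?case
  proof (rule L1_translation_approx)
    show "integrable lborel (\<lambda>x. indicator A x *\<^sub>R c)" using base by simp
    fix e :: real assume "e > 0"
    \<comment> \<open>Dividing by \<open>\<bar>c\<bar> + 1\<close> instead of
      \<open>\<bar>c\<bar>\<close> covers the case \<open>c = 0\<close>.\<close>
    then obtain \<phi> :: "'a \<Rightarrow> real" and R :: real where \<phi>: "continuous_on UNIV \<phi>" "\<And>x. 0 \<le> \<phi> x" "\<And>x. \<phi> x \<le> 1"
      "\<And>x. norm x > R \<Longrightarrow> \<phi> x = 0" "(LINT x|lborel. \<bar>indicator A x - \<phi> x\<bar>) < e / (\<bar>c\<bar> + 1)"
      using lborel_indicator_approx[OF base, of "e / (\<bar>c\<bar> + 1)"] by auto
    have [measurable]: "\<phi> \<in> borel_measurable borel" using \<phi>(1) by (rule borel_measurable_continuous_onI)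
    have bnd: "\<phi> x \<le> indicator (cball 0 R) x" for x
      using \<phi>(2-4)[of x] by (auto simp: indicator_def not_le)
    have ib: "integrable lborel (indicator (cball (0::'a) R') :: 'a \<Rightarrow> real)" for R'
      using emeasure_bounded_finite[of "cball (0::'a) R'"] by (intro integrable_real_indicator) auto
    have i\<phi>: "integrable lborel \<phi>"
      by (rule Bochner_Integration.integrable_bound[OF ib[of R]]) (use bnd \<phi>(2) in auto)
    have "integrable lborel (\<lambda>x. c * \<phi> x)" using i\<phi> by simp
    moreover have "(LINT x|lborel. \<bar>indicator A x *\<^sub>R c - c * \<phi> x\<bar>) < e"
    proof -
      have "\<bar>indicator A x *\<^sub>R c - c * \<phi> x\<bar> = \<bar>c\<bar> * \<bar>indicator A x - \<phi> x\<bar>" for x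
        by (simp add: abs_mult[symmetric] algebra_simps)
      then have "(LINT x|lborel. \<bar>indicator A x *\<^sub>R c - c * \<phi> x\<bar>) = \<bar>c\<bar> * (LINT x|lborel. \<bar>indicator A x - \<phi> x\<bar>)"
        by simp
      also have "\<dots> \<le> \<bar>c\<bar> * (e / (\<bar>c\<bar> + 1))" using \<phi>(5) by (intro mult_left_mono) auto
      also have "\<dots> < e" using \<open>e > 0\<close> by (simp add: field_simps)
      finally show ?thesis .
    qed
    moreover have "(\<lambda>k. \<integral>x. \<bar>c * \<phi> (x + a k) - c * \<phi> x\<bar> \<partial>lborel) \<longlonglongrightarrow> 0"
    proof -
      obtain M where M: "\<And>k. norm (a k) \<le> M"
        using convergent_imp_Bseq[OF convergentI[OF a]] by (auto simp: Bseq_def)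
      then have "0 \<le> M" using norm_ge_zero order_trans by blast
      have "(\<lambda>k. \<integral>x. \<bar>c * \<phi> (x + a k) - c * \<phi> x\<bar> \<partial>lborel) \<longlonglongrightarrow> (LINT x|(lborel :: 'a measure). 0)"
      \<comment> \<open>\<open>M\<close> bounds the translations, so outside the ball of radius
        \<open>R + M\<close> both \<open>x\<close> and \<open>x + a k\<close> lie outside the
        support of \<phi>.\<close>
      proof (rule integral_dominated_convergence[where w = "\<lambda>x. 2 * \<bar>c\<bar> * indicator (cball 0 (R + M)) x"])
        show "integrable lborel (\<lambda>x::'a. 2 * \<bar>c\<bar> * indicator (cball 0 (R + M)) x)" using ib[of "R + M"] by simp
        have "(\<lambda>k. \<bar>c * \<phi> (x + a k) - c * \<phi> x\<bar>) \<longlonglongrightarrow> \<bar>c * \<phi> (x + 0) - c * \<phi> x\<bar>" for x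
          using \<phi>(1) by (intro tendsto_intros isCont_tendsto_compose[of "x + 0" \<phi>] a)
             (simp add: continuous_on_eq_continuous_at)
        then show "AE x in lborel. (\<lambda>k. \<bar>c * \<phi> (x + a k) - c * \<phi> x\<bar>) \<longlonglongrightarrow> 0" by simp
        show "AE x in lborel. norm \<bar>c * \<phi> (x + a k) - c * \<phi> x\<bar> \<le> 2 * \<bar>c\<bar> * indicator (cball 0 (R + M)) x" for k
        proof (rule AE_I2)
          fix x
          show "norm \<bar>c * \<phi> (x + a k) - c * \<phi> x\<bar> \<le> 2 * \<bar>c\<bar> * indicator (cball 0 (R + M)) x"
          proof (cases "norm x \<le> R + M")
            case True
            have "\<bar>\<phi> (x + a k) - \<phi> x\<bar> \<le> 2" using \<phi>(2,3)[of x] \<phi>(2,3)[of "x + a k"] by linarith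
            then have "\<bar>c\<bar> * \<bar>\<phi> (x + a k) - \<phi> x\<bar> \<le> \<bar>c\<bar> * 2" by (intro mult_left_mono) auto
            then show ?thesis using True by (simp add: abs_mult[symmetric] algebra_simps)
          next
            case False
            have "norm x \<le> norm (x + a k) + norm (a k)" by (metis add_diff_cancel norm_triangle_ineq4)
            then have "norm (x + a k) > R" "norm x > R" using False M[of k] \<open>0 \<le> M\<close> by auto
            then show ?thesis using \<phi>(4) by simp
          qed
        qed
      qed auto
      then show ?thesis by simp
    qed
    ultimately show "\<exists>g. integrable lborel g \<and> (LINT x|lborel. \<bar>indicator A x *\<^sub>R c - g x\<bar>) < e
        \<and> (\<lambda>k. \<integral>x. \<bar>g (x + a k) - g x\<bar> \<partial>lborel) \<longlonglongrightarrow> 0" by blast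
  qed
next
  case (add f g)
  note i = add.hyps integrable_lborel_translate[OF add.hyps(1)] integrable_lborel_translate[OF add.hyps(2)]
  show ?case
  proof (rule real_tendsto_sandwich[OF _ _ tendsto_const])
    show "(\<lambda>k. (LINT x|lborel. \<bar>f (x + a k) - f x\<bar>) + (LINT x|lborel. \<bar>g (x + a k) - g x\<bar>)) \<longlonglongrightarrow> 0"
      using tendsto_add[OF add.IH] by simp
    have "(LINT x|lborel. \<bar>f (x + a k) + g (x + a k) - (f x + g x)\<bar>)
        \<le> (LINT x|lborel. \<bar>f (x + a k) - f x\<bar> + \<bar>g (x + a k) - g x\<bar>)" for k
      by (rule integral_mono) (use i in auto)
    then show "\<forall>\<^sub>F k in sequentially. (LINT x|lborel. \<bar>f (x + a k) + g (x + a k) - (f x + g x)\<bar>)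
       \<le> (LINT x|lborel. \<bar>f (x + a k) - f x\<bar>) + (LINT x|lborel. \<bar>g (x + a k) - g x\<bar>)"
      using i by simp
  qed simp
next
  case (lim f s)
  show ?case
  proof (rule L1_translation_approx[OF lim.hyps(4)])
    fix e :: real assume "e > 0"
    have [measurable]: "f \<in> borel_measurable borel" "\<And>i. s i \<in> borel_measurable borel"
      using lim.hyps by auto
    have "(\<lambda>i. \<integral>x. \<bar>f x - s i x\<bar> \<partial>lborel) \<longlonglongrightarrow> (LINT x|(lborel :: 'a measure). 0)"
    \<comment> \<open>The approximations satisfy |s i| \<le> 2 |f|, whence the factor 3.\<close>
    proof (rule integral_dominated_convergence[where w = "\<lambda>x. 3 * \<bar>f x\<bar>"])
      show "integrable lborel (\<lambda>x. 3 * \<bar>f x\<bar>)" using lim.hyps by simp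
      have "(\<lambda>i. \<bar>f x - s i x\<bar>) \<longlonglongrightarrow> \<bar>f x - f x\<bar>" for x
        using lim.hyps(2)[of x] by (intro tendsto_intros) auto
      then show "AE x in lborel. (\<lambda>i. \<bar>f x - s i x\<bar>) \<longlonglongrightarrow> 0" by simp
      have "norm \<bar>f x - s i x\<bar> \<le> 3 * \<bar>f x\<bar>" for i x
        using lim.hyps(3)[of x i] by simp
      then show "AE x in lborel. norm \<bar>f x - s i x\<bar> \<le> 3 * \<bar>f x\<bar>" for i by simp
    qed auto
    then have "\<forall>\<^sub>F i in sequentially. \<bar>\<integral>x. \<bar>f x - s i x\<bar> \<partial>lborel\<bar> < e"
      using \<open>e > 0\<close> by (auto dest!: tendstoD[of _ _ _ e] simp: dist_real_def)
    then obtain i where "\<bar>\<integral>x. \<bar>f x - s i x\<bar> \<partial>lborel\<bar> < e" by (auto simp: eventually_sequentially)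
    then show "\<exists>g. integrable lborel g \<and> (LINT x|lborel. \<bar>f x - g x\<bar>) < e
        \<and> (\<lambda>k. \<integral>x. \<bar>g (x + a k) - g x\<bar> \<partial>lborel) \<longlonglongrightarrow> 0"
      using lim.hyps(1)[of i] lim.IH[of i] by (intro exI[of _ "s i"]) auto
  qed
qed

section \<open>Supports, bounds and translates of test functions\<close>

lemma compact_support_bounded:
  fixes f :: "'a::euclidean_space \<Rightarrow> real"
  assumes "continuous_on UNIV f" "compact K" "\<And>x. x \<notin> K \<Longrightarrow> f x = 0"
  obtains M where "M > 0" "\<And>x. \<bar>f x\<bar> \<le> M"
proof -
  have "bounded (f ` K)"
    using assms by (meson compact_continuous_image compact_imp_bounded continuous_on_subset subset_UNIV)
  then obtain M where "M > 0" "\<And>x. x \<in> K \<Longrightarrow> \<bar>f x\<bar> \<le> M" by (auto simp: bounded_pos)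
  then show ?thesis using assms(3) that[of M] by (metis abs_zero less_imp_le)
qed

lemma
  assumes "\<phi> \<in> test_functions S"
  shows test_function_has_derivative: "(\<phi> has_derivative frechet_derivative \<phi> (at x)) (at x)"
    and test_function_continuous: "continuous_on UNIV \<phi>"
    and test_function_partial_continuous:
      "b \<in> Basis \<Longrightarrow> continuous_on UNIV (\<lambda>x. frechet_derivative \<phi> (at x) b)"
    and test_function_compact: "compact (closure {x. \<phi> x \<noteq> 0})"
    and test_function_support: "closure {x. \<phi> x \<noteq> 0} \<subseteq> S"
    and test_function_partial_zero: "y \<notin> closure {x. \<phi> x \<noteq> 0} \<Longrightarrow> frechet_derivative \<phi> (at y) b = 0"
proof -
  have C: "C_k k \<phi>" for k using assms by (simp add: test_functions_def)
  show "(\<phi> has_derivative frechet_derivative \<phi> (at x)) (at x)"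
    using C[of 1] by (simp add: frechet_derivative_works[symmetric])
  show "continuous_on UNIV \<phi>" using C[of 0] by simp
  show "b \<in> Basis \<Longrightarrow> continuous_on UNIV (\<lambda>x. frechet_derivative \<phi> (at x) b)"
    using C[of "Suc 0"] by simp
  show "compact (closure {x. \<phi> x \<noteq> 0})" "closure {x. \<phi> x \<noteq> 0} \<subseteq> S"
    using assms by (auto simp: test_functions_def)
  assume y: "y \<notin> closure {x. \<phi> x \<noteq> 0}"
  have "(\<phi> has_derivative (\<lambda>h. 0)) (at y)"
  proof (rule has_derivative_transform_within_open)
    show "((\<lambda>x. 0) has_derivative (\<lambda>h. 0)) (at y)" by simp
    show "open (- closure {x. \<phi> x \<noteq> 0})" "y \<in> - closure {x. \<phi> x \<noteq> 0}" using y by auto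
    show "x \<in> - closure {x. \<phi> x \<noteq> 0} \<Longrightarrow> 0 = \<phi> x" for x
      using test_function_zero[OF assms, of x] by (metis ComplD)
  qed
  then show "frechet_derivative \<phi> (at y) b = 0" by (simp add: frechet_derivative_eqI)
qed

lemma test_function_bounded:
  assumes "\<phi> \<in> test_functions S"
  obtains M where "M > 0" "\<And>x. \<bar>\<phi> x\<bar> \<le> M"
  using compact_support_bounded[OF test_function_continuous[OF assms] test_function_compact[OF assms]]
    test_function_zero[OF assms] by metis

lemma test_function_partial_bounded:
  assumes "\<phi> \<in> test_functions S" "b \<in> Basis"
  obtains M where "M > 0" "\<And>x. \<bar>frechet_derivative \<phi> (at x) b\<bar> \<le> M"
  using compact_support_bounded[OF test_function_partial_continuous[OF assms] test_function_compact[OF assms(1)]]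
    test_function_partial_zero[OF assms(1)] by metis

lemma has_derivative_shift:
  assumes "(f has_derivative f') (at (x - c))"
  shows "((\<lambda>x. f (x - c)) has_derivative f') (at x)"
proof -
  have "((\<lambda>x. x - c) has_derivative (\<lambda>h. h)) (at x)" by (auto intro!: derivative_eq_intros)
  from has_derivative_compose[OF this, of f f'] assms show ?thesis by simp
qed

lemma C_k_shift: "C_k k f \<Longrightarrow> C_k k (\<lambda>x. f (x - c))"
proof (induction k arbitrary: f)
  case 0
  then show ?case by (auto intro!: continuous_intros continuous_on_compose2[of UNIV f])
next
  case (Suc k)
  show ?case
    by (rule C_k_SucI, rule has_derivative_shift[OF C_k_Suc_has_derivative[OF Suc.prems]])
       (use Suc in auto)
qed

lemma test_function_shift:
  assumes \<psi>: "\<psi> \<in> test_functions N" and K: "compact K" "K \<subseteq> S" "\<And>x. x \<in> N \<Longrightarrow> x + c \<in> K"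
  shows "(\<lambda>x. \<psi> (x - c)) \<in> test_functions S"
    and "frechet_derivative (\<lambda>x. \<psi> (x - c)) (at x) = frechet_derivative \<psi> (at (x - c))"
    and "y \<notin> K \<Longrightarrow> \<psi> (y - c) = 0" "y \<notin> K \<Longrightarrow> frechet_derivative \<psi> (at (y - c)) b = 0"
proof -
  have *: "y - c \<in> closure {x. \<psi> x \<noteq> 0} \<Longrightarrow> y \<in> K" for y
    using test_function_support[OF \<psi>] K(3)[of "y - c"] by auto
  show "y \<notin> K \<Longrightarrow> \<psi> (y - c) = 0" "y \<notin> K \<Longrightarrow> frechet_derivative \<psi> (at (y - c)) b = 0"
    using * test_function_zero[OF \<psi>] test_function_partial_zero[OF \<psi>] by metis+
  show "frechet_derivative (\<lambda>x. \<psi> (x - c)) (at x) = frechet_derivative \<psi> (at (x - c))"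
    by (rule frechet_derivative_eqI has_derivative_shift test_function_has_derivative[OF \<psi>])+
  have "closure {x. \<psi> (x - c) \<noteq> 0} \<subseteq> K"
    using * closure_subset[of "{x. \<psi> x \<noteq> 0}"] compact_imp_closed[OF K(1)]
    by (intro closure_minimal) auto
  moreover have "compact (closure {x. \<psi> (x - c) \<noteq> 0})"
    using calculation K(1) by (metis closed_closure compact_Int_closed inf.absorb_iff2)
  moreover have "C_k k (\<lambda>x. \<psi> (x - c))" for k
    using \<psi> by (intro C_k_shift) (simp add: test_functions_def)
  ultimately show "(\<lambda>x. \<psi> (x - c)) \<in> test_functions S"
    using K(2) by (auto simp: test_functions_def)
qed

lemma integral_lebesgue_on_eq_lborel:
  fixes f g :: "'a::euclidean_space \<Rightarrow> real"
  assumes "S \<in> sets lebesgue" "g \<in> borel_measurable borel" "AE x in lebesgue. indicator S x * f x = g x"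
  shows "(LINT x|lebesgue_on S. f x) = (LINT x|lborel. g x)"
proof -
  have gm: "g \<in> borel_measurable lebesgue" using assms(2) by (rule borel_measurable_lebesgueI)
  have "(\<lambda>x. indicator S x * f x) \<in> borel_measurable lebesgue"
    using borel_measurable_AE[OF gm] assms(3) by (simp add: eq_commute)
  then have "(LINT x|lebesgue. indicator S x * f x) = (LINT x|lebesgue. g x)"
    using assms gm by (intro integral_cong_AE) auto
  also have "\<dots> = (LINT x|lborel. g x)" using assms(2) by (intro integral_completion) simp
  finally show ?thesis using assms(1) by (subst integral_restrict_space) auto
qed

lemma integrable_lborel_locally_integrable_on:
  fixes f :: "'a::euclidean_space \<Rightarrow> real"
  assumes "integrable lborel f"
  shows "locally_integrable_on f S"
proof -
  have "integrable lebesgue f" using assms by (subst integrable_completion) auto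
  then have "integrable lebesgue (\<lambda>x. indicator C x *\<^sub>R f x)" if "compact C" for C
    using that by (intro integrable_mult_indicator) (auto intro: fmeasurableD lmeasurable_compact)
  then show ?thesis by (auto simp: locally_integrable_on_def set_integrable_def)
qed

text \<open>By translation invariance the integral over x of the absolute value is the same for
  every r in [0, 1], so the Fubini criterion for joint integrability is satisfied.\<close>

lemma segment_average_integrable:
  fixes V :: "'a::euclidean_space \<Rightarrow> real"
  assumes V: "integrable lborel V"
  shows "integrable (lborel \<Otimes>\<^sub>M lborel) (\<lambda>(r::real, x). indicator {0..1} r * V (x + r *\<^sub>R a))"
proof (rule lborel_pair.Fubini_integrable)
  have [measurable]: "V \<in> borel_measurable borel" using V by auto
  show "(\<lambda>(r::real, x). indicator {0..1} r * V (x + r *\<^sub>R a)) \<in> borel_measurable (lborel \<Otimes>\<^sub>M lborel)"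
    by measurable
  have "(LINT x|lborel. norm (indicator {0..1} r * V (x + r *\<^sub>R a))) = indicator {0..1} r * (LINT x|lborel. \<bar>V x\<bar>)" for r :: real
    using V integral_lborel_translate[of "\<lambda>x. \<bar>V x\<bar>" "r *\<^sub>R a"] by (simp add: abs_mult)
  then show "integrable lborel (\<lambda>r::real. \<integral>x. norm (case (r, x) of (r, x) \<Rightarrow> indicator {0..1} r * V (x + r *\<^sub>R a)) \<partial>lborel)"
    by simp
  show "AE r in lborel. integrable lborel (\<lambda>x. case (r::real, x) of (r, x) \<Rightarrow> indicator {0..1} r * V (x + r *\<^sub>R a))"
    using integrable_lborel_translate[OF V] by auto
qed

lemma test_function_difference:
  assumes "\<psi> \<in> test_functions N" "b \<in> Basis"
  shows "(LINT r|lborel. indicator {0..1} r * frechet_derivative \<psi> (at (x - (r * h) *\<^sub>R b)) b) * h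
    = \<psi> x - \<psi> (x - h *\<^sub>R b)"
proof -
  let ?D = "\<lambda>x. frechet_derivative \<psi> (at x)"
  have lin: "linear (?D y)" for y
    using test_function_has_derivative[OF assms(1)] has_derivative_bounded_linear bounded_linear.linear by blast
  have "((\<lambda>r. \<psi> (x - (r * h) *\<^sub>R b)) has_vector_derivative - (h * ?D (x - (r * h) *\<^sub>R b) b)) (at r)" for r
  proof -
    have 1: "((\<lambda>r. x - (r * h) *\<^sub>R b) has_derivative (\<lambda>s. - ((s * h) *\<^sub>R b))) (at r)"
      by (auto intro!: derivative_eq_intros)
    show ?thesis
      using has_derivative_compose[OF 1 test_function_has_derivative[OF assms(1)]]
      by (simp add: has_vector_derivative_def linear_neg[OF lin] linear_scale[OF lin] algebra_simps)
  qed
  then have "integral\<^sup>L lborel (\<lambda>r. indicator {0..1} r *\<^sub>R - (h * ?D (x - (r * h) *\<^sub>R b) b))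
     = \<psi> (x - (1 * h) *\<^sub>R b) - \<psi> (x - (0 * h) *\<^sub>R b)"
  proof (intro integral_FTC_atLeastAtMost[where F = "\<lambda>r. \<psi> (x - (r * h) *\<^sub>R b)"])
    have "continuous_on {0..1} (\<lambda>r. x - (r * h) *\<^sub>R b)" by (intro continuous_intros)
    then have "continuous_on {0..1} (\<lambda>r. ?D (x - (r * h) *\<^sub>R b) b)"
      by (rule continuous_on_compose2[OF test_function_partial_continuous[OF assms]]) simp
    then show "continuous_on {0..1} (\<lambda>r. - (h * ?D (x - (r * h) *\<^sub>R b) b))"
      by (intro continuous_intros)
  qed (auto intro: has_vector_derivative_at_within)
  moreover have "integral\<^sup>L lborel (\<lambda>r. indicator {0..1} r *\<^sub>R - (h * ?D (x - (r * h) *\<^sub>R b) b))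
     = (LINT r|lborel. - h * (indicator {0..1} r * ?D (x - (r * h) *\<^sub>R b) b))"
    by (intro Bochner_Integration.integral_cong) auto
  ultimately show ?thesis unfolding integral_mult_right_zero by (simp add: mult.commute)
qed

lemma abs_mult_bound:
  fixes d :: real
  assumes "\<bar>d\<bar> \<le> m"
  shows "norm (i * (p * d)) \<le> norm (m * (i * p))"
proof -
  have "\<bar>i * p\<bar> * \<bar>d\<bar> \<le> \<bar>i * p\<bar> * \<bar>m\<bar>" using assms by (intro mult_left_mono) auto
  then show ?thesis by (simp add: abs_mult mult_ac)
qed

text \<open>A weak derivative integrates to finite differences: for test functions this is the
  fundamental theorem of calculus, and translating the test function instead of the function
  transfers it by duality.\<close>

lemma weak_partial_difference:
  fixes u v U V :: "'a::euclidean_space \<Rightarrow> real"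
  assumes S: "open S" and w: "has_weak_partial S b u v" and b: "b \<in> Basis"
    and N: "open N" and K: "compact K" "K \<subseteq> S"
    and seg: "\<And>x r. x \<in> N \<Longrightarrow> r \<in> {0..1} \<Longrightarrow> x + (r * h) *\<^sub>R b \<in> K"
    and U: "integrable lborel U" and V: "integrable lborel V"
    and uU: "AE x in lebesgue. x \<in> K \<longrightarrow> u x = U x" and vV: "AE x in lebesgue. x \<in> K \<longrightarrow> v x = V x"
  shows "AE x in lebesgue_on N. U (x + h *\<^sub>R b) - U x
           = h * (LINT r|lborel. indicator {0..1} r * V (x + (r * h) *\<^sub>R b))"
proof -
  have [measurable]: "U \<in> borel_measurable borel" "V \<in> borel_measurable borel" using U V by auto
  let ?V = "\<lambda>(r::real, x). indicator {0..1} r * V (x + r *\<^sub>R (h *\<^sub>R b))"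
  define W where "W x = (LINT r|lborel. indicator {0..1} r * V (x + (r * h) *\<^sub>R b))" for x
  have jV: "integrable (lborel \<Otimes>\<^sub>M lborel) ?V" by (rule segment_average_integrable[OF V])
  have W: "integrable lborel W"
    using lborel_pair.integrable_snd[of "\<lambda>r x. indicator {0..1} r * V (x + r *\<^sub>R (h *\<^sub>R b))"] jV
    by (simp add: W_def[abs_def])
  note Uh = integrable_lborel_translate[OF U, of "h *\<^sub>R b"]
  define f where "f x = U (x + h *\<^sub>R b) - U x - h * W x" for x
  have f: "integrable lborel f" unfolding f_def using U Uh W by auto
  have "AE x in lebesgue_on N. f x = 0"
  proof (rule AE_zero_if_test_integrals_zero[OF N integrable_lborel_locally_integrable_on[OF f]])
    fix \<psi> assume \<psi>: "\<psi> \<in> test_functions N"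
    let ?D = "\<lambda>x. frechet_derivative \<psi> (at x) b"
    have [measurable]: "\<psi> \<in> borel_measurable borel"
      using test_function_continuous[OF \<psi>] by (rule borel_measurable_continuous_onI)
    have Dm[measurable]: "?D \<in> borel_measurable borel"
      using test_function_partial_continuous[OF \<psi> b] by (rule borel_measurable_continuous_onI)
    obtain M where M: "M > 0" "\<And>x. \<bar>\<psi> x\<bar> \<le> M" using test_function_bounded[OF \<psi>] by blast
    obtain M' where M': "M' > 0" "\<And>x. \<bar>?D x\<bar> \<le> M'" using test_function_partial_bounded[OF \<psi> b] by blast
    have bmult: "integrable lborel (\<lambda>x. g x * p x)"
      if "integrable lborel g" "p \<in> borel_measurable borel" "\<And>x. \<bar>p x\<bar> \<le> m" for g p :: "'a \<Rightarrow> real" and m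
      using integrable_mult_bounded[OF that(1) _ that(3)] that(2) by simp
    have \<psi>c: "(\<lambda>x. \<psi> (x - c)) \<in> borel_measurable borel" for c by measurable
    \<comment> \<open>Integration by parts against the translate of \<psi> by (r h) b, after which
      the translation is undone on the side of V. The hypothesis on segments keeps the translate
      supported in \<open>K\<close>, where U and V represent u and v.\<close>
    have dual: "(LINT x|lborel. U x * ?D (x - (r * h) *\<^sub>R b)) = - (LINT x|lborel. V (x + (r * h) *\<^sub>R b) * \<psi> x)"
      if r: "r \<in> {0..1}" for r
    proof -
      note sh = test_function_shift[OF \<psi> K, of "(r * h) *\<^sub>R b", OF seg[OF _ r]]
      have "(LINT x|lborel. U x * ?D (x - (r * h) *\<^sub>R b))
         = (LINT x|lebesgue_on S. u x * frechet_derivative (\<lambda>x. \<psi> (x - (r * h) *\<^sub>R b)) (at x) b)"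
      proof (rule integral_lebesgue_on_eq_lborel[symmetric])
        show "AE x in lebesgue. indicator S x * (u x * frechet_derivative (\<lambda>x. \<psi> (x - (r * h) *\<^sub>R b)) (at x) b)
            = U x * ?D (x - (r * h) *\<^sub>R b)"
          using uU
        proof eventually_elim
          case (elim x)
          then show ?case using sh(2)[of x] sh(4)[of x b] K(2) by (cases "x \<in> K") auto
        qed
        show "(\<lambda>x. U x * ?D (x - (r * h) *\<^sub>R b)) \<in> borel_measurable borel"
          by (rule borel_measurable_times[OF _ measurable_compose[OF _ Dm]]) measurable
      qed (use S in auto)
      also have "\<dots> = - (LINT x|lebesgue_on S. v x * \<psi> (x - (r * h) *\<^sub>R b))"
        using w sh(1) by (simp add: has_weak_partial_def)
      also have "(LINT x|lebesgue_on S. v x * \<psi> (x - (r * h) *\<^sub>R b)) = (LINT x|lborel. V x * \<psi> (x - (r * h) *\<^sub>R b))"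
      proof (rule integral_lebesgue_on_eq_lborel)
        show "AE x in lebesgue. indicator S x * (v x * \<psi> (x - (r * h) *\<^sub>R b)) = V x * \<psi> (x - (r * h) *\<^sub>R b)"
          using vV
        proof eventually_elim
          case (elim x)
          then show ?case using sh(3)[of x] K(2) by (cases "x \<in> K") auto
        qed
      qed (use S in auto)
      also have "\<dots> = (LINT x|lborel. V (x + (r * h) *\<^sub>R b) * \<psi> x)"
        using integral_lborel_translate[OF bmult[OF V \<psi>c[of "(r * h) *\<^sub>R b"] M(2)], of "(r * h) *\<^sub>R b"] by simp
      finally show ?thesis .
    qed
    have i1: "integrable lborel (\<lambda>x. U (x + h *\<^sub>R b) * \<psi> x)" "integrable lborel (\<lambda>x. U x * \<psi> x)"
      "integrable lborel (\<lambda>x. W x * \<psi> x)" "integrable lborel (\<lambda>x. U x * \<psi> (x - h *\<^sub>R b))"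
      using bmult[OF _ _ M(2)] U Uh W bmult[OF U \<psi>c M(2)] by auto
    have jU: "integrable (lborel \<Otimes>\<^sub>M lborel) (\<lambda>(r::real, x). indicator {0..1} r * (U x * ?D (x - (r * h) *\<^sub>R b)))"
    proof (rule Bochner_Integration.integrable_bound)
      show "integrable (lborel \<Otimes>\<^sub>M lborel) (\<lambda>z. M' * (case z of (r::real, x) \<Rightarrow> indicator {0..1} r * U (x + r *\<^sub>R 0)))"
        by (intro integrable_mult_right segment_average_integrable U)
      have "(\<lambda>z::real \<times> 'a. ?D (snd z - (fst z * h) *\<^sub>R b)) \<in> borel_measurable (borel \<Otimes>\<^sub>M borel)"
        by (rule measurable_compose[OF _ Dm]) measurable
      then show "(\<lambda>(r::real, x). indicator {0..1} r * (U x * ?D (x - (r * h) *\<^sub>R b))) \<in> borel_measurable (lborel \<Otimes>\<^sub>M lborel)"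
        by (simp add: case_prod_beta)
      show "AE z in lborel \<Otimes>\<^sub>M lborel. norm (case z of (r::real, x) \<Rightarrow> indicator {0..1} r * (U x * ?D (x - (r * h) *\<^sub>R b)))
         \<le> norm (M' * (case z of (r, x) \<Rightarrow> indicator {0..1} r * U (x + r *\<^sub>R 0)))"
        using abs_mult_bound[OF M'(2)] by (intro AE_I2) (simp add: case_prod_beta)
    qed
    have jVp: "integrable (lborel \<Otimes>\<^sub>M lborel) (\<lambda>(r::real, x). indicator {0..1} r * (V (x + (r * h) *\<^sub>R b) * \<psi> x))"
    proof (rule Bochner_Integration.integrable_bound)
      show "integrable (lborel \<Otimes>\<^sub>M lborel) (\<lambda>z. M * ?V z)" using jV by simp
      show "(\<lambda>(r::real, x). indicator {0..1} r * (V (x + (r * h) *\<^sub>R b) * \<psi> x)) \<in> borel_measurable (lborel \<Otimes>\<^sub>M lborel)"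
        by measurable
      show "AE z in lborel \<Otimes>\<^sub>M lborel. norm (case z of (r::real, x) \<Rightarrow> indicator {0..1} r * (V (x + (r * h) *\<^sub>R b) * \<psi> x))
         \<le> norm (M * ?V z)"
        using abs_mult_bound[OF M(2)] by (intro AE_I2) (simp add: case_prod_beta)
    qed
    have "(LINT x|lborel. (U (x + h *\<^sub>R b) - U x) * \<psi> x)
       = (LINT x|lborel. U (x + h *\<^sub>R b) * \<psi> x) - (LINT x|lborel. U x * \<psi> x)"
      using i1 by (simp add: left_diff_distrib)
    also have "(LINT x|lborel. U (x + h *\<^sub>R b) * \<psi> x) = (LINT x|lborel. U x * \<psi> (x - h *\<^sub>R b))"
      using integral_lborel_translate[OF i1(4), of "h *\<^sub>R b"] by simp
    also have "\<dots> - (LINT x|lborel. U x * \<psi> x) = - (LINT x|lborel. U x * (\<psi> x - \<psi> (x - h *\<^sub>R b)))"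
      using i1 by (simp add: right_diff_distrib)
    also have "(LINT x|lborel. U x * (\<psi> x - \<psi> (x - h *\<^sub>R b)))
       = h * (LINT x|lborel. (LINT r|lborel. indicator {0..1} r * (U x * ?D (x - (r * h) *\<^sub>R b))))"
    proof -
      have "U x * (\<psi> x - \<psi> (x - h *\<^sub>R b))
          = h * (LINT r|lborel. indicator {0..1} r * (U x * ?D (x - (r * h) *\<^sub>R b)))" for x
      proof -
        have "(LINT r|lborel. indicator {0..1} r * (U x * ?D (x - (r * h) *\<^sub>R b)))
          = (LINT r|lborel. U x * (indicator {0..1} r * ?D (x - (r * h) *\<^sub>R b)))"
          by (intro Bochner_Integration.integral_cong) auto
        also have "\<dots> = U x * (LINT r|lborel. indicator {0..1} r * ?D (x - (r * h) *\<^sub>R b))" by simp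
        finally show ?thesis
          unfolding test_function_difference[OF \<psi> b, of x h, symmetric] by (simp add: mult_ac)
      qed
      then show ?thesis by simp
    qed
    also have "(LINT x|lborel. (LINT r|lborel. indicator {0..1} r * (U x * ?D (x - (r * h) *\<^sub>R b))))
       = (LINT r|lborel. (LINT x|lborel. indicator {0..1} r * (U x * ?D (x - (r * h) *\<^sub>R b))))"
      by (rule lborel_pair.Fubini_integral[OF jU])
    also have "\<dots> = - (LINT r|lborel. (LINT x|lborel. indicator {0..1} r * (V (x + (r * h) *\<^sub>R b) * \<psi> x)))"
    proof -
      have "(LINT x|lborel. indicator {0..1} r * (U x * ?D (x - (r * h) *\<^sub>R b)))
          = - (LINT x|lborel. indicator {0..1} r * (V (x + (r * h) *\<^sub>R b) * \<psi> x))" for r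
        using dual[of r] by (cases "r \<in> {0..1}") simp_all
      then show ?thesis by simp
    qed
    also have "(LINT r|lborel. (LINT x|lborel. indicator {0..1} r * (V (x + (r * h) *\<^sub>R b) * \<psi> x)))
       = (LINT x|lborel. (LINT r|lborel. indicator {0..1} r * (V (x + (r * h) *\<^sub>R b) * \<psi> x)))"
      by (rule lborel_pair.Fubini_integral[OF jVp, symmetric])
    also have "\<dots> = (LINT x|lborel. W x * \<psi> x)"
    proof -
      have "(LINT r|lborel. indicator {0..1} r * (V (x + (r * h) *\<^sub>R b) * \<psi> x)) = W x * \<psi> x" for x
        unfolding W_def by (subst integral_mult_left_zero[symmetric]) (simp add: mult.assoc)
      then show ?thesis by simp
    qed
    finally have eq: "(LINT x|lborel. (U (x + h *\<^sub>R b) - U x) * \<psi> x) = h * (LINT x|lborel. W x * \<psi> x)" by simp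
    have "(LINT x|lebesgue_on N. f x * \<psi> x) = (LINT x|lborel. f x * \<psi> x)"
    proof (rule integral_lebesgue_on_eq_lborel)
      have "\<psi> x = 0" if "x \<notin> N" for x
        using test_function_zero[OF \<psi>, of x] test_function_support[OF \<psi>] that by blast
      then show "AE x in lebesgue. indicator N x * (f x * \<psi> x) = f x * \<psi> x"
        by (intro AE_I2) (auto simp: indicator_def)
    qed (use N f in auto)
    also have "\<dots> = (LINT x|lborel. (U (x + h *\<^sub>R b) - U x) * \<psi> x - h * (W x * \<psi> x))"
      by (intro Bochner_Integration.integral_cong) (auto simp: f_def algebra_simps)
    also have "\<dots> = 0"
      using eq i1 by (simp add: left_diff_distrib)
    finally show "(LINT x|lebesgue_on N. f x * \<psi> x) = 0" .
  qed
  then show ?thesis by (simp add: f_def W_def)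
qed

text \<open>By Fubini the L1 error is at most the average over r in [0, 1] of the L1 distance
  between V and its translate by \<open>r *\<^sub>R a n\<close>. This distance tends to 0 for each r
  and is bounded by twice the L1 norm of V.\<close>

lemma segment_average_tendsto:
  fixes V :: "'a::euclidean_space \<Rightarrow> real"
  assumes V: "integrable lborel V" and a: "a \<longlonglongrightarrow> 0"
  shows "(\<lambda>n. \<integral>x. \<bar>(LINT r|lborel. indicator {0..1::real} r * V (x + r *\<^sub>R a n)) - V x\<bar> \<partial>lborel) \<longlonglongrightarrow> 0"
proof -
  have [measurable]: "V \<in> borel_measurable borel" using V by auto
  define \<omega> where "\<omega> n r = (LINT x|lborel. \<bar>V (x + r *\<^sub>R a n) - V x\<bar>)" for n and r :: real
  have j: "integrable (lborel \<Otimes>\<^sub>M lborel) (\<lambda>(r::real, x). \<bar>indicator {0..1} r * (V (x + r *\<^sub>R a n) - V x)\<bar>)" for n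
  proof -
    have "integrable (lborel \<Otimes>\<^sub>M lborel)
       (\<lambda>z. (case z of (r::real, x) \<Rightarrow> indicator {0..1} r * V (x + r *\<^sub>R a n))
           - (case z of (r::real, x) \<Rightarrow> indicator {0..1} r * V (x + r *\<^sub>R 0)))"
      by (intro Bochner_Integration.integrable_diff segment_average_integrable V)
    then have "integrable (lborel \<Otimes>\<^sub>M lborel)
       (\<lambda>z. \<bar>(case z of (r::real, x) \<Rightarrow> indicator {0..1} r * V (x + r *\<^sub>R a n))
           - (case z of (r::real, x) \<Rightarrow> indicator {0..1} r * V (x + r *\<^sub>R 0))\<bar>)"
      by (rule integrable_abs)
    then show ?thesis by (simp add: case_prod_unfold right_diff_distrib)
  qed
  have le: "(LINT x|lborel. \<bar>(LINT r|lborel. indicator {0..1::real} r * V (x + r *\<^sub>R a n)) - V x\<bar>)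
      \<le> (LINT r|lborel. indicator {0..1} r * \<omega> n r)" for n
  proof -
    have 1: "AE x in lborel. integrable lborel (\<lambda>r. indicator {0..1::real} r * V (x + r *\<^sub>R a n))"
      using lborel_pair.AE_integrable_snd[of "\<lambda>r x. indicator {0..1} r * V (x + r *\<^sub>R a n)"]
        segment_average_integrable[OF V, of "a n"] by simp
    have 2: "AE x in lborel. \<bar>(LINT r|lborel. indicator {0..1::real} r * V (x + r *\<^sub>R a n)) - V x\<bar>
        \<le> (LINT r|lborel. \<bar>indicator {0..1} r * (V (x + r *\<^sub>R a n) - V x)\<bar>)"
      using 1
    proof eventually_elim
      case (elim x)
      have i: "integrable lborel (\<lambda>r. indicator {0..1::real} r * V x)" by simp
      have "(LINT r|lborel. indicator {0..1::real} r * V x) = V x" by simp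
      then have "(LINT r|lborel. indicator {0..1::real} r * V (x + r *\<^sub>R a n)) - V x
         = (LINT r|lborel. indicator {0..1::real} r * V (x + r *\<^sub>R a n) - indicator {0..1} r * V x)"
        by (subst Bochner_Integration.integral_diff[OF elim i]) simp
      also have "\<dots> = (LINT r|lborel. indicator {0..1} r * (V (x + r *\<^sub>R a n) - V x))"
        by (simp add: right_diff_distrib)
      finally show ?case by (simp only: integral_abs_bound)
    qed
    have "(LINT x|lborel. \<bar>(LINT r|lborel. indicator {0..1::real} r * V (x + r *\<^sub>R a n)) - V x\<bar>)
       \<le> (LINT x|lborel. (LINT r|lborel. \<bar>indicator {0..1} r * (V (x + r *\<^sub>R a n) - V x)\<bar>))"
    proof (rule integral_mono_AE)
      show "integrable lborel (\<lambda>x. \<bar>(LINT r|lborel. indicator {0..1::real} r * V (x + r *\<^sub>R a n)) - V x\<bar>)"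
        using lborel_pair.integrable_snd[of "\<lambda>r x. indicator {0..1} r * V (x + r *\<^sub>R a n)"]
          segment_average_integrable[OF V, of "a n"] V by simp
      show "integrable lborel (\<lambda>x. \<integral>r. \<bar>indicator {0..1} r * (V (x + r *\<^sub>R a n) - V x)\<bar> \<partial>lborel)"
        using lborel_pair.integrable_snd[of "\<lambda>r x. \<bar>indicator {0..1} r * (V (x + r *\<^sub>R a n) - V x)\<bar>"] j by simp
    qed (use 2 in auto)
    also have "\<dots> = (LINT r|lborel. (LINT x|lborel. \<bar>indicator {0..1} r * (V (x + r *\<^sub>R a n) - V x)\<bar>))"
      by (rule lborel_pair.Fubini_integral[OF j])
    also have "\<dots> = (LINT r|lborel. indicator {0..1} r * \<omega> n r)"
      by (simp add: \<omega>_def abs_mult)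
    finally show ?thesis .
  qed
  have "(\<lambda>n. \<integral>r. indicator {0..1} r * \<omega> n r \<partial>lborel) \<longlonglongrightarrow> (LINT r|(lborel :: real measure). 0)"
  proof (rule integral_dominated_convergence[where w = "\<lambda>r. indicator {0..1} r * (2 * (LINT x|lborel. \<bar>V x\<bar>))"])
    show "(\<lambda>r. indicator {0..1} r * \<omega> n r) \<in> borel_measurable lborel" for n
      unfolding \<omega>_def by measurable
    have "(\<lambda>n. indicator {0..1} r * \<omega> n r) \<longlonglongrightarrow> indicator {0..1} r * 0" for r
    proof (intro tendsto_intros)
      have "(\<lambda>n. r *\<^sub>R a n) \<longlonglongrightarrow> r *\<^sub>R 0" by (intro tendsto_intros a)
      then show "(\<lambda>n. \<omega> n r) \<longlonglongrightarrow> 0"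
        unfolding \<omega>_def by (intro L1_translation_tendsto[OF V]) simp
    qed
    then show "AE r in lborel. (\<lambda>n. indicator {0..1} r * \<omega> n r) \<longlonglongrightarrow> 0" by simp
    have "\<omega> n r \<le> 2 * (LINT x|lborel. \<bar>V x\<bar>)" for n r
    proof -
      have iV: "integrable lborel (\<lambda>x. \<bar>V x\<bar>)" using V by simp
      have "\<omega> n r \<le> (LINT x|lborel. \<bar>V (x + r *\<^sub>R a n)\<bar> + \<bar>V x\<bar>)"
        unfolding \<omega>_def by (intro integral_mono')
          (use iV integrable_lborel_translate[OF iV] in auto)
      also have "\<dots> = 2 * (LINT x|lborel. \<bar>V x\<bar>)"
        using iV integrable_lborel_translate[OF iV] integral_lborel_translate[OF iV] by simp
      finally show ?thesis .
    qed
    moreover have "0 \<le> \<omega> n r" for n r by (simp add: \<omega>_def)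
    ultimately show "AE r in lborel. norm (indicator {0..1} r * \<omega> n r) \<le> indicator {0..1} r * (2 * (LINT x|lborel. \<bar>V x\<bar>))" for n
      by (intro AE_I2) (auto split: split_indicator)
  qed auto
  then have lim: "(\<lambda>n. \<integral>r. indicator {0..1} r * \<omega> n r \<partial>lborel) \<longlonglongrightarrow> 0" by simp
  show ?thesis
    by (rule tendsto_sandwich[OF _ _ tendsto_const lim]) (use le in auto)
qed

section \<open>Calculus of weak partial derivatives: measurability, linearity, uniqueness,
  limits\<close>

lemma borel_measurable_lebesgue_on_AE:
  fixes f g :: "'a::euclidean_space \<Rightarrow> 'b::euclidean_space"
  assumes "f \<in> borel_measurable (lebesgue_on S)" "S \<in> sets lebesgue" "AE x in lebesgue_on S. f x = g x"
  shows "g \<in> borel_measurable (lebesgue_on S)"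
proof -
  have "(\<lambda>x. indicator S x *\<^sub>R f x) \<in> borel_measurable lebesgue"
    using assms by (subst (asm) borel_measurable_restrict_space_iff) auto
  moreover have "AE x in lebesgue. indicator S x *\<^sub>R f x = indicator S x *\<^sub>R g x"
    using assms by (subst (asm) AE_restrict_space_iff) (auto simp: indicator_def elim!: eventually_mono)
  ultimately have "(\<lambda>x. indicator S x *\<^sub>R g x) \<in> borel_measurable lebesgue"
    by (rule borel_measurable_AE)
  then show ?thesis using assms(2) by (subst borel_measurable_restrict_space_iff) auto
qed

lemma locally_integrable_on_measurable:
  assumes "open S" "locally_integrable_on f S"
  shows "f \<in> borel_measurable (lebesgue_on S)"
proof -
  obtain C :: "nat \<Rightarrow> 'a set" where C: "\<And>n. compact (C n)" "\<And>n. C n \<subseteq> S" "\<And>n. C n \<subseteq> interior (C (Suc n))" "\<Union>(range C) = S"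
    using open_Union_compact_subsets[OF assms(1)] by metis
  have mono: "incseq C" using C(3) interior_subset by (intro incseq_SucI) blast
  have "(\<lambda>x. indicator S x * f x) \<in> borel_measurable lebesgue"
  proof (rule borel_measurable_LIMSEQ_real)
    show "(\<lambda>x. indicator (C n) x * f x) \<in> borel_measurable lebesgue" for n
      using locally_integrable_on_integrable[OF assms(2) C(1,2)] by auto
    show "(\<lambda>n. indicator (C n) x * f x) \<longlonglongrightarrow> indicator S x * f x" for x
    proof (cases "x \<in> S")
      case True
      then obtain N where "x \<in> C N" using C(4) by auto
      then have "x \<in> C n" if "n \<ge> N" for n using mono that by (auto simp: incseq_def)
      then show ?thesis using True
        by (intro tendsto_eventually) (auto simp: eventually_sequentially intro!: exI[of _ N])
    next
      case False
      then have "x \<notin> C n" for n using C(2) by auto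
      then show ?thesis using False by simp
    qed
  qed
  then show ?thesis using assms(1) by (subst borel_measurable_restrict_space_iff) auto
qed

lemma locally_integrable_onI:
  assumes "\<And>C. compact C \<Longrightarrow> C \<subseteq> S \<Longrightarrow> integrable lebesgue (\<lambda>x. indicator C x * f x)"
  shows "locally_integrable_on f S"
  using assms by (auto simp: locally_integrable_on_def set_integrable_def)

lemma integrable_locally_integrable_on:
  assumes "S \<in> sets lebesgue" "integrable (lebesgue_on S) f"
  shows "locally_integrable_on f S"
proof (rule locally_integrable_onI)
  fix C assume C: "compact C" "C \<subseteq> S"
  have "integrable lebesgue (\<lambda>x. indicator C x *\<^sub>R (indicator S x * f x))"
    using assms C integrable_lebesgue_on_indicator[OF assms(1)]
    by (intro integrable_mult_indicator) (auto intro: fmeasurableD lmeasurable_compact)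
  moreover have "indicator C x *\<^sub>R (indicator S x * f x) = indicator C x * f x" for x
    using C by (auto split: split_indicator)
  ultimately show "integrable lebesgue (\<lambda>x. indicator C x * f x)" by (simp only:)
qed

lemma locally_integrable_on_bound:
  assumes S: "open S" and f: "locally_integrable_on f S" and g: "g \<in> borel_measurable (lebesgue_on S)"
    and le: "\<And>x. x \<in> S \<Longrightarrow> \<bar>g x\<bar> \<le> a + c * \<bar>f x\<bar>"
  shows "locally_integrable_on g S"
proof (rule locally_integrable_onI)
  fix C assume C: "compact C" "C \<subseteq> S"
  have [measurable]: "C \<in> sets lebesgue" using C by (auto intro: fmeasurableD lmeasurable_compact)
  have iC: "integrable lebesgue (indicator C :: 'a \<Rightarrow> real)"
    using lmeasurable_compact[OF C(1)] by (simp add: fmeasurable_def)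
  note fC = locally_integrable_on_integrable[OF f C]
  show "integrable lebesgue (\<lambda>x. indicator C x * g x)"
  proof (rule Bochner_Integration.integrable_bound)
    show "integrable lebesgue (\<lambda>x. \<bar>a\<bar> * indicator C x + \<bar>c\<bar> * \<bar>indicator C x * f x\<bar>)"
      using iC fC by (intro Bochner_Integration.integrable_add integrable_mult_right integrable_abs) auto
    have "(\<lambda>x. indicator S x * g x) \<in> borel_measurable lebesgue"
      using g S by (subst (asm) borel_measurable_restrict_space_iff) auto
    then have "(\<lambda>x. indicator C x * (indicator S x * g x)) \<in> borel_measurable lebesgue"
      by (rule borel_measurable_times[rotated]) simp
    moreover have "indicator C x * (indicator S x * g x) = indicator C x * g x" for x
      using C by (auto split: split_indicator)
    ultimately show "(\<lambda>x. indicator C x * g x) \<in> borel_measurable lebesgue" by (simp only:)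
    show "AE x in lebesgue. norm (indicator C x * g x) \<le> norm (\<bar>a\<bar> * indicator C x + \<bar>c\<bar> * \<bar>indicator C x * f x\<bar>)"
    proof (rule AE_I2)
      fix x
      show "norm (indicator C x * g x) \<le> norm (\<bar>a\<bar> * indicator C x + \<bar>c\<bar> * \<bar>indicator C x * f x\<bar>)"
      proof (cases "x \<in> C")
        case True
        then have "\<bar>g x\<bar> \<le> a + c * \<bar>f x\<bar>" using le C by auto
        also have "\<dots> \<le> \<bar>a\<bar> + \<bar>c\<bar> * \<bar>f x\<bar>" by (intro add_mono mult_right_mono) auto
        finally show ?thesis using True by simp
      qed simp
    qed
  qed
qed

lemma locally_integrable_on_test_function:
  assumes "open S" "locally_integrable_on f S" "\<phi> \<in> test_functions S"
  shows "integrable (lebesgue_on S) (\<lambda>x. f x * \<phi> x)"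
    and "b \<in> Basis \<Longrightarrow> integrable (lebesgue_on S) (\<lambda>x. f x * frechet_derivative \<phi> (at x) b)"
proof -
  have *: "integrable (lebesgue_on S) (\<lambda>x. f x * p x)"
    if p: "continuous_on UNIV p" "\<And>x. x \<notin> closure {x. \<phi> x \<noteq> 0} \<Longrightarrow> p x = 0" for p
  proof -
    let ?K = "closure {x. \<phi> x \<noteq> 0}"
    note K = test_function_compact[OF assms(3)] test_function_support[OF assms(3)]
    obtain M where M: "M > 0" "\<And>x. \<bar>p x\<bar> \<le> M" using compact_support_bounded[OF p(1) K(1) p(2)] by blast
    have [measurable]: "p \<in> borel_measurable lebesgue"
      using p(1) by (intro borel_measurable_lebesgueI borel_measurable_continuous_onI)
    note fK = locally_integrable_on_integrable[OF assms(2) K]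
    have "integrable lebesgue (\<lambda>x. indicator ?K x * f x * p x)"
    proof (rule Bochner_Integration.integrable_bound)
      show "integrable lebesgue (\<lambda>x. M * (indicator ?K x * f x))" using fK by simp
      show "(\<lambda>x. indicator ?K x * f x * p x) \<in> borel_measurable lebesgue"
        by (rule borel_measurable_times[OF borel_measurable_integrable[OF fK]]) simp
      show "AE x in lebesgue. norm (indicator ?K x * f x * p x) \<le> norm (M * (indicator ?K x * f x))"
        using abs_mult_bound[OF M(2)] by (intro AE_I2) (simp add: mult.assoc)
    qed
    moreover have "indicator ?K x * f x * p x = indicator S x * (f x * p x)" for x
      using p(2)[of x] K(2) by (auto simp: indicator_def)
    ultimately show ?thesis
      using assms(1) by (subst integrable_lebesgue_on_indicator) auto
  qed
  show "integrable (lebesgue_on S) (\<lambda>x. f x * \<phi> x)"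
    using test_function_zero[OF assms(3)] by (intro * test_function_continuous[OF assms(3)]) blast
  show "integrable (lebesgue_on S) (\<lambda>x. f x * frechet_derivative \<phi> (at x) b)" if "b \<in> Basis"
    using test_function_partial_zero[OF assms(3)] by (intro * test_function_partial_continuous[OF assms(3) that]) blast
qed

lemma locally_integrable_on_linear:
  assumes "locally_integrable_on f S" "locally_integrable_on g S"
  shows "locally_integrable_on (\<lambda>x. c * f x + d * g x) S"
proof (rule locally_integrable_onI)
  fix C assume C: "compact C" "C \<subseteq> S"
  have "integrable lebesgue (\<lambda>x. c * (indicator C x * f x) + d * (indicator C x * g x))"
    using assms[THEN locally_integrable_on_integrable, OF C]
    by (intro Bochner_Integration.integrable_add integrable_mult_right)
  then show "integrable lebesgue (\<lambda>x. indicator C x * (c * f x + d * g x))"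
    by (simp add: algebra_simps)
qed

lemma has_weak_partial_linear:
  assumes S: "open S" "b \<in> Basis" and u: "has_weak_partial S b u v" and u': "has_weak_partial S b u' v'"
  shows "has_weak_partial S b (\<lambda>x. c * u x + d * u' x) (\<lambda>x. c * v x + d * v' x)"
  unfolding has_weak_partial_def
proof (intro conjI ballI)
  note li = u[unfolded has_weak_partial_def, THEN conjunct1] u[unfolded has_weak_partial_def, THEN conjunct2, THEN conjunct1]
     u'[unfolded has_weak_partial_def, THEN conjunct1] u'[unfolded has_weak_partial_def, THEN conjunct2, THEN conjunct1]
  show "locally_integrable_on (\<lambda>x. c * u x + d * u' x) S" "locally_integrable_on (\<lambda>x. c * v x + d * v' x) S"
    using li by (auto intro: locally_integrable_on_linear)
  fix \<phi> assume \<phi>: "\<phi> \<in> test_functions S"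
  note i = locally_integrable_on_test_function[OF S(1) _ \<phi>]
  have "(LINT x|lebesgue_on S. (c * u x + d * u' x) * frechet_derivative \<phi> (at x) b)
     = c * (LINT x|lebesgue_on S. u x * frechet_derivative \<phi> (at x) b) + d * (LINT x|lebesgue_on S. u' x * frechet_derivative \<phi> (at x) b)"
    using i(2)[OF li(1) S(2)] i(2)[OF li(3) S(2)] by (simp add: distrib_right mult.assoc)
  also have "\<dots> = - (c * (LINT x|lebesgue_on S. v x * \<phi> x) + d * (LINT x|lebesgue_on S. v' x * \<phi> x))"
    using u u' \<phi> by (simp add: has_weak_partial_def)
  also have "\<dots> = - (LINT x|lebesgue_on S. (c * v x + d * v' x) * \<phi> x)"
    using i(1)[OF li(2)] i(1)[OF li(4)] by (simp add: distrib_right mult.assoc)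
  finally show "(LINT x|lebesgue_on S. (c * u x + d * u' x) * frechet_derivative \<phi> (at x) b)
     = - (LINT x|lebesgue_on S. (c * v x + d * v' x) * \<phi> x)" .
qed

lemma has_weak_partial_unique:
  assumes S: "open S" "b \<in> Basis" and u: "has_weak_partial S b u v" and u': "has_weak_partial S b u v'"
  shows "AE x in lebesgue_on S. v x = v' x"
proof -
  have w: "has_weak_partial S b (\<lambda>x. 1 * u x + (- 1) * u x) (\<lambda>x. 1 * v x + (- 1) * v' x)"
    by (rule has_weak_partial_linear[OF S u u'])
  have "AE x in lebesgue_on S. 1 * v x + (- 1) * v' x = 0"
  proof (rule AE_zero_if_test_integrals_zero[OF S(1)])
    show "locally_integrable_on (\<lambda>x. 1 * v x + (- 1) * v' x) S" using w by (simp add: has_weak_partial_def)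
    show "(LINT x|lebesgue_on S. (1 * v x + (- 1) * v' x) * \<phi> x) = 0" if "\<phi> \<in> test_functions S" for \<phi>
      using w that by (simp add: has_weak_partial_def)
  qed
  then show ?thesis by eventually_elim simp
qed

lemma has_weak_partial_cong_AE:
  assumes S: "open S" and u: "has_weak_partial S b u v" and b: "b \<in> Basis"
    and ae: "AE x in lebesgue_on S. u x = u' x" "AE x in lebesgue_on S. v x = v' x"
  shows "has_weak_partial S b u' v'"
proof -
  have sl: "S \<in> sets lebesgue" using S by simp
  have li: "locally_integrable_on f' S" if "locally_integrable_on f S" "AE x in lebesgue_on S. f x = f' x" for f f'
  proof (rule locally_integrable_onI)
    fix C assume C: "compact C" "C \<subseteq> S"
    note i = locally_integrable_on_integrable[OF that(1) C]
    have ae: "AE x in lebesgue. indicator C x * f x = indicator C x * f' x"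
      using that(2) sl C(2) by (subst (asm) AE_restrict_space_iff) (auto simp: indicator_def elim!: eventually_mono)
    show "integrable lebesgue (\<lambda>x. indicator C x * f' x)"
      using i integrable_cong_AE[OF borel_measurable_integrable[OF i]
          borel_measurable_AE[OF borel_measurable_integrable[OF i] ae] ae] by blast
  qed
  have u0: "locally_integrable_on u S" "locally_integrable_on v S" using u by (auto simp: has_weak_partial_def)
  have cong: "(LINT x|lebesgue_on S. f' x * p x) = (LINT x|lebesgue_on S. f x * p x)"
    if i: "integrable (lebesgue_on S) (\<lambda>x. f x * p x)" and ae: "AE x in lebesgue_on S. f x = f' x" for f f' p :: "'a \<Rightarrow> real"
  proof -
    have ae': "AE x in lebesgue_on S. f x * p x = f' x * p x" using ae by eventually_elim simp
    show ?thesis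
      by (rule integral_cong_AE[symmetric, OF borel_measurable_integrable[OF i]
            borel_measurable_lebesgue_on_AE[OF borel_measurable_integrable[OF i] sl ae'] ae'])
  qed
  show ?thesis
    unfolding has_weak_partial_def
  proof (intro conjI ballI)
    show "locally_integrable_on u' S" "locally_integrable_on v' S" using li u0 ae by blast+
    fix \<phi> assume \<phi>: "\<phi> \<in> test_functions S"
    show "(LINT x|lebesgue_on S. u' x * frechet_derivative \<phi> (at x) b) = - (LINT x|lebesgue_on S. v' x * \<phi> x)"
      using cong[OF locally_integrable_on_test_function(2)[OF S u0(1) \<phi> b] ae(1)]
         cong[OF locally_integrable_on_test_function(1)[OF S u0(2) \<phi>] ae(2)] u \<phi>
      by (simp add: has_weak_partial_def)
  qed
qed

text \<open>Test functions and their derivatives are bounded, so the defining identity is stable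
  under L1 convergence of the functions and of their derivatives. In this way the singular f' is
  reached, to which the chain rule below does not apply directly.\<close>

lemma has_weak_partial_L1_limit:
  assumes S: "open S" and b: "b \<in> Basis" and w: "\<And>n. has_weak_partial S b (u n) (v n)"
    and i: "\<And>n. integrable (lebesgue_on S) (u n)" "\<And>n. integrable (lebesgue_on S) (v n)"
      "integrable (lebesgue_on S) u'" "integrable (lebesgue_on S) v'"
    and l: "(\<lambda>n. \<integral>x. \<bar>u n x - u' x\<bar> \<partial>lebesgue_on S) \<longlonglongrightarrow> 0" "(\<lambda>n. \<integral>x. \<bar>v n x - v' x\<bar> \<partial>lebesgue_on S) \<longlonglongrightarrow> 0"
  shows "has_weak_partial S b u' v'"
proof -
  have sl: "S \<in> sets lebesgue" using S by simp
  have lim: "(\<lambda>n. \<integral>x. f n x * p x \<partial>lebesgue_on S) \<longlonglongrightarrow> (LINT x|lebesgue_on S. f' x * p x)"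
    if f: "\<And>n. integrable (lebesgue_on S) (f n)" "integrable (lebesgue_on S) f'"
      and l: "(\<lambda>n. \<integral>x. \<bar>f n x - f' x\<bar> \<partial>lebesgue_on S) \<longlonglongrightarrow> 0"
      and p: "\<And>x. \<bar>p x\<bar> \<le> M" and fp: "\<And>n. integrable (lebesgue_on S) (\<lambda>x. f n x * p x)" "integrable (lebesgue_on S) (\<lambda>x. f' x * p x)"
    for f :: "nat \<Rightarrow> 'a \<Rightarrow> real" and f' p :: "'a \<Rightarrow> real" and M
  proof -
    have "(\<lambda>n. (LINT x|lebesgue_on S. f n x * p x) - (LINT x|lebesgue_on S. f' x * p x)) \<longlonglongrightarrow> 0"
    proof (rule Lim_null_comparison)
      show "(\<lambda>n. M * (LINT x|lebesgue_on S. \<bar>f n x - f' x\<bar>)) \<longlonglongrightarrow> 0"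
        using tendsto_mult[OF tendsto_const l, of M] by simp
      have "norm ((LINT x|lebesgue_on S. f n x * p x) - (LINT x|lebesgue_on S. f' x * p x))
          \<le> M * (LINT x|lebesgue_on S. \<bar>f n x - f' x\<bar>)" for n
      proof -
        have "norm ((LINT x|lebesgue_on S. f n x * p x) - (LINT x|lebesgue_on S. f' x * p x))
           = norm (LINT x|lebesgue_on S. f n x * p x - f' x * p x)" using fp by simp
        also have "\<dots> \<le> (LINT x|lebesgue_on S. norm (f n x * p x - f' x * p x))" by (rule integral_norm_bound)
        also have "\<dots> \<le> (LINT x|lebesgue_on S. M * \<bar>f n x - f' x\<bar>)"
        proof (rule integral_mono)
          show "integrable (lebesgue_on S) (\<lambda>x. norm (f n x * p x - f' x * p x))" using fp by auto
          show "integrable (lebesgue_on S) (\<lambda>x. M * \<bar>f n x - f' x\<bar>)" using f by auto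
          show "norm (f n x * p x - f' x * p x) \<le> M * \<bar>f n x - f' x\<bar>" for x
          proof -
            have "norm (f n x * p x - f' x * p x) = \<bar>p x\<bar> * \<bar>f n x - f' x\<bar>"
              by (simp add: abs_mult[symmetric] algebra_simps)
            then show ?thesis using mult_right_mono[OF p[of x], of "\<bar>f n x - f' x\<bar>"] by simp
          qed
        qed
        finally show ?thesis by simp
      qed
      then show "\<forall>\<^sub>F n in sequentially. norm ((LINT x|lebesgue_on S. f n x * p x) - (LINT x|lebesgue_on S. f' x * p x))
          \<le> M * (LINT x|lebesgue_on S. \<bar>f n x - f' x\<bar>)" by simp
    qed
    then show ?thesis by (rule LIM_zero_cancel)
  qed
  note li = integrable_locally_integrable_on[OF sl]
  show ?thesis
    unfolding has_weak_partial_def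
  proof (intro conjI ballI)
    show "locally_integrable_on u' S" "locally_integrable_on v' S" using li i by auto
    fix \<phi> assume \<phi>: "\<phi> \<in> test_functions S"
    obtain M where M: "\<And>x. \<bar>\<phi> x\<bar> \<le> M" using test_function_bounded[OF \<phi>] by blast
    obtain M' where M': "\<And>x. \<bar>frechet_derivative \<phi> (at x) b\<bar> \<le> M'" using test_function_partial_bounded[OF \<phi> b] by blast
    note t = locally_integrable_on_test_function[OF S li \<phi>]
    have "(\<lambda>n. \<integral>x. u n x * frechet_derivative \<phi> (at x) b \<partial>lebesgue_on S) \<longlonglongrightarrow> (LINT x|lebesgue_on S. u' x * frechet_derivative \<phi> (at x) b)"
      by (rule lim[OF i(1,3) l(1) M' t(2)[OF i(1) b] t(2)[OF i(3) b]])
    moreover have "(\<lambda>n. - (LINT x|lebesgue_on S. v n x * \<phi> x)) \<longlonglongrightarrow> - (LINT x|lebesgue_on S. v' x * \<phi> x)"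
      by (intro tendsto_minus lim[OF i(2,4) l(2) M t(1)[OF i(2)] t(1)[OF i(4)]])
    moreover have "(LINT x|lebesgue_on S. u n x * frechet_derivative \<phi> (at x) b) = - (LINT x|lebesgue_on S. v n x * \<phi> x)" for n
      using w \<phi> by (simp add: has_weak_partial_def)
    ultimately show "(LINT x|lebesgue_on S. u' x * frechet_derivative \<phi> (at x) b) = - (LINT x|lebesgue_on S. v' x * \<phi> x)"
      using LIMSEQ_unique by auto
  qed
qed

subsection \<open>The chain rule\<close>

lemma real_lipschitz_of_deriv:
  fixes F :: "real \<Rightarrow> real"
  assumes "\<And>y. (F has_real_derivative F' y) (at y)" "\<And>y. \<bar>F' y\<bar> \<le> C"
  shows "\<bar>F y - F z\<bar> \<le> C * \<bar>y - z\<bar>"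
  using field_differentiable_bound[of UNIV F F' C y z] assms
  by (auto intro: has_field_derivative_at_within)

lemma test_function_directional_limit:
  assumes \<psi>: "\<psi> \<in> test_functions S" and h: "h \<longlonglongrightarrow> 0" "\<And>n. h n \<noteq> 0"
  shows "(\<lambda>n. (\<psi> x - \<psi> (x - h n *\<^sub>R b)) / h n) \<longlonglongrightarrow> frechet_derivative \<psi> (at x) b"
proof -
  let ?D = "frechet_derivative \<psi> (at x)"
  have lin: "linear ?D"
    using test_function_has_derivative[OF \<psi>] has_derivative_bounded_linear bounded_linear.linear by blast
  have 1: "((\<lambda>t. x - t *\<^sub>R b) has_derivative (\<lambda>s. - (s *\<^sub>R b))) (at 0)"
    by (auto intro!: derivative_eq_intros)
  have "((\<lambda>t. \<psi> (x - t *\<^sub>R b)) has_derivative (\<lambda>s. ?D (- (s *\<^sub>R b)))) (at 0)"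
    by (rule has_derivative_compose[OF 1]) (simp add: test_function_has_derivative[OF \<psi>])
  then have "((\<lambda>t. \<psi> (x - t *\<^sub>R b)) has_derivative (\<lambda>s. (- ?D b) * s)) (at 0)"
    by (simp add: linear_neg[OF lin] linear_scale[OF lin] mult.commute)
  then have "((\<lambda>t. (\<psi> (x - t *\<^sub>R b) - \<psi> x) / t) \<longlongrightarrow> - ?D b) (at 0)"
    unfolding has_field_derivative_def[symmetric] has_field_derivative_iff by simp
  moreover have "filterlim h (at 0) sequentially" using h by (simp add: filterlim_at)
  ultimately have "(\<lambda>n. (\<psi> (x - h n *\<^sub>R b) - \<psi> x) / h n) \<longlonglongrightarrow> - ?D b"
    by (rule filterlim_compose)
  then have "(\<lambda>n. - ((\<psi> (x - h n *\<^sub>R b) - \<psi> x) / h n)) \<longlonglongrightarrow> - (- ?D b)" by (rule tendsto_minus)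
  then show ?thesis by (simp add: minus_divide_left)
qed

text \<open>By the difference formula, \<open>U (x + h b) = U x + h q\<close> where q converges in
  L1 to the weak derivative as h tends to 0. The difference quotient of F(u) is then that of F along
  a known increment, and a discrete integration by parts passes to the limit. The bound on F'
  supplies the Lipschitz estimate and the majorants.\<close>

lemma has_weak_partial_chain:
  fixes u v :: "'a::euclidean_space \<Rightarrow> real"
  assumes S: "open S" and b: "b \<in> Basis" and w: "has_weak_partial S b u v"
    and F: "\<And>y. (F has_real_derivative F' y) (at y)" and F'c: "continuous_on UNIV F'"
    and F'b: "\<And>y. \<bar>F' y\<bar> \<le> C"
  shows "has_weak_partial S b (\<lambda>x. F (u x)) (\<lambda>x. F' (u x) * v x)"
  unfolding has_weak_partial_def
proof (intro conjI ballI)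
  have C0: "C \<ge> 0" using F'b[of 0] by linarith
  have lip: "\<bar>F y - F z\<bar> \<le> C * \<bar>y - z\<bar>" for y z by (rule real_lipschitz_of_deriv[OF F F'b])
  have Fc: "continuous_on UNIV F" using F by (meson DERIV_isCont continuous_at_imp_continuous_on)
  have [measurable]: "F \<in> borel_measurable borel" "F' \<in> borel_measurable borel"
    using Fc F'c by (auto intro: borel_measurable_continuous_onI)
  have li: "locally_integrable_on u S" "locally_integrable_on v S" using w by (auto simp: has_weak_partial_def)
  note um = locally_integrable_on_measurable[OF S li(1)] locally_integrable_on_measurable[OF S li(2)]
  have Fum: "(\<lambda>x. F (u x)) \<in> borel_measurable (lebesgue_on S)" "(\<lambda>x. F' (u x)) \<in> borel_measurable (lebesgue_on S)"
    by (rule measurable_compose[OF um(1)], simp)+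
  show "locally_integrable_on (\<lambda>x. F (u x)) S"
  proof (rule locally_integrable_on_bound[OF S li(1) Fum(1)])
    show "\<bar>F (u x)\<bar> \<le> \<bar>F 0\<bar> + C * \<bar>u x\<bar>" for x using lip[of "u x" 0] by simp
  qed
  show "locally_integrable_on (\<lambda>x. F' (u x) * v x) S"
  proof (rule locally_integrable_on_bound[OF S li(2)])
    show "(\<lambda>x. F' (u x) * v x) \<in> borel_measurable (lebesgue_on S)" using Fum(2) um(2) by (rule borel_measurable_times)
    show "\<bar>F' (u x) * v x\<bar> \<le> 0 + C * \<bar>v x\<bar>" for x
      using mult_right_mono[OF F'b[of "u x"], of "\<bar>v x\<bar>"] by (simp add: abs_mult)
  qed
  fix \<psi> assume \<psi>: "\<psi> \<in> test_functions S"
  let ?D = "\<lambda>x. frechet_derivative \<psi> (at x) b"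
  let ?K0 = "closure {x. \<psi> x \<noteq> 0}"
  note K0 = test_function_compact[OF \<psi>] test_function_support[OF \<psi>]
  have \<psi>0: "\<psi> x = 0" if "x \<notin> ?K0" for x using test_function_zero[OF \<psi> that] .
  have D0: "?D x = 0" if "x \<notin> ?K0" for x using test_function_partial_zero[OF \<psi> that] .
  obtain M where M: "M > 0" "\<And>x. \<bar>\<psi> x\<bar> \<le> M" using test_function_bounded[OF \<psi>] by blast
  obtain M' where M': "M' > 0" "\<And>x. \<bar>?D x\<bar> \<le> M'" using test_function_partial_bounded[OF \<psi> b] by blast
  have \<psi>m[measurable]: "\<psi> \<in> borel_measurable borel"
    using test_function_continuous[OF \<psi>] by (rule borel_measurable_continuous_onI)
  have Dm[measurable]: "?D \<in> borel_measurable borel"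
    using test_function_partial_continuous[OF \<psi> b] by (rule borel_measurable_continuous_onI)
  obtain e where e: "e > 0" "(\<Union>x\<in>?K0. cball x e) \<subseteq> S"
    using compact_subset_open_imp_cball_epsilon_subset[OF K0(1) S K0(2)] by blast
  \<comment> \<open>\<open>K\<close> is the closed e-neighbourhood of the support of \<psi> and
    \<open>N\<close> its open e/2-neighbourhood, so steps of length at most e/2 lead from
    \<open>N\<close> into \<open>K\<close>.\<close>
  define K where "K = {x + y | x y. x \<in> ?K0 \<and> y \<in> cball 0 e}"
  define N where "N = (\<Union>x\<in>?K0. ball x (e/2))"
  have K: "compact K" "K \<subseteq> S"
  proof -
    show "compact K" unfolding K_def by (rule compact_sums[OF K0(1) compact_cball])
    have "x0 + y \<in> S" if "x0 \<in> ?K0" "norm y \<le> e" for x0 y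
    proof -
      have "x0 + y \<in> cball x0 e" using that(2) by (simp add: dist_norm)
      then show ?thesis using e(2) that(1) by blast
    qed
    then show "K \<subseteq> S" by (auto simp: K_def)
  qed
  have N: "open N" by (auto simp: N_def)
  have K0N: "?K0 \<subseteq> N" using e(1) by (auto simp: N_def)
  define h where "h n = (e / 2) / (real n + 1)" for n
  have h: "0 < h n" "h n \<le> e / 2" for n
    using e(1) by (auto simp: h_def field_simps)
  have h0: "h \<longlonglongrightarrow> 0"
    unfolding h_def using tendsto_mult[OF tendsto_const LIMSEQ_inverse_real_of_nat, of "e/2"]
    by (simp add: field_simps)
  have nb: "norm b = 1" using b by simp
  have NK: "x + t *\<^sub>R b \<in> K" if x: "x \<in> N" and t: "\<bar>t\<bar> \<le> e / 2" for x t
  proof -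
    obtain x0 where x0: "x0 \<in> ?K0" "dist x0 x < e / 2" using x by (auto simp: N_def)
    have "norm (x - x0 + t *\<^sub>R b) \<le> norm (x - x0) + norm (t *\<^sub>R b)" by (rule norm_triangle_ineq)
    also have "\<dots> \<le> e" using x0(2) t nb by (simp add: dist_norm norm_minus_commute)
    finally have "x - x0 + t *\<^sub>R b \<in> cball 0 e" by simp
    moreover have "x + t *\<^sub>R b = x0 + (x - x0 + t *\<^sub>R b)" by simp
    ultimately show ?thesis using x0(1) unfolding K_def by blast
  qed
  have [measurable]: "K \<in> sets borel" using K(1) by (simp add: compact_imp_closed)
  obtain U where U: "integrable lborel U" and uU: "AE x in lebesgue. indicator K x * u x = U x"
    using integrable_lebesgue_borel_rep[OF locally_integrable_on_integrable[OF li(1) K]] by blast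
  obtain V where V: "integrable lborel V" and vV: "AE x in lebesgue. indicator K x * v x = V x"
    using integrable_lebesgue_borel_rep[OF locally_integrable_on_integrable[OF li(2) K]] by blast
  have [measurable]: "U \<in> borel_measurable borel" "V \<in> borel_measurable borel" using U V by auto
  define q where "q n x = (LINT r|lborel. indicator {0..1} r * V (x + (r * h n) *\<^sub>R b))" for n x
  have diff: "AE x in lborel. x \<in> N \<longrightarrow> U (x + h n *\<^sub>R b) - U x = h n * q n x" for n
  proof -
    have "AE x in lebesgue_on N. U (x + h n *\<^sub>R b) - U x = h n * q n x"
      unfolding q_def
    proof (rule weak_partial_difference[OF S w b N K _ U V])
      fix x and r :: real assume x: "x \<in> N" and r: "r \<in> {0..1}"
      have "\<bar>r * h n\<bar> \<le> 1 * (e / 2)" unfolding abs_mult using r h[of n] by (intro mult_mono) auto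
      then show "x + (r * h n) *\<^sub>R b \<in> K" using NK[OF x] by simp
    next
      show "AE x in lebesgue. x \<in> K \<longrightarrow> u x = U x" using uU by eventually_elim auto
      show "AE x in lebesgue. x \<in> K \<longrightarrow> v x = V x" using vV by eventually_elim auto
    qed
    then have "AE x in lebesgue. x \<in> N \<longrightarrow> U (x + h n *\<^sub>R b) - U x = h n * q n x"
      using N by (subst (asm) AE_restrict_space_iff) auto
    then show ?thesis by (simp add: AE_completion_iff)
  qed
  have [measurable]: "q n \<in> borel_measurable borel" for n unfolding q_def by measurable
  have qL1: "integrable lborel (q n)" for n
    using lborel_pair.integrable_snd[of "\<lambda>r x. indicator {0..1} r * V (x + r *\<^sub>R (h n *\<^sub>R b))"]
      segment_average_integrable[OF V, of "h n *\<^sub>R b"] by (simp add: q_def[abs_def])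
  have qV: "(\<lambda>n. \<integral>x. \<bar>q n x - V x\<bar> \<partial>lborel) \<longlonglongrightarrow> 0"
  proof -
    have "(\<lambda>n. h n *\<^sub>R b) \<longlonglongrightarrow> 0 *\<^sub>R b" by (intro tendsto_intros h0)
    then have "(\<lambda>n. h n *\<^sub>R b) \<longlonglongrightarrow> 0" by simp
    from segment_average_tendsto[OF V this] show ?thesis by (simp add: q_def)
  qed
  \<comment> \<open>The cut-off to \<open>K\<close> makes F(U) integrable on the whole space, since
    \<open>F 0\<close> need not be 0. It is invisible to the test function: for x in the support of
    \<psi>, both x and its shift by \<open>h n\<close> lie in \<open>K\<close>.\<close>
  define P where "P x = indicator K x * F (U x)" for x
  have [measurable]: "P \<in> borel_measurable borel" unfolding P_def by measurable
  have iK: "integrable lborel (indicator K :: 'a \<Rightarrow> real)"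
    using emeasure_bounded_finite[OF compact_imp_bounded[OF K(1)]] by (intro integrable_real_indicator) auto
  have P: "integrable lborel P"
  proof (rule Bochner_Integration.integrable_bound)
    show "integrable lborel (\<lambda>x. \<bar>F 0\<bar> * indicator K x + C * \<bar>U x\<bar>)" using iK U by auto
    have "\<bar>F (U x)\<bar> \<le> \<bar>F 0\<bar> + C * \<bar>U x\<bar>" for x using lip[of "U x" 0] by simp
    then show "AE x in lborel. norm (P x) \<le> norm (\<bar>F 0\<bar> * indicator K x + C * \<bar>U x\<bar>)"
      using C0 by (intro AE_I2) (auto simp: P_def split: split_indicator)
  qed simp
  \<comment> \<open>Difference quotients of F along the true increment and along its linearization
    with V. Since \<open>q n\<close> converges to V in L1 only, the two are compared through the
    Lipschitz bound, and pointwise convergence is used for \<open>R'\<close> alone.\<close>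
  define R where "R n x = (F (U x + h n * q n x) - F (U x)) / h n" for n x
  define R' where "R' n x = (F (U x + h n * V x) - F (U x)) / h n" for n x
  have [measurable]: "R n \<in> borel_measurable borel" "R' n \<in> borel_measurable borel" for n
    unfolding R_def R'_def by measurable
  have Rb: "\<bar>R n x\<bar> \<le> C * \<bar>q n x\<bar>" "\<bar>R' n x\<bar> \<le> C * \<bar>V x\<bar>" "\<bar>R n x - R' n x\<bar> \<le> C * \<bar>q n x - V x\<bar>" for n x
  proof -
    have *: "\<bar>(F y - F z) / h n\<bar> \<le> C * \<bar>(y - z) / h n\<bar>" for y z
      using lip[of y z] h(1)[of n] by (simp add: abs_divide divide_right_mono)
    show "\<bar>R n x\<bar> \<le> C * \<bar>q n x\<bar>" "\<bar>R' n x\<bar> \<le> C * \<bar>V x\<bar>"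
      using *[of "U x + h n * q n x" "U x"] *[of "U x + h n * V x" "U x"] h(1)[of n]
      by (auto simp: R_def R'_def)
    have "((U x + h n * q n x) - (U x + h n * V x)) / h n = q n x - V x"
      using h(1)[of n] by (simp add: field_simps)
    then show "\<bar>R n x - R' n x\<bar> \<le> C * \<bar>q n x - V x\<bar>"
      using *[of "U x + h n * q n x" "U x + h n * V x"] by (simp add: R_def R'_def diff_divide_distrib)
  qed
  have iR: "integrable lborel (\<lambda>x. R n x * \<psi> x)" "integrable lborel (\<lambda>x. R' n x * \<psi> x)" for n
  proof -
    have *: "integrable lborel (\<lambda>x. f x * \<psi> x)" if "integrable lborel g" "f \<in> borel_measurable borel" "\<And>x. \<bar>f x\<bar> \<le> C * \<bar>g x\<bar>" for f g
    proof (rule Bochner_Integration.integrable_bound)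
      show "integrable lborel (\<lambda>x. M * (C * \<bar>g x\<bar>))" using that by simp
      have "norm (f x * \<psi> x) \<le> norm (M * (C * \<bar>g x\<bar>))" for x
        using mult_mono[OF M(2)[of x] that(3)[of x]] M C0 by (simp add: abs_mult mult.commute)
      then show "AE x in lborel. norm (f x * \<psi> x) \<le> norm (M * (C * \<bar>g x\<bar>))" by simp
    qed (use that in auto)
    show "integrable lborel (\<lambda>x. R n x * \<psi> x)" by (rule *[OF qL1[of n]]) (use Rb in auto)
    show "integrable lborel (\<lambda>x. R' n x * \<psi> x)" by (rule *[OF V]) (use Rb in auto)
  qed
  \<comment> \<open>Discrete integration by parts: the shift moves from \<psi> to \<open>P\<close>,
    where the difference formula turns the increment of U into \<open>h n * q n\<close>.\<close>
  have step: "(LINT x|lborel. P x * ((\<psi> x - \<psi> (x - h n *\<^sub>R b)) / h n)) = - (LINT x|lborel. R n x * \<psi> x)" for n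
  proof -
    have bm: "integrable lborel (\<lambda>x. f x * p x)"
      if "integrable lborel f" "p \<in> borel_measurable borel" "\<And>x. \<bar>p x\<bar> \<le> M" for f p :: "'a \<Rightarrow> real"
      using integrable_mult_bounded[OF that(1) _ that(3)] that(2) by simp
    note i1 = bm[OF P \<psi>m M(2)]
    have i2: "integrable lborel (\<lambda>x. P x * \<psi> (x - h n *\<^sub>R b))" by (rule bm[OF P _ M(2)]) measurable
    have i3: "integrable lborel (\<lambda>x. P (x + h n *\<^sub>R b) * \<psi> x)"
      by (rule bm[OF integrable_lborel_translate[OF P] \<psi>m M(2)])
    have "(LINT x|lborel. P x * ((\<psi> x - \<psi> (x - h n *\<^sub>R b)) / h n))
       = (LINT x|lborel. P x * \<psi> x - P x * \<psi> (x - h n *\<^sub>R b)) / h n"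
      by (simp add: right_diff_distrib)
    also have "\<dots> = ((LINT x|lborel. P x * \<psi> x) - (LINT x|lborel. P x * \<psi> (x - h n *\<^sub>R b))) / h n"
      using i1 i2 by simp
    also have "(LINT x|lborel. P x * \<psi> (x - h n *\<^sub>R b)) = (LINT x|lborel. P (x + h n *\<^sub>R b) * \<psi> x)"
      using integral_lborel_translate[OF i2, of "h n *\<^sub>R b"] by simp
    also have "((LINT x|lborel. P x * \<psi> x) - (LINT x|lborel. P (x + h n *\<^sub>R b) * \<psi> x)) / h n
       = - (LINT x|lborel. (P (x + h n *\<^sub>R b) * \<psi> x - P x * \<psi> x) / h n)"
      using i1 i3 by (simp add: diff_divide_distrib)
    also have "(LINT x|lborel. (P (x + h n *\<^sub>R b) * \<psi> x - P x * \<psi> x) / h n) = (LINT x|lborel. R n x * \<psi> x)"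
    proof (rule integral_cong_AE)
      show "AE x in lborel. (P (x + h n *\<^sub>R b) * \<psi> x - P x * \<psi> x) / h n = R n x * \<psi> x"
        using diff[of n]
      proof eventually_elim
        case (elim x)
        show ?case
        proof (cases "x \<in> ?K0")
          case True
          then have xN: "x \<in> N" using K0N by auto
          have "x \<in> K" "x + h n *\<^sub>R b \<in> K" using NK[OF xN, of 0] NK[OF xN, of "h n"] h[of n] e(1) by auto
          moreover have "U (x + h n *\<^sub>R b) = U x + h n * q n x" using elim xN by simp
          ultimately show ?thesis by (simp add: P_def R_def left_diff_distrib diff_divide_distrib)
        next
          case False
          from \<psi>0[OF this] show ?thesis by simp
        qed
      qed
    qed auto
    finally show ?thesis .
  qed
  have L1: "(\<lambda>n. \<integral>x. P x * ((\<psi> x - \<psi> (x - h n *\<^sub>R b)) / h n) \<partial>lborel) \<longlonglongrightarrow> (LINT x|lborel. P x * ?D x)"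
  proof (rule integral_dominated_convergence[where w = "\<lambda>x. M' * \<bar>P x\<bar>"])
    show "integrable lborel (\<lambda>x. M' * \<bar>P x\<bar>)" using P by simp
    show "AE x in lborel. (\<lambda>n. P x * ((\<psi> x - \<psi> (x - h n *\<^sub>R b)) / h n)) \<longlonglongrightarrow> P x * ?D x"
      using h by (intro AE_I2 tendsto_intros test_function_directional_limit[OF \<psi> h0]) (metis less_irrefl)
    have "\<bar>(\<psi> x - \<psi> (x - h n *\<^sub>R b)) / h n\<bar> \<le> M'" for n x
    proof -
      have i: "integrable lborel (\<lambda>r. M' * indicator {0..1::real} r)" by simp
      have "(\<psi> x - \<psi> (x - h n *\<^sub>R b)) / h n = (LINT r|lborel. indicator {0..1} r * ?D (x - (r * h n) *\<^sub>R b))"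
        unfolding test_function_difference[OF \<psi> b, symmetric] using h(1)[of n] by simp
      also have "\<bar>\<dots>\<bar> \<le> (LINT r|lborel. \<bar>indicator {0..1} r * ?D (x - (r * h n) *\<^sub>R b)\<bar>)" by (rule integral_abs_bound)
      also have "\<dots> \<le> (LINT r|lborel. M' * indicator {0..1::real} r)"
        using M' by (intro integral_mono'[OF i]) (auto split: split_indicator)
      finally show ?thesis by simp
    qed
    then have "norm (P x * ((\<psi> x - \<psi> (x - h n *\<^sub>R b)) / h n)) \<le> M' * \<bar>P x\<bar>" for n x
      unfolding real_norm_def abs_mult by (subst mult.commute) (intro mult_right_mono, auto)
    then show "AE x in lborel. norm (P x * ((\<psi> x - \<psi> (x - h n *\<^sub>R b)) / h n)) \<le> M' * \<bar>P x\<bar>" for n by simp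
  qed measurable
  have L2: "(\<lambda>n. (LINT x|lborel. R n x * \<psi> x) - (LINT x|lborel. R' n x * \<psi> x)) \<longlonglongrightarrow> 0"
  proof (rule Lim_null_comparison)
    show "(\<lambda>n. (C * M) * (LINT x|lborel. \<bar>q n x - V x\<bar>)) \<longlonglongrightarrow> 0"
      using tendsto_mult[OF tendsto_const qV, of "C * M"] by simp
    have "norm ((LINT x|lborel. R n x * \<psi> x) - (LINT x|lborel. R' n x * \<psi> x)) \<le> (C * M) * (LINT x|lborel. \<bar>q n x - V x\<bar>)" for n
    proof -
      have "norm ((LINT x|lborel. R n x * \<psi> x) - (LINT x|lborel. R' n x * \<psi> x)) = norm (LINT x|lborel. R n x * \<psi> x - R' n x * \<psi> x)"
        using iR[of n] by simp
      also have "\<dots> \<le> (LINT x|lborel. norm (R n x * \<psi> x - R' n x * \<psi> x))" by (rule integral_norm_bound)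
      also have "\<dots> \<le> (LINT x|lborel. (C * M) * \<bar>q n x - V x\<bar>)"
      proof (rule integral_mono)
        show "integrable lborel (\<lambda>x. norm (R n x * \<psi> x - R' n x * \<psi> x))" using iR[of n] by auto
        show "integrable lborel (\<lambda>x. (C * M) * \<bar>q n x - V x\<bar>)" using qL1[of n] V by auto
        show "norm (R n x * \<psi> x - R' n x * \<psi> x) \<le> (C * M) * \<bar>q n x - V x\<bar>" for x
        proof -
          have "norm (R n x * \<psi> x - R' n x * \<psi> x) = \<bar>R n x - R' n x\<bar> * \<bar>\<psi> x\<bar>"
            by (simp add: abs_mult[symmetric] left_diff_distrib)
          also have "\<dots> \<le> (C * \<bar>q n x - V x\<bar>) * M" by (intro mult_mono Rb M) (use C0 in auto)
          finally show ?thesis by (simp add: mult_ac)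
        qed
      qed
      finally show ?thesis by simp
    qed
    then show "\<forall>\<^sub>F n in sequentially. norm ((LINT x|lborel. R n x * \<psi> x) - (LINT x|lborel. R' n x * \<psi> x))
        \<le> (C * M) * (LINT x|lborel. \<bar>q n x - V x\<bar>)" by simp
  qed
  have L3: "(\<lambda>n. \<integral>x. R' n x * \<psi> x \<partial>lborel) \<longlonglongrightarrow> (LINT x|lborel. (F' (U x) * V x) * \<psi> x)"
  proof (rule integral_dominated_convergence[where w = "\<lambda>x. (C * M) * \<bar>V x\<bar>"])
    show "integrable lborel (\<lambda>x. (C * M) * \<bar>V x\<bar>)" using V by simp
    have "(\<lambda>n. R' n x) \<longlonglongrightarrow> F' (U x) * V x" for x
    proof -
      have "((\<lambda>t. F (U x + t * V x)) has_real_derivative F' (U x + 0 * V x) * V x) (at 0)"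
        by (rule DERIV_chain2[OF F]) (auto intro!: derivative_eq_intros)
      then have "((\<lambda>t. (F (U x + t * V x) - F (U x)) / t) \<longlongrightarrow> F' (U x) * V x) (at 0)"
        by (simp add: has_field_derivative_iff)
      moreover have "filterlim h (at 0) sequentially"
        using h0 less_imp_neq[OF h(1), symmetric] by (simp add: filterlim_at)
      ultimately show ?thesis unfolding R'_def by (rule filterlim_compose)
    qed
    then show "AE x in lborel. (\<lambda>n. R' n x * \<psi> x) \<longlonglongrightarrow> (F' (U x) * V x) * \<psi> x"
      by (intro AE_I2 tendsto_intros)
    have "norm (R' n x * \<psi> x) \<le> (C * M) * \<bar>V x\<bar>" for n x
      using mult_mono[OF Rb(2)[of n x] M(2)[of x]] C0 by (simp add: abs_mult mult_ac)
    then show "AE x in lborel. norm (R' n x * \<psi> x) \<le> (C * M) * \<bar>V x\<bar>" for n by simp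
  qed measurable
  have "(\<lambda>n. - (((LINT x|lborel. R n x * \<psi> x) - (LINT x|lborel. R' n x * \<psi> x)) + (LINT x|lborel. R' n x * \<psi> x)))
     \<longlonglongrightarrow> - (0 + (LINT x|lborel. (F' (U x) * V x) * \<psi> x))"
    by (intro tendsto_minus tendsto_add L2 L3)
  then have "(\<lambda>n. - (LINT x|lborel. R n x * \<psi> x)) \<longlonglongrightarrow> - (LINT x|lborel. (F' (U x) * V x) * \<psi> x)" by simp
  then have eq: "(LINT x|lborel. P x * ?D x) = - (LINT x|lborel. (F' (U x) * V x) * \<psi> x)"
    using L1 unfolding step by (rule LIMSEQ_unique[rotated])
  have K0K: "?K0 \<subseteq> K" using NK[of _ 0] K0N e(1) by fastforce
  have "(LINT x|lebesgue_on S. F (u x) * ?D x) = (LINT x|lborel. P x * ?D x)"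
  proof (rule integral_lebesgue_on_eq_lborel)
    show "AE x in lebesgue. indicator S x * (F (u x) * ?D x) = P x * ?D x"
      using uU
    proof eventually_elim
      case (elim x)
      show ?case
      proof (cases "x \<in> ?K0")
        case True
        then have "x \<in> K" "x \<in> S" using K0K K0(2) by auto
        then show ?thesis using elim by (simp add: P_def)
      next
        case False
        from D0[OF this] show ?thesis by simp
      qed
    qed
  qed (use S in auto)
  also note eq
  also have "(LINT x|lborel. (F' (U x) * V x) * \<psi> x) = (LINT x|lebesgue_on S. F' (u x) * v x * \<psi> x)"
  proof (rule integral_lebesgue_on_eq_lborel[symmetric])
    show "AE x in lebesgue. indicator S x * (F' (u x) * v x * \<psi> x) = F' (U x) * V x * \<psi> x"
      using uU vV
    proof eventually_elim
      case (elim x)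
      show ?case
      proof (cases "x \<in> ?K0")
        case True
        then have "x \<in> K" "x \<in> S" using K0K K0(2) by auto
        then show ?thesis using elim by simp
      next
        case False
        from \<psi>0[OF this] show ?thesis by simp
      qed
    qed
  qed (use S in auto)
  finally show "(LINT x|lebesgue_on S. F (u x) * ?D x) = - (LINT x|lebesgue_on S. F' (u x) * v x * \<psi> x)" .
qed

section \<open>Weak derivatives in one variable\<close>

lemma AE_exists_in_interval:
  fixes a b :: real
  assumes "AE x in lebesgue_on S. P x" "S \<in> sets lebesgue" "{a<..<b} \<subseteq> S" "a < b"
  shows "\<exists>x\<in>{a<..<b}. P x"
proof (rule ccontr)
  assume nex: "\<not> ?thesis"
  have "AE x in lebesgue. x \<in> S \<longrightarrow> P x"
    using assms(1,2) by (subst (asm) AE_restrict_space_iff) auto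
  then have "AE x in lebesgue. x \<notin> {a<..<b}"
    by eventually_elim (use assms(3) nex in auto)
  then have "{a<..<b} \<in> null_sets lebesgue"
    by (subst (asm) AE_iff_null[where P = "\<lambda>x. x \<notin> {a<..<b}"]) (auto simp: greaterThanLessThan_def Int_def)
  then have "emeasure lborel {a<..<b} = 0" by auto
  then show False using assms(4) by simp
qed

text \<open>Here \<open>q\<close> is the weak derivative and \<open>p'\<close> the continuous
  representative of \<open>p\<close>. The difference formula with the fixed step
  \<open>t - s\<close> holds for almost every starting point near s; admissible starting points
  converging to s from the right, with both sides continuous in them, give it at s itself.\<close>

lemma weak_derivative_interval_difference:
  fixes p q p' :: "real \<Rightarrow> real"
  assumes w: "has_weak_partial {0<..<T} 1 p q" and p': "continuous_on {0<..<T} p'"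
    and pp': "AE t in lebesgue_on {0<..<T}. p t = p' t" and st: "0 < s" "s < t" "t < T"
  shows "p' t - p' s = (LINT \<tau>|lebesgue. indicator {s..t} \<tau> * q \<tau>)"
proof -
  define \<epsilon> where "\<epsilon> = (T - t) / 2"
  define h where "h = t - s"
  have \<epsilon>: "\<epsilon> > 0" "t + \<epsilon> < T" using st by (auto simp: \<epsilon>_def field_simps)
  have h: "h > 0" using st by (simp add: h_def)
  \<comment> \<open>Starting points are taken in \<open>?N\<close>, to the right of s, so the
    segments of length h end between t and \<open>t + \<epsilon>\<close>; this is why
    \<open>?K\<close> extends beyond t.\<close>
  let ?K = "{s..t + \<epsilon>}" and ?N = "{s<..<s + \<epsilon>}"
  have K: "compact ?K" "?K \<subseteq> {0<..<T}" using st \<epsilon> by auto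
  have li: "locally_integrable_on q {0<..<T}" using w by (simp add: has_weak_partial_def)
  obtain V where V: "integrable lborel V" and qV: "AE x in lebesgue. indicator ?K x * q x = V x"
    using integrable_lebesgue_borel_rep[OF locally_integrable_on_integrable[OF li K]] by blast
  have [measurable]: "V \<in> borel_measurable borel" using V by auto
  define U where "U x = indicator ?K x * p' x" for x
  have U: "integrable lborel U"
    using borel_integrable_atLeastAtMost'[OF continuous_on_subset[OF p' K(2)]]
    by (simp add: U_def[abs_def] set_integrable_def)
  have "AE x in lebesgue_on ?N. U (x + h *\<^sub>R 1) - U x = h * (LINT r|lborel. indicator {0..1} r * V (x + (r * h) *\<^sub>R 1))"
  proof (rule weak_partial_difference[OF _ w _ _ K _ U V])
    show "x + (r * h) *\<^sub>R 1 \<in> ?K" if "x \<in> ?N" "r \<in> {0..1}" for x r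
    proof -
      have "r * h \<le> 1 * h" "0 \<le> r * h" using that h by (auto intro: mult_right_mono)
      then show ?thesis using that by (simp add: h_def)
    qed
    show "AE x in lebesgue. x \<in> ?K \<longrightarrow> p x = U x"
    proof -
      have "AE x in lebesgue. x \<in> {0<..<T} \<longrightarrow> p x = p' x"
        using pp' by (subst (asm) AE_restrict_space_iff) auto
      then show ?thesis by eventually_elim (use K(2) in \<open>auto simp: U_def\<close>)
    qed
    show "AE x in lebesgue. x \<in> ?K \<longrightarrow> q x = V x" using qV by eventually_elim (auto simp: indicator_def split: if_splits)
  qed auto
  moreover have "h * (LINT r|lborel. indicator {0..1} r * V (x + (r * h) *\<^sub>R 1)) = (LINT \<tau>|lborel. indicator {x..x + h} \<tau> * V \<tau>)" for x
  proof -
    have "indicator {x..x + h} (x + h * r) = (indicator {0..1} r :: real)" for r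
    proof -
      have "(x \<le> x + h * r) = (0 \<le> r)" "(x + h * r \<le> x + h) = (r \<le> 1)"
        using h by (auto simp: zero_le_mult_iff)
      then show ?thesis by (auto simp: indicator_def)
    qed
    then show ?thesis
      using h lborel_integral_real_affine[of h "\<lambda>\<tau>. indicator {x..x + h} \<tau> * V \<tau>" x] by (simp add: mult.commute)
  qed
  ultimately have ae: "AE x in lebesgue_on ?N. U (x + h) - U x = (LINT \<tau>|lborel. indicator {x..x + h} \<tau> * V \<tau>)" by simp
  have "\<exists>x\<in>{s<..<s + \<epsilon> / (real n + 1)}. U (x + h) - U x = (LINT \<tau>|lborel. indicator {x..x + h} \<tau> * V \<tau>)" for n
  proof (intro AE_exists_in_interval[OF ae])
    have "\<epsilon> / (real n + 1) \<le> \<epsilon>" using \<epsilon>(1) by (simp add: field_simps)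
    then show "{s<..<s + \<epsilon> / (real n + 1)} \<subseteq> ?N" by auto
  qed (use \<epsilon> in auto)
  then obtain x where x: "\<And>n. x n \<in> {s<..<s + \<epsilon> / (real n + 1)}"
    "\<And>n. U (x n + h) - U (x n) = (LINT \<tau>|lborel. indicator {x n..x n + h} \<tau> * V \<tau>)" by metis
  have xs: "x \<longlonglongrightarrow> s"
  proof (rule real_tendsto_sandwich[OF _ _ tendsto_const])
    have "(\<lambda>n. s + \<epsilon> * inverse (real (Suc n))) \<longlonglongrightarrow> s + \<epsilon> * 0"
      by (intro tendsto_intros LIMSEQ_inverse_real_of_nat)
    then show "(\<lambda>n. s + \<epsilon> / (real n + 1)) \<longlonglongrightarrow> s" by (simp add: field_simps)
  qed (use x(1) in \<open>auto intro!: always_eventually less_imp_le\<close>)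
  have xr: "s < x n" "x n < s + \<epsilon>" for n
  proof -
    have "\<epsilon> / (real n + 1) \<le> \<epsilon>" using \<epsilon>(1) by (simp add: field_simps)
    then show "s < x n" "x n < s + \<epsilon>" using x(1)[of n] by auto
  qed
  have c: "isCont p' y" if "y \<in> {0<..<T}" for y using p' that by (simp add: continuous_on_eq_continuous_at)
  have "(\<lambda>n. p' (x n + h) - p' (x n)) \<longlonglongrightarrow> p' (s + h) - p' s"
    using st by (intro tendsto_intros isCont_tendsto_compose[OF c] xs) (auto simp: h_def)
  moreover have "p' (x n + h) - p' (x n) = (LINT \<tau>|lborel. indicator {x n..x n + h} \<tau> * V \<tau>)" for n
    using x(2)[of n] xr[of n] st by (simp add: U_def h_def)
  moreover have "(\<lambda>n. \<integral>\<tau>. indicator {x n..x n + h} \<tau> * V \<tau> \<partial>lborel) \<longlonglongrightarrow> (LINT \<tau>|lborel. indicator {s..t} \<tau> * V \<tau>)"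
  proof (rule integral_dominated_convergence[where w = "\<lambda>\<tau>. \<bar>V \<tau>\<bar>"])
    show "integrable lborel (\<lambda>\<tau>. \<bar>V \<tau>\<bar>)" using V by simp
    have ind: "(\<lambda>n. indicator {x n..x n + h} \<tau> :: real) \<longlonglongrightarrow> indicator {s..t} \<tau>" if "\<tau> \<noteq> s" "\<tau> \<noteq> t" for \<tau>
    proof -
      consider "\<tau> < s" | "s < \<tau>" "\<tau> < t" | "t < \<tau>" using \<open>\<tau> \<noteq> s\<close> \<open>\<tau> \<noteq> t\<close> by linarith
      then show ?thesis
      proof cases
        case 1
        then have "indicator {x n..x n + h} \<tau> = (0::real)" for n using xr[of n] by (simp add: indicator_def)
        then show ?thesis using 1 by simp
      next
        case 2
        have "\<forall>\<^sub>F n in sequentially. x n < \<tau>" using order_tendstoD(2)[OF xs] 2 by blast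
        then have "\<forall>\<^sub>F n in sequentially. indicator {x n..x n + h} \<tau> = (1::real)"
        proof eventually_elim
          case (elim n)
          then show ?case using xr[of n] 2 by (auto simp: indicator_def h_def)
        qed
        then show ?thesis using 2 by (simp add: tendsto_eventually)
      next
        case 3
        have "\<forall>\<^sub>F n in sequentially. x n < \<tau> - h" using order_tendstoD(2)[OF xs, of "\<tau> - h"] 3 by (simp add: h_def)
        then have "\<forall>\<^sub>F n in sequentially. indicator {x n..x n + h} \<tau> = (0::real)"
          by eventually_elim (auto simp: indicator_def)
        then show ?thesis using 3 by (simp add: tendsto_eventually)
      qed
    qed
    show "AE \<tau> in lborel. (\<lambda>n. indicator {x n..x n + h} \<tau> * V \<tau>) \<longlonglongrightarrow> indicator {s..t} \<tau> * V \<tau>"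
      using AE_lborel_singleton[of s] AE_lborel_singleton[of t]
      by eventually_elim (intro tendsto_intros ind)
    show "AE \<tau> in lborel. norm (indicator {x n..x n + h} \<tau> * V \<tau>) \<le> \<bar>V \<tau>\<bar>" for n
      by (auto split: split_indicator)
  qed measurable
  ultimately have "p' (s + h) - p' s = (LINT \<tau>|lborel. indicator {s..t} \<tau> * V \<tau>)"
    by (simp add: LIMSEQ_unique)
  also have "\<dots> = (LINT \<tau>|lebesgue. indicator {s..t} \<tau> * q \<tau>)"
  proof -
    have "AE \<tau> in lebesgue. indicator UNIV \<tau> * (indicator {s..t} \<tau> * q \<tau>) = indicator {s..t} \<tau> * V \<tau>"
      using qV by eventually_elim (use \<epsilon> in \<open>auto split: split_indicator split_indicator_asm\<close>)
    from integral_lebesgue_on_eq_lborel[OF _ _ this] show ?thesis by (simp add: lebesgue_on_UNIV_eq)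
  qed
  finally show ?thesis by (simp add: h_def)
qed

subsection \<open>The spaces \<open>L\<^sup>2\<close> and \<open>H\<^sup>1\<close>\<close>

text \<open>Otherwise \<open>H1\<close>, an abbreviation containing \<open>1\<close>, is not recognized after simplification.\<close>

declare One_nat_def [simp del]

text \<open>\<open>fspace\<close> is a bare record without laws; these are the laws that L2 and
  \<open>H1\<close> share. Only a seminorm is asked for, since representatives that agree almost
  everywhere are different elements.\<close>

locale seminormed =
  fixes X :: "('c, 'e::real_vector) fspace"
  assumes zero_in: "(\<lambda>x. 0) \<in> vecs X"
    and lin_in: "f \<in> vecs X \<Longrightarrow> h \<in> vecs X \<Longrightarrow> (\<lambda>x. a *\<^sub>R f x + b *\<^sub>R h x) \<in> vecs X"
    and nrm_nonneg: "f \<in> vecs X \<Longrightarrow> 0 \<le> nrm X f"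
    and nrm_scale: "f \<in> vecs X \<Longrightarrow> nrm X (\<lambda>x. a *\<^sub>R f x) = \<bar>a\<bar> * nrm X f"
    and nrm_add: "f \<in> vecs X \<Longrightarrow> h \<in> vecs X \<Longrightarrow> nrm X (\<lambda>x. f x + h x) \<le> nrm X f + nrm X h"
begin

lemma diff_in: "f \<in> vecs X \<Longrightarrow> h \<in> vecs X \<Longrightarrow> (\<lambda>x. f x - h x) \<in> vecs X"
  using lin_in[of f h 1 "-1"] by simp

lemma scale_in: "f \<in> vecs X \<Longrightarrow> (\<lambda>x. a *\<^sub>R f x) \<in> vecs X"
  using lin_in[of f f a 0] by simp

lemma nrm_zero: "nrm X (\<lambda>x. 0) = 0"
  using nrm_scale[OF zero_in, of 0] by simp

lemma nrm_diff_commute: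
  assumes "f \<in> vecs X" "h \<in> vecs X"
  shows "nrm X (\<lambda>x. f x - h x) = nrm X (\<lambda>x. h x - f x)"
  using nrm_scale[OF diff_in[OF assms], of "-1"] by simp

lemma nrm_triangle:
  assumes "f \<in> vecs X" "g \<in> vecs X" "h \<in> vecs X"
  shows "nrm X (\<lambda>x. f x - h x) \<le> nrm X (\<lambda>x. f x - g x) + nrm X (\<lambda>x. g x - h x)"
  using nrm_add[OF diff_in[OF assms(1,2)] diff_in[OF assms(2,3)]] by simp

lemma nrm_diff_ineq:
  assumes "f \<in> vecs X" "h \<in> vecs X"
  shows "\<bar>nrm X f - nrm X h\<bar> \<le> nrm X (\<lambda>x. f x - h x)"
  using nrm_add[OF diff_in[OF assms] assms(2)] nrm_add[OF diff_in[OF assms(2,1)] assms(1)]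
    nrm_diff_commute[OF assms] by simp

lemma nrm_diff_le:
  assumes "f \<in> vecs X" "h \<in> vecs X"
  shows "nrm X (\<lambda>x. f x - h x) \<le> nrm X f + nrm X h"
  using nrm_triangle[OF assms(1) zero_in assms(2)] nrm_scale[OF assms(2), of "-1"] by simp

lemma nrm_diff_tendsto:
  assumes "\<And>n. f n \<in> vecs X" "g \<in> vecs X" "h \<in> vecs X" "(\<lambda>n. nrm X (\<lambda>x. f n x - g x)) \<longlonglongrightarrow> 0"
  shows "(\<lambda>n. nrm X (\<lambda>x. f n x - h x)) \<longlonglongrightarrow> nrm X (\<lambda>x. g x - h x)"
proof (rule Lim_transform_bound[where g = "\<lambda>n. nrm X (\<lambda>x. f n x - g x)", OF _ assms(4), THEN LIM_zero_cancel])
  have "norm (nrm X (\<lambda>x. f n x - h x) - nrm X (\<lambda>x. g x - h x)) \<le> norm (nrm X (\<lambda>x. f n x - g x))" for n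
    using nrm_diff_ineq[OF diff_in[OF assms(1)[of n] assms(3)] diff_in[OF assms(2,3)]] 
    by simp
  then show "\<forall>\<^sub>F n in sequentially. norm (nrm X (\<lambda>x. f n x - h x) - nrm X (\<lambda>x. g x - h x)) \<le> norm (nrm X (\<lambda>x. f n x - g x))"
    by simp
qed

end

section \<open>Minkowski, Cauchy-Schwarz and dominated convergence in L2\<close>

lemma mem_L2: "f \<in> vecs (Lp_space M 2) \<longleftrightarrow> f \<in> borel_measurable M \<and> integrable M (\<lambda>x. (norm (f x))\<^sup>2)"
  by (auto simp: Lp_space_def)

lemma nrm_L2: "nrm (Lp_space M 2) f = sqrt (LINT x|M. (norm (f x))\<^sup>2)"
  by (simp add: Lp_space_def powr_half_sqrt)

lemma nrm_L2_nonneg: "0 \<le> nrm (Lp_space M 2) f"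
  by (simp add: nrm_L2)

text \<open>Minkowski's inequality from Young's inequality with a free weight t, integrated; the
  optimal weight is the quotient of the two norms.\<close>

lemma integral_square_add_le:
  fixes a b :: "'a \<Rightarrow> real"
  assumes a: "integrable M (\<lambda>x. (a x)\<^sup>2)" and b: "integrable M (\<lambda>x. (b x)\<^sup>2)"
    and c: "\<And>x. \<bar>c x\<bar> \<le> \<bar>a x\<bar> + \<bar>b x\<bar>" and cm: "c \<in> borel_measurable M"
  shows "integrable M (\<lambda>x. (c x)\<^sup>2)"
    and "sqrt (LINT x|M. (c x)\<^sup>2) \<le> sqrt (LINT x|M. (a x)\<^sup>2) + sqrt (LINT x|M. (b x)\<^sup>2)"
proof -
  have young: "(c x)\<^sup>2 \<le> (1 + t) * (a x)\<^sup>2 + (1 + 1 / t) * (b x)\<^sup>2" if t: "t > 0" for t x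
  proof -
    have "(c x)\<^sup>2 \<le> (\<bar>a x\<bar> + \<bar>b x\<bar>)\<^sup>2" using c[of x] by (metis abs_ge_zero power2_abs power_mono)
    also have "\<dots> \<le> (1 + t) * (a x)\<^sup>2 + (1 + 1 / t) * (b x)\<^sup>2"
    proof -
      have "0 \<le> (t * \<bar>a x\<bar> - \<bar>b x\<bar>)\<^sup>2 / t" using t by simp
      also have "\<dots> = t * (a x)\<^sup>2 + (b x)\<^sup>2 / t - 2 * \<bar>a x\<bar> * \<bar>b x\<bar>"
        using t by (simp add: power2_eq_square field_simps)
      finally show ?thesis by (simp add: power2_eq_square field_simps)
    qed
    finally show ?thesis .
  qed
  show ic: "integrable M (\<lambda>x. (c x)\<^sup>2)"
  proof (rule Bochner_Integration.integrable_bound)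
    show "integrable M (\<lambda>x. (1 + 1) * (a x)\<^sup>2 + (1 + 1 / 1) * (b x)\<^sup>2)"
      using a b by (intro Bochner_Integration.integrable_add integrable_mult_right) auto
    show "AE x in M. norm ((c x)\<^sup>2) \<le> norm ((1 + 1) * (a x)\<^sup>2 + (1 + 1 / 1) * (b x)\<^sup>2)"
      using young[of 1] by (intro AE_I2) (simp del: power2_abs)
  qed (use cm in auto)
  let ?A = "\<integral>x. (a x)\<^sup>2 \<partial>M" and ?B = "\<integral>x. (b x)\<^sup>2 \<partial>M"
  have A0: "0 \<le> ?A" "0 \<le> ?B" by auto
  have le: "(LINT x|M. (c x)\<^sup>2) \<le> (1 + t) * ?A + (1 + 1 / t) * ?B" if "t > 0" for t
  proof -
    have "(LINT x|M. (c x)\<^sup>2) \<le> (LINT x|M. (1 + t) * (a x)\<^sup>2 + (1 + 1 / t) * (b x)\<^sup>2)"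
      using a b ic young[OF that] by (intro integral_mono) auto
    then show ?thesis using a b by simp
  qed
  \<comment> \<open>Adding \<delta> to both norms keeps the optimal weight \<beta> / \<alpha>
    defined and positive when a norm vanishes; \<delta> then tends to 0 from the right.\<close>
  have *: "(LINT x|M. (c x)\<^sup>2) \<le> ((sqrt ?A + \<delta>) + (sqrt ?B + \<delta>))\<^sup>2" if "\<delta> > 0" for \<delta>
  proof -
    define \<alpha> where "\<alpha> = sqrt ?A + \<delta>"
    define \<beta> where "\<beta> = sqrt ?B + \<delta>"
    have p: "0 < \<alpha>" "0 < \<beta>" "sqrt ?A \<le> \<alpha>" "sqrt ?B \<le> \<beta>"
      using that A0 by (auto simp: \<alpha>_def \<beta>_def add_nonneg_pos)
    have q: "?A \<le> \<alpha>\<^sup>2" "?B \<le> \<beta>\<^sup>2"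
      using power_mono[OF p(3), of 2] power_mono[OF p(4), of 2] A0 by auto
    have r: "0 < \<beta> / \<alpha>" "0 \<le> 1 + \<beta> / \<alpha>" "0 \<le> 1 + 1 / (\<beta> / \<alpha>)" using p by auto
    have "(LINT x|M. (c x)\<^sup>2) \<le> (1 + \<beta> / \<alpha>) * ?A + (1 + 1 / (\<beta> / \<alpha>)) * ?B" by (rule le[OF r(1)])
    also have "\<dots> \<le> (1 + \<beta> / \<alpha>) * \<alpha>\<^sup>2 + (1 + 1 / (\<beta> / \<alpha>)) * \<beta>\<^sup>2"
      using q r by (intro add_mono mult_left_mono)
    also have "\<dots> = (\<alpha> + \<beta>)\<^sup>2" using p by (simp add: field_simps power2_eq_square)
    finally show ?thesis by (simp add: \<alpha>_def \<beta>_def)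
  qed
  have "((\<lambda>\<delta>. ((sqrt ?A + \<delta>) + (sqrt ?B + \<delta>))\<^sup>2) \<longlongrightarrow> ((sqrt ?A + 0) + (sqrt ?B + 0))\<^sup>2) (at_right 0)"
    by (intro tendsto_intros)
  moreover have "\<forall>\<^sub>F \<delta> in at_right 0. (LINT x|M. (c x)\<^sup>2) \<le> ((sqrt ?A + \<delta>) + (sqrt ?B + \<delta>))\<^sup>2"
    using * by (auto simp: eventually_at_filter)
  ultimately have "(LINT x|M. (c x)\<^sup>2) \<le> ((sqrt ?A + 0) + (sqrt ?B + 0))\<^sup>2"
    by (rule tendsto_lowerbound) simp
  then have "(LINT x|M. (c x)\<^sup>2) \<le> (sqrt ?A + sqrt ?B)\<^sup>2" by simp
  then have "sqrt (LINT x|M. (c x)\<^sup>2) \<le> sqrt ((sqrt ?A + sqrt ?B)\<^sup>2)" by (rule real_sqrt_le_mono)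
  then show "sqrt (LINT x|M. (c x)\<^sup>2) \<le> sqrt ?A + sqrt ?B" using A0 by simp
qed

lemma L2_dominated:
  assumes f: "f \<in> vecs (Lp_space M 2)" and g: "g \<in> vecs (Lp_space M 2)" and h: "h \<in> borel_measurable M"
    and le: "\<And>x. norm (h x) \<le> norm (f x) + norm (g x)"
  shows "h \<in> vecs (Lp_space M 2)" "nrm (Lp_space M 2) h \<le> nrm (Lp_space M 2) f + nrm (Lp_space M 2) g"
  using integral_square_add_le[of M "\<lambda>x. norm (f x)" "\<lambda>x. norm (g x)" "\<lambda>x. norm (h x)"] assms
  by (auto simp: mem_L2 nrm_L2)

lemma L2_cong_AE:
  assumes f: "f \<in> vecs (Lp_space M 2)" and h: "h \<in> borel_measurable M" and ae: "AE x in M. f x = h x"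
  shows "h \<in> vecs (Lp_space M 2)" "nrm (Lp_space M 2) h = nrm (Lp_space M 2) f"
proof -
  have m: "(\<lambda>x. (norm (f x))\<^sup>2) \<in> borel_measurable M" "(\<lambda>x. (norm (h x))\<^sup>2) \<in> borel_measurable M"
    using f h by (auto simp: mem_L2)
  have ae': "AE x in M. (norm (f x))\<^sup>2 = (norm (h x))\<^sup>2" using ae by eventually_elim simp
  show "h \<in> vecs (Lp_space M 2)" using f h integrable_cong_AE[OF m ae'] by (simp add: mem_L2)
  show "nrm (Lp_space M 2) h = nrm (Lp_space M 2) f" using integral_cong_AE[OF m ae'] by (simp add: nrm_L2)
qed

lemma L2_seminormed: "seminormed (Lp_space M 2 :: ('a, 'e::euclidean_space) fspace)"
proof
  let ?X = "Lp_space M 2 :: ('a, 'e) fspace"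
  show "(\<lambda>x. 0) \<in> vecs ?X" by (simp add: mem_L2)
  have scale: "(\<lambda>x. a *\<^sub>R f x) \<in> vecs ?X" "nrm ?X (\<lambda>x. a *\<^sub>R f x) = \<bar>a\<bar> * nrm ?X f"
    if "f \<in> vecs ?X" for f :: "'a \<Rightarrow> 'e" and a
    using that by (auto simp: mem_L2 nrm_L2 power_mult_distrib real_sqrt_mult)
  show "nrm ?X (\<lambda>x. a *\<^sub>R f x) = \<bar>a\<bar> * nrm ?X f" if "f \<in> vecs ?X" for f :: "'a \<Rightarrow> 'e" and a
    using scale[OF that] by simp
  show "0 \<le> nrm ?X f" for f :: "'a \<Rightarrow> 'e" by (rule nrm_L2_nonneg)
  show "(\<lambda>x. a *\<^sub>R f x + b *\<^sub>R h x) \<in> vecs ?X" if "f \<in> vecs ?X" "h \<in> vecs ?X" for f h :: "'a \<Rightarrow> 'e" and a b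
    by (rule L2_dominated(1)[OF scale(1)[OF that(1), of a] scale(1)[OF that(2), of b]])
       (use that norm_triangle_ineq in \<open>auto simp: mem_L2 simp del: norm_scaleR\<close>)
  show "nrm ?X (\<lambda>x. f x + h x) \<le> nrm ?X f + nrm ?X h" if "f \<in> vecs ?X" "h \<in> vecs ?X" for f h :: "'a \<Rightarrow> 'e"
    by (rule L2_dominated(2)[OF that]) (use that norm_triangle_ineq in \<open>auto simp: mem_L2\<close>)
qed

text \<open>Young's inequality \<open>2 * \<bar>f g\<bar> \<le> t f^2 + g^2 / t\<close> is
  integrated and then optimized in t. As for Minkowski's inequality, both norms are increased by
  \<delta> so that the optimal weight b / a makes sense.\<close>

lemma
  fixes f g :: "'a \<Rightarrow> real"
  assumes f: "f \<in> vecs (Lp_space M 2)" and g: "g \<in> vecs (Lp_space M 2)"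
  shows L2_mult_integrable: "integrable M (\<lambda>x. f x * g x)"
    and L2_Cauchy_Schwarz: "\<bar>\<integral>x. f x * g x \<partial>M\<bar> \<le> nrm (Lp_space M 2) f * nrm (Lp_space M 2) g"
proof -
  let ?n = "nrm (Lp_space M 2) :: ('a \<Rightarrow> real) \<Rightarrow> real"
  have i: "integrable M (\<lambda>x. (f x)\<^sup>2)" "integrable M (\<lambda>x. (g x)\<^sup>2)" "f \<in> borel_measurable M" "g \<in> borel_measurable M"
    using f g by (auto simp: mem_L2)
  have y: "2 * \<bar>f x * g x\<bar> \<le> t * (f x)\<^sup>2 + (g x)\<^sup>2 / t" if "t > 0" for t x
  proof -
    have "0 \<le> (t * \<bar>f x\<bar> - \<bar>g x\<bar>)\<^sup>2 / t" using that by simp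
    also have "\<dots> = t * (f x)\<^sup>2 + (g x)\<^sup>2 / t - 2 * \<bar>f x\<bar> * \<bar>g x\<bar>"
      using that by (simp add: power2_eq_square field_simps)
    finally show ?thesis by (simp add: abs_mult)
  qed
  show fg: "integrable M (\<lambda>x. f x * g x)"
  proof (rule Bochner_Integration.integrable_bound)
    show "integrable M (\<lambda>x. 1 * (f x)\<^sup>2 + (g x)\<^sup>2 / 1)" using i by simp
    have "\<bar>f x * g x\<bar> \<le> 1 * (f x)\<^sup>2 + (g x)\<^sup>2 / 1" for x using y[of 1 x] by linarith
    then show "AE x in M. norm (f x * g x) \<le> norm (1 * (f x)\<^sup>2 + (g x)\<^sup>2 / 1)" by (intro AE_I2) simp
  qed (use i in auto)
  have le: "2 * \<bar>\<integral>x. f x * g x \<partial>M\<bar> \<le> t * (?n f)\<^sup>2 + (?n g)\<^sup>2 / t" if t: "t > 0" for t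
  proof -
    have "2 * \<bar>\<integral>x. f x * g x \<partial>M\<bar> \<le> 2 * (LINT x|M. \<bar>f x * g x\<bar>)" using integral_abs_bound[of M "\<lambda>x. f x * g x"] by simp
    also have "\<dots> = (LINT x|M. 2 * \<bar>f x * g x\<bar>)" by simp
    also have "\<dots> \<le> (LINT x|M. t * (f x)\<^sup>2 + (g x)\<^sup>2 / t)"
      by (intro integral_mono y[OF t]) (use i fg in auto)
    also have "\<dots> = t * (?n f)\<^sup>2 + (?n g)\<^sup>2 / t" using i by (simp add: nrm_L2)
    finally show ?thesis .
  qed
  have n0: "0 \<le> ?n f" "0 \<le> ?n g" by (auto simp: nrm_L2_nonneg)
  have *: "\<bar>\<integral>x. f x * g x \<partial>M\<bar> \<le> (?n f + \<delta>) * (?n g + \<delta>)" if "\<delta> > 0" for \<delta>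
  proof -
    define a where "a = ?n f + \<delta>"
    define b where "b = ?n g + \<delta>"
    have ab: "a > 0" "b > 0" "?n f \<le> a" "?n g \<le> b" using that n0 by (auto simp: a_def b_def)
    have b2: "b / a * (?n f)\<^sup>2 \<le> b / a * a\<^sup>2" "(?n g)\<^sup>2 / (b / a) \<le> b\<^sup>2 / (b / a)"
      using ab n0 by (auto intro!: mult_left_mono divide_right_mono power_mono)
    have "2 * \<bar>\<integral>x. f x * g x \<partial>M\<bar> \<le> b / a * (?n f)\<^sup>2 + (?n g)\<^sup>2 / (b / a)" using le[of "b / a"] ab by simp
    also have "\<dots> \<le> b / a * a\<^sup>2 + b\<^sup>2 / (b / a)" using b2 by (rule add_mono)
    also have "\<dots> = 2 * (a * b)" using ab by (simp add: power2_eq_square field_simps)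
    finally show ?thesis by (simp add: a_def b_def)
  qed
  have "((\<lambda>\<delta>. (?n f + \<delta>) * (?n g + \<delta>)) \<longlongrightarrow> (?n f + 0) * (?n g + 0)) (at_right 0)"
    by (intro tendsto_intros)
  moreover have "\<forall>\<^sub>F \<delta> in at_right 0. \<bar>\<integral>x. f x * g x \<partial>M\<bar> \<le> (?n f + \<delta>) * (?n g + \<delta>)"
    using * by (auto simp: eventually_at_filter)
  ultimately have "\<bar>\<integral>x. f x * g x \<partial>M\<bar> \<le> (?n f + 0) * (?n g + 0)"
    by (rule tendsto_lowerbound) simp
  then show "\<bar>\<integral>x. f x * g x \<partial>M\<bar> \<le> ?n f * ?n g" by simp
qed

lemma L2_L1_bound:
  fixes f :: "'a \<Rightarrow> real"
  assumes "finite_measure M" "f \<in> vecs (Lp_space M 2)"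
  shows "integrable M f" "(LINT x|M. \<bar>f x\<bar>) \<le> sqrt (measure M (space M)) * nrm (Lp_space M 2) f"
proof -
  interpret finite_measure M by fact
  have one: "(\<lambda>x. 1::real) \<in> vecs (Lp_space M 2)" "nrm (Lp_space M 2) (\<lambda>x. 1::real) = sqrt (measure M (space M))"
    by (auto simp: mem_L2 nrm_L2)
  show "integrable M f" using L2_mult_integrable[OF one(1) assms(2)] by simp
  have a: "(\<lambda>x. \<bar>f x\<bar>) \<in> vecs (Lp_space M 2)" "nrm (Lp_space M 2) (\<lambda>x. \<bar>f x\<bar>) = nrm (Lp_space M 2) f"
    using assms(2) by (auto simp: mem_L2 nrm_L2)
  show "(LINT x|M. \<bar>f x\<bar>) \<le> sqrt (measure M (space M)) * nrm (Lp_space M 2) f"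
    using L2_Cauchy_Schwarz[OF one(1) a(1)] one a by simp
qed

lemma L2_tendsto_L1:
  fixes f :: "nat \<Rightarrow> 'a \<Rightarrow> real"
  assumes M: "finite_measure M" and f: "\<And>n. f n \<in> vecs (Lp_space M 2)" "g \<in> vecs (Lp_space M 2)"
    and l: "(\<lambda>n. nrm (Lp_space M 2) (\<lambda>x. f n x - g x)) \<longlonglongrightarrow> 0"
  shows "(\<lambda>n. \<integral>x. \<bar>f n x - g x\<bar> \<partial>M) \<longlonglongrightarrow> 0"
proof (rule real_tendsto_sandwich[OF _ _ tendsto_const])
  show "(\<lambda>n. sqrt (measure M (space M)) * nrm (Lp_space M 2) (\<lambda>x. f n x - g x)) \<longlonglongrightarrow> 0"
    using tendsto_mult[OF tendsto_const l] by simp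
  show "\<forall>\<^sub>F n in sequentially. (LINT x|M. \<bar>f n x - g x\<bar>) \<le> sqrt (measure M (space M)) * nrm (Lp_space M 2) (\<lambda>x. f n x - g x)"
    using L2_L1_bound(2)[OF M seminormed.diff_in[OF L2_seminormed f]] by simp
qed simp

lemma L2_dominated_convergence:
  fixes f :: "nat \<Rightarrow> 'a \<Rightarrow> 'e::euclidean_space"
  assumes w: "w \<in> vecs (Lp_space M 2)" and m: "\<And>n. f n \<in> borel_measurable M" "g \<in> borel_measurable M"
    and b: "\<And>n. AE x in M. norm (f n x) \<le> norm (w x :: 'e2::euclidean_space)" and l: "AE x in M. (\<lambda>n. f n x) \<longlonglongrightarrow> g x"
  shows "\<And>n. f n \<in> vecs (Lp_space M 2)" "g \<in> vecs (Lp_space M 2)"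
    "(\<lambda>n. nrm (Lp_space M 2) (\<lambda>x. f n x - g x)) \<longlonglongrightarrow> 0"
proof -
  have iw: "integrable M (\<lambda>x. (norm (w x))\<^sup>2)" using w by (simp add: mem_L2)
  have bg: "AE x in M. norm (g x) \<le> norm (w x)"
  proof -
    have "AE x in M. \<forall>n. norm (f n x) \<le> norm (w x)" using b by (simp add: AE_all_countable)
    then show ?thesis using l
    proof eventually_elim
      case (elim x)
      show ?case by (rule tendsto_upperbound[OF tendsto_norm[OF elim(2)]]) (use elim in auto)
    qed
  qed
  show fn: "f n \<in> vecs (Lp_space M 2)" for n
    unfolding mem_L2
  proof (intro conjI m Bochner_Integration.integrable_bound[OF iw])
    show "AE x in M. norm ((norm (f n x))\<^sup>2) \<le> norm ((norm (w x))\<^sup>2)"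
      using b[of n] by eventually_elim (simp add: power_mono)
  qed (use m in measurable)
  show g: "g \<in> vecs (Lp_space M 2)"
    unfolding mem_L2
  proof (intro conjI m Bochner_Integration.integrable_bound[OF iw])
    show "AE x in M. norm ((norm (g x))\<^sup>2) \<le> norm ((norm (w x))\<^sup>2)"
      using bg by eventually_elim (simp add: power_mono)
  qed (use m in measurable)
  have "(\<lambda>n. \<integral>x. (norm (f n x - g x))\<^sup>2 \<partial>M) \<longlonglongrightarrow> (LINT x|M. 0)"
  proof (rule integral_dominated_convergence[where w = "\<lambda>x. 4 * (norm (w x))\<^sup>2"])
    show "integrable M (\<lambda>x. 4 * (norm (w x))\<^sup>2)" using iw by simp
    show "AE x in M. (\<lambda>n. (norm (f n x - g x))\<^sup>2) \<longlonglongrightarrow> 0"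
      using l
    proof eventually_elim
      case (elim x)
      have "(\<lambda>n. (norm (f n x - g x))\<^sup>2) \<longlonglongrightarrow> (norm (g x - g x))\<^sup>2" by (intro tendsto_intros elim)
      then show ?case by simp
    qed
    show "AE x in M. norm ((norm (f n x - g x))\<^sup>2) \<le> 4 * (norm (w x))\<^sup>2" for n
      using b[of n] bg
    proof eventually_elim
      case (elim x)
      have "norm (f n x - g x) \<le> 2 * norm (w x)" using norm_triangle_ineq4[of "f n x" "g x"] elim by linarith
      then have "(norm (f n x - g x))\<^sup>2 \<le> (2 * norm (w x))\<^sup>2" by (intro power_mono) auto
      then show ?case by (simp add: power_mult_distrib)
    qed
  qed (use m in measurable)
  then have "(\<lambda>n. sqrt (LINT x|M. (norm (f n x - g x))\<^sup>2)) \<longlonglongrightarrow> sqrt 0"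
    by (intro tendsto_real_sqrt) simp
  then show "(\<lambda>n. nrm (Lp_space M 2) (\<lambda>x. f n x - g x)) \<longlonglongrightarrow> 0" by (simp add: nrm_L2)
qed

lemma finite_measure_lebesgue_on: "bounded S \<Longrightarrow> S \<in> sets lebesgue \<Longrightarrow> finite_measure (lebesgue_on S)"
proof (rule finite_measureI)
  assume "bounded S" "S \<in> sets lebesgue"
  then have "S \<in> lmeasurable" by (rule bounded_set_imp_lmeasurable)
  then show "emeasure (lebesgue_on S) (space (lebesgue_on S)) \<noteq> \<infinity>"
    by (subst emeasure_restrict_space) (auto simp: fmeasurable_def)
qed

section \<open>The space \<open>H1\<close>, its seminorm and its dual\<close>

lemma weak_partial_works: "has_weak_partial S b f h \<Longrightarrow> has_weak_partial S b f (weak_partial S b f)"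
  unfolding weak_partial_def by (rule someI[of "has_weak_partial S b f"])

lemma weak_partial_AE:
  assumes "open S" "b \<in> Basis" "has_weak_partial S b f h"
  shows "AE x in lebesgue_on S. h x = weak_partial S b f x"
  using has_weak_partial_unique[OF assms weak_partial_works[OF assms(3)]] .

lemma weak_partial_measurable:
  assumes "open S" "b \<in> Basis" "has_weak_partial S b f h"
  shows "weak_partial S b f \<in> borel_measurable (lebesgue_on S)"
  using weak_partial_works[OF assms(3)] locally_integrable_on_measurable[OF assms(1)]
  by (simp add: has_weak_partial_def)

lemma mem_H1: "f \<in> vecs (H1 S) \<longleftrightarrow> f \<in> vecs (Lp_space (lebesgue_on S) 2) \<and>
    (\<forall>b\<in>Basis. \<exists>h\<in>vecs (Lp_space (lebesgue_on S) 2). has_weak_partial S b f h)"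
  unfolding Sobolev_def One_nat_def by simp

lemma nrm_H1: "nrm (H1 S) f = nrm (Lp_space (lebesgue_on S) 2) f
    + (\<Sum>b\<in>Basis. nrm (Lp_space (lebesgue_on S) 2) (weak_partial S b f))"
  unfolding Sobolev_def One_nat_def by simp

lemma H1_weak_partial:
  assumes "open S" "b \<in> Basis" "f \<in> vecs (H1 S)"
  shows "has_weak_partial S b f (weak_partial S b f)"
    and "weak_partial S b f \<in> vecs (Lp_space (lebesgue_on S) 2)"
proof -
  obtain h where h: "h \<in> vecs (Lp_space (lebesgue_on S) 2)" "has_weak_partial S b f h"
    using assms by (auto simp: mem_H1)
  show "has_weak_partial S b f (weak_partial S b f)" using h(2) by (rule weak_partial_works)
  show "weak_partial S b f \<in> vecs (Lp_space (lebesgue_on S) 2)"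
    by (rule L2_cong_AE(1)[OF h(1) weak_partial_measurable[OF assms(1,2) h(2)] weak_partial_AE[OF assms(1,2) h(2)]])
qed

text \<open>The norm is defined through the derivatives picked by \<open>weak_partial\<close>; weak
  derivatives are unique up to null sets, so any other choice in L2 yields the same value.\<close>

lemma nrm_H1_eq:
  assumes "open S" "\<And>b. b \<in> Basis \<Longrightarrow> has_weak_partial S b f (h b)"
    "\<And>b. b \<in> Basis \<Longrightarrow> h b \<in> vecs (Lp_space (lebesgue_on S) 2)"
  shows "nrm (H1 S) f = nrm (Lp_space (lebesgue_on S) 2) f + (\<Sum>b\<in>Basis. nrm (Lp_space (lebesgue_on S) 2) (h b))"
  unfolding nrm_H1
  by (intro arg_cong2[where f = "(+)"] sum.cong refl L2_cong_AE(2) assms(3)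
      weak_partial_measurable[OF assms(1) _ assms(2)] weak_partial_AE[OF assms(1) _ assms(2)])

lemma H1_seminormed:
  fixes S :: "'a::euclidean_space set"
  assumes "open S"
  shows "seminormed (H1 S)"
proof
  let ?L = "Lp_space (lebesgue_on S) 2 :: ('a, real) fspace"
  interpret L: seminormed ?L by (rule L2_seminormed)
  have lin: "(\<lambda>x. a *\<^sub>R f x + c *\<^sub>R h x) \<in> vecs (H1 S)"
    "\<And>b. b \<in> Basis \<Longrightarrow> has_weak_partial S b (\<lambda>x. a *\<^sub>R f x + c *\<^sub>R h x) (\<lambda>x. a *\<^sub>R weak_partial S b f x + c *\<^sub>R weak_partial S b h x)"
    "\<And>b. b \<in> Basis \<Longrightarrow> (\<lambda>x. a *\<^sub>R weak_partial S b f x + c *\<^sub>R weak_partial S b h x) \<in> vecs ?L"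
    if f: "f \<in> vecs (H1 S)" and h: "h \<in> vecs (H1 S)" for f h a c
  proof -
    note wf = H1_weak_partial[OF assms _ f] and wh = H1_weak_partial[OF assms _ h]
    show w: "has_weak_partial S b (\<lambda>x. a *\<^sub>R f x + c *\<^sub>R h x) (\<lambda>x. a *\<^sub>R weak_partial S b f x + c *\<^sub>R weak_partial S b h x)"
      if "b \<in> Basis" for b
      using has_weak_partial_linear[OF assms that wf(1)[OF that] wh(1)[OF that], of a c] by simp
    show l: "(\<lambda>x. a *\<^sub>R weak_partial S b f x + c *\<^sub>R weak_partial S b h x) \<in> vecs ?L" if "b \<in> Basis" for b
      by (rule L.lin_in[OF wf(2)[OF that] wh(2)[OF that]])
    show "(\<lambda>x. a *\<^sub>R f x + c *\<^sub>R h x) \<in> vecs (H1 S)"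
      unfolding mem_H1 using w l L.lin_in[of f h a c] f h by (auto simp: mem_H1)
  qed
  show "(\<lambda>x. a *\<^sub>R f x + c *\<^sub>R h x) \<in> vecs (H1 S)" if "f \<in> vecs (H1 S)" "h \<in> vecs (H1 S)" for f h a c
    using lin(1)[OF that] .
  have z: "has_weak_partial S b (\<lambda>x. 0) (\<lambda>x. 0)" for b
    by (auto simp: has_weak_partial_def locally_integrable_on_def)
  show "(\<lambda>x. 0) \<in> vecs (H1 S)"
    unfolding mem_H1 using L.zero_in z by blast
  show "0 \<le> nrm (H1 S) f" for f by (auto simp: nrm_H1 nrm_L2_nonneg intro!: add_nonneg_nonneg sum_nonneg)
  show "nrm (H1 S) (\<lambda>x. a *\<^sub>R f x) = \<bar>a\<bar> * nrm (H1 S) f" if f: "f \<in> vecs (H1 S)" for f a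
  proof -
    have "nrm (H1 S) (\<lambda>x. a *\<^sub>R f x + 0 *\<^sub>R f x) = nrm ?L (\<lambda>x. a *\<^sub>R f x + 0 *\<^sub>R f x)
        + (\<Sum>b\<in>Basis. nrm ?L (\<lambda>x. a *\<^sub>R weak_partial S b f x + 0 *\<^sub>R weak_partial S b f x))"
      by (rule nrm_H1_eq[OF assms lin(2,3)[OF f f]])
    also have "\<dots> = \<bar>a\<bar> * nrm (H1 S) f"
      using L.nrm_scale f H1_weak_partial(2)[OF assms _ f]
      by (simp add: nrm_H1 mem_H1 distrib_left sum_distrib_left del: real_scaleR_def)
    finally show ?thesis by simp
  qed
  show "nrm (H1 S) (\<lambda>x. f x + h x) \<le> nrm (H1 S) f + nrm (H1 S) h" if f: "f \<in> vecs (H1 S)" and h: "h \<in> vecs (H1 S)" for f h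
  proof -
    note wf = H1_weak_partial[OF assms _ f] and wh = H1_weak_partial[OF assms _ h]
    have "nrm (H1 S) (\<lambda>x. 1 *\<^sub>R f x + 1 *\<^sub>R h x) = nrm ?L (\<lambda>x. 1 *\<^sub>R f x + 1 *\<^sub>R h x)
        + (\<Sum>b\<in>Basis. nrm ?L (\<lambda>x. 1 *\<^sub>R weak_partial S b f x + 1 *\<^sub>R weak_partial S b h x))"
      by (rule nrm_H1_eq[OF assms lin(2,3)[OF f h]])
    also have "\<dots> \<le> (nrm ?L f + nrm ?L h) + (\<Sum>b\<in>Basis. nrm ?L (weak_partial S b f) + nrm ?L (weak_partial S b h))"
      using f h wf wh L.nrm_add by (intro add_mono sum_mono) (auto simp: mem_H1)
    finally show ?thesis by (simp add: nrm_H1 sum.distrib)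
  qed
qed

lemma nrm_H1_diff:
  assumes "open S" "f \<in> vecs (H1 S)" "h \<in> vecs (H1 S)"
  shows "nrm (H1 S) (\<lambda>x. f x - h x) = nrm (Lp_space (lebesgue_on S) 2) (\<lambda>x. f x - h x)
    + (\<Sum>b\<in>Basis. nrm (Lp_space (lebesgue_on S) 2) (\<lambda>x. weak_partial S b f x - weak_partial S b h x))"
proof (rule nrm_H1_eq[OF assms(1)])
  fix b :: 'a assume b: "b \<in> Basis"
  note wf = H1_weak_partial[OF assms(1) b assms(2)] and wh = H1_weak_partial[OF assms(1) b assms(3)]
  show "has_weak_partial S b (\<lambda>x. f x - h x) (\<lambda>x. weak_partial S b f x - weak_partial S b h x)"
    using has_weak_partial_linear[OF assms(1) b wf(1) wh(1), of 1 "-1"] by simp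
  show "(\<lambda>x. weak_partial S b f x - weak_partial S b h x) \<in> vecs (Lp_space (lebesgue_on S) 2)"
    by (rule seminormed.diff_in[OF L2_seminormed wf(2) wh(2)])
qed

text \<open>The dual norm is a real supremum, so boundedness of the set must be known before it
  bounds anything; membership in the dual provides it. Elements of seminorm 0 cannot be normalized,
  and for them the same membership forces the value 0.\<close>

lemma dual_bound:
  assumes X: "seminormed X" and \<phi>: "\<phi> \<in> vecs (dual_space X)" and f: "f \<in> vecs X"
  shows "\<bar>\<phi> f\<bar> \<le> nrm (dual_space X) \<phi> * nrm X f"
proof -
  interpret seminormed X by fact
  have "\<exists>C. \<forall>f\<in>vecs X. \<bar>\<phi> f\<bar> \<le> C * nrm X f" using \<phi> by (simp add: dual_space_def)
  then obtain C where C: "\<And>f. f \<in> vecs X \<Longrightarrow> \<bar>\<phi> f\<bar> \<le> C * nrm X f" by blast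
  have lin: "\<phi> (\<lambda>x. a *\<^sub>R f x) = a * \<phi> f" for a
  proof -
    have "\<forall>f\<in>vecs X. \<forall>h\<in>vecs X. \<forall>a b. \<phi> (\<lambda>x. a *\<^sub>R f x + b *\<^sub>R h x) = a * \<phi> f + b * \<phi> h"
      using \<phi> by (simp add: dual_space_def)
    then have "\<phi> (\<lambda>x. a *\<^sub>R f x + 0 *\<^sub>R f x) = a * \<phi> f + 0 * \<phi> f" using f by blast
    then show ?thesis by simp
  qed
  have bdd: "bdd_above ((\<lambda>f. \<bar>\<phi> f\<bar>) ` {f \<in> vecs X. nrm X f \<le> 1})"
  proof (rule bdd_aboveI2)
    fix f assume "f \<in> {f \<in> vecs X. nrm X f \<le> 1}"
    then have f: "f \<in> vecs X" "nrm X f \<le> 1" by auto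
    have "\<bar>\<phi> f\<bar> \<le> C * nrm X f" by (rule C[OF f(1)])
    also have "\<dots> \<le> \<bar>C\<bar> * 1" using f nrm_nonneg[OF f(1)] by (intro mult_mono) auto
    finally show "\<bar>\<phi> f\<bar> \<le> \<bar>C\<bar>" by simp
  qed
  show ?thesis
  proof (cases "nrm X f = 0")
    case True
    then show ?thesis using C[OF f] by simp
  next
    case False
    then have p: "nrm X f > 0" using nrm_nonneg[OF f] by simp
    let ?g = "\<lambda>x. (1 / nrm X f) *\<^sub>R f x"
    have "nrm X ?g = 1" using nrm_scale[OF f] p by simp
    then have "?g \<in> {f \<in> vecs X. nrm X f \<le> 1}" using scale_in[OF f] by simp
    then have "\<bar>\<phi> ?g\<bar> \<le> nrm (dual_space X) \<phi>"
      unfolding dual_space_def by (auto intro!: cSUP_upper[OF _ bdd])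
    then show ?thesis using p by (simp add: lin field_simps)
  qed
qed

lemma dual_diff_in:
  assumes "\<phi> \<in> vecs (dual_space X)" "\<psi> \<in> vecs (dual_space X)"
  shows "(\<lambda>f. \<phi> f - \<psi> f) \<in> vecs (dual_space X)"
proof -
  have "\<exists>C. \<forall>f\<in>vecs X. \<bar>\<phi> f\<bar> \<le> C * nrm X f" "\<exists>C. \<forall>f\<in>vecs X. \<bar>\<psi> f\<bar> \<le> C * nrm X f"
    using assms by (simp_all add: dual_space_def)
  then obtain C C' where "\<And>f. f \<in> vecs X \<Longrightarrow> \<bar>\<phi> f\<bar> \<le> C * nrm X f" "\<And>f. f \<in> vecs X \<Longrightarrow> \<bar>\<psi> f\<bar> \<le> C' * nrm X f" by blast
  then have "\<bar>\<phi> f - \<psi> f\<bar> \<le> (C + C') * nrm X f" if "f \<in> vecs X" for f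
    using that by (smt (verit) distrib_right)
  moreover have "\<phi> (\<lambda>x. a *\<^sub>R f x + b *\<^sub>R h x) - \<psi> (\<lambda>x. a *\<^sub>R f x + b *\<^sub>R h x)
      = a * (\<phi> f - \<psi> f) + b * (\<phi> h - \<psi> h)" if "f \<in> vecs X" "h \<in> vecs X" for f h a b
    using assms that by (simp add: dual_space_def algebra_simps)
  ultimately show ?thesis by (auto simp: dual_space_def)
qed

subsection \<open>Strong measurability\<close>

lemma AE_LIMSEQ_measurable:
  fixes f :: "nat \<Rightarrow> 'a::euclidean_space \<Rightarrow> real"
  assumes "\<And>n. f n \<in> borel_measurable (lebesgue_on S)" "S \<in> sets lebesgue"
    and "AE x in lebesgue_on S. (\<lambda>n. f n x) \<longlonglongrightarrow> g x"
  shows "g \<in> borel_measurable (lebesgue_on S)"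
proof (rule borel_measurable_lebesgue_on_AE)
  show "(\<lambda>x. lim (\<lambda>n. f n x)) \<in> borel_measurable (lebesgue_on S)"
    using assms(1) by (rule borel_measurable_lim_metric)
  show "AE x in lebesgue_on S. lim (\<lambda>n. f n x) = g x"
    using assms(3) by eventually_elim (rule limI)
qed fact

lemma (in seminormed) strongly_measurable_nrm_diff:
  assumes z: "strongly_measurable T X z" and zX: "AE t in lebesgue_on {0<..<T}. z t \<in> vecs X" and c: "c \<in> vecs X"
  shows "(\<lambda>t. nrm X (\<lambda>x. z t x - c x)) \<in> borel_measurable (lebesgue_on {0<..<T})"
proof -
  obtain s where s: "\<And>n. simple_function (lebesgue_on {0<..<T}) (s n)"
    "\<And>n t. t \<in> {0<..<T} \<Longrightarrow> s n t \<in> vecs X"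
    "AE t in lebesgue_on {0<..<T}. (\<lambda>n. nrm X (\<lambda>x. s n t x - z t x)) \<longlonglongrightarrow> 0"
    using z unfolding strongly_measurable_def by blast
  show ?thesis
  proof (rule AE_LIMSEQ_measurable)
    show "(\<lambda>t. nrm X (\<lambda>x. s n t x - c x)) \<in> borel_measurable (lebesgue_on {0<..<T})" for n
      using simple_function_compose1[OF s(1)[of n], of "\<lambda>f. nrm X (\<lambda>x. f x - c x)"]
      by (rule borel_measurable_simple_function)
    show "AE t in lebesgue_on {0<..<T}. (\<lambda>n. nrm X (\<lambda>x. s n t x - c x)) \<longlonglongrightarrow> nrm X (\<lambda>x. z t x - c x)"
      using s(3) zX AE_space
    proof eventually_elim
      case (elim t)
      then have "t \<in> {0<..<T}" by simp
      then show ?case using nrm_diff_tendsto[OF s(2) elim(2) c elim(1)] by simp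
    qed
  qed simp
qed

lemma (in seminormed) strongly_measurable_nrm:
  assumes "strongly_measurable T X z" "AE t in lebesgue_on {0<..<T}. z t \<in> vecs X"
  shows "(\<lambda>t. nrm X (z t)) \<in> borel_measurable (lebesgue_on {0<..<T})"
  using strongly_measurable_nrm_diff[OF assms zero_in] by simp

text \<open>Continuity of \<Psi> is asked sequentially and at the values of z, which suits nonlinear
  maps such as composition with a smooth function: the approximating simple functions are mapped by
  \<Psi> and remain simple.\<close>

lemma strongly_measurable_compose:
  assumes z: "strongly_measurable T X z" and \<Psi>: "\<And>f. f \<in> vecs X \<Longrightarrow> \<Psi> f \<in> vecs Y"
    and c: "AE t in lebesgue_on {0<..<T}. \<forall>f. (\<forall>n. f n \<in> vecs X) \<longrightarrow> (\<lambda>n::nat. nrm X (\<lambda>x. f n x - z t x)) \<longlonglongrightarrow> 0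
        \<longrightarrow> (\<lambda>n. nrm Y (\<lambda>x. \<Psi> (f n) x - \<Psi> (z t) x)) \<longlonglongrightarrow> 0"
  shows "strongly_measurable T Y (\<lambda>t. \<Psi> (z t))"
proof -
  obtain s where s: "\<And>n. simple_function (lebesgue_on {0<..<T}) (s n)"
    "\<And>n t. t \<in> {0<..<T} \<Longrightarrow> s n t \<in> vecs X"
    "AE t in lebesgue_on {0<..<T}. (\<lambda>n. nrm X (\<lambda>x. s n t x - z t x)) \<longlonglongrightarrow> 0"
    using z unfolding strongly_measurable_def by blast
  show ?thesis
    unfolding strongly_measurable_def
  proof (intro exI[of _ "\<lambda>n t. \<Psi> (s n t)"] conjI allI ballI)
    show "simple_function (lebesgue_on {0<..<T}) (\<lambda>t. \<Psi> (s n t))" for n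
      by (rule simple_function_compose1[OF s(1)])
    show "\<Psi> (s n t) \<in> vecs Y" if "t \<in> {0<..<T}" for n t using s(2)[OF that] by (rule \<Psi>)
    show "AE t in lebesgue_on {0<..<T}. (\<lambda>n. nrm Y (\<lambda>x. \<Psi> (s n t) x - \<Psi> (z t) x)) \<longlonglongrightarrow> 0"
      using c s(3) AE_space
    proof eventually_elim
      case (elim t)
      have "\<forall>n. s n t \<in> vecs X" using s(2) elim(3) by simp
      then show ?case using elim(1)[THEN spec, of "\<lambda>n. s n t"] elim(2) by simp
    qed
  qed
qed

primrec argmin_upto :: "(nat \<Rightarrow> 'a \<Rightarrow> real) \<Rightarrow> nat \<Rightarrow> 'a \<Rightarrow> nat" where
  "argmin_upto N 0 t = 0"
| "argmin_upto N (Suc n) t = (if N (Suc n) t < N (argmin_upto N n t) t then Suc n else argmin_upto N n t)"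

lemma argmin_upto_le: "i \<le> n \<Longrightarrow> N (argmin_upto N n t) t \<le> N i t"
proof (induction n)
  case (Suc n)
  then show ?case by (cases "i = Suc n") (auto simp: le_Suc_eq)
qed simp

lemma argmin_upto_bound: "argmin_upto N n t \<le> n"
  by (induction n) auto

lemma argmin_upto_measurable:
  assumes [measurable]: "\<And>i. N i \<in> borel_measurable M"
  shows "argmin_upto N n \<in> measurable M (count_space UNIV)"
proof (induction n)
  case 0
  have "argmin_upto N 0 = (\<lambda>t. 0)" by auto
  then show ?case by simp
next
  case (Suc n)
  have eq: "argmin_upto N (Suc n) = (\<lambda>t. if N (Suc n) t < N (argmin_upto N n t) t then Suc n else argmin_upto N n t)"
    by auto
  note [measurable] = Suc
  have [measurable]: "(\<lambda>t. N (argmin_upto N n t) t) \<in> borel_measurable M"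
    by (rule measurable_compose_countable[OF assms Suc])
  show ?case unfolding eq by measurable
qed

text \<open>Pettis-type criterion: approximate by the nearest among finitely many points of a countable
  set whose distances to \<open>z\<close> are measurable.\<close>

lemma (in seminormed) strongly_measurable_criterion:
  fixes d :: "nat \<Rightarrow> 'c \<Rightarrow> 'e"
  assumes zX: "AE t in lebesgue_on {0<..<T}. z t \<in> vecs X"
    and d: "\<And>i. d i \<in> vecs X" and m: "\<And>i. (\<lambda>t. nrm X (\<lambda>x. z t x - d i x)) \<in> borel_measurable (lebesgue_on {0<..<T})"
    and dense: "AE t in lebesgue_on {0<..<T}. \<forall>e>0. \<exists>i. nrm X (\<lambda>x. z t x - d i x) < e"
  shows "strongly_measurable T X z"
  unfolding strongly_measurable_def
proof (intro exI[of _ "\<lambda>n t. d (argmin_upto (\<lambda>i t. nrm X (\<lambda>x. z t x - d i x)) n t)"] conjI allI ballI)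
  let ?N = "\<lambda>i t. nrm X (\<lambda>x. z t x - d i x)"
  show "simple_function (lebesgue_on {0<..<T}) (\<lambda>t. d (argmin_upto ?N n t))" for n
  proof (rule simple_function_compose1[where g = d])
    show "simple_function (lebesgue_on {0<..<T}) (argmin_upto ?N n)"
      unfolding simple_function_eq_measurable
    proof
      have "argmin_upto ?N n ` space (lebesgue_on {0<..<T}) \<subseteq> {..n}"
        using argmin_upto_bound by auto
      then show "finite (argmin_upto ?N n ` space (lebesgue_on {0<..<T}))" by (rule finite_subset) simp
      show "argmin_upto ?N n \<in> measurable (lebesgue_on {0<..<T}) (count_space UNIV)"
        by (rule argmin_upto_measurable[OF m])
    qed
  qed
  show "d i \<in> vecs X" for i by (rule d)
  show "AE t in lebesgue_on {0<..<T}. (\<lambda>n. nrm X (\<lambda>x. d (argmin_upto ?N n t) x - z t x)) \<longlonglongrightarrow> 0"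
    using zX dense
  proof eventually_elim
    case (elim t)
    show ?case
    proof (rule LIMSEQ_I)
      fix e :: real assume "e > 0"
      then obtain i where i: "?N i t < e" using elim by blast
      have "norm (nrm X (\<lambda>x. d (argmin_upto ?N n t) x - z t x) - 0) < e" if "n \<ge> i" for n
      proof -
        have "nrm X (\<lambda>x. d (argmin_upto ?N n t) x - z t x) = ?N (argmin_upto ?N n t) t"
          by (rule nrm_diff_commute[OF d elim(1)])
        also have "\<dots> \<le> ?N i t" by (rule argmin_upto_le[OF that])
        finally show ?thesis using i nrm_nonneg[OF diff_in[OF d[of "argmin_upto ?N n t"] elim(1)]] by simp
      qed
      then show "\<exists>no. \<forall>n\<ge>no. norm (nrm X (\<lambda>x. d (argmin_upto ?N n t) x - z t x) - 0) < e" by blast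
    qed
  qed
qed

lemma LIMSEQ_zero_exists_less:
  fixes f :: "nat \<Rightarrow> real"
  assumes "f \<longlonglongrightarrow> 0" "e > 0"
  shows "\<exists>n. f n < e"
  using order_tendstoD(2)[OF assms] by (auto simp: eventually_sequentially)

text \<open>The values of all simple functions approximating all the \<open>z k\<close> form a
  countable set that comes arbitrarily close to \<open>y t\<close> for almost every t, and distances
  to \<open>y\<close> are limits of measurable functions. So the criterion applies, in place of a
  diagonal sequence.\<close>

lemma (in seminormed) strongly_measurable_limit:
  assumes T: "0 < T" and z: "\<And>k::nat. strongly_measurable T X (z k)" and zX: "\<And>k. AE t in lebesgue_on {0<..<T}. z k t \<in> vecs X"
    and yX: "AE t in lebesgue_on {0<..<T}. y t \<in> vecs X"
    and l: "AE t in lebesgue_on {0<..<T}. (\<lambda>k. nrm X (\<lambda>x. z k t x - y t x)) \<longlonglongrightarrow> 0"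
  shows "strongly_measurable T X y"
proof -
  have "\<forall>k. \<exists>s. (\<forall>n. simple_function (lebesgue_on {0<..<T}) (s n) \<and> (\<forall>t\<in>{0<..<T}. s n t \<in> vecs X)) \<and>
      (AE t in lebesgue_on {0<..<T}. (\<lambda>n::nat. nrm X (\<lambda>x. s n t x - z k t x)) \<longlonglongrightarrow> 0)"
    using z by (simp add: strongly_measurable_def)
  from choice[OF this] obtain s where sk: "\<forall>k. (\<forall>n. simple_function (lebesgue_on {0<..<T}) (s k n) \<and> (\<forall>t\<in>{0<..<T}. s k n t \<in> vecs X)) \<and>
      (AE t in lebesgue_on {0<..<T}. (\<lambda>n::nat. nrm X (\<lambda>x. s k n t x - z k t x)) \<longlonglongrightarrow> 0)"
    by (rule exE)
  have s: "simple_function (lebesgue_on {0<..<T}) (s k n)" "t \<in> {0<..<T} \<Longrightarrow> s k n t \<in> vecs X"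
     "AE t in lebesgue_on {0<..<T}. (\<lambda>n::nat. nrm X (\<lambda>x. s k n t x - z k t x)) \<longlonglongrightarrow> 0" for k n t
    using sk by simp_all
  define D where "D = (\<Union>k n. s k n ` {0<..<T})"
  have cD: "countable D"
    unfolding D_def using s(1) by (intro countable_UN countableI_type countable_finite) (auto simp: simple_function_def)
  have D0: "D \<noteq> {}" using T unfolding D_def by (auto intro!: exI[of _ "T/2"])
  have DX: "D \<subseteq> vecs X" using s(2) by (auto simp: D_def)
  define d where "d = from_nat_into D"
  have d: "d i \<in> vecs X" for i using from_nat_into[OF D0] DX by (auto simp: d_def)
  show ?thesis
  proof (rule strongly_measurable_criterion[OF yX d])
    show "(\<lambda>t. nrm X (\<lambda>x. y t x - d i x)) \<in> borel_measurable (lebesgue_on {0<..<T})" for i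
    proof (rule AE_LIMSEQ_measurable)
      show "(\<lambda>t. nrm X (\<lambda>x. z k t x - d i x)) \<in> borel_measurable (lebesgue_on {0<..<T})" for k
        by (rule strongly_measurable_nrm_diff[OF z zX d])
      have "AE t in lebesgue_on {0<..<T}. \<forall>k. z k t \<in> vecs X" using zX by (simp add: AE_all_countable)
      then show "AE t in lebesgue_on {0<..<T}. (\<lambda>k. nrm X (\<lambda>x. z k t x - d i x)) \<longlonglongrightarrow> nrm X (\<lambda>x. y t x - d i x)"
        using yX l
      proof eventually_elim
        case (elim t)
        show ?case by (rule nrm_diff_tendsto[OF _ elim(2) d elim(3)]) (use elim(1) in blast)
      qed
    qed simp
    have "AE t in lebesgue_on {0<..<T}. \<forall>k. z k t \<in> vecs X" using zX by (simp add: AE_all_countable)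
    moreover have "AE t in lebesgue_on {0<..<T}. \<forall>k. (\<lambda>n::nat. nrm X (\<lambda>x. s k n t x - z k t x)) \<longlonglongrightarrow> 0"
      using s(3) by (simp add: AE_all_countable)
    ultimately show "AE t in lebesgue_on {0<..<T}. \<forall>e>0. \<exists>i. nrm X (\<lambda>x. y t x - d i x) < e"
      using yX l AE_space
    proof eventually_elim
      case (elim t)
      show ?case
      proof (intro allI impI)
        fix e :: real assume e: "e > 0"
        have t: "t \<in> {0<..<T}" using elim(5) by simp
        obtain k where k: "nrm X (\<lambda>x. z k t x - y t x) < e / 2"
          using LIMSEQ_zero_exists_less[OF elim(4), of "e/2"] e by auto
        have zk: "z k t \<in> vecs X" using elim(1) by blast
        have "(\<lambda>n. nrm X (\<lambda>x. s k n t x - z k t x)) \<longlonglongrightarrow> 0" using elim(2) by blast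
        from LIMSEQ_zero_exists_less[OF this, of "e/2"] e obtain n where n: "nrm X (\<lambda>x. s k n t x - z k t x) < e / 2" by auto
        have "s k n t \<in> D" using t unfolding D_def by blast
        then obtain i where i: "d i = s k n t" using cD by (metis d_def from_nat_into_surj)
        have "nrm X (\<lambda>x. y t x - d i x) \<le> nrm X (\<lambda>x. y t x - z k t x) + nrm X (\<lambda>x. z k t x - d i x)"
          by (rule nrm_triangle[OF elim(3) zk d])
        also have "\<dots> < e"
          using k n nrm_diff_commute[OF elim(3) zk] nrm_diff_commute[OF zk d, of i] i by simp
        finally show "\<exists>i. nrm X (\<lambda>x. y t x - d i x) < e" by blast
      qed
    qed
  qed
qed

section \<open>Approximation in time by simple functions and by continuous ones\<close>

lemma simple_function_measurable_family:
  fixes F :: "'b \<Rightarrow> 'a \<Rightarrow> real"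
  assumes s: "simple_function M s" and F: "\<And>c. c \<in> s ` space M \<Longrightarrow> F c \<in> borel_measurable M"
  shows "(\<lambda>t. F (s t) t) \<in> borel_measurable M"
proof -
  have fin: "finite (s ` space M)" using s by (simp add: simple_function_def)
  have "(\<lambda>t. \<Sum>c\<in>s ` space M. indicator (s -` {c} \<inter> space M) t * F c t) \<in> borel_measurable M"
    using s F by (intro borel_measurable_sum borel_measurable_times borel_measurable_indicator) (auto simp: simple_function_def)
  moreover have "(\<Sum>c\<in>s ` space M. indicator (s -` {c} \<inter> space M) t * F c t) = F (s t) t" if "t \<in> space M" for t
  proof -
    have "(\<Sum>c\<in>s ` space M. indicator (s -` {c} \<inter> space M) t * F c t) = (\<Sum>c\<in>s ` space M. if c = s t then F c t else 0)"
      using that by (intro sum.cong) (auto simp: indicator_def)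
    then show ?thesis using fin that by simp
  qed
  ultimately show ?thesis by (simp cong: measurable_cong)
qed

text \<open>Used for the level sets of a simple function: up to a small L1 error their indicators
  become continuous, hence uniformly continuous on [0, T], which gives control at nearby
  times.\<close>

lemma lebesgue_indicator_uniform_approx:
  fixes A :: "real set"
  assumes A: "A \<in> sets lebesgue" "A \<subseteq> {0<..<T}" and \<eta>: "\<eta> > 0"
  obtains \<phi> :: "real \<Rightarrow> real" and r where "integrable (lebesgue_on {0<..<T}) (\<lambda>t. \<bar>indicator A t - \<phi> t\<bar>)"
    "(LINT t|lebesgue_on {0<..<T}. \<bar>indicator A t - \<phi> t\<bar>) < \<eta>" "r > 0"
    "\<And>t \<tau>. t \<in> {0<..<T} \<Longrightarrow> \<tau> \<in> {0<..<T} \<Longrightarrow> \<bar>t - \<tau>\<bar> < r \<Longrightarrow> \<bar>\<phi> t - \<phi> \<tau>\<bar> < \<eta>"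
proof -
  obtain S N N' where SN: "A = S \<union> N" "N \<subseteq> N'" "N' \<in> null_sets lborel" "S \<in> sets lborel"
    using A(1) by (rule sets_completionE)
  have "emeasure lborel S \<le> emeasure lborel {0<..<T}" using SN A by (intro emeasure_mono) auto
  also have "\<dots> < \<infinity>" using emeasure_bounded_finite[of "{0<..<T}"] by simp
  finally have fin: "emeasure lborel S < \<infinity>" .
  obtain \<phi> :: "real \<Rightarrow> real" and R :: real where \<phi>: "continuous_on UNIV \<phi>" "\<And>x. 0 \<le> \<phi> x" "\<And>x. \<phi> x \<le> 1"
    "\<And>x. norm x > R \<Longrightarrow> \<phi> x = 0" "(LINT x|lborel. \<bar>indicator S x - \<phi> x\<bar>) < \<eta>"
    using lborel_indicator_approx[OF SN(4) fin \<eta>] by auto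
  have [measurable]: "\<phi> \<in> borel_measurable borel" "S \<in> sets borel"
    using \<phi>(1) SN(4) by (auto intro: borel_measurable_continuous_onI)
  have iS: "integrable lborel (\<lambda>x. \<bar>indicator S x - \<phi> x\<bar>)"
  proof (rule Bochner_Integration.integrable_bound)
    show "integrable lborel (indicator ({- max 0 R..max 0 R} \<union> {0..max 0 T}) :: real \<Rightarrow> real)"
      using emeasure_bounded_finite[of "{- max 0 R..max 0 R} \<union> {0..max 0 T}"] 
      by (intro integrable_real_indicator) auto
    have "\<bar>indicator S x - \<phi> x\<bar> \<le> indicator ({- max 0 R..max 0 R} \<union> {0..max 0 T}) x" for x
    proof (cases "x \<in> {- max 0 R..max 0 R} \<union> {0..max 0 T}")
      case True
      then show ?thesis using \<phi>(2,3)[of x] by (auto simp: indicator_def)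
    next
      case False
      then have "norm x > R" "x \<notin> S" using A SN(1) by (auto simp: max_def split: if_splits)
      then show ?thesis using \<phi>(4) by simp
    qed
    then show "AE x in lborel. norm \<bar>indicator S x - \<phi> x\<bar> \<le> norm (indicator ({- max 0 R..max 0 R} \<union> {0..max 0 T}) x :: real)"
      by simp
  qed measurable
  have ae: "AE x in lebesgue. \<bar>indicator S x - \<phi> x\<bar> = \<bar>indicator A x - \<phi> x\<bar>"
  proof -
    have "AE x in lebesgue. x \<notin> N'" using SN(3) by (intro AE_completion AE_not_in)
    then show ?thesis by eventually_elim (use SN(1,2) in \<open>auto simp: indicator_def\<close>)
  qed
  have [measurable]: "\<phi> \<in> borel_measurable lebesgue" by (rule borel_measurable_lebesgueI) simp
  have m: "(\<lambda>x. \<bar>indicator S x - \<phi> x\<bar>) \<in> borel_measurable lebesgue" by (rule borel_measurable_lebesgueI) measurable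
  have mA: "(\<lambda>x. \<bar>indicator A x - \<phi> x\<bar>) \<in> borel_measurable lebesgue" by (rule borel_measurable_AE[OF m ae])
  have iA: "integrable lebesgue (\<lambda>x. \<bar>indicator A x - \<phi> x\<bar>)"
    using iS integrable_cong_AE[OF m mA ae] by (simp add: integrable_completion)
  have eqA: "(LINT x|lebesgue. \<bar>indicator A x - \<phi> x\<bar>) = (LINT x|lborel. \<bar>indicator S x - \<phi> x\<bar>)"
    using integral_cong_AE[OF m mA ae] by (simp add: integral_completion)
  have iAT: "integrable lebesgue (\<lambda>x. indicator {0<..<T} x *\<^sub>R \<bar>indicator A x - \<phi> x\<bar>)"
    using iA by (intro integrable_mult_indicator) auto
  have "uniformly_continuous_on {0..T} \<phi>"
    using \<phi>(1) by (intro compact_uniformly_continuous) (auto intro: continuous_on_subset)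
  then obtain r where r: "r > 0" "\<And>t \<tau>. t \<in> {0..T} \<Longrightarrow> \<tau> \<in> {0..T} \<Longrightarrow> dist \<tau> t < r \<Longrightarrow> dist (\<phi> \<tau>) (\<phi> t) < \<eta>"
    using \<eta> unfolding uniformly_continuous_on_def by metis
  show ?thesis
  proof (rule that[of \<phi> r])
    show "integrable (lebesgue_on {0<..<T}) (\<lambda>t. \<bar>indicator A t - \<phi> t\<bar>)"
      using iAT by (subst integrable_restrict_space) auto
    have "(LINT t|lebesgue_on {0<..<T}. \<bar>indicator A t - \<phi> t\<bar>) \<le> (LINT x|lebesgue. \<bar>indicator A x - \<phi> x\<bar>)"
      using iA iAT by (subst integral_restrict_space) (auto intro!: integral_mono split: split_indicator)
    then show "(LINT t|lebesgue_on {0<..<T}. \<bar>indicator A t - \<phi> t\<bar>) < \<eta>" using \<phi>(5) eqA by simp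
    show "\<bar>\<phi> t - \<phi> \<tau>\<bar> < \<eta>" if "t \<in> {0<..<T}" "\<tau> \<in> {0<..<T}" "\<bar>t - \<tau>\<bar> < r" for t \<tau>
      using r(2)[of \<tau> t] that by (simp add: dist_real_def)
  qed (rule r)
qed

text \<open>Where the norm of the approximating value exceeds twice that of \<open>z t\<close>, the
  value is replaced by 0. The error then has the majorant 3 times the norm of \<open>z t\<close>, so
  pointwise convergence becomes convergence in L2. Where \<open>z t\<close> has positive norm the
  replacement eventually stops; where it has norm 0, replacing by 0 is harmless.\<close>

lemma (in seminormed) strongly_measurable_simple_approx:
  assumes z: "strongly_measurable T X z" and zX: "AE t in lebesgue_on {0<..<T}. z t \<in> vecs X"
    and i: "integrable (lebesgue_on {0<..<T}) (\<lambda>t. (nrm X (z t))\<^sup>2)" and e: "e > 0"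
  obtains p where "simple_function (lebesgue_on {0<..<T}) p" "\<And>t. t \<in> {0<..<T} \<Longrightarrow> p t \<in> vecs X"
    "integrable (lebesgue_on {0<..<T}) (\<lambda>t. (nrm X (\<lambda>x. z t x - p t x))\<^sup>2)"
    "(LINT t|lebesgue_on {0<..<T}. (nrm X (\<lambda>x. z t x - p t x))\<^sup>2) < e"
proof -
  let ?M = "lebesgue_on {0<..<T}"
  obtain s where s: "\<And>n. simple_function ?M (s n)" "\<And>n t. t \<in> {0<..<T} \<Longrightarrow> s n t \<in> vecs X"
    "AE t in ?M. (\<lambda>n. nrm X (\<lambda>x. s n t x - z t x)) \<longlonglongrightarrow> 0"
    using z unfolding strongly_measurable_def by blast
  define p where "p n t = (if nrm X (s n t) \<le> 2 * nrm X (z t) then s n t else (\<lambda>x. 0))" for n t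
  have zm: "(\<lambda>t. nrm X (z t)) \<in> borel_measurable ?M" by (rule strongly_measurable_nrm[OF z zX])
  have ps: "simple_function ?M (p n)" for n
    unfolding p_def
  proof (rule simple_function_If)
    show "{t \<in> space ?M. nrm X (s n t) \<le> 2 * nrm X (z t)} \<in> sets ?M"
      by (rule borel_measurable_le[OF
            borel_measurable_simple_function[OF simple_function_compose1[OF s(1)[of n], of "nrm X"]]
            borel_measurable_times[OF borel_measurable_const zm]])
  qed (use s(1) in auto)
  have pX: "p n t \<in> vecs X" if "t \<in> {0<..<T}" for n t using s(2)[OF that] zero_in by (simp add: p_def)
  have pm: "(\<lambda>t. nrm X (\<lambda>x. z t x - p n t x)) \<in> borel_measurable ?M" for n
    by (rule simple_function_measurable_family[OF ps, where F = "\<lambda>c t. nrm X (\<lambda>x. z t x - c x)"])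
       (use pX in \<open>auto intro!: strongly_measurable_nrm_diff[OF z zX]\<close>)
  have bd: "AE t in ?M. nrm X (\<lambda>x. z t x - p n t x) \<le> 3 * nrm X (z t)" for n
    using zX AE_space
  proof eventually_elim
    case (elim t)
    then have t: "t \<in> {0<..<T}" by simp
    have "nrm X (p n t) \<le> 2 * nrm X (z t)" using nrm_nonneg[OF elim(1)] by (auto simp: p_def nrm_zero)
    then show ?case using nrm_diff_le[OF elim(1) pX[OF t], of n] by linarith
  qed
  have lim: "AE t in ?M. (\<lambda>n. nrm X (\<lambda>x. z t x - p n t x)) \<longlonglongrightarrow> 0"
    using zX s(3) AE_space
  proof eventually_elim
    case (elim t)
    then have t: "t \<in> {0<..<T}" by simp
    have comm: "nrm X (\<lambda>x. z t x - s n t x) = nrm X (\<lambda>x. s n t x - z t x)" for n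
      by (rule nrm_diff_commute[OF elim(1) s(2)[OF t]])
    show ?case
    proof (cases "nrm X (z t) = 0")
      case True
      show ?thesis
      proof (rule real_tendsto_sandwich[OF _ _ tendsto_const elim(2)])
        have "nrm X (\<lambda>x. z t x - p n t x) \<le> nrm X (\<lambda>x. s n t x - z t x)" for n
          using comm[of n] True nrm_nonneg[OF diff_in[OF s(2)[OF t] elim(1)], of n] by (simp add: p_def)
        then show "\<forall>\<^sub>F n in sequentially. nrm X (\<lambda>x. z t x - p n t x) \<le> nrm X (\<lambda>x. s n t x - z t x)" by simp
      qed (simp add: nrm_nonneg[OF diff_in[OF elim(1) pX[OF t]]])
    next
      case False
      then have pos: "nrm X (z t) > 0" using nrm_nonneg[OF elim(1)] by simp
      have "\<forall>\<^sub>F n in sequentially. nrm X (\<lambda>x. s n t x - z t x) < nrm X (z t)"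
        using order_tendstoD(2)[OF elim(2) pos] .
      then have "\<forall>\<^sub>F n in sequentially. nrm X (\<lambda>x. s n t x - z t x) = nrm X (\<lambda>x. z t x - p n t x)"
      proof eventually_elim
        case (elim n)
        have "nrm X (s n t) \<le> 2 * nrm X (z t)"
          using nrm_diff_ineq[OF s(2)[OF t] \<open>z t \<in> vecs X\<close>, of n] elim by simp
        then show ?case using comm by (simp add: p_def)
      qed
      then show ?thesis using elim(2) by (rule Lim_transform_eventually[rotated])
    qed
  qed
  have p2: "integrable ?M (\<lambda>t. (nrm X (\<lambda>x. z t x - p n t x))\<^sup>2)" for n
  proof (rule Bochner_Integration.integrable_bound)
    show "integrable ?M (\<lambda>t. 9 * (nrm X (z t))\<^sup>2)" using i by simp
    show "(\<lambda>t. (nrm X (\<lambda>x. z t x - p n t x))\<^sup>2) \<in> borel_measurable ?M" using pm[of n] by measurable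
    show "AE t in ?M. norm ((nrm X (\<lambda>x. z t x - p n t x))\<^sup>2) \<le> norm (9 * (nrm X (z t))\<^sup>2)"
      using bd[of n] zX AE_space
    proof eventually_elim
      case (elim t)
      then have "0 \<le> nrm X (\<lambda>x. z t x - p n t x)" using nrm_nonneg[OF diff_in[OF elim(2) pX]] by simp
      with power_mono[OF elim(1), of 2] show ?case by (simp add: power_mult_distrib)
    qed
  qed
  have "(\<lambda>n. \<integral>t. (nrm X (\<lambda>x. z t x - p n t x))\<^sup>2 \<partial>?M) \<longlonglongrightarrow> (LINT t|?M. 0)"
  proof (rule integral_dominated_convergence[where w = "\<lambda>t. 9 * (nrm X (z t))\<^sup>2"])
    show "integrable ?M (\<lambda>t. 9 * (nrm X (z t))\<^sup>2)" using i by simp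
    show "(\<lambda>t. (nrm X (\<lambda>x. z t x - p n t x))\<^sup>2) \<in> borel_measurable ?M" for n using pm[of n] by measurable
    show "AE t in ?M. (\<lambda>n. (nrm X (\<lambda>x. z t x - p n t x))\<^sup>2) \<longlonglongrightarrow> 0"
      using lim by eventually_elim (use tendsto_power[of _ 0 sequentially 2] in simp)
    show "AE t in ?M. norm ((nrm X (\<lambda>x. z t x - p n t x))\<^sup>2) \<le> 9 * (nrm X (z t))\<^sup>2" for n
      using bd[of n] zX AE_space
    proof eventually_elim
      case (elim t)
      then have "0 \<le> nrm X (\<lambda>x. z t x - p n t x)" using nrm_nonneg[OF diff_in[OF elim(2) pX]] by simp
      with power_mono[OF elim(1), of 2] show ?case by (simp add: power_mult_distrib)
    qed
  qed simp
  then have "\<forall>\<^sub>F n in sequentially. (LINT t|?M. (nrm X (\<lambda>x. z t x - p n t x))\<^sup>2) < e"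
    using e by (intro order_tendstoD(2)[where y = 0]) auto
  then obtain n where "(LINT t|?M. (nrm X (\<lambda>x. z t x - p n t x))\<^sup>2) < e"
    by (auto simp: eventually_sequentially)
  then show ?thesis using that[of "p n"] ps pX p2 by blast
qed

lemma power2_sum3_le: "((a::real) + b + c)\<^sup>2 \<le> 3 * a\<^sup>2 + 3 * b\<^sup>2 + 3 * c\<^sup>2"
  using zero_le_power2[of "a - b"] zero_le_power2[of "b - c"] zero_le_power2[of "a - c"]
  by (simp add: power2_eq_square algebra_simps)

text \<open>A Lusin-type substitute for the continuity of translations in \<open>L\<^sup>2(0,T;X)\<close>.\<close>

lemma (in seminormed) strongly_measurable_Lusin:
  assumes z: "strongly_measurable T X z" and zX: "AE t in lebesgue_on {0<..<T}. z t \<in> vecs X"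
    and i: "integrable (lebesgue_on {0<..<T}) (\<lambda>t. (nrm X (z t))\<^sup>2)" and e: "e > 0"
  shows "\<exists>E r G. integrable (lebesgue_on {0<..<T}) E \<and> (\<forall>t. 0 \<le> E t) \<and> (LINT t|lebesgue_on {0<..<T}. E t) < e
     \<and> 0 < r \<and> (AE t in lebesgue_on {0<..<T}. t \<in> G)
     \<and> (\<forall>t\<in>G. \<forall>\<tau>\<in>G. \<bar>t - \<tau>\<bar> < r \<longrightarrow> (nrm X (\<lambda>x. z t x - z \<tau> x))\<^sup>2 \<le> E t + E \<tau> + e)"
proof -
  let ?M = "lebesgue_on {0<..<T}"
  obtain p where p: "simple_function ?M p" "\<And>t. t \<in> {0<..<T} \<Longrightarrow> p t \<in> vecs X"
    "integrable ?M (\<lambda>t. (nrm X (\<lambda>x. z t x - p t x))\<^sup>2)"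
    "(LINT t|?M. (nrm X (\<lambda>x. z t x - p t x))\<^sup>2) < e / 12"
    using strongly_measurable_simple_approx[OF z zX i, of "e/12"] e by auto
  define R where "R = p ` {0<..<T}"
  have fR: "finite R" using p(1) by (simp add: simple_function_def R_def)
  \<comment> \<open>The sum over all pairs is a crude bound for every single squared distance
    between two values of \<open>p\<close>.\<close>
  define B where "B = (\<Sum>c\<in>R. \<Sum>c'\<in>R. (nrm X (\<lambda>x. c x - c' x))\<^sup>2)"
  have B0: "0 \<le> B" by (auto simp: B_def intro!: sum_nonneg)
  have B: "(nrm X (\<lambda>x. c x - c' x))\<^sup>2 \<le> B" if "c \<in> R" "c' \<in> R" for c c'
  proof -
    have "(nrm X (\<lambda>x. c x - c' x))\<^sup>2 \<le> (\<Sum>c'\<in>R. (nrm X (\<lambda>x. c x - c' x))\<^sup>2)"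
      by (rule member_le_sum[OF that(2) _ fR]) simp
    also have "\<dots> \<le> B" unfolding B_def
      by (rule member_le_sum[OF that(1) _ fR, where f = "\<lambda>c. \<Sum>c'\<in>R. (nrm X (\<lambda>x. c x - c' x))\<^sup>2"]) (auto intro!: sum_nonneg)
    finally show ?thesis .
  qed
  define A where "A c = p -` {c} \<inter> {0<..<T}" for c
  have A: "A c \<in> sets lebesgue" "A c \<subseteq> {0<..<T}" if "c \<in> R" for c
  proof -
    have "p -` {c} \<inter> space ?M \<in> sets ?M" using p(1) that by (auto simp: simple_function_def R_def)
    then show "A c \<in> sets lebesgue" by (auto simp: A_def sets_restrict_space_iff)
  qed (auto simp: A_def)
  \<comment> \<open>Chosen so that \<open>3 * B * (card R * \<eta>) \<le> e / 2\<close>. With the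
    e/12 above, which is tripled in \<open>E\<close>, the integral of \<open>E\<close> stays below
    e. The added ones keep the denominator positive.\<close>
  define \<eta> where "\<eta> = e / (6 * (B + 1) * (real (card R) + 1))"
  have \<eta>: "\<eta> > 0" using e B0 by (auto simp: \<eta>_def intro!: divide_pos_pos mult_pos_pos)
  have B\<eta>: "3 * B * (real (card R) * \<eta>) \<le> e / 2"
  proof -
    have "3 * B * (real (card R) * \<eta>) \<le> 3 * (B + 1) * ((real (card R) + 1) * \<eta>)"
      using B0 \<eta> by (intro mult_mono) auto
    also have "\<dots> = e / 2"
    proof -
      have "3 * b * (k * (e / (6 * b * k))) = e / 2" if "b > 0" "k > 0" for b k :: real
        using that by (simp add: field_simps)
      from this[of "B + 1" "real (card R) + 1"] show ?thesis using B0 by (simp add: \<eta>_def)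
    qed
    finally show ?thesis .
  qed
  have "\<forall>c\<in>R. \<exists>\<phi>r. integrable ?M (\<lambda>t. \<bar>indicator (A c) t - fst \<phi>r t\<bar>) \<and>
    (LINT t|?M. \<bar>indicator (A c) t - fst \<phi>r t\<bar>) < \<eta> \<and> snd \<phi>r > 0 \<and>
    (\<forall>t\<in>{0<..<T}. \<forall>\<tau>\<in>{0<..<T}. \<bar>t - \<tau>\<bar> < snd \<phi>r \<longrightarrow> \<bar>fst \<phi>r t - fst \<phi>r \<tau>\<bar> < \<eta>)"
  proof
    fix c assume "c \<in> R"
    obtain \<phi> :: "real \<Rightarrow> real" and r where "integrable ?M (\<lambda>t. \<bar>indicator (A c) t - \<phi> t\<bar>)"
      "(LINT t|?M. \<bar>indicator (A c) t - \<phi> t\<bar>) < \<eta>" "r > 0"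
      "\<And>t \<tau>. t \<in> {0<..<T} \<Longrightarrow> \<tau> \<in> {0<..<T} \<Longrightarrow> \<bar>t - \<tau>\<bar> < r \<Longrightarrow> \<bar>\<phi> t - \<phi> \<tau>\<bar> < \<eta>"
      using lebesgue_indicator_uniform_approx[OF A[OF \<open>c \<in> R\<close>] \<eta>] by blast
    then show "\<exists>\<phi>r. integrable ?M (\<lambda>t. \<bar>indicator (A c) t - fst \<phi>r t\<bar>) \<and>
      (LINT t|?M. \<bar>indicator (A c) t - fst \<phi>r t\<bar>) < \<eta> \<and> snd \<phi>r > 0 \<and>
      (\<forall>t\<in>{0<..<T}. \<forall>\<tau>\<in>{0<..<T}. \<bar>t - \<tau>\<bar> < snd \<phi>r \<longrightarrow> \<bar>fst \<phi>r t - fst \<phi>r \<tau>\<bar> < \<eta>)"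
      by (intro exI[of _ "(\<phi>, r)"]) simp
  qed
  from bchoice[OF this] obtain \<phi>r where \<phi>r: "\<forall>c\<in>R. integrable ?M (\<lambda>t. \<bar>indicator (A c) t - fst (\<phi>r c) t\<bar>) \<and>
    (LINT t|?M. \<bar>indicator (A c) t - fst (\<phi>r c) t\<bar>) < \<eta> \<and> snd (\<phi>r c) > 0 \<and>
    (\<forall>t\<in>{0<..<T}. \<forall>\<tau>\<in>{0<..<T}. \<bar>t - \<tau>\<bar> < snd (\<phi>r c) \<longrightarrow> \<bar>fst (\<phi>r c) t - fst (\<phi>r c) \<tau>\<bar> < \<eta>)"
    by (rule exE)
  define \<phi> where "\<phi> c = fst (\<phi>r c)" for c
  \<comment> \<open>The inserted 1 keeps the minimum over a nonempty set if \<open>R\<close> is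
    empty.\<close>
  define r where "r = Min (insert 1 ((\<lambda>c. snd (\<phi>r c)) ` R))"
  have r: "r > 0" using fR \<phi>r by (auto simp: r_def)
  have \<phi>: "integrable ?M (\<lambda>t. \<bar>indicator (A c) t - \<phi> c t\<bar>)" "(LINT t|?M. \<bar>indicator (A c) t - \<phi> c t\<bar>) < \<eta>"
    if "c \<in> R" for c using \<phi>r that by (auto simp: \<phi>_def)
  have \<phi>u: "\<bar>\<phi> c t - \<phi> c \<tau>\<bar> \<le> \<eta>" if "c \<in> R" "t \<in> {0<..<T}" "\<tau> \<in> {0<..<T}" "\<bar>t - \<tau>\<bar> < r" for c t \<tau>
  proof -
    have "r \<le> snd (\<phi>r c)" using fR that(1) by (auto simp: r_def)
    then have "\<bar>t - \<tau>\<bar> < snd (\<phi>r c)" using that(4) by simp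
    then show ?thesis using \<phi>r that(1-3) unfolding \<phi>_def by fastforce
  qed
  \<comment> \<open>The error of approximating z by \<open>p\<close> plus that of approximating the
    level sets of \<open>p\<close> by continuous functions. The factors 3 come from splitting the
    square of a sum of three terms.\<close>
  define E where "E t = 3 * (nrm X (\<lambda>x. z t x - p t x))\<^sup>2 + 3 * B * (\<Sum>c\<in>R. \<bar>indicator (A c) t - \<phi> c t\<bar>)" for t
  have iE: "integrable ?M E"
    unfolding E_def using p(3) \<phi>(1) by (intro Bochner_Integration.integrable_add integrable_mult_right Bochner_Integration.integrable_sum) auto
  have E0: "0 \<le> E t" for t using B0 by (auto simp: E_def intro!: add_nonneg_nonneg mult_nonneg_nonneg sum_nonneg)
  have "(LINT t|?M. E t) = 3 * (LINT t|?M. (nrm X (\<lambda>x. z t x - p t x))\<^sup>2) + 3 * B * (\<Sum>c\<in>R. \<integral>t. \<bar>indicator (A c) t - \<phi> c t\<bar> \<partial>?M)"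
    unfolding E_def using p(3) \<phi>(1)
    by (subst Bochner_Integration.integral_add) (auto simp: Bochner_Integration.integral_sum intro!: Bochner_Integration.integrable_sum)
  also have "(\<Sum>c\<in>R. \<integral>t. \<bar>indicator (A c) t - \<phi> c t\<bar> \<partial>?M) \<le> (\<Sum>c\<in>R. \<eta>)"
    using \<phi>(2) by (intro sum_mono less_imp_le)
  also have "(\<Sum>c\<in>R. \<eta>) = real (card R) * \<eta>" by simp
  finally have "(LINT t|?M. E t) \<le> 3 * (LINT t|?M. (nrm X (\<lambda>x. z t x - p t x))\<^sup>2) + 3 * B * (real (card R) * \<eta>)"
    using B0 by (simp add: mult_left_mono)
  then have intE: "(LINT t|?M. E t) < e" using p(4) B\<eta> e by linarith
  define G where "G = {t \<in> {0<..<T}. z t \<in> vecs X}"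
  have "AE t in ?M. t \<in> G" using zX AE_space by eventually_elim (simp add: G_def)
  moreover have "(nrm X (\<lambda>x. z t x - z \<tau> x))\<^sup>2 \<le> E t + E \<tau> + e" if t: "t \<in> G" and \<tau>: "\<tau> \<in> G" and tr: "\<bar>t - \<tau>\<bar> < r" for t \<tau>
  proof -
    have tT: "t \<in> {0<..<T}" "\<tau> \<in> {0<..<T}" "z t \<in> vecs X" "z \<tau> \<in> vecs X" using t \<tau> by (auto simp: G_def)
    note pt = p(2)[OF tT(1)] p(2)[OF tT(2)]
    let ?a = "nrm X (\<lambda>x. z t x - p t x)" and ?b = "nrm X (\<lambda>x. p t x - p \<tau> x)" and ?c = "nrm X (\<lambda>x. z \<tau> x - p \<tau> x)"
    have "nrm X (\<lambda>x. z t x - z \<tau> x) \<le> ?a + ?b + ?c"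
      using nrm_triangle[OF tT(3) pt(1) tT(4)] nrm_triangle[OF pt tT(4)] nrm_diff_commute[OF pt(2) tT(4)] by simp
    then have "(nrm X (\<lambda>x. z t x - z \<tau> x))\<^sup>2 \<le> (?a + ?b + ?c)\<^sup>2"
      by (rule power_mono) (rule nrm_nonneg[OF diff_in[OF tT(3,4)]])
    also have "\<dots> \<le> 3 * ?a\<^sup>2 + 3 * ?b\<^sup>2 + 3 * ?c\<^sup>2" by (rule power2_sum3_le)
    \<comment> \<open>If \<open>p\<close> takes different values at t and \<tau>, the indicator of
      the level set of \<open>p t\<close> changes by 1 between them, so the jump is paid for by the
      sum of indicator differences.\<close>
    also have "?b\<^sup>2 \<le> B * (\<Sum>c\<in>R. \<bar>indicator (A c) t - indicator (A c) \<tau>\<bar>)"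
    proof (cases "p t = p \<tau>")
      case True
      then show ?thesis using B0 by (simp add: nrm_zero sum_nonneg)
    next
      case False
      have R: "p t \<in> R" "p \<tau> \<in> R" using tT by (auto simp: R_def)
      have "(1::real) = \<bar>indicator (A (p t)) t - indicator (A (p t)) \<tau>\<bar>"
        using False tT by (auto simp: A_def indicator_def)
      also have "\<dots> \<le> (\<Sum>c\<in>R. \<bar>indicator (A c) t - indicator (A c) \<tau>\<bar>)"
        by (rule member_le_sum[OF R(1) _ fR, where f = "\<lambda>c. \<bar>indicator (A c) t - indicator (A c) \<tau> :: real\<bar>"]) simp
      finally have "B * 1 \<le> B * (\<Sum>c\<in>R. \<bar>indicator (A c) t - indicator (A c) \<tau>\<bar>)" using B0 by (rule mult_left_mono)
      then show ?thesis using B[OF R] by simp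
    qed
    also have "(\<Sum>c\<in>R. \<bar>indicator (A c) t - indicator (A c) \<tau>\<bar> :: real)
        \<le> (\<Sum>c\<in>R. \<bar>indicator (A c) t - \<phi> c t\<bar> + \<bar>indicator (A c) \<tau> - \<phi> c \<tau>\<bar> + \<eta>)"
    proof (rule sum_mono)
      fix c assume "c \<in> R"
      from \<phi>u[OF this tT(1,2) tr] show "\<bar>indicator (A c) t - indicator (A c) \<tau>\<bar>
        \<le> \<bar>indicator (A c) t - \<phi> c t\<bar> + \<bar>indicator (A c) \<tau> - \<phi> c \<tau>\<bar> + \<eta>" by linarith
    qed
    also have "\<dots> = (\<Sum>c\<in>R. \<bar>indicator (A c) t - \<phi> c t\<bar>) + (\<Sum>c\<in>R. \<bar>indicator (A c) \<tau> - \<phi> c \<tau>\<bar>) + real (card R) * \<eta>"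
      by (simp add: sum.distrib)
    finally have "(nrm X (\<lambda>x. z t x - z \<tau> x))\<^sup>2 \<le> 3 * ?a\<^sup>2 + 3 * (B * ((\<Sum>c\<in>R. \<bar>indicator (A c) t - \<phi> c t\<bar>)
        + (\<Sum>c\<in>R. \<bar>indicator (A c) \<tau> - \<phi> c \<tau>\<bar>) + real (card R) * \<eta>)) + 3 * ?c\<^sup>2"
      using B0 by (simp add: mult_left_mono)
    also have "\<dots> = E t + E \<tau> + 3 * B * (real (card R) * \<eta>)" by (simp add: E_def algebra_simps)
    also have "\<dots> \<le> E t + E \<tau> + e" using B\<eta> e by simp
    finally show ?thesis .
  qed
  ultimately show ?thesis using iE E0 intE r by blast
qed

subsection \<open>Integrating local inequalities in time\<close>

lemma integral_shift_difference:
  fixes f :: "real \<Rightarrow> real"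
  assumes f: "\<And>c d. integrable lborel (\<lambda>t. indicator {c..d} t * f t)" and h: "0 < h" "h \<le> b - a"
  shows "(LINT t|lborel. indicator {a..b} t * (f t - f (t - h)))
     = (LINT t|lborel. indicator {b - h..b} t * f t) - (LINT t|lborel. indicator {a - h..a} t * f t)"
proof -
  let ?I = "\<lambda>c d. \<integral>t. indicator {c..d} t * f t \<partial>lborel"
  have sh: "integrable lborel (\<lambda>t. indicator {a..b} t * f (t - h))" "(LINT t|lborel. indicator {a..b} t * f (t - h)) = ?I (a - h) (b - h)"
  proof -
    have eq: "(\<lambda>t. indicator {a - h..b - h} (t + - h) * f (t + - h)) = (\<lambda>t. indicator {a..b} t * f (t - h))"
      by (auto simp: indicator_def fun_eq_iff)
    show "integrable lborel (\<lambda>t. indicator {a..b} t * f (t - h))" "(LINT t|lborel. indicator {a..b} t * f (t - h)) = ?I (a - h) (b - h)"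
      using integrable_lborel_translate[OF f, of "a - h" "b - h" "- h"] integral_lborel_translate[OF f, of "a - h" "b - h" "- h"]
      unfolding eq .
  qed
  have split: "?I c e = ?I c d + ?I d e" if "c \<le> d" "d \<le> e" for c d e
  proof -
    have "?I c e = (LINT t|lborel. indicator {c..d} t * f t + indicator {d..e} t * f t)"
    proof (rule integral_cong_AE)
      show "AE t in lborel. indicator {c..e} t * f t = indicator {c..d} t * f t + indicator {d..e} t * f t"
        using AE_lborel_singleton[of d] by eventually_elim (use that in \<open>auto simp: indicator_def\<close>)
    qed (use f in auto)
    then show ?thesis using f by simp
  qed
  have "(LINT t|lborel. indicator {a..b} t * (f t - f (t - h))) = ?I a b - ?I (a - h) (b - h)"
    using f sh by (simp add: right_diff_distrib)
  also have "?I a b = ?I a (b - h) + ?I (b - h) b" using h by (intro split) auto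
  also have "?I (a - h) (b - h) = ?I (a - h) a + ?I a (b - h)" using h by (intro split) auto
  finally show ?thesis by simp
qed

lemma integral_lebesgue_on_Ioo_eq:
  fixes f :: "real \<Rightarrow> real"
  assumes "{c..d} \<subseteq> {0<..<T}" "f \<in> borel_measurable borel"
  shows "(LINT t|lebesgue_on {0<..<T}. indicator {c..d} t * f t) = (LINT t|lborel. indicator {c..d} t * f t)"
proof (rule integral_lebesgue_on_eq_lborel)
  show "AE t in lebesgue. indicator {0<..<T} t * (indicator {c..d} t * f t) = indicator {c..d} t * f t"
    using assms(1) by (intro AE_I2) (auto simp: indicator_def subset_iff)
qed (use assms(2) in auto)

text \<open>Integrating the hypothesis over \<open>t\<close> with \<open>s = t - h\<close>, the left-hand side telescopes, and
  so does the contribution of the primitive of the Lusin error \<open>E\<close>.\<close>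

lemma (in seminormed) averaged_inequality_interior:
  fixes y G :: "real \<Rightarrow> real"
  assumes z: "strongly_measurable T X z" and zX: "AE t in lebesgue_on {0<..<T}. z t \<in> vecs X"
    and i: "integrable (lebesgue_on {0<..<T}) (\<lambda>t. (nrm X (z t))\<^sup>2)"
    and y: "continuous_on {0..T} y" and G: "integrable (lebesgue_on {0<..<T}) G" and C: "0 \<le> C"
    and main: "AE t in lebesgue_on {0<..<T}. \<forall>s. 0 < s \<and> s < t \<longrightarrow>
        y t - y s \<le> (t - s) * G t + C * (LINT \<tau>|lebesgue_on {0<..<T}. indicator {s..t} \<tau> * (nrm X (\<lambda>x. z \<tau> x - z t x))\<^sup>2)"
    and ab: "0 < a" "a < b" "b < T"
  shows "y b - y a \<le> (LINT t|lebesgue_on {0<..<T}. indicator {a..b} t * G t)"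
proof (rule field_le_epsilon)
  let ?M = "lebesgue_on {0<..<T}"
  fix \<epsilon> :: real assume \<epsilon>: "\<epsilon> > 0"
  \<comment> \<open>After division by h the errors add up to \<open>C * e * (T + 2)\<close>: e from
    the telescoped primitive \<open>P\<close>, e from the integral of \<open>E\<close>, and at most
    e T from the additive constant in the Lusin bound. This is at most \<epsilon> / 4; the endpoints
    of y cost another \<epsilon> / 2.\<close>
  define e where "e = \<epsilon> / (4 * (C + 1) * (T + 2))"
  have T: "T > 0" using ab by simp
  have e: "e > 0" using \<epsilon> C T by (auto simp: e_def intro!: divide_pos_pos mult_pos_pos)
  obtain E r Gd where E: "integrable ?M E" "\<And>t. 0 \<le> E t" "(LINT t|?M. E t) < e" and r: "0 < r"
    and Gd: "AE t in ?M. t \<in> Gd"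
    and lus: "\<And>t \<tau>. t \<in> Gd \<Longrightarrow> \<tau> \<in> Gd \<Longrightarrow> \<bar>t - \<tau>\<bar> < r \<Longrightarrow> (nrm X (\<lambda>x. z t x - z \<tau> x))\<^sup>2 \<le> E t + E \<tau> + e"
    using strongly_measurable_Lusin[OF z zX i e] by blast
  \<comment> \<open>Integrating \<open>E\<close> over [t - h, t] gives an increment of
    \<open>P\<close>. As \<open>P\<close> stays in [0, e), the average of these increments over t
    telescopes to at most h e, without any regularity of \<open>E\<close>.\<close>
  define P where "P t = (LINT \<tau>|?M. indicator {..t} \<tau> * E \<tau>)" for t
  note iE = integrable_indicator_mult[OF E(1)]
  have Pm: "mono P" unfolding P_def
    by (intro monoI integral_mono iE) (auto simp: E(2) split: split_indicator)
  have P0: "0 \<le> P t" "P t < e" for t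
  proof -
    show "0 \<le> P t" unfolding P_def using E(2) by (intro integral_nonneg_AE AE_I2) auto
    have "P t \<le> (LINT t|?M. E t)" unfolding P_def
      by (intro integral_mono iE E(1)) (auto simp: E(2) split: split_indicator)
    then show "P t < e" using E(3) by simp
  qed
  have [measurable]: "P \<in> borel_measurable borel" using Pm by (rule borel_measurable_mono)
  have iI: "integrable lborel (indicator {c..d} :: real \<Rightarrow> real)" for c d :: real
    using emeasure_bounded_finite[of "{c..d}"] by (intro integrable_real_indicator) auto
  have iP: "integrable lborel (\<lambda>t. indicator {c..d} t * P t)" for c d
  proof (rule Bochner_Integration.integrable_bound)
    show "integrable lborel (\<lambda>t. e * indicator {c..d} t)" using iI by simp
    show "AE t in lborel. norm (indicator {c..d} t * P t) \<le> norm (e * indicator {c..d} t)"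
      using P0 e by (intro AE_I2) (auto simp: less_imp_le split: split_indicator)
  qed measurable
  \<comment> \<open>Constant extension beyond [0, T], so that y can be shifted in time as a function
    on the whole line.\<close>
  define y' where "y' t = y (max 0 (min T t))" for t
  have y'c: "continuous_on UNIV y'"
    unfolding y'_def using T by (intro continuous_on_compose2[OF y] continuous_intros) auto
  have [measurable]: "y' \<in> borel_measurable borel" using y'c by (rule borel_measurable_continuous_onI)
  have iy: "integrable lborel (\<lambda>t. indicator {c..d} t * y' t)" for c d
    using borel_integrable_atLeastAtMost'[OF continuous_on_subset[OF y'c subset_UNIV], of c d]
    by (simp add: set_integrable_def)
  have y': "y' t = y t" if "t \<in> {0..T}" for t using that by (simp add: y'_def)
  have cont: "\<exists>d>0. \<forall>t. \<bar>t - c\<bar> < d \<longrightarrow> \<bar>y' t - y' c\<bar> < \<epsilon> / 4" for c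
    using y'c[unfolded continuous_on_iff, rule_format, of c "\<epsilon>/4"] \<epsilon> by (simp add: dist_real_def)
  obtain \<delta>b where \<delta>b: "\<delta>b > 0" "\<And>t. \<bar>t - b\<bar> < \<delta>b \<Longrightarrow> \<bar>y' t - y' b\<bar> < \<epsilon> / 4" using cont[of b] by blast
  obtain \<delta>a where \<delta>a: "\<delta>a > 0" "\<And>t. \<bar>t - a\<bar> < \<delta>a \<Longrightarrow> \<bar>y' t - y' a\<bar> < \<epsilon> / 4" using cont[of a] by blast
  \<comment> \<open>The bound by r makes the Lusin estimate applicable, the one by a keeps t - h
    positive, the one by b - a lets the shifted integrals telescope, and the last two give
    continuity at the endpoints.\<close>
  define h where "h = Min {r, a, b - a, \<delta>a, \<delta>b} / 2"
  have h: "0 < h" "h < r" "h < a" "h < b - a" "h < \<delta>a" "h < \<delta>b"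
    using r ab \<delta>a \<delta>b by (auto simp: h_def min_def)
  have len: "(LINT t|lborel. indicator {c..d} t) = d - c" if "c \<le> d" for c d :: real using that by simp
  have L: "h * (y b - y a - \<epsilon> / 2) \<le> (LINT t|lborel. indicator {a..b} t * (y' t - y' (t - h)))"
  proof -
    have "h * (y b - \<epsilon> / 4) = (LINT t|lborel. (y b - \<epsilon> / 4) * indicator {b - h..b} t)" using h len[of "b - h" b] by simp
    also have "\<dots> \<le> (LINT t|lborel. indicator {b - h..b} t * y' t)"
    proof (intro integral_mono iy)
      show "integrable lborel (\<lambda>t. (y b - \<epsilon> / 4) * indicator {b - h..b} t)" using iI by simp
      show "(y b - \<epsilon> / 4) * indicator {b - h..b} t \<le> indicator {b - h..b} t * y' t" for t
      proof (cases "t \<in> {b - h..b}")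
        case True
        have "\<bar>y' t - y' b\<bar> < \<epsilon> / 4" by (rule \<delta>b(2)) (use True h in auto)
        then have "y' b - \<epsilon> / 4 \<le> y' t" unfolding abs_diff_less_iff by simp
        moreover have "y' b = y b" by (rule y') (use ab in auto)
        ultimately show ?thesis using True by simp
      qed simp
    qed
    finally have 1: "h * (y b - \<epsilon> / 4) \<le> (LINT t|lborel. indicator {b - h..b} t * y' t)" .
    have "(LINT t|lborel. indicator {a - h..a} t * y' t) \<le> (LINT t|lborel. (y a + \<epsilon> / 4) * indicator {a - h..a} t)"
    proof (intro integral_mono iy)
      show "integrable lborel (\<lambda>t. (y a + \<epsilon> / 4) * indicator {a - h..a} t)" using iI by simp
      show "indicator {a - h..a} t * y' t \<le> (y a + \<epsilon> / 4) * indicator {a - h..a} t" for t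
      proof (cases "t \<in> {a - h..a}")
        case True
        have "\<bar>y' t - y' a\<bar> < \<epsilon> / 4" by (rule \<delta>a(2)) (use True h in auto)
        then have "y' t \<le> y' a + \<epsilon> / 4" unfolding abs_diff_less_iff by simp
        moreover have "y' a = y a" by (rule y') (use ab in auto)
        ultimately show ?thesis using True by simp
      qed simp
    qed
    also have "\<dots> = h * (y a + \<epsilon> / 4)" using h len[of "a - h" a] by simp
    finally have 2: "(LINT t|lborel. indicator {a - h..a} t * y' t) \<le> h * (y a + \<epsilon> / 4)" .
    have "(LINT t|lborel. indicator {a..b} t * (y' t - y' (t - h)))
       = (LINT t|lborel. indicator {b - h..b} t * y' t) - (LINT t|lborel. indicator {a - h..a} t * y' t)"
      using h by (intro integral_shift_difference iy) auto
    then show ?thesis using 1 2 by (simp add: algebra_simps)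
  qed
  have Pb: "(LINT t|lborel. indicator {a..b} t * (P t - P (t - h))) \<le> h * e"
  proof -
    have "(LINT t|lborel. indicator {a..b} t * (P t - P (t - h)))
       = (LINT t|lborel. indicator {b - h..b} t * P t) - (LINT t|lborel. indicator {a - h..a} t * P t)"
      using h by (intro integral_shift_difference iP) auto
    also have "\<dots> \<le> (LINT t|lborel. e * indicator {b - h..b} t) - 0"
    proof (intro diff_mono integral_mono iP)
      show "integrable lborel (\<lambda>t. e * indicator {b - h..b} t)" using iI by simp
      show "indicator {b - h..b} t * P t \<le> e * indicator {b - h..b} t" for t
        using P0(2)[of t] by (auto simp: indicator_def)
      show "0 \<le> (LINT t|lborel. indicator {a - h..a} t * P t)" using P0 by (intro integral_nonneg_AE AE_I2) auto
    qed
    also have "\<dots> = h * e" using h len[of "b - h" b] by simp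
    finally show ?thesis .
  qed
  have Iab: "{a..b} \<subseteq> {0<..<T}" using ab by auto
  have pt: "AE t in ?M. indicator {a..b} t * (y' t - y' (t - h))
      \<le> h * (indicator {a..b} t * G t) + C * (indicator {a..b} t * (P t - P (t - h)) + h * (indicator {a..b} t * E t) + h * e * indicator {a..b} t)"
    using main Gd AE_space zX
  proof eventually_elim
    case (elim t)
    then have tT: "t \<in> {0<..<T}" by simp
    show ?case
    proof (cases "t \<in> {a..b}")
      case True
      let ?d = "\<lambda>\<tau>. (nrm X (\<lambda>x. z \<tau> x - z t x))\<^sup>2"
      have th: "0 < t - h" using True h by auto
      have hint: "(LINT \<tau>|?M. indicator {t - h..t} \<tau>) = h" "integrable ?M (indicator {t - h..t} :: real \<Rightarrow> real)"
      proof -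
        have sub: "{t - h..t} \<subseteq> {0<..<T}" using th tT by auto
        show "(LINT \<tau>|?M. indicator {t - h..t} \<tau>) = h"
          using integral_lebesgue_on_Ioo_eq[OF sub, of "\<lambda>x. 1"] h len[of "t - h" t] by simp
        interpret finite_measure ?M by (rule finite_measure_lebesgue_on) auto
        show "integrable ?M (indicator {t - h..t} :: real \<Rightarrow> real)"
          using sub by (intro integrable_real_indicator) (auto simp: sets_restrict_space_iff less_top[symmetric])
      qed
      have PE: "(LINT \<tau>|?M. indicator {t - h..t} \<tau> * E \<tau>) = P t - P (t - h)"
      proof -
        have "(LINT \<tau>|?M. indicator {t - h..t} \<tau> * E \<tau>) = (LINT \<tau>|?M. indicator {..t} \<tau> * E \<tau> - indicator {..t - h} \<tau> * E \<tau>)"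
        proof (rule integral_cong_AE)
          have "AE \<tau> in lebesgue. \<tau> \<noteq> t - h" using AE_lborel_singleton by (rule AE_completion)
          then have "AE \<tau> in ?M. \<tau> \<noteq> t - h" by (subst AE_restrict_space_iff) (auto elim: eventually_mono)
          then show "AE \<tau> in ?M. indicator {t - h..t} \<tau> * E \<tau> = indicator {..t} \<tau> * E \<tau> - indicator {..t - h} \<tau> * E \<tau>"
            by eventually_elim (use h in \<open>auto simp: indicator_def\<close>)
        qed (use iE in \<open>auto intro!: borel_measurable_diff\<close>)
        then show ?thesis using iE by (simp add: P_def)
      qed
      have "(LINT \<tau>|?M. indicator {t - h..t} \<tau> * ?d \<tau>)
          \<le> (LINT \<tau>|?M. indicator {t - h..t} \<tau> * E \<tau> + (E t + e) * indicator {t - h..t} \<tau>)"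
      proof (rule integral_mono_AE)
        have iR: "integrable ?M (\<lambda>\<tau>. indicator {t - h..t} \<tau> * E \<tau> + (E t + e) * indicator {t - h..t} \<tau>)"
          using iE hint(2) by (intro Bochner_Integration.integrable_add integrable_mult_right) auto
        then show "integrable ?M (\<lambda>\<tau>. indicator {t - h..t} \<tau> * E \<tau> + (E t + e) * indicator {t - h..t} \<tau>)" .
        show le: "AE \<tau> in ?M. indicator {t - h..t} \<tau> * ?d \<tau> \<le> indicator {t - h..t} \<tau> * E \<tau> + (E t + e) * indicator {t - h..t} \<tau>"
          using Gd
        proof eventually_elim
          case (elim \<tau>)
          show ?case
          proof (cases "\<tau> \<in> {t - h..t}")
            case True
            then have "\<bar>\<tau> - t\<bar> < r" using h by auto
            with lus[OF elim \<open>t \<in> Gd\<close> this] True show ?thesis by simp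
          qed simp
        qed
        show "integrable ?M (\<lambda>\<tau>. indicator {t - h..t} \<tau> * ?d \<tau>)"
        proof (rule Bochner_Integration.integrable_bound[OF iR])
          have "(\<lambda>\<tau>. nrm X (\<lambda>x. z \<tau> x - z t x)) \<in> borel_measurable ?M"
            by (rule strongly_measurable_nrm_diff[OF z zX \<open>z t \<in> vecs X\<close>])
          then show "(\<lambda>\<tau>. indicator {t - h..t} \<tau> * ?d \<tau>) \<in> borel_measurable ?M"
            by (intro borel_measurable_times borel_measurable_power borel_measurable_integrable[OF hint(2)])
          show "AE \<tau> in ?M. norm (indicator {t - h..t} \<tau> * ?d \<tau>) \<le> norm (indicator {t - h..t} \<tau> * E \<tau> + (E t + e) * indicator {t - h..t} \<tau>)"
            using le by eventually_elim (auto simp: indicator_def)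
        qed
      qed
      also have "\<dots> = P t - P (t - h) + (E t + e) * h" using iE hint PE by simp
      finally have "(LINT \<tau>|?M. indicator {t - h..t} \<tau> * ?d \<tau>) \<le> P t - P (t - h) + (E t + e) * h" .
      then have "C * (LINT \<tau>|?M. indicator {t - h..t} \<tau> * ?d \<tau>) \<le> C * (P t - P (t - h) + (E t + e) * h)"
        using C by (rule mult_left_mono)
      moreover have "y t - y (t - h) \<le> (t - (t - h)) * G t + C * (LINT \<tau>|?M. indicator {t - h..t} \<tau> * ?d \<tau>)"
        using elim(1) th h(1) by (auto dest!: spec[of _ "t - h"])
      moreover have "y' t = y t" "y' (t - h) = y (t - h)" using tT th h(1) by (auto intro!: y')
      ultimately show ?thesis using True by (simp add: algebra_simps)
    qed simp
  qed
  have iM: "integrable ?M (\<lambda>t. indicator {a..b} t * f t)" "(LINT t|?M. indicator {a..b} t * f t) = (LINT t|lborel. indicator {a..b} t * f t)"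
    if f: "integrable lborel (\<lambda>t. indicator {a..b} t * f t)" "f \<in> borel_measurable borel" for f :: "real \<Rightarrow> real"
  proof -
    show "(LINT t|?M. indicator {a..b} t * f t) = (LINT t|lborel. indicator {a..b} t * f t)"
      by (rule integral_lebesgue_on_Ioo_eq[OF Iab f(2)])
    have "integrable lebesgue (\<lambda>t. indicator {a..b} t * f t)" using f by (simp add: integrable_completion)
    moreover have eq: "(\<lambda>t. indicator {0<..<T} t *\<^sub>R (indicator {a..b} t * f t)) = (\<lambda>t. indicator {a..b} t * f t)"
      using Iab by (auto simp: indicator_def fun_eq_iff subset_iff)
    have "integrable ?M (\<lambda>t. indicator {a..b} t * f t)
        \<longleftrightarrow> integrable lebesgue (\<lambda>t. indicator {0<..<T} t *\<^sub>R (indicator {a..b} t * f t))"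
      by (rule integrable_restrict_space) simp
    ultimately show "integrable ?M (\<lambda>t. indicator {a..b} t * f t)"
      unfolding eq by blast
  qed
  have shi: "integrable lborel (\<lambda>t. indicator {a..b} t * f (t - h))" if "\<And>c d. integrable lborel (\<lambda>t. indicator {c..d} t * f t)" for f :: "real \<Rightarrow> real"
  proof -
    have eq: "(\<lambda>t. indicator {a - h..b - h} (t + - h) * f (t + - h)) = (\<lambda>t. indicator {a..b} t * f (t - h))"
      by (auto simp: indicator_def fun_eq_iff)
    show ?thesis using integrable_lborel_translate[OF that, of "a - h" "b - h" "- h"] unfolding eq .
  qed
  have iy2: "integrable lborel (\<lambda>t. indicator {a..b} t * (y' t - y' (t - h)))" and iP2: "integrable lborel (\<lambda>t. indicator {a..b} t * (P t - P (t - h)))"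
    using iy shi[OF iy] iP shi[OF iP] by (simp_all add: right_diff_distrib)
  have iG: "integrable ?M (\<lambda>t. indicator {a..b} t * G t)" by (rule integrable_indicator_mult[OF G]) simp
  have i1: "integrable ?M (\<lambda>t. indicator {a..b} t :: real)" "(LINT t|?M. indicator {a..b} t) = b - a"
    using iM[of "\<lambda>t. 1"] iI ab len[of a b] by auto
  have "h * (y b - y a - \<epsilon> / 2) \<le> (LINT t|?M. indicator {a..b} t * (y' t - y' (t - h)))"
    using L iM(2)[OF iy2] by simp
  also have "\<dots> \<le> (LINT t|?M. h * (indicator {a..b} t * G t) + C * (indicator {a..b} t * (P t - P (t - h)) + h * (indicator {a..b} t * E t) + h * e * indicator {a..b} t))"
    by (intro integral_mono_AE pt iM(1)[OF iy2] Bochner_Integration.integrable_add integrable_mult_right iG iE i1(1) iM(1)[OF iP2]) auto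
  also have "\<dots> = h * (LINT t|?M. indicator {a..b} t * G t) + C * ((LINT t|?M. indicator {a..b} t * (P t - P (t - h))) + h * (LINT t|?M. indicator {a..b} t * E t) + h * e * (b - a))"
    using iG iE[of "{a..b}"] i1 iM(1)[OF iP2] by simp
  also have "\<dots> \<le> h * (LINT t|?M. indicator {a..b} t * G t) + C * (h * e + h * e + h * e * T)"
  proof -
    have "(LINT t|?M. indicator {a..b} t * E t) \<le> (LINT t|?M. E t)"
      by (intro integral_mono iE E(1)) (auto simp: E(2) split: split_indicator)
    then have "h * (LINT t|?M. indicator {a..b} t * E t) \<le> h * e" using E(3) h(1) by simp
    moreover have "h * e * (b - a) \<le> h * e * T" using h e ab by (intro mult_left_mono) auto
    moreover have "(LINT t|?M. indicator {a..b} t * (P t - P (t - h))) \<le> h * e" using Pb iM(2)[OF iP2] by simp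
    ultimately have "(LINT t|?M. indicator {a..b} t * (P t - P (t - h))) + h * (LINT t|?M. indicator {a..b} t * E t) + h * e * (b - a)
        \<le> h * e + h * e + h * e * T" by (intro add_mono)
    then show ?thesis using C by (intro add_left_mono mult_left_mono)
  qed
  also have "\<dots> = h * ((LINT t|?M. indicator {a..b} t * G t) + C * e * (T + 2))" by (simp add: algebra_simps)
  finally have "y b - y a - \<epsilon> / 2 \<le> (LINT t|?M. indicator {a..b} t * G t) + C * e * (T + 2)"
    using h(1) by simp
  moreover have "C * e * (T + 2) \<le> \<epsilon> / 4"
  proof -
    have "C * e * (T + 2) \<le> (C + 1) * e * (T + 2)" using e T by (intro mult_right_mono) auto
    also have "\<dots> = \<epsilon> / 4"
    proof -
      have "k * (\<epsilon> / (4 * k * l)) * l = \<epsilon> / 4" if "k > 0" "l > 0" for k l :: real using that by (simp add: field_simps)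
      from this[of "C + 1" "T + 2"] show ?thesis using C T by (simp add: e_def)
    qed
    finally show ?thesis .
  qed
  ultimately show "y b - y a \<le> (LINT t|?M. indicator {a..b} t * G t) + \<epsilon>" using \<epsilon> by linarith
qed

lemma (in seminormed) averaged_inequality:
  fixes y G :: "real \<Rightarrow> real"
  assumes z: "strongly_measurable T X z" and zX: "AE t in lebesgue_on {0<..<T}. z t \<in> vecs X"
    and i: "integrable (lebesgue_on {0<..<T}) (\<lambda>t. (nrm X (z t))\<^sup>2)"
    and y: "continuous_on {0..T} y" and G: "integrable (lebesgue_on {0<..<T}) G" and C: "0 \<le> C"
    and main: "AE t in lebesgue_on {0<..<T}. \<forall>s. 0 < s \<and> s < t \<longrightarrow>
        y t - y s \<le> (t - s) * G t + C * (LINT \<tau>|lebesgue_on {0<..<T}. indicator {s..t} \<tau> * (nrm X (\<lambda>x. z \<tau> x - z t x))\<^sup>2)"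
    and b: "0 < b" "b \<le> T"
  shows "y b - y 0 \<le> (LINT t|lebesgue_on {0<..<T}. indicator {0..b} t * G t)"
proof (rule LIMSEQ_le)
  let ?M = "lebesgue_on {0<..<T}"
  \<comment> \<open>The summand 3 gives \<open>d n \<le> b / 3\<close>, so that the interval from
    \<open>d n\<close> to \<open>b - d n\<close> is nondegenerate for every n.\<close>
  define d where "d n = b / (real n + 3)" for n
  have d: "0 < d n" "d n < b - d n" "b - d n < T" for n
  proof -
    show "0 < d n" using b by (simp add: d_def)
    have "d n \<le> b / 3" unfolding d_def using b by (intro divide_left_mono) auto
    then show "d n < b - d n" "b - d n < T" using b \<open>0 < d n\<close> by auto
  qed
  have d0: "d \<longlonglongrightarrow> 0"
  proof -
    have "(\<lambda>n. b * inverse (real (Suc (n + 2)))) \<longlonglongrightarrow> b * 0"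
      using LIMSEQ_ignore_initial_segment[OF LIMSEQ_inverse_real_of_nat, of 2] by (intro tendsto_intros)
    then show ?thesis by (simp add: d_def[abs_def] divide_inverse add.commute)
  qed
  have bd: "(\<lambda>n. b - d n) \<longlonglongrightarrow> b" using tendsto_diff[OF tendsto_const d0, of b] by simp
  have r: "d n \<in> {0..T}" "b - d n \<in> {0..T}" for n using d[of n] b by auto
  show "(\<lambda>n. y (b - d n) - y (d n)) \<longlonglongrightarrow> y b - y 0"
    using r b by (intro tendsto_diff continuous_on_tendsto_compose[OF y] d0 bd) auto
  show "\<exists>N. \<forall>n\<ge>N. y (b - d n) - y (d n) \<le> (LINT t|?M. indicator {d n..b - d n} t * G t)"
    using averaged_inequality_interior[OF z zX i y G C main d] by blast
  have im: "(indicator {c..e} :: real \<Rightarrow> real) \<in> borel_measurable ?M" for c e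
    by (intro measurable_restrict_space1 borel_measurable_lebesgueI borel_measurable_indicator) simp
  show "(\<lambda>n. \<integral>t. indicator {d n..b - d n} t * G t \<partial>?M) \<longlonglongrightarrow> (LINT t|?M. indicator {0..b} t * G t)"
  proof (rule integral_dominated_convergence[where w = "\<lambda>t. \<bar>G t\<bar>"])
    show "integrable ?M (\<lambda>t. \<bar>G t\<bar>)" using G by simp
    show "(\<lambda>t. indicator {d n..b - d n} t * G t) \<in> borel_measurable ?M" for n
      by (rule borel_measurable_times[OF im borel_measurable_integrable[OF G]])
    show "(\<lambda>t. indicator {0..b} t * G t) \<in> borel_measurable ?M"
      by (rule borel_measurable_times[OF im borel_measurable_integrable[OF G]])
    have "AE t in lebesgue. t \<noteq> b" using AE_lborel_singleton by (rule AE_completion)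
    then have "AE t in ?M. t \<noteq> b" by (subst AE_restrict_space_iff) (auto elim: eventually_mono)
    then show "AE t in ?M. (\<lambda>n. indicator {d n..b - d n} t * G t) \<longlonglongrightarrow> indicator {0..b} t * G t"
      using AE_space
    proof eventually_elim
      case (elim t)
      then have t: "0 < t" by simp
      have "\<forall>\<^sub>F n in sequentially. indicator {d n..b - d n} t = (indicator {0..b} t :: real)"
      proof (cases "t < b")
        case True
        have "\<forall>\<^sub>F n in sequentially. d n < t" "\<forall>\<^sub>F n in sequentially. t < b - d n"
          using order_tendstoD(2)[OF d0 t] order_tendstoD(1)[OF bd True] by auto
        then show ?thesis by eventually_elim (use t True in \<open>auto simp: indicator_def\<close>)
      next
        case False
        then have "indicator {d n..b - d n} t = (indicator {0..b} t :: real)" for n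
          using elim(1) d(1)[of n] by (auto simp: indicator_def)
        then show ?thesis by simp
      qed
      then show ?case by (intro tendsto_intros tendsto_eventually)
    qed
    show "AE t in ?M. norm (indicator {d n..b - d n} t * G t) \<le> \<bar>G t\<bar>" for n
      by (auto simp: indicator_def)
  qed
qed

text \<open>Let m be the maximum of exp(-2 k t) y(t). At the maximum point the integral term, after
  weighting, contributes at most m / 2, hence m \<le> 2 A. The doubled exponent is what makes this
  half available.\<close>

lemma gronwall_bound:
  fixes y :: "real \<Rightarrow> real"
  assumes T: "0 < T" and y: "continuous_on {0..T} y" and k: "0 < k" and A: "0 \<le> A" and y0: "\<And>t. t \<in> {0..T} \<Longrightarrow> 0 \<le> y t"
    and le: "\<And>b. b \<in> {0..T} \<Longrightarrow> y b \<le> A + k * integral {0..b} y" and t: "t \<in> {0..T}"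
  shows "y t \<le> 2 * A * exp (2 * k * T)"
proof -
  have "continuous_on {0..T} (\<lambda>t. exp (- (2 * k * t)) * y t)" by (intro continuous_intros y)
  then obtain s where s: "s \<in> {0..T}" "\<And>t. t \<in> {0..T} \<Longrightarrow> exp (- (2 * k * t)) * y t \<le> exp (- (2 * k * s)) * y s"
    using continuous_attains_sup[of "{0..T}" "\<lambda>t. exp (- (2 * k * t)) * y t"] T by auto
  define m where "m = exp (- (2 * k * s)) * y s"
  have m: "y t \<le> m * exp (2 * k * t)" if "t \<in> {0..T}" for t
    using mult_right_mono[OF s(2)[OF that], of "exp (2 * k * t)"] by (simp add: m_def exp_minus field_simps)
  have m0: "0 \<le> m" using y0[OF s(1)] by (simp add: m_def)
  have "integral {0..s} y \<le> integral {0..s} (\<lambda>t. m * exp (2 * k * t))"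
    using s(1) m by (intro integral_le integrable_continuous_real continuous_on_subset[OF y] continuous_intros) auto
  also have "\<dots> = m * exp (2 * k * s) / (2 * k) - m * exp (2 * k * 0) / (2 * k)"
  proof (rule integral_unique, rule fundamental_theorem_of_calculus)
    fix x
    have "((\<lambda>t. m * exp (2 * k * t) / (2 * k)) has_real_derivative m * exp (2 * k * x)) (at x)"
      using k by (auto intro!: derivative_eq_intros)
    then show "((\<lambda>t. m * exp (2 * k * t) / (2 * k)) has_vector_derivative m * exp (2 * k * x)) (at x within {0..s})"
      unfolding has_real_derivative_iff_has_vector_derivative by (rule has_vector_derivative_at_within)
  qed (use s in auto)
  also have "\<dots> \<le> m * exp (2 * k * s) / (2 * k)" using m0 k by simp
  finally have "k * integral {0..s} y \<le> k * (m * exp (2 * k * s) / (2 * k))" using k by (intro mult_left_mono) auto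
  then have "y s \<le> A + m * exp (2 * k * s) / 2" using le[OF s(1)] k by simp
  then have "exp (- (2 * k * s)) * y s \<le> exp (- (2 * k * s)) * (A + m * exp (2 * k * s) / 2)" by (intro mult_left_mono) auto
  also have "\<dots> = exp (- (2 * k * s)) * A + m / 2" by (simp add: exp_minus field_simps)
  also have "exp (- (2 * k * s)) * A \<le> 1 * A" using A k s by (intro mult_right_mono) auto
  finally have "m \<le> 2 * A" by (simp add: m_def)
  have "y t \<le> m * exp (2 * k * t)" by (rule m[OF t])
  also have "\<dots> \<le> (2 * A) * exp (2 * k * T)"
    using \<open>m \<le> 2 * A\<close> A t k by (intro mult_mono) auto
  finally show ?thesis .
qed

subsection \<open>The regularized logit\<close>

text \<open>The function F of the overview. Adding \<delta> to numerator and denominator keeps it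
  smooth on the neighbourhood (-\<delta>, 1 + \<delta>) of [0, 1] and odd about s = 1/2.\<close>

definition logit_reg :: "real \<Rightarrow> real \<Rightarrow> real" where
  "logit_reg \<delta> s = ln ((s + \<delta>) / (1 - s + \<delta>))"

definition logit_reg' :: "real \<Rightarrow> real \<Rightarrow> real" where
  "logit_reg' \<delta> s = (1 + 2 * \<delta>) / ((s + \<delta>) * (1 - s + \<delta>))"

definition energy_mult :: "real \<Rightarrow> real \<Rightarrow> real" where
  "energy_mult \<delta> s = logit_reg \<delta> s * logit_reg' \<delta> s"

text \<open>This is F'^2 + F F'' with F'' = F'^2 (2 s - 1) / (1 + 2 \<delta>) inserted, arranged so
  that F'^2 factors out and the correction to 1 has a sign on [0, 1].\<close>

definition energy_mult' :: "real \<Rightarrow> real \<Rightarrow> real" where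
  "energy_mult' \<delta> s = (logit_reg' \<delta> s)\<^sup>2 * (1 + logit_reg \<delta> s * (2 * s - 1) / (1 + 2 * \<delta>))"

lemma logit_reg_deriv:
  assumes "- \<delta> < s" "s < 1 + \<delta>"
  shows "(logit_reg \<delta> has_real_derivative logit_reg' \<delta> s) (at s)"
proof -
  have p: "0 < s + \<delta>" "0 < 1 - s + \<delta>" using assms by auto
  have "((\<lambda>s. ln ((s + \<delta>) / (1 - s + \<delta>))) has_real_derivative logit_reg' \<delta> s) (at s)"
    using p by (auto intro!: derivative_eq_intros simp: logit_reg'_def divide_simps)
  then show ?thesis by (simp add: logit_reg_def[abs_def])
qed

lemma logit_reg'_deriv:
  assumes "- \<delta> < s" "s < 1 + \<delta>" "0 < \<delta>"
  shows "(logit_reg' \<delta> has_real_derivative (logit_reg' \<delta> s)\<^sup>2 * (2 * s - 1) / (1 + 2 * \<delta>)) (at s)"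
proof -
  define p where "p = s + \<delta>"
  define q where "q = 1 - s + \<delta>"
  have p: "0 < p" "0 < q" "0 < 1 + 2 * \<delta>" using assms by (auto simp: p_def q_def)
  have "((\<lambda>s. (1 + 2 * \<delta>) / ((s + \<delta>) * (1 - s + \<delta>))) has_real_derivative - ((1 + 2 * \<delta>) * (q - p)) / ((p * q) * (p * q))) (at s)"
    using p by (auto intro!: derivative_eq_intros simp: p_def q_def)
  moreover have "- ((1 + 2 * \<delta>) * (q - p)) / ((p * q) * (p * q)) = ((1 + 2 * \<delta>) / (p * q))\<^sup>2 * (2 * s - 1) / (1 + 2 * \<delta>)"
  proof -
    have "2 * s - 1 = - (q - p)" by (simp add: p_def q_def)
    then show ?thesis using p by (simp add: power2_eq_square mult.assoc minus_divide_left minus_mult_right)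
  qed
  ultimately show ?thesis by (simp add: logit_reg'_def[abs_def] p_def q_def)
qed

lemma energy_mult_deriv:
  assumes "- \<delta> < s" "s < 1 + \<delta>" "0 < \<delta>"
  shows "(energy_mult \<delta> has_real_derivative energy_mult' \<delta> s) (at s)"
proof -
  have "((\<lambda>s. logit_reg \<delta> s * logit_reg' \<delta> s) has_real_derivative energy_mult' \<delta> s) (at s)"
    by (rule derivative_eq_intros logit_reg_deriv[OF assms(1,2)] logit_reg'_deriv[OF assms] refl)+
       (simp add: energy_mult'_def power2_eq_square algebra_simps)
  then show ?thesis by (simp add: energy_mult_def[abs_def])
qed

lemma logit_reg'_pos: "0 < \<delta> \<Longrightarrow> - \<delta> < s \<Longrightarrow> s < 1 + \<delta> \<Longrightarrow> 0 < logit_reg' \<delta> s"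
  by (auto simp: logit_reg'_def intro!: divide_pos_pos mult_pos_pos)

lemma logit_reg_sign:
  assumes "0 < \<delta>" "- \<delta> < s" "s < 1 + \<delta>"
  shows "1 / 2 \<le> s \<Longrightarrow> 0 \<le> logit_reg \<delta> s" "s \<le> 1 / 2 \<Longrightarrow> logit_reg \<delta> s \<le> 0"
proof -
  have p: "0 < s + \<delta>" "0 < 1 - s + \<delta>" using assms by auto
  show "0 \<le> logit_reg \<delta> s" if "1 / 2 \<le> s"
    unfolding logit_reg_def using p that by (intro ln_ge_zero) (simp add: le_divide_eq)
  show "logit_reg \<delta> s \<le> 0" if "s \<le> 1 / 2"
    unfolding logit_reg_def using p that by (subst ln_le_zero_iff) (simp_all add: divide_le_eq)
qed

text \<open>F and 2 s - 1 change sign together at 1/2. The quantity is the factor P in F F'' = F'^2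
  P: its sign makes the multiplier nondecreasing, and its bound by |F| keeps the contribution of the
  drift at most linear in F.\<close>

lemma energy_factor_bounds:
  assumes "0 < \<delta>" "0 \<le> s" "s \<le> 1"
  shows "0 \<le> logit_reg \<delta> s * (2 * s - 1) / (1 + 2 * \<delta>)"
    and "logit_reg \<delta> s * (2 * s - 1) / (1 + 2 * \<delta>) \<le> \<bar>logit_reg \<delta> s\<bar>"
proof -
  have "0 \<le> logit_reg \<delta> s * (2 * s - 1)"
    using logit_reg_sign[of \<delta> s] assms by (cases "s \<le> 1 / 2") (auto simp: mult_nonpos_nonpos)
  then show "0 \<le> logit_reg \<delta> s * (2 * s - 1) / (1 + 2 * \<delta>)" using assms by simp
  have "logit_reg \<delta> s * (2 * s - 1) \<le> \<bar>logit_reg \<delta> s\<bar> * \<bar>2 * s - 1\<bar>" by (metis abs_ge_self abs_mult)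
  also have "\<dots> \<le> \<bar>logit_reg \<delta> s\<bar> * (1 + 2 * \<delta>)" using assms by (intro mult_left_mono) auto
  finally show "logit_reg \<delta> s * (2 * s - 1) / (1 + 2 * \<delta>) \<le> \<bar>logit_reg \<delta> s\<bar>"
    using assms by (simp add: divide_le_eq)
qed

lemma energy_mult'_ge:
  assumes "0 < \<delta>" "0 \<le> s" "s \<le> 1"
  shows "(logit_reg' \<delta> s)\<^sup>2 \<le> energy_mult' \<delta> s" "0 \<le> energy_mult' \<delta> s"
proof -
  show "(logit_reg' \<delta> s)\<^sup>2 \<le> energy_mult' \<delta> s"
    using mult_left_mono[of 1 "1 + logit_reg \<delta> s * (2 * s - 1) / (1 + 2 * \<delta>)" "(logit_reg' \<delta> s)\<^sup>2"]
      energy_factor_bounds(1)[OF assms] by (simp add: energy_mult'_def)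
  then show "0 \<le> energy_mult' \<delta> s" using zero_le_power2 order_trans by blast
qed

text \<open>For s \<ge> 1/2 the multiplier is nonnegative, so the upper bound L (1 - s) on g is
  inserted, and its zero at s = 1 cancels the growth of F': (1 - s) F' \<le> 2. The other half is
  symmetric with the lower bound - L s.\<close>

lemma reaction_energy_mult_le:
  assumes d: "0 < \<delta>" and s: "0 \<le> s" "s \<le> 1" and g: "- (L * s) \<le> g" "g \<le> L * (1 - s)" and L: "0 \<le> L"
  shows "g * energy_mult \<delta> s \<le> 2 * L * \<bar>logit_reg \<delta> s\<bar>"
proof -
  have pos: "0 < logit_reg' \<delta> s" using logit_reg'_pos d s by simp
  show ?thesis
  proof (cases "1 / 2 \<le> s")
    case True
    then have F: "0 \<le> logit_reg \<delta> s" using logit_reg_sign d s by simp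
    have "(1 - s) * logit_reg' \<delta> s \<le> 2"
    proof -
      have "(1 - s) * (1 + 2 * \<delta>) \<le> 2 * ((s + \<delta>) * (1 - s + \<delta>))"
      proof -
        have "(1 - s) * (1 + 2 * \<delta>) \<le> (1 - s + \<delta>) * (2 * (s + \<delta>))"
          using d s True by (intro mult_mono) auto
        also have "\<dots> = 2 * ((s + \<delta>) * (1 - s + \<delta>))" by algebra
        finally show ?thesis .
      qed
      then show ?thesis using d s True by (simp add: logit_reg'_def divide_le_eq)
    qed
    then have b: "L * ((1 - s) * logit_reg' \<delta> s) \<le> L * 2" using L by (intro mult_left_mono)
    have "g * energy_mult \<delta> s \<le> L * (1 - s) * energy_mult \<delta> s"
      using g F pos by (intro mult_right_mono) (auto simp: energy_mult_def)
    also have "\<dots> = L * ((1 - s) * logit_reg' \<delta> s) * logit_reg \<delta> s" by (simp add: energy_mult_def mult_ac)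
    also have "\<dots> \<le> L * 2 * logit_reg \<delta> s" using b F by (intro mult_right_mono)
    finally show ?thesis using F by (simp add: mult_ac)
  next
    case False
    then have F: "logit_reg \<delta> s \<le> 0" using logit_reg_sign d s by simp
    have "s * logit_reg' \<delta> s \<le> 2"
    proof -
      have "s * (1 + 2 * \<delta>) \<le> (s + \<delta>) * (2 * (1 - s + \<delta>))"
        using d s False by (intro mult_mono) auto
      then show ?thesis using d s False by (simp add: logit_reg'_def divide_le_eq mult_ac)
    qed
    then have b: "L * (s * logit_reg' \<delta> s) \<le> L * 2" using L by (intro mult_left_mono)
    have "g * energy_mult \<delta> s \<le> - (L * s) * energy_mult \<delta> s"
      using g F pos by (intro mult_right_mono_neg) (auto simp: energy_mult_def mult_nonpos_nonneg)
    also have "\<dots> = L * (s * logit_reg' \<delta> s) * (- logit_reg \<delta> s)" by (simp add: energy_mult_def mult_ac)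
    also have "\<dots> \<le> L * 2 * (- logit_reg \<delta> s)" using b F by (intro mult_right_mono) auto
    finally show ?thesis using F by (simp add: mult_ac)
  qed
qed

text \<open>The regularized form of \<mu> f'' = 1: the product is at most 1 + 2 \<delta>, which is
  where the restriction \<delta> \<le> 1/2 enters.\<close>

lemma mobility_logit_reg'_le:
  assumes "0 < \<delta>" "\<delta> \<le> 1 / 2" "0 \<le> s" "s \<le> 1"
  shows "mobility s * logit_reg' \<delta> s \<le> 2"
proof -
  have "s * (1 - s) * (1 + 2 * \<delta>) \<le> ((s + \<delta>) * (1 - s + \<delta>)) * 2"
    using assms by (intro mult_mono) auto
  then show ?thesis using assms by (simp add: mobility_def logit_reg'_def divide_le_eq mult_ac)
qed

lemma mobility_lipschitz:
  assumes "0 \<le> a" "a \<le> 1" "0 \<le> b" "b \<le> 1"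
  shows "\<bar>mobility b - mobility a\<bar> \<le> \<bar>b - a\<bar>"
proof -
  have "mobility b - mobility a = (b - a) * (1 - a - b)" by (simp add: mobility_def algebra_simps)
  then have "\<bar>mobility b - mobility a\<bar> = \<bar>b - a\<bar> * \<bar>1 - a - b\<bar>" by (simp add: abs_mult)
  also have "\<dots> \<le> \<bar>b - a\<bar> * 1" using assms by (intro mult_left_mono) auto
  finally show ?thesis by simp
qed

lemma young_eps: "0 < k \<Longrightarrow> (x::real) * y \<le> k * y\<^sup>2 + x\<^sup>2 / (4 * k)"
proof -
  assume k: "0 < k"
  have "0 \<le> (2 * k * y - x)\<^sup>2 / (4 * k)" using k by simp
  also have "\<dots> = k * y\<^sup>2 + x\<^sup>2 / (4 * k) - x * y" using k by (simp add: power2_eq_square field_simps)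
  finally show ?thesis by simp
qed

text \<open>The multiplier \<open>f' f''\<close> is tested at time \<open>t\<close> (values \<open>a\<close>, \<open>A\<close>) against the equation
  at time \<open>\<tau>\<close> (values \<open>b\<close>, \<open>B\<close>). The cross term is absorbed since \<open>f'(s) (2 s - 1) \<ge> 0\<close> and
  \<open>\<mu> f'' = 1\<close>; the constant in front of the entropy is independent of \<open>\<delta>\<close>.\<close>

lemma energy_pointwise:
  fixes A B W :: "'a::real_inner"
  assumes d: "0 < \<delta>" "\<delta> \<le> 1 / 2" and a: "0 \<le> a" "a \<le> 1" and b: "0 \<le> b" "b \<le> 1"
    and ga: "- (L * a) \<le> ga" "ga \<le> L * (1 - a)" and gb: "\<bar>gb - ga\<bar> \<le> L * \<bar>b - a\<bar>" and L: "0 \<le> L"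
    and W: "norm W \<le> R"
    and M: "\<bar>energy_mult \<delta> a\<bar> \<le> M" "energy_mult' \<delta> a \<le> M" and k: "0 < k"
  shows "gb * energy_mult \<delta> a - mobility b * (W \<bullet> (energy_mult' \<delta> a *\<^sub>R A)) - B \<bullet> (energy_mult' \<delta> a *\<^sub>R A)
    \<le> (2 * L + 4 * R\<^sup>2) * (1 + (logit_reg \<delta> a)\<^sup>2) - 1 / 2 * (logit_reg' \<delta> a)\<^sup>2 * (norm A)\<^sup>2
      + k * (1 + (norm A)\<^sup>2) + ((L * M)\<^sup>2 + (M * R)\<^sup>2 + M\<^sup>2) / k * ((b - a)\<^sup>2 + (norm (B - A))\<^sup>2)"
proof -
  define F where "F = logit_reg \<delta> a"
  define F' where "F' = logit_reg' \<delta> a"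
  define P where "P = logit_reg \<delta> a * (2 * a - 1) / (1 + 2 * \<delta>)"
  define h where "h = energy_mult' \<delta> a"
  define x where "x = norm A"
  have F'0: "0 < F'" using logit_reg'_pos d a by (simp add: F'_def)
  have P: "0 \<le> P" "P \<le> \<bar>F\<bar>" using energy_factor_bounds[OF d(1) a] by (simp_all add: P_def F_def)
  have h: "h = F'\<^sup>2 * (1 + P)" "0 \<le> h" "h \<le> M"
    using energy_mult'_ge(2)[OF d(1) a] M(2) by (simp_all add: h_def energy_mult'_def F'_def P_def)
  have R0: "0 \<le> R" using W norm_ge_zero order_trans by blast
  have x0: "0 \<le> x" by (simp add: x_def)
  have mu: "0 \<le> mobility b" "mobility b \<le> mobility a + \<bar>b - a\<bar>"
    using mobility_lipschitz[OF a b] b by (auto simp: mobility_def)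
  have t1: "gb * energy_mult \<delta> a \<le> 2 * L * \<bar>F\<bar> + L * \<bar>b - a\<bar> * M"
  proof -
    have "gb * energy_mult \<delta> a = ga * energy_mult \<delta> a + (gb - ga) * energy_mult \<delta> a" by (simp add: algebra_simps)
    also have "\<dots> \<le> 2 * L * \<bar>F\<bar> + \<bar>(gb - ga) * energy_mult \<delta> a\<bar>"
      using reaction_energy_mult_le[OF d(1) a ga L] by (intro add_mono) (auto simp: F_def)
    also have "\<bar>(gb - ga) * energy_mult \<delta> a\<bar> \<le> L * \<bar>b - a\<bar> * M"
      unfolding abs_mult by (intro mult_mono gb M) (use L in auto)
    finally show ?thesis by simp
  qed
  have t2: "- mobility b * (W \<bullet> (h *\<^sub>R A)) \<le> mobility a * h * R * x + \<bar>b - a\<bar> * M * R * x"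
  proof -
    have "\<bar>W \<bullet> (h *\<^sub>R A)\<bar> \<le> norm W * norm (h *\<^sub>R A)" by (rule Cauchy_Schwarz_ineq2)
    also have "\<dots> \<le> R * (h * x)" using W h R0 x0 by (intro mult_mono) (auto simp: x_def)
    finally have "- (W \<bullet> (h *\<^sub>R A)) \<le> R * (h * x)" by linarith
    then have "mobility b * - (W \<bullet> (h *\<^sub>R A)) \<le> mobility b * (R * (h * x))" using mu(1) by (rule mult_left_mono)
    also have "\<dots> \<le> (mobility a + \<bar>b - a\<bar>) * (R * (h * x))"
      using mu(2) R0 h x0 by (intro mult_right_mono) auto
    also have "\<dots> = mobility a * h * R * x + \<bar>b - a\<bar> * (R * x) * h" by (simp add: algebra_simps)
    also have "\<bar>b - a\<bar> * (R * x) * h \<le> \<bar>b - a\<bar> * (R * x) * M" using h R0 x0 by (intro mult_left_mono) auto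
    finally show ?thesis by (simp add: mult_ac)
  qed
  have t3: "- (B \<bullet> (h *\<^sub>R A)) \<le> - (h * x\<^sup>2) + M * norm (B - A) * x"
  proof -
    have "- (B \<bullet> (h *\<^sub>R A)) = - (h * x\<^sup>2) - h * ((B - A) \<bullet> A)"
      by (simp add: inner_diff_left x_def power2_norm_eq_inner algebra_simps)
    moreover have "- h * ((B - A) \<bullet> A) \<le> h * (norm (B - A) * x)"
    proof -
      have "- ((B - A) \<bullet> A) \<le> norm (B - A) * x" using Cauchy_Schwarz_ineq2[of "B - A" A] by (simp add: x_def)
      then have "h * - ((B - A) \<bullet> A) \<le> h * (norm (B - A) * x)" using h(2) by (rule mult_left_mono)
      then show ?thesis by simp
    qed
    moreover have "h * (norm (B - A) * x) \<le> M * (norm (B - A) * x)" using h(3) x0 by (intro mult_right_mono) auto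
    ultimately show ?thesis by (simp add: mult.assoc)
  qed
  \<comment> \<open>One of the two factors F' in h is spent on the mobility, the other stays with
    the gradient. Young's inequality with weight 1/2 leaves half of the diffusion term h x^2
    unspent, which \<open>t5\<close> collects.\<close>
  have t4: "mobility a * h * R * x \<le> (1 + P) * (1 / 2 * F'\<^sup>2 * x\<^sup>2 + 2 * R\<^sup>2)"
  proof -
    have "mobility a * h * R * x = (mobility a * F') * ((1 + P) * F' * R * x)" by (simp add: h power2_eq_square)
    also have "\<dots> \<le> 2 * ((1 + P) * F' * R * x)"
      using mobility_logit_reg'_le[OF d a] F'0 P R0 x0 by (intro mult_right_mono) (auto simp: F'_def)
    also have "\<dots> = (1 + P) * ((2 * R) * (F' * x))" by simp
    also have "\<dots> \<le> (1 + P) * (1 / 2 * (F' * x)\<^sup>2 + (2 * R)\<^sup>2 / (4 * (1 / 2)))"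
      using P by (intro mult_left_mono young_eps) auto
    finally show ?thesis by (simp add: power_mult_distrib)
  qed
  have t5: "(1 + P) * (1 / 2 * F'\<^sup>2 * x\<^sup>2 + 2 * R\<^sup>2) - h * x\<^sup>2 \<le> 2 * R\<^sup>2 * (1 + \<bar>F\<bar>) - 1 / 2 * F'\<^sup>2 * x\<^sup>2"
  proof -
    have "(1 + P) * (1 / 2 * F'\<^sup>2 * x\<^sup>2 + 2 * R\<^sup>2) - h * x\<^sup>2 = 2 * R\<^sup>2 * (1 + P) - 1 / 2 * F'\<^sup>2 * x\<^sup>2 - P * (1 / 2 * F'\<^sup>2 * x\<^sup>2)"
      by (simp add: h field_simps)
    also have "\<dots> \<le> 2 * R\<^sup>2 * (1 + \<bar>F\<bar>) - 1 / 2 * F'\<^sup>2 * x\<^sup>2 - 0"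
      using P by (intro diff_mono mult_left_mono) auto
    finally show ?thesis by simp
  qed
  have t6: "2 * L * \<bar>F\<bar> + 2 * R\<^sup>2 * (1 + \<bar>F\<bar>) \<le> (2 * L + 4 * R\<^sup>2) * (1 + F\<^sup>2)"
  proof -
    have f: "\<bar>F\<bar> \<le> 1 + F\<^sup>2" "1 \<le> 1 + F\<^sup>2" using young_eps[of 1 1 "\<bar>F\<bar>"] by simp_all
    have "2 * L * \<bar>F\<bar> \<le> 2 * L * (1 + F\<^sup>2)" using f L by (intro mult_left_mono) auto
    moreover have "1 + x \<le> 2 * (1 + z)" if "x \<le> 1 + z" "0 \<le> z" for x z :: real using that by simp
    from this[OF f(1) zero_le_power2] have "1 + \<bar>F\<bar> \<le> 2 * (1 + F\<^sup>2)" .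
    then have "2 * R\<^sup>2 * (1 + \<bar>F\<bar>) \<le> 2 * R\<^sup>2 * (2 * (1 + F\<^sup>2))" by (intro mult_left_mono) auto
    ultimately show ?thesis by (simp add: algebra_simps)
  qed
  \<comment> \<open>The budget k (1 + x^2) is shared out: k for the constant in \<open>e1\<close>,
    and k/2 for x^2 in each of \<open>e2\<close> and \<open>e3\<close>.\<close>
  have e1: "L * \<bar>b - a\<bar> * M \<le> k + (L * M)\<^sup>2 / (4 * k) * (b - a)\<^sup>2"
    using young_eps[OF k, of "L * M * \<bar>b - a\<bar>" 1] by (simp add: power_mult_distrib mult_ac)
  have e2: "\<bar>b - a\<bar> * M * R * x \<le> (k / 2) * x\<^sup>2 + (M * R)\<^sup>2 / (2 * k) * (b - a)\<^sup>2"
    using young_eps[of "k / 2" "\<bar>b - a\<bar> * M * R" x] k by (simp add: power_mult_distrib mult_ac)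
  have e3: "M * norm (B - A) * x \<le> (k / 2) * x\<^sup>2 + M\<^sup>2 / (2 * k) * (norm (B - A))\<^sup>2"
    using young_eps[of "k / 2" "M * norm (B - A)" x] k by (simp add: power_mult_distrib mult_ac)
  have e4: "(L * M)\<^sup>2 / (4 * k) * (b - a)\<^sup>2 + (M * R)\<^sup>2 / (2 * k) * (b - a)\<^sup>2 + M\<^sup>2 / (2 * k) * (norm (B - A))\<^sup>2
      \<le> ((L * M)\<^sup>2 + (M * R)\<^sup>2 + M\<^sup>2) / k * ((b - a)\<^sup>2 + (norm (B - A))\<^sup>2)"
  proof -
    have q: "u / (4 * k) \<le> u / k" "u / (2 * k) \<le> u / k" "0 \<le> u / k" if "0 \<le> u" for u
      using that k by (auto intro!: divide_left_mono)
    have "(L * M)\<^sup>2 / (4 * k) * (b - a)\<^sup>2 + (M * R)\<^sup>2 / (2 * k) * (b - a)\<^sup>2 + M\<^sup>2 / (2 * k) * (norm (B - A))\<^sup>2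
       \<le> (L * M)\<^sup>2 / k * (b - a)\<^sup>2 + (M * R)\<^sup>2 / k * (b - a)\<^sup>2 + M\<^sup>2 / k * (norm (B - A))\<^sup>2"
      using q by (intro add_mono mult_right_mono) auto
    also have "\<dots> \<le> \<dots> + (M\<^sup>2 / k * (b - a)\<^sup>2 + (L * M)\<^sup>2 / k * (norm (B - A))\<^sup>2 + (M * R)\<^sup>2 / k * (norm (B - A))\<^sup>2)"
      using q by simp
    also have "\<dots> = ((L * M)\<^sup>2 + (M * R)\<^sup>2 + M\<^sup>2) / k * ((b - a)\<^sup>2 + (norm (B - A))\<^sup>2)"
      by (simp add: add_divide_distrib distrib_left distrib_right)
    finally show ?thesis .
  qed
  have "gb * energy_mult \<delta> a - mobility b * (W \<bullet> (h *\<^sub>R A)) - B \<bullet> (h *\<^sub>R A)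
     \<le> (2 * L + 4 * R\<^sup>2) * (1 + F\<^sup>2) - 1 / 2 * F'\<^sup>2 * x\<^sup>2 + k * (1 + x\<^sup>2)
      + ((L * M)\<^sup>2 + (M * R)\<^sup>2 + M\<^sup>2) / k * ((b - a)\<^sup>2 + (norm (B - A))\<^sup>2)"
    using t1 t2 t3 t4 t5 t6 e1 e2 e3 e4 by (simp add: distrib_left)
  then show ?thesis by (simp add: F_def F'_def h_def x_def)
qed

text \<open>The tangent inequality for F^2 / 2, whose derivative is nondecreasing on [0, 1] because
  \<open>energy_mult'\<close> is nonnegative there. Since a and b come in either order, the mean
  value theorem is applied in both directions.\<close>

lemma logit_reg_square_convex:
  assumes d: "0 < \<delta>" and a: "0 \<le> a" "a \<le> 1" and b: "0 \<le> b" "b \<le> 1"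
  shows "(logit_reg \<delta> a)\<^sup>2 / 2 - (logit_reg \<delta> b)\<^sup>2 / 2 \<le> energy_mult \<delta> a * (a - b)"
proof -
  have D: "((\<lambda>s. (logit_reg \<delta> s)\<^sup>2 / 2) has_real_derivative energy_mult \<delta> s) (at s)" if "0 \<le> s" "s \<le> 1" for s
    using that d by (auto intro!: derivative_eq_intros logit_reg_deriv simp: energy_mult_def)
  have mono: "energy_mult \<delta> s \<le> energy_mult \<delta> t" if "0 \<le> s" "s \<le> t" "t \<le> 1" for s t
  proof (rule DERIV_nonneg_imp_nondecreasing[OF that(2)])
    fix x assume "s \<le> x" "x \<le> t"
    then have x: "0 \<le> x" "x \<le> 1" using that by auto
    show "\<exists>y. (energy_mult \<delta> has_real_derivative y) (at x) \<and> 0 \<le> y"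
      using energy_mult_deriv[of \<delta> x] energy_mult'_ge(2)[OF d x] d x by (intro exI[of _ "energy_mult' \<delta> x"]) auto
  qed
  consider "a = b" | "a < b" | "b < a" by linarith
  then show ?thesis
  proof cases
    case 2
    obtain z where z: "a < z" "z < b" "(logit_reg \<delta> b)\<^sup>2 / 2 - (logit_reg \<delta> a)\<^sup>2 / 2 = (b - a) * energy_mult \<delta> z"
      using MVT2[OF 2, of "\<lambda>s. (logit_reg \<delta> s)\<^sup>2 / 2" "energy_mult \<delta>"] D a b by auto
    have "(b - a) * energy_mult \<delta> a \<le> (b - a) * energy_mult \<delta> z"
      using z a b by (intro mult_left_mono mono) auto
    then show ?thesis using z(3) by (simp add: algebra_simps)
  next
    case 3
    obtain z where z: "b < z" "z < a" "(logit_reg \<delta> a)\<^sup>2 / 2 - (logit_reg \<delta> b)\<^sup>2 / 2 = (a - b) * energy_mult \<delta> z"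
      using MVT2[OF 3, of "\<lambda>s. (logit_reg \<delta> s)\<^sup>2 / 2" "energy_mult \<delta>"] D a b by auto
    have "(a - b) * energy_mult \<delta> z \<le> (a - b) * energy_mult \<delta> a"
      using z a b by (intro mult_left_mono mono) auto
    then show ?thesis using z(3) by (simp add: algebra_simps)
  qed simp
qed

lemma glue_has_real_derivative_everywhere:
  fixes f g :: "real \<Rightarrow> real"
  assumes "\<And>x. (f has_real_derivative f' x) (at x)" "\<And>x. (g has_real_derivative g' x) (at x)" "f a = g a" "f' a = g' a"
  shows "((\<lambda>x. if x \<le> a then f x else g x) has_real_derivative (if x \<le> a then f' x else g' x)) (at x)"
proof -
  consider "x < a" | "x = a" | "a < x" by linarith
  then show ?thesis
  proof cases
    case 1
    then have "\<forall>\<^sub>F y in nhds x. (if y \<le> a then f y else g y) = f y"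
      using eventually_nhds_in_open[of "{..<a}" x] by (auto elim!: eventually_mono)
    then show ?thesis using 1 assms(1)[of x] by (subst DERIV_cong_ev[OF refl _ refl]) auto
  next
    case 2
    have "(f has_real_derivative g' a) (at a)" using assms(1)[of a] assms(4) by simp
    from glue_has_real_derivative[OF this assms(2)[of a] assms(3)] show ?thesis using 2 assms(4) by simp
  next
    case 3
    then have "\<forall>\<^sub>F y in nhds x. (if y \<le> a then f y else g y) = g y"
      using eventually_nhds_in_open[of "{a<..}" x] by (auto elim!: eventually_mono)
    then show ?thesis using 3 assms(2)[of x] by (subst DERIV_cong_ev[OF refl _ refl]) auto
  qed
qed

text \<open>Composition with this map extends functions given near \<open>[0, 1]\<close> to the whole line without losing
  differentiability, as the chain rule for weak derivatives requires.\<close>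

definition soft_clamp :: "real \<Rightarrow> real \<Rightarrow> real" where
  "soft_clamp \<sigma> s = (if s \<le> 0 then \<sigma> * arctan (s / \<sigma>) else if s \<le> 1 then s else 1 + \<sigma> * arctan ((s - 1) / \<sigma>))"

definition soft_clamp' :: "real \<Rightarrow> real \<Rightarrow> real" where
  "soft_clamp' \<sigma> s = (if s \<le> 0 then 1 / (1 + (s / \<sigma>)\<^sup>2) else if s \<le> 1 then 1 else 1 / (1 + ((s - 1) / \<sigma>)\<^sup>2))"

lemma soft_clamp_deriv:
  assumes "0 < \<sigma>"
  shows "(soft_clamp \<sigma> has_real_derivative soft_clamp' \<sigma> s) (at s)"
proof -
  have arc: "((\<lambda>s. c + \<sigma> * arctan ((s - c) / \<sigma>)) has_real_derivative 1 / (1 + ((s - c) / \<sigma>)\<^sup>2)) (at s)" for c s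
    using assms by (auto intro!: derivative_eq_intros simp: divide_inverse)
  have inner: "((\<lambda>s. if s \<le> 1 then s else 1 + \<sigma> * arctan ((s - 1) / \<sigma>)) has_real_derivative
      (if s \<le> 1 then 1 else 1 / (1 + ((s - 1) / \<sigma>)\<^sup>2))) (at s)" for s
    by (rule glue_has_real_derivative_everywhere[OF _ arc]) auto
  show ?thesis
    unfolding soft_clamp_def[abs_def] soft_clamp'_def
    by (rule glue_has_real_derivative_everywhere[OF _ inner]) (use arc[of 0] in auto)
qed

lemma soft_clamp'_continuous: "0 < \<sigma> \<Longrightarrow> continuous_on UNIV (soft_clamp' \<sigma>)"
  unfolding soft_clamp'_def[abs_def]
  by (intro continuous_on_cases_le continuous_intros) (auto simp: add_nonneg_eq_0_iff)

lemma soft_clamp'_bounds: "0 < soft_clamp' \<sigma> s" "soft_clamp' \<sigma> s \<le> 1"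
  by (auto simp: soft_clamp'_def divide_le_eq add_pos_nonneg)

lemma soft_clamp_id: "0 \<le> s \<Longrightarrow> s \<le> 1 \<Longrightarrow> soft_clamp \<sigma> s = s"
  by (auto simp: soft_clamp_def)

lemma soft_clamp'_id: "0 \<le> s \<Longrightarrow> s \<le> 1 \<Longrightarrow> soft_clamp' \<sigma> s = 1"
  by (auto simp: soft_clamp'_def)

lemma soft_clamp_bounds:
  assumes "0 < \<sigma>"
  shows "- 2 * \<sigma> \<le> soft_clamp \<sigma> s" "soft_clamp \<sigma> s \<le> 1 + 2 * \<sigma>"
proof -
  have a: "\<bar>\<sigma> * arctan x\<bar> \<le> 2 * \<sigma>" for x
  proof -
    have "\<bar>arctan x\<bar> \<le> 2" using arctan_bounded[of x] pi_half_less_two by linarith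
    then have "\<sigma> * \<bar>arctan x\<bar> \<le> \<sigma> * 2" using assms by (intro mult_left_mono) auto
    then show ?thesis using assms by (simp add: abs_mult)
  qed
  have n: "x \<le> 0 \<Longrightarrow> \<sigma> * arctan (x / \<sigma>) \<le> 0" "0 \<le> x \<Longrightarrow> 0 \<le> \<sigma> * arctan (x / \<sigma>)" for x
    using assms by (auto simp: mult_le_0_iff divide_le_0_iff)
  consider "s \<le> 0" | "0 < s" "s \<le> 1" | "1 < s" by linarith
  then have "- 2 * \<sigma> \<le> soft_clamp \<sigma> s \<and> soft_clamp \<sigma> s \<le> 1 + 2 * \<sigma>"
  proof cases
    case 1
    then show ?thesis using a[of "s / \<sigma>"] n(1)[OF 1] assms by (simp add: soft_clamp_def abs_le_iff)
  next
    case 2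
    then show ?thesis using assms by (simp add: soft_clamp_def)
  next
    case 3
    then have 1: "0 \<le> \<sigma> * arctan ((s - 1) / \<sigma>)" by (intro n(2)) simp
    have 2: "\<sigma> * arctan ((s - 1) / \<sigma>) \<le> 2 * \<sigma>" by (rule order_trans[OF abs_ge_self a])
    have "soft_clamp \<sigma> s = 1 + \<sigma> * arctan ((s - 1) / \<sigma>)" using 3 by (simp add: soft_clamp_def)
    then show ?thesis using 1 2 assms by linarith
  qed
  then show "- 2 * \<sigma> \<le> soft_clamp \<sigma> s" "soft_clamp \<sigma> s \<le> 1 + 2 * \<sigma>" by auto
qed

text \<open>With \<sigma> = \<delta> / 4 the clamp leaves [0, 1] by at most 2 \<sigma> = \<delta> /
  2. Its range lies in a compact part of the interval on which F is differentiable, and compactness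
  yields the global bounds.\<close>

lemma soft_clamp_extension:
  fixes F F' :: "real \<Rightarrow> real"
  assumes d: "0 < \<delta>" and F: "\<And>s. - \<delta> < s \<Longrightarrow> s < 1 + \<delta> \<Longrightarrow> (F has_real_derivative F' s) (at s)"
    and F': "continuous_on {- \<delta><..<1 + \<delta>} F'"
  defines "\<theta> \<equiv> soft_clamp (\<delta> / 4)" and "\<theta>' \<equiv> soft_clamp' (\<delta> / 4)"
  shows "((\<lambda>s. F (\<theta> s)) has_real_derivative F' (\<theta> s) * \<theta>' s) (at s)"
    and "continuous_on UNIV (\<lambda>s. F' (\<theta> s) * \<theta>' s)"
    and "\<exists>C. \<forall>s. \<bar>F (\<theta> s)\<bar> \<le> C \<and> \<bar>F' (\<theta> s) * \<theta>' s\<bar> \<le> C"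
proof -
  have d4: "0 < \<delta> / 4" using d by simp
  have r: "\<theta> s \<in> {- (\<delta> / 2)..1 + \<delta> / 2}" for s
    using soft_clamp_bounds[OF d4, of s] by (simp add: \<theta>_def)
  have r': "- \<delta> < \<theta> s" "\<theta> s < 1 + \<delta>" for s using r[of s] d by auto
  have \<theta>: "(\<theta> has_real_derivative \<theta>' s) (at s)" for s unfolding \<theta>_def \<theta>'_def by (rule soft_clamp_deriv[OF d4])
  show "((\<lambda>s. F (\<theta> s)) has_real_derivative F' (\<theta> s) * \<theta>' s) (at s)"
    by (rule DERIV_chain2[OF F[OF r'] \<theta>])
  have \<theta>c: "continuous_on UNIV \<theta>" using \<theta> by (meson DERIV_isCont continuous_at_imp_continuous_on)
  have \<theta>'c: "continuous_on UNIV \<theta>'" unfolding \<theta>'_def by (rule soft_clamp'_continuous[OF d4])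
  have "continuous_on UNIV (\<lambda>s. F' (\<theta> s))"
    by (rule continuous_on_compose2[OF F' \<theta>c]) (use r' in auto)
  then show "continuous_on UNIV (\<lambda>s. F' (\<theta> s) * \<theta>' s)" by (intro continuous_on_mult \<theta>'c)
  have sub: "{- (\<delta> / 2)..1 + \<delta> / 2} \<subseteq> {- \<delta><..<1 + \<delta>}" using d by auto
  have Fc: "continuous_on {- (\<delta> / 2)..1 + \<delta> / 2} F"
  proof (intro continuous_at_imp_continuous_on ballI)
    fix x assume "x \<in> {- (\<delta> / 2)..1 + \<delta> / 2}"
    then have "- \<delta> < x" "x < 1 + \<delta>" using d by auto
    from DERIV_isCont[OF F[OF this]] show "isCont F x" .
  qed
  obtain C1 where C1: "\<forall>x\<in>{- (\<delta> / 2)..1 + \<delta> / 2}. \<bar>F x\<bar> \<le> C1"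
    using compact_imp_bounded[OF compact_continuous_image[OF Fc]] by (auto simp: bounded_iff)
  obtain C2 where C2: "\<forall>x\<in>{- (\<delta> / 2)..1 + \<delta> / 2}. \<bar>F' x\<bar> \<le> C2"
    using compact_imp_bounded[OF compact_continuous_image[OF continuous_on_subset[OF F' sub]]] by (auto simp: bounded_iff)
  have "\<bar>F (\<theta> s)\<bar> \<le> max C1 C2 \<and> \<bar>F' (\<theta> s) * \<theta>' s\<bar> \<le> max C1 C2" for s
  proof
    show "\<bar>F (\<theta> s)\<bar> \<le> max C1 C2" using C1[rule_format, OF r[of s]] by simp
    have "\<bar>\<theta>' s\<bar> \<le> 1" using soft_clamp'_bounds[of "\<delta>/4" s] by (simp add: \<theta>'_def)
    then have "\<bar>F' (\<theta> s)\<bar> * \<bar>\<theta>' s\<bar> \<le> \<bar>F' (\<theta> s)\<bar> * 1" by (intro mult_left_mono) auto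
    then show "\<bar>F' (\<theta> s) * \<theta>' s\<bar> \<le> max C1 C2" using C2[rule_format, OF r[of s]] by (simp add: abs_mult)
  qed
  then show "\<exists>C. \<forall>s. \<bar>F (\<theta> s)\<bar> \<le> C \<and> \<bar>F' (\<theta> s) * \<theta>' s\<bar> \<le> C" by blast
qed

lemma logit_reg'_continuous: "0 < \<delta> \<Longrightarrow> continuous_on {- \<delta><..<1 + \<delta>} (logit_reg' \<delta>)"
  unfolding logit_reg'_def[abs_def] by (intro continuous_intros) auto

lemma logit_reg_continuous: "0 < \<delta> \<Longrightarrow> continuous_on {- \<delta><..<1 + \<delta>} (logit_reg \<delta>)"
  by (intro continuous_at_imp_continuous_on ballI DERIV_isCont[OF logit_reg_deriv]) auto

lemma energy_mult'_continuous: "0 < \<delta> \<Longrightarrow> continuous_on {- \<delta><..<1 + \<delta>} (energy_mult' \<delta>)"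
  unfolding energy_mult'_def[abs_def]
  by (intro continuous_intros logit_reg'_continuous logit_reg_continuous) auto

text \<open>Adding the same positive number to numerator and denominator moves a quotient towards 1.
  The resulting domination by f' bounds the initial energy uniformly in \<delta> and provides a
  majorant as \<delta> tends to 0.\<close>

lemma abs_logit_reg_le:
  assumes "0 < \<delta>" "0 < s" "s < 1"
  shows "\<bar>logit_reg \<delta> s\<bar> \<le> \<bar>f_prime s\<bar>"
proof (cases "1 / 2 \<le> s")
  case True
  then have "0 \<le> logit_reg \<delta> s" using logit_reg_sign assms by simp
  moreover have "logit_reg \<delta> s \<le> f_prime s"
    unfolding logit_reg_def f_prime_def using assms True
    by (intro ln_mono divide_pos_pos) (auto simp: divide_simps algebra_simps)
  ultimately show ?thesis by simp
next
  case False
  then have "logit_reg \<delta> s \<le> 0" using logit_reg_sign assms by simp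
  moreover have "f_prime s \<le> logit_reg \<delta> s"
    unfolding logit_reg_def f_prime_def using assms False
    by (intro ln_mono divide_pos_pos) (auto simp: divide_simps algebra_simps)
  ultimately show ?thesis by simp
qed

lemma logit_reg'_le:
  assumes "0 < \<delta>" "0 < s" "s < 1"
  shows "logit_reg' \<delta> s \<le> 1 / (s * (1 - s))"
proof -
  have "logit_reg' \<delta> s = 1 / (s + \<delta>) + 1 / (1 - s + \<delta>)" using assms by (simp add: logit_reg'_def divide_simps)
  also have "\<dots> \<le> 1 / s + 1 / (1 - s)" using assms by (intro add_mono divide_left_mono) auto
  also have "\<dots> = 1 / (s * (1 - s))" using assms by (simp add: divide_simps)
  finally show ?thesis .
qed

definition reg_seq :: "nat \<Rightarrow> real" where
  "reg_seq n = 1 / (real n + 2)"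

lemma reg_seq: "0 < reg_seq n" "reg_seq n \<le> 1 / 2" "reg_seq \<longlonglongrightarrow> 0"
proof -
  show "0 < reg_seq n" "reg_seq n \<le> 1 / 2" by (auto simp: reg_seq_def divide_simps)
  have "(\<lambda>n. inverse (real (Suc (n + 1)))) \<longlonglongrightarrow> 0"
    by (rule LIMSEQ_ignore_initial_segment[OF LIMSEQ_inverse_real_of_nat])
  then show "reg_seq \<longlonglongrightarrow> 0" by (simp add: reg_seq_def[abs_def] divide_inverse add.commute)
qed

lemma logit_reg_tendsto:
  assumes "0 < s" "s < 1"
  shows "(\<lambda>n. logit_reg (reg_seq n) s) \<longlonglongrightarrow> f_prime s"
    "(\<lambda>n. logit_reg' (reg_seq n) s) \<longlonglongrightarrow> 1 / (s * (1 - s))"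
proof -
  have "(\<lambda>n. ln ((s + reg_seq n) / (1 - s + reg_seq n))) \<longlonglongrightarrow> ln ((s + 0) / (1 - s + 0))"
    using assms by (intro tendsto_intros reg_seq(3)) auto
  then show "(\<lambda>n. logit_reg (reg_seq n) s) \<longlonglongrightarrow> f_prime s" by (simp add: logit_reg_def f_prime_def)
  have "(\<lambda>n. (1 + 2 * reg_seq n) / ((s + reg_seq n) * (1 - s + reg_seq n))) \<longlonglongrightarrow> (1 + 2 * 0) / ((s + 0) * (1 - s + 0))"
    using assms by (intro tendsto_intros reg_seq(3)) auto
  then show "(\<lambda>n. logit_reg' (reg_seq n) s) \<longlonglongrightarrow> 1 / (s * (1 - s))" by (simp add: logit_reg'_def)
qed

text \<open>The values of F at 0 and 1 are - ln (n + 3) and ln (n + 3). Their divergence is what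
  will exclude that u equals 0 or 1 on a set of positive measure.\<close>

lemma logit_reg_square_at_top:
  assumes "s = 0 \<or> s = 1"
  shows "filterlim (\<lambda>n. (logit_reg (reg_seq n) s)\<^sup>2) at_top sequentially"
proof -
  have sq: "(logit_reg (reg_seq n) s)\<^sup>2 = (ln (real n + 3))\<^sup>2" for n
  proof -
    have "reg_seq n / (1 + reg_seq n) = inverse (real n + 3)" "(1 + reg_seq n) / reg_seq n = real n + 3"
      by (auto simp: reg_seq_def divide_simps)
    then show ?thesis using assms by (auto simp: logit_reg_def ln_inverse)
  qed
  have "filterlim (\<lambda>n. real n + 3) at_top sequentially"
    by (rule filterlim_at_top_mono[OF filterlim_real_sequentially]) simp
  then have "filterlim (\<lambda>n. ln (real n + 3)) at_top sequentially"
    by (rule filterlim_compose[OF ln_at_top])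
  then have "filterlim (\<lambda>n. (ln (real n + 3))\<^sup>2) at_top sequentially"
    unfolding power2_eq_square by (intro filterlim_at_top_mult_at_top)
  then show ?thesis by (simp add: sq)
qed

subsection \<open>Composition with smooth functions in \<open>H\<^sup>1\<close>\<close>

lemma LIMSEQ_from_subsubsequences:
  fixes f :: "nat \<Rightarrow> real"
  assumes "\<And>r :: nat \<Rightarrow> nat. strict_mono r \<Longrightarrow> \<exists>q :: nat \<Rightarrow> nat. strict_mono q \<and> (\<lambda>n. f (r (q n))) \<longlonglongrightarrow> l"
  shows "f \<longlonglongrightarrow> l"
proof (rule ccontr)
  assume "\<not> f \<longlonglongrightarrow> l"
  then obtain e where e: "e > 0" "\<And>N. \<exists>n\<ge>N. dist (f n) l \<ge> e"
    unfolding lim_sequentially by (auto simp: not_less)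
  then have "infinite {n. dist (f n) l \<ge> e}" unfolding infinite_nat_iff_unbounded_le by auto
  then obtain r :: "nat \<Rightarrow> nat" where r: "strict_mono r" "\<And>n. r n \<in> {n. dist (f n) l \<ge> e}"
    using infinite_enumerate by blast
  from assms[OF r(1)] obtain q :: "nat \<Rightarrow> nat" where "(\<lambda>n. f (r (q n))) \<longlonglongrightarrow> l" by blast
  from tendstoD[OF this e(1)] obtain n where "dist (f (r (q n))) l < e" by (auto simp: eventually_sequentially)
  moreover have "dist (f (r (q n))) l \<ge> e" using r(2) by blast
  ultimately show False by simp
qed

text \<open>\<open>G\<close> is merely continuous, so convergence in L2 is first turned into
  convergence almost everywhere along a further subsequence; then 2 C |w| serves as
  majorant.\<close>

lemma L2_mult_bounded_continuous:
  fixes g :: "'a \<Rightarrow> real" and s :: "nat \<Rightarrow> 'a \<Rightarrow> real"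
  assumes s: "\<And>n. s n \<in> vecs (Lp_space M 2)" and g: "g \<in> vecs (Lp_space M 2)" and w: "w \<in> vecs (Lp_space M 2)"
    and l: "(\<lambda>n. nrm (Lp_space M 2) (\<lambda>x. s n x - g x)) \<longlonglongrightarrow> 0"
    and G: "continuous_on UNIV G" "\<And>y. \<bar>G y\<bar> \<le> (C::real)"
  shows "(\<lambda>n. nrm (Lp_space M 2) (\<lambda>x. (G (s n x) - G (g x)) * w x)) \<longlonglongrightarrow> 0"
proof (rule LIMSEQ_from_subsubsequences)
  fix r :: "nat \<Rightarrow> nat" assume r: "strict_mono r"
  have [measurable]: "G \<in> borel_measurable borel" using G(1) by (rule borel_measurable_continuous_onI)
  have [measurable]: "\<And>n. s n \<in> borel_measurable M" "g \<in> borel_measurable M" "w \<in> borel_measurable M"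
    using s g w by (auto simp: mem_L2)
  have "\<exists>q :: nat \<Rightarrow> nat. strict_mono q \<and> (AE x in M. (\<lambda>n. (s (r (q n)) x - g x)\<^sup>2) \<longlonglongrightarrow> 0)"
  proof (rule tendsto_L1_AE_subseq[where u = "\<lambda>n x. (s (r n) x - g x)\<^sup>2"])
    show "integrable M (\<lambda>x. (s (r n) x - g x)\<^sup>2)" for n
      using seminormed.diff_in[OF L2_seminormed s[of "r n"] g] by (simp add: mem_L2)
    have "(\<lambda>n. (nrm (Lp_space M 2) (\<lambda>x. s n x - g x))\<^sup>2) \<longlonglongrightarrow> 0\<^sup>2" by (intro tendsto_intros l)
    then have "(\<lambda>n. (nrm (Lp_space M 2) (\<lambda>x. s n x - g x))\<^sup>2) \<longlonglongrightarrow> 0" by simp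
    from LIMSEQ_subseq_LIMSEQ[OF this r] show "(\<lambda>n. \<integral>x. norm ((s (r n) x - g x)\<^sup>2) \<partial>M) \<longlonglongrightarrow> 0"
      by (simp add: nrm_L2 o_def)
  qed
  then obtain q :: "nat \<Rightarrow> nat" where q: "strict_mono q" "AE x in M. (\<lambda>n. (s (r (q n)) x - g x)\<^sup>2) \<longlonglongrightarrow> 0" by blast
  have "(\<lambda>n. nrm (Lp_space M 2) (\<lambda>x. (G (s (r (q n)) x) - G (g x)) * w x - 0)) \<longlonglongrightarrow> 0"
  proof (rule L2_dominated_convergence(3)[where w = "\<lambda>x. (2 * C) * w x"])
    show "(\<lambda>x. (2 * C) * w x) \<in> vecs (Lp_space M 2)"
      using seminormed.scale_in[OF L2_seminormed w, of "2 * C"] by simp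
    show "AE x in M. norm ((G (s (r (q n)) x) - G (g x)) * w x) \<le> norm ((2 * C) * w x)" for n
    proof (rule AE_I2)
      fix x
      have "\<bar>G (s (r (q n)) x) - G (g x)\<bar> \<le> 2 * C" using G(2)[of "s (r (q n)) x"] G(2)[of "g x"] by linarith
      also have "\<dots> \<le> \<bar>2 * C\<bar>" by simp
      finally have "\<bar>G (s (r (q n)) x) - G (g x)\<bar> * \<bar>w x\<bar> \<le> \<bar>2 * C\<bar> * \<bar>w x\<bar>" by (rule mult_right_mono) simp
      then show "norm ((G (s (r (q n)) x) - G (g x)) * w x) \<le> norm ((2 * C) * w x)" by (simp add: abs_mult)
    qed
    show "AE x in M. (\<lambda>n. (G (s (r (q n)) x) - G (g x)) * w x) \<longlonglongrightarrow> 0"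
      using q(2)
    proof eventually_elim
      case (elim x)
      have "(\<lambda>n. sqrt ((s (r (q n)) x - g x)\<^sup>2)) \<longlonglongrightarrow> sqrt 0" by (intro tendsto_intros elim)
      then have "(\<lambda>n. s (r (q n)) x - g x) \<longlonglongrightarrow> 0" by (simp add: tendsto_rabs_zero_iff)
      then have "(\<lambda>n. s (r (q n)) x) \<longlonglongrightarrow> g x" by (rule LIM_zero_cancel)
      then have "(\<lambda>n. G (s (r (q n)) x)) \<longlonglongrightarrow> G (g x)"
        using G(1) by (intro isCont_tendsto_compose[of "g x" G]) (auto simp: continuous_on_eq_continuous_at)
      then have "(\<lambda>n. (G (s (r (q n)) x) - G (g x)) * w x) \<longlonglongrightarrow> (G (g x) - G (g x)) * w x" by (intro tendsto_intros)
      then show ?case by simp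
    qed
  qed measurable
  then show "\<exists>q :: nat \<Rightarrow> nat. strict_mono q \<and> (\<lambda>n. nrm (Lp_space M 2) (\<lambda>x. (G (s (r (q n)) x) - G (g x)) * w x)) \<longlonglongrightarrow> 0"
    using q(1) by auto
qed

lemma L2_const:
  assumes "finite_measure M"
  shows "(\<lambda>x. c::real) \<in> vecs (Lp_space M 2)"
proof -
  interpret finite_measure M by fact
  show ?thesis by (simp add: mem_L2)
qed

lemma L2_norm_mono:
  assumes f: "f \<in> vecs (Lp_space M 2)" and h: "h \<in> borel_measurable M"
    and le: "AE x in M. norm (h x) \<le> norm (f x)"
  shows "h \<in> vecs (Lp_space M 2)" "nrm (Lp_space M 2) h \<le> nrm (Lp_space M 2) f"
proof -
  have i: "integrable M (\<lambda>x. (norm (f x))\<^sup>2)" using f by (simp add: mem_L2)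
  have le2: "AE x in M. (norm (h x))\<^sup>2 \<le> (norm (f x))\<^sup>2" using le by eventually_elim (simp add: power_mono)
  have ih: "integrable M (\<lambda>x. (norm (h x))\<^sup>2)"
    by (rule Bochner_Integration.integrable_bound[OF i]) (use h le2 in auto)
  show "h \<in> vecs (Lp_space M 2)" using h ih by (simp add: mem_L2)
  show "nrm (Lp_space M 2) h \<le> nrm (Lp_space M 2) f"
    unfolding nrm_L2 by (intro real_sqrt_le_mono integral_mono_AE ih i le2)
qed

lemma H1_comp:
  fixes S :: "'a::euclidean_space set"
  assumes S: "open S" "bounded S" and F: "\<And>y. (F has_real_derivative F' y) (at y)"
    and F': "continuous_on UNIV F'" "\<And>y. \<bar>F' y\<bar> \<le> C" and f: "f \<in> vecs (H1 S)"
  shows "(\<lambda>x. F (f x)) \<in> vecs (H1 S)"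
    and "b \<in> Basis \<Longrightarrow> has_weak_partial S b (\<lambda>x. F (f x)) (\<lambda>x. F' (f x) * weak_partial S b f x)"
    and "b \<in> Basis \<Longrightarrow> (\<lambda>x. F' (f x) * weak_partial S b f x) \<in> vecs (Lp_space (lebesgue_on S) 2)"
proof -
  let ?M = "lebesgue_on S"
  have M: "finite_measure ?M" using S by (intro finite_measure_lebesgue_on) auto
  have fL: "f \<in> vecs (Lp_space ?M 2)" using f by (simp add: mem_H1)
  have Fc: "continuous_on UNIV F" using F by (meson DERIV_isCont continuous_at_imp_continuous_on)
  have [measurable]: "F \<in> borel_measurable borel" "F' \<in> borel_measurable borel"
    using Fc F' by (auto intro: borel_measurable_continuous_onI)
  have [measurable]: "f \<in> borel_measurable ?M" using fL by (simp add: mem_L2)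
  have scale: "(\<lambda>x. c * h x) \<in> vecs (Lp_space ?M 2)" if "h \<in> vecs (Lp_space ?M 2)" for c and h :: "'a \<Rightarrow> real"
    using seminormed.scale_in[OF L2_seminormed that, of c] by simp
  show w: "has_weak_partial S b (\<lambda>x. F (f x)) (\<lambda>x. F' (f x) * weak_partial S b f x)" if "b \<in> Basis" for b
    by (rule has_weak_partial_chain[OF S(1) that H1_weak_partial(1)[OF S(1) that f] F F'])
  show l: "(\<lambda>x. F' (f x) * weak_partial S b f x) \<in> vecs (Lp_space ?M 2)" if b: "b \<in> Basis" for b
  proof (rule L2_norm_mono(1)[OF scale[OF H1_weak_partial(2)[OF S(1) b f], of C]])
    have [measurable]: "weak_partial S b f \<in> borel_measurable ?M"
      using H1_weak_partial(2)[OF S(1) b f] by (simp add: mem_L2)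
    show "(\<lambda>x. F' (f x) * weak_partial S b f x) \<in> borel_measurable ?M" by measurable
    show "AE x in ?M. norm (F' (f x) * weak_partial S b f x) \<le> norm (C * weak_partial S b f x)"
      using order_trans[OF F'(2) abs_ge_self] by (intro AE_I2) (auto simp: abs_mult intro!: mult_right_mono)
  qed
  have "(\<lambda>x. F (f x)) \<in> vecs (Lp_space ?M 2)"
  proof (rule L2_dominated(1)[OF L2_const[OF M, of "F 0"] scale[OF fL, of C]])
    show "norm (F (f x)) \<le> norm (F 0) + norm (C * f x)" for x
    proof -
      have "\<bar>F (f x) - F 0\<bar> \<le> C * \<bar>f x - 0\<bar>" by (rule real_lipschitz_of_deriv[OF F F'(2)])
      also have "\<dots> \<le> \<bar>C\<bar> * \<bar>f x\<bar>" by (simp add: mult_right_mono)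
      finally show ?thesis by (simp add: abs_mult)
    qed
  qed measurable
  then show "(\<lambda>x. F (f x)) \<in> vecs (H1 S)" using w l by (auto simp: mem_H1)
qed

text \<open>The gradient difference splits into F'(s_n) (\<nabla>s_n - \<nabla>f), small because F'
  is bounded, and (F'(s_n) - F'(f)) \<nabla>f, small by the preceding lemma. The continuity is
  needed for strong measurability in time of F(u).\<close>

lemma H1_comp_continuous:
  fixes S :: "'a::euclidean_space set"
  assumes S: "open S" "bounded S" and F: "\<And>y. (F has_real_derivative F' y) (at y)"
    and F': "continuous_on UNIV F'" "\<And>y. \<bar>F' y\<bar> \<le> C" and s: "\<And>n::nat. s n \<in> vecs (H1 S)" and f: "f \<in> vecs (H1 S)"
    and l: "(\<lambda>n. nrm (H1 S) (\<lambda>x. s n x - f x)) \<longlonglongrightarrow> 0"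
  shows "(\<lambda>n. nrm (H1 S) (\<lambda>x. F (s n x) - F (f x))) \<longlonglongrightarrow> 0"
proof -
  let ?M = "lebesgue_on S"
  let ?n = "nrm (Lp_space ?M 2) :: ('a \<Rightarrow> real) \<Rightarrow> real"
  interpret L: seminormed "Lp_space ?M 2 :: ('a, real) fspace" by (rule L2_seminormed)
  note cs = H1_comp[OF S F F' s] and cf = H1_comp[OF S F F' f]
  have C0: "0 \<le> C" using F'(2)[of 0] by linarith
  have sL: "\<And>n. s n \<in> vecs (Lp_space ?M 2)" "f \<in> vecs (Lp_space ?M 2)" using s f by (auto simp: mem_H1)
  have "continuous_on UNIV F" using F by (meson DERIV_isCont continuous_at_imp_continuous_on)
  then have [measurable]: "F \<in> borel_measurable borel" "F' \<in> borel_measurable borel"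
    using F' by (auto intro: borel_measurable_continuous_onI)
  have [measurable]: "\<And>n. s n \<in> borel_measurable ?M" "f \<in> borel_measurable ?M" using sL by (auto simp: mem_L2)
  have nd: "nrm (H1 S) (\<lambda>x. s n x - f x) = ?n (\<lambda>x. s n x - f x) + (\<Sum>b\<in>Basis. ?n (\<lambda>x. weak_partial S b (s n) x - weak_partial S b f x))" for n
    by (rule nrm_H1_diff[OF S(1) s f])
  have l0: "(\<lambda>n. ?n (\<lambda>x. s n x - f x)) \<longlonglongrightarrow> 0"
  proof (rule real_tendsto_sandwich[OF _ _ tendsto_const l])
    show "\<forall>\<^sub>F n in sequentially. ?n (\<lambda>x. s n x - f x) \<le> nrm (H1 S) (\<lambda>x. s n x - f x)"
      by (intro always_eventually allI) (simp add: nd sum_nonneg nrm_L2_nonneg)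
  qed (simp add: nrm_L2_nonneg)
  have lb: "(\<lambda>n. ?n (\<lambda>x. weak_partial S b (s n) x - weak_partial S b f x)) \<longlonglongrightarrow> 0" if b: "b \<in> Basis" for b
  proof (rule real_tendsto_sandwich[OF _ _ tendsto_const l])
    have "?n (\<lambda>x. weak_partial S b (s n) x - weak_partial S b f x)
        \<le> (\<Sum>b\<in>Basis. ?n (\<lambda>x. weak_partial S b (s n) x - weak_partial S b f x))" for n
      using b by (intro member_le_sum[of b _ "\<lambda>b. ?n (\<lambda>x. weak_partial S b (s n) x - weak_partial S b f x)"]) (auto simp: nrm_L2_nonneg)
    then show "\<forall>\<^sub>F n in sequentially. ?n (\<lambda>x. weak_partial S b (s n) x - weak_partial S b f x) \<le> nrm (H1 S) (\<lambda>x. s n x - f x)"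
      by (intro always_eventually allI) (simp add: nd add_increasing nrm_L2_nonneg)
  qed (simp add: nrm_L2_nonneg)
  have sc: "(\<lambda>x. C * h x) \<in> vecs (Lp_space ?M 2)" "?n (\<lambda>x. C * h x) = C * ?n h" if "h \<in> vecs (Lp_space ?M 2)" for h :: "'a \<Rightarrow> real"
    using L.scale_in[OF that, of C] L.nrm_scale[OF that, of C] C0 by simp_all
  have L0: "(\<lambda>n. ?n (\<lambda>x. F (s n x) - F (f x))) \<longlonglongrightarrow> 0"
  proof (rule real_tendsto_sandwich[OF _ _ tendsto_const])
    show "(\<lambda>n. C * ?n (\<lambda>x. s n x - f x)) \<longlonglongrightarrow> 0" using tendsto_mult[OF tendsto_const l0, of C] by simp
    have "?n (\<lambda>x. F (s n x) - F (f x)) \<le> ?n (\<lambda>x. C * (s n x - f x))" for n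
    proof (rule L2_norm_mono(2)[OF sc(1)[OF L.diff_in[OF sL(1) sL(2)]]])
      show "AE x in ?M. norm (F (s n x) - F (f x)) \<le> norm (C * (s n x - f x))"
        using real_lipschitz_of_deriv[OF F F'(2)] C0 by (intro AE_I2) (simp add: abs_mult)
    qed measurable
    then show "\<forall>\<^sub>F n in sequentially. ?n (\<lambda>x. F (s n x) - F (f x)) \<le> C * ?n (\<lambda>x. s n x - f x)"
      using sc(2)[OF L.diff_in[OF sL(1) sL(2)]] by simp
  qed (simp add: nrm_L2_nonneg)
  have Lb: "(\<lambda>n. ?n (\<lambda>x. F' (s n x) * weak_partial S b (s n) x - F' (f x) * weak_partial S b f x)) \<longlonglongrightarrow> 0" if b: "b \<in> Basis" for b
  proof (rule real_tendsto_sandwich[OF _ _ tendsto_const])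
    note ws = H1_weak_partial(2)[OF S(1) b s] and wf = H1_weak_partial(2)[OF S(1) b f]
    have [measurable]: "weak_partial S b (s n) \<in> borel_measurable ?M" "weak_partial S b f \<in> borel_measurable ?M" for n
      using ws[of n] wf by (auto simp: mem_L2)
    show "(\<lambda>n. C * ?n (\<lambda>x. weak_partial S b (s n) x - weak_partial S b f x) + ?n (\<lambda>x. (F' (s n x) - F' (f x)) * weak_partial S b f x)) \<longlonglongrightarrow> 0"
      using tendsto_add[OF tendsto_mult[OF tendsto_const lb[OF b], of C] L2_mult_bounded_continuous[OF sL wf l0 F']] by simp
    have m2: "(\<lambda>x. (F' (s n x) - F' (f x)) * weak_partial S b f x) \<in> vecs (Lp_space ?M 2)" for n
    proof (rule L2_norm_mono(1))
      show "(\<lambda>x. C * (2 * weak_partial S b f x)) \<in> vecs (Lp_space ?M 2)"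
        using sc(1) L.scale_in[OF wf, of 2] by simp
      show "AE x in ?M. norm ((F' (s n x) - F' (f x)) * weak_partial S b f x) \<le> norm (C * (2 * weak_partial S b f x))"
      proof (rule AE_I2)
        fix x
        have "\<bar>F' (s n x) - F' (f x)\<bar> \<le> 2 * C" using F'(2)[of "s n x"] F'(2)[of "f x"] by linarith
        from mult_right_mono[OF this abs_ge_zero[of "weak_partial S b f x"]]
        show "norm ((F' (s n x) - F' (f x)) * weak_partial S b f x) \<le> norm (C * (2 * weak_partial S b f x))"
          using C0 by (simp add: abs_mult mult_ac)
      qed
    qed measurable
    have "?n (\<lambda>x. F' (s n x) * weak_partial S b (s n) x - F' (f x) * weak_partial S b f x)
       \<le> ?n (\<lambda>x. C * (weak_partial S b (s n) x - weak_partial S b f x)) + ?n (\<lambda>x. (F' (s n x) - F' (f x)) * weak_partial S b f x)" for n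
    proof (rule L2_dominated(2)[OF sc(1)[OF L.diff_in[OF ws wf]] m2])
      fix x
      have "F' (s n x) * weak_partial S b (s n) x - F' (f x) * weak_partial S b f x
        = F' (s n x) * (weak_partial S b (s n) x - weak_partial S b f x) + (F' (s n x) - F' (f x)) * weak_partial S b f x"
        by (simp add: algebra_simps)
      also have "norm \<dots> \<le> norm (F' (s n x) * (weak_partial S b (s n) x - weak_partial S b f x)) + norm ((F' (s n x) - F' (f x)) * weak_partial S b f x)"
        by (rule norm_triangle_ineq)
      also have "norm (F' (s n x) * (weak_partial S b (s n) x - weak_partial S b f x)) \<le> norm (C * (weak_partial S b (s n) x - weak_partial S b f x))"
        using F'(2)[of "s n x"] C0 by (simp add: abs_mult mult_right_mono)
      finally show "norm (F' (s n x) * weak_partial S b (s n) x - F' (f x) * weak_partial S b f x)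
        \<le> norm (C * (weak_partial S b (s n) x - weak_partial S b f x)) + norm ((F' (s n x) - F' (f x)) * weak_partial S b f x)" by simp
    qed measurable
    then show "\<forall>\<^sub>F n in sequentially. ?n (\<lambda>x. F' (s n x) * weak_partial S b (s n) x - F' (f x) * weak_partial S b f x)
       \<le> C * ?n (\<lambda>x. weak_partial S b (s n) x - weak_partial S b f x) + ?n (\<lambda>x. (F' (s n x) - F' (f x)) * weak_partial S b f x)"
      using sc(2)[OF L.diff_in[OF ws wf]] by simp
  qed (simp add: nrm_L2_nonneg)
  have "nrm (H1 S) (\<lambda>x. F (s n x) - F (f x)) = ?n (\<lambda>x. F (s n x) - F (f x))
     + (\<Sum>b\<in>Basis. ?n (\<lambda>x. F' (s n x) * weak_partial S b (s n) x - F' (f x) * weak_partial S b f x))" for n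
  proof (rule nrm_H1_eq[OF S(1)])
    fix b :: 'a assume b: "b \<in> Basis"
    show "has_weak_partial S b (\<lambda>x. F (s n x) - F (f x)) (\<lambda>x. F' (s n x) * weak_partial S b (s n) x - F' (f x) * weak_partial S b f x)"
      using has_weak_partial_linear[OF S(1) b cs(2)[OF b, of n] cf(2)[OF b], of 1 "-1"] by simp
    show "(\<lambda>x. F' (s n x) * weak_partial S b (s n) x - F' (f x) * weak_partial S b f x) \<in> vecs (Lp_space ?M 2)"
      by (rule L.diff_in[OF cs(3)[OF b] cf(3)[OF b]])
  qed
  moreover have "(\<lambda>n. ?n (\<lambda>x. F (s n x) - F (f x))
     + (\<Sum>b\<in>Basis. ?n (\<lambda>x. F' (s n x) * weak_partial S b (s n) x - F' (f x) * weak_partial S b f x))) \<longlonglongrightarrow> 0 + (\<Sum>b\<in>(Basis::'a set). 0)"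
    by (intro tendsto_add L0 tendsto_sum Lb)
  ultimately show ?thesis by simp
qed

section \<open>Weak gradients in L2 and their energies\<close>

lemma norm_weak_grad: "(norm (weak_grad S f x))\<^sup>2 = (\<Sum>b\<in>Basis. (weak_partial S b f x)\<^sup>2)"
  unfolding power2_norm_eq_inner euclidean_inner[of "weak_grad S f x" "weak_grad S f x"]
  by (simp add: weak_grad_def power2_eq_square)

lemma weak_grad_inner: "b \<in> Basis \<Longrightarrow> weak_grad S f x \<bullet> b = weak_partial S b f x"
  by (simp add: weak_grad_def)

lemma weak_grad_L2:
  assumes "open S" "f \<in> vecs (H1 S)"
  shows "weak_grad S f \<in> vecs (Lp_space (lebesgue_on S) 2)"
    and "(LINT x|lebesgue_on S. (norm (weak_grad S f x))\<^sup>2) = (\<Sum>b\<in>Basis. (nrm (Lp_space (lebesgue_on S) 2) (weak_partial S b f))\<^sup>2)"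
proof -
  have l: "weak_partial S b f \<in> vecs (Lp_space (lebesgue_on S) 2)" if "b \<in> Basis" for b
    using H1_weak_partial(2)[OF assms(1) that assms(2)] .
  have "weak_grad S f \<in> borel_measurable (lebesgue_on S)"
    unfolding weak_grad_def[abs_def] using l by (intro borel_measurable_sum borel_measurable_scaleR) (auto simp: mem_L2)
  then show "weak_grad S f \<in> vecs (Lp_space (lebesgue_on S) 2)"
    unfolding mem_L2 norm_weak_grad using l by (auto simp: mem_L2)
  show "(LINT x|lebesgue_on S. (norm (weak_grad S f x))\<^sup>2) = (\<Sum>b\<in>Basis. (nrm (Lp_space (lebesgue_on S) 2) (weak_partial S b f))\<^sup>2)"
    unfolding norm_weak_grad using l by (subst Bochner_Integration.integral_sum) (auto simp: mem_L2 nrm_L2)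
qed

text \<open>The norm of \<open>H1\<close> is a sum of L2 norms rather than their Euclidean
  combination, whose square stands on the left; an l2 norm is at most the l1 norm.\<close>

lemma L2_parallel_sum_le_H1:
  "(nrm (Lp_space (lebesgue_on S) 2) f)\<^sup>2 + (\<Sum>b\<in>Basis. (nrm (Lp_space (lebesgue_on S) 2) (weak_partial S b f))\<^sup>2)
    \<le> (nrm (H1 S) f)\<^sup>2"
proof -
  let ?a = "nrm (Lp_space (lebesgue_on S) 2) f" and ?c = "\<lambda>b. nrm (Lp_space (lebesgue_on S) 2) (weak_partial S b f)"
  have "sqrt (\<Sum>b\<in>Basis. (?c b)\<^sup>2) \<le> (\<Sum>b\<in>Basis. ?c b)"
    using L2_set_le_sum[of Basis ?c] by (simp add: L2_set_def nrm_L2_nonneg)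
  then have "(sqrt (\<Sum>b\<in>Basis. (?c b)\<^sup>2))\<^sup>2 \<le> (\<Sum>b\<in>Basis. ?c b)\<^sup>2" by (rule power_mono) (simp add: sum_nonneg)
  then have 1: "(\<Sum>b\<in>Basis. (?c b)\<^sup>2) \<le> (\<Sum>b\<in>Basis. ?c b)\<^sup>2" by (simp add: sum_nonneg)
  have "0 \<le> 2 * ?a * (\<Sum>b\<in>Basis. ?c b)" by (auto intro!: mult_nonneg_nonneg sum_nonneg simp: nrm_L2_nonneg)
  then show ?thesis using 1 by (simp add: nrm_H1 power2_sum)
qed

lemma H1_cong_AE:
  assumes S: "open S" and f: "f \<in> vecs (H1 S)" and ae: "AE x in lebesgue_on S. f x = h x"
  shows "h \<in> vecs (H1 S)" "nrm (H1 S) h = nrm (H1 S) f"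
proof -
  let ?M = "lebesgue_on S"
  have sl: "S \<in> sets lebesgue" using S by simp
  have fL: "f \<in> vecs (Lp_space ?M 2)" using f by (simp add: mem_H1)
  then have hm: "h \<in> borel_measurable ?M" using borel_measurable_lebesgue_on_AE[OF _ sl ae] by (simp add: mem_L2)
  have w: "has_weak_partial S b h (weak_partial S b f)" if "b \<in> Basis" for b
    by (rule has_weak_partial_cong_AE[OF S H1_weak_partial(1)[OF S that f] that ae]) simp
  note l = H1_weak_partial(2)[OF S _ f]
  show "h \<in> vecs (H1 S)" using L2_cong_AE(1)[OF fL hm ae] w l by (auto simp: mem_H1)
  show "nrm (H1 S) h = nrm (H1 S) f"
    using nrm_H1_eq[OF S w l] L2_cong_AE(2)[OF fL hm ae] by (simp add: nrm_H1)
qed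

lemma Linf_AE_le:
  fixes f :: "'a \<Rightarrow> real"
  assumes "f \<in> vecs (Lp_space M \<infinity>)"
  shows "AE x in M. \<bar>f x\<bar> \<le> nrm (Lp_space M \<infinity>) f"
proof -
  let ?e = "esssup M (\<lambda>x. ereal \<bar>f x\<bar>)"
  have e: "?e < \<infinity>" "nrm (Lp_space M \<infinity>) f = real_of_ereal ?e" using assms by (auto simp: Lp_space_def)
  have "AE x in M. ereal \<bar>f x\<bar> \<le> ?e" by (rule esssup_AE)
  then show ?thesis
  proof eventually_elim
    case (elim x)
    then show ?case using e by (cases ?e) auto
  qed
qed

lemma Linf_nonneg:
  fixes f :: "'a \<Rightarrow> real"
  assumes "f \<in> vecs (Lp_space M \<infinity>)" "emeasure M (space M) \<noteq> 0"
  shows "0 \<le> nrm (Lp_space M \<infinity>) f"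
proof (rule ccontr)
  assume "\<not> 0 \<le> nrm (Lp_space M \<infinity>) f"
  then have neg: "nrm (Lp_space M \<infinity>) f < 0" by simp
  have "AE x in M. False"
  proof (rule eventually_mono[OF Linf_AE_le[OF assms(1)]])
    fix x assume "\<bar>f x\<bar> \<le> nrm (Lp_space M \<infinity>) f"
    then show False using neg abs_ge_zero[of "f x"] by linarith
  qed
  then have "emeasure M (space M) = 0" by (subst (asm) AE_iff_null) auto
  then show False using assms(2) by simp
qed

lemma Linf_I:
  fixes f :: "'a \<Rightarrow> real"
  assumes "f \<in> borel_measurable M" "AE x in M. \<bar>f x\<bar> \<le> c" "0 \<le> c"
  shows "f \<in> vecs (Lp_space M \<infinity>)" "nrm (Lp_space M \<infinity>) f \<le> c"
proof -
  let ?e = "esssup M (\<lambda>x. ereal \<bar>f x\<bar>)"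
  have e: "?e \<le> ereal c" using assms by (intro esssup_I) auto
  then have "?e < \<infinity>" by (cases ?e) auto
  then show "f \<in> vecs (Lp_space M \<infinity>)" using assms(1) by (simp add: Lp_space_def)
  \<comment> \<open>On a space of measure 0 the essential supremum is -\<infinity>, which
    \<open>real_of_ereal\<close> maps to 0; this case is settled by
    \<open>0 \<le> c\<close>.\<close>
  have "real_of_ereal ?e \<le> c" using e assms(3) by (cases ?e) auto
  then show "nrm (Lp_space M \<infinity>) f \<le> c" by (simp add: Lp_space_def)
qed

subsection \<open>Time slices and convolution\<close>

lemma AE_lborel_slice:
  assumes "AE z in (lborel :: ('a::euclidean_space \<times> real) measure). Q z"
  shows "AE t in lborel. AE x in lborel. Q (x, t)"
proof -
  obtain N where N: "{z. \<not> Q z} \<subseteq> N" "N \<in> null_sets (lborel :: ('a \<times> real) measure)"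
    using assms unfolding eventually_ae_filter by auto
  have Ns: "N \<in> sets ((lborel :: 'a measure) \<Otimes>\<^sub>M (lborel :: real measure))"
    using N(2) unfolding lborel_prod by (simp add: null_sets_def)
  have "(\<integral>\<^sup>+t. emeasure lborel ((\<lambda>x. (x, t)) -` N) \<partial>lborel) = emeasure ((lborel :: 'a measure) \<Otimes>\<^sub>M (lborel :: real measure)) N"
    by (rule lborel_pair.emeasure_pair_measure_alt2[OF Ns, symmetric])
  also have "\<dots> = 0" using N(2) by (simp add: lborel_prod null_sets_def)
  finally have "AE t in lborel. emeasure lborel ((\<lambda>x. (x, t)) -` N) = 0"
    using nn_integral_0_iff_AE[OF lborel_pair.measurable_emeasure_Pair2[OF Ns]] by blast
  then show ?thesis
  proof eventually_elim
    case (elim t)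
    have "(\<lambda>x. (x, t)) -` N \<in> sets lborel" using sets_Pair2[OF Ns, of t] by simp
    with elim have "(\<lambda>x. (x, t)) -` N \<in> null_sets lborel" by (auto simp: null_sets_def)
    then have "AE x in lborel. x \<notin> (\<lambda>x. (x, t)) -` N" by (rule AE_not_in)
    then show ?case by eventually_elim (use N(1) in auto)
  qed
qed

lemma AE_lebesgue_on_slice:
  assumes S: "open S" and ae: "AE z in lebesgue_on (S \<times> {0<..<T::real}). Q z"
  shows "AE t in lebesgue_on {0<..<T}. AE x in lebesgue_on S. Q (x, t)"
proof -
  have o: "open (S \<times> {0<..<T})" using S by (intro open_Times) auto
  have "AE z in lebesgue. z \<in> S \<times> {0<..<T} \<longrightarrow> Q z"
    using ae o by (subst (asm) AE_restrict_space_iff) auto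
  then have "AE z in lborel. z \<in> S \<times> {0<..<T} \<longrightarrow> Q z" by (simp add: AE_completion_iff)
  then have "AE t in lborel. AE x in lborel. (x, t) \<in> S \<times> {0<..<T} \<longrightarrow> Q (x, t)" by (rule AE_lborel_slice)
  then have "AE t in lebesgue. t \<in> {0<..<T} \<longrightarrow> (AE x in lebesgue_on S. Q (x, t))"
  proof (intro AE_completion, eventually_elim)
    case (elim t)
    show ?case
    proof
      assume "t \<in> {0<..<T}"
      with elim have "AE x in lborel. x \<in> S \<longrightarrow> Q (x, t)" by auto
      then have "AE x in lebesgue. x \<in> S \<longrightarrow> Q (x, t)" by (rule AE_completion)
      then show "AE x in lebesgue_on S. Q (x, t)" using S by (subst AE_restrict_space_iff) auto
    qed
  qed
  then show ?thesis by (subst AE_restrict_space_iff) auto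
qed

text \<open>Null slices do not make an arbitrary set null, so measurability of the exceptional set
  is assumed. Its Borel part has null slices and is null by Tonelli; the remainder is contained in a
  null set by completion.\<close>

lemma AE_lebesgue_on_from_slices:
  fixes S :: "'a::euclidean_space set"
  assumes S: "open S" and m: "{z \<in> S \<times> {0<..<T::real}. \<not> Q z} \<in> sets lebesgue"
    and ae: "AE t in lebesgue_on {0<..<T}. AE x in lebesgue_on S. Q (x, t)"
  shows "AE z in lebesgue_on (S \<times> {0<..<T}). Q z"
proof -
  have o: "open (S \<times> {0<..<T})" using S by (intro open_Times) auto
  obtain B N N' where B: "{z \<in> S \<times> {0<..<T}. \<not> Q z} = B \<union> N" "N \<subseteq> N'" "N' \<in> null_sets lborel" "B \<in> sets lborel"
    using m by (rule sets_completionE)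
  have Bs: "B \<in> sets ((lborel :: 'a measure) \<Otimes>\<^sub>M (lborel :: real measure))"
    using B(4) unfolding lborel_prod .
  have "AE t in lebesgue. t \<in> {0<..<T} \<longrightarrow> (AE x in lebesgue_on S. Q (x, t))"
    using ae by (subst (asm) AE_restrict_space_iff) auto
  then have "AE t in lborel. t \<in> {0<..<T} \<longrightarrow> (AE x in lebesgue_on S. Q (x, t))" by (simp add: AE_completion_iff)
  then have "AE t in lborel. emeasure lborel ((\<lambda>x. (x, t)) -` B) = 0"
  proof eventually_elim
    case (elim t)
    have sub: "(x, t) \<in> B \<Longrightarrow> x \<in> S \<and> t \<in> {0<..<T} \<and> \<not> Q (x, t)" for x using B(1) by blast
    show ?case
    proof (cases "t \<in> {0<..<T}")
      case True
      have "AE x in lebesgue. x \<in> S \<longrightarrow> Q (x, t)"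
        using elim True S by (subst (asm) AE_restrict_space_iff) auto
      then have "AE x in lborel. x \<in> S \<longrightarrow> Q (x, t)" by (simp add: AE_completion_iff)
      then have "AE x in lborel. x \<notin> (\<lambda>x. (x, t)) -` B" by eventually_elim (use sub in auto)
      then have "(\<lambda>x. (x, t)) -` B \<in> null_sets lborel"
        using AE_iff_null_sets[OF sets_Pair2[OF Bs, of t]] by blast
      then show ?thesis by (simp add: null_sets_def)
    next
      case False
      then have "(\<lambda>x. (x, t)) -` B = {}" using sub by auto
      then show ?thesis by simp
    qed
  qed
  then have "(\<integral>\<^sup>+t. emeasure lborel ((\<lambda>x. (x, t)) -` B) \<partial>lborel) = 0"
    using nn_integral_0_iff_AE[OF lborel_pair.measurable_emeasure_Pair2[OF Bs]] by blast
  then have "emeasure lborel B = 0"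
    using lborel_pair.emeasure_pair_measure_alt2[OF Bs] by (simp add: lborel_prod)
  then have "B \<in> null_sets lborel" using B(4) by auto
  then have "B \<union> N' \<in> null_sets lborel" using B(3) by (rule null_sets.Un)
  then have "AE z in lborel. z \<notin> B \<union> N'" by (rule AE_not_in)
  then have "AE z in lebesgue. z \<in> S \<times> {0<..<T} \<longrightarrow> Q z"
  proof (intro AE_completion, eventually_elim)
    case (elim z)
    then show ?case using B(1,2) by blast
  qed
  then show ?thesis using o by (subst AE_restrict_space_iff) auto
qed

text \<open>Applied to the density 1 - 2 u(t), whose absolute value is at most 1, this turns the
  kernel hypothesis for p = \<infinity> into a pointwise bound on \<nabla>w uniform in time. It is
  the origin of the constant \<open>R\<close>.\<close>

lemma convolution_gradient_bound:
  fixes S :: "'a::euclidean_space set"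
  assumes S: "open S" "S \<noteq> {}"
    and r: "\<And>\<rho>. \<rho> \<in> vecs (Lp_space (lebesgue_on S) \<infinity>) \<Longrightarrow> convol K S \<rho> \<in> vecs (Sobolev 1 \<infinity> S) \<and>
         nrm (Sobolev 1 \<infinity> S) (convol K S \<rho>) \<le> r * nrm (Lp_space (lebesgue_on S) \<infinity>) \<rho>" "0 < r"
    and \<rho>: "\<rho> \<in> borel_measurable (lebesgue_on S)" "AE x in lebesgue_on S. \<bar>\<rho> x\<bar> \<le> 1"
  shows "weak_grad S (convol K S \<rho>) \<in> borel_measurable (lebesgue_on S)"
    and "AE x in lebesgue_on S. norm (weak_grad S (convol K S \<rho>) x) \<le> r"
proof -
  let ?M = "lebesgue_on S" and ?w = "convol K S \<rho>"
  let ?n = "nrm (Lp_space ?M \<infinity>) :: ('a \<Rightarrow> real) \<Rightarrow> real"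
  have pos: "emeasure ?M (space ?M) \<noteq> 0"
  proof -
    have "\<not> negligible S" using open_not_negligible[OF S] .
    then show ?thesis using S(1) by (auto simp: emeasure_restrict_space negligible_iff_null_sets null_sets_def)
  qed
  have \<rho>v: "\<rho> \<in> vecs (Lp_space ?M \<infinity>)" "?n \<rho> \<le> 1" using Linf_I[OF \<rho>] by auto
  have w: "?w \<in> vecs (Sobolev 1 \<infinity> S)" "nrm (Sobolev 1 \<infinity> S) ?w \<le> r"
  proof -
    show "?w \<in> vecs (Sobolev 1 \<infinity> S)" using r(1)[OF \<rho>v(1)] by simp
    have "nrm (Sobolev 1 \<infinity> S) ?w \<le> r * ?n \<rho>" using r(1)[OF \<rho>v(1)] by simp
    also have "\<dots> \<le> r * 1" using \<rho>v(2) r(2) by (intro mult_left_mono) auto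
    finally show "nrm (Sobolev 1 \<infinity> S) ?w \<le> r" by simp
  qed
  have wv: "?w \<in> vecs (Lp_space ?M \<infinity>)" "\<And>b. b \<in> Basis \<Longrightarrow> \<exists>h\<in>vecs (Lp_space ?M \<infinity>). has_weak_partial S b ?w h"
    using w(1) unfolding Sobolev_def One_nat_def by auto
  have pv: "weak_partial S b ?w \<in> vecs (Lp_space ?M \<infinity>)" if b: "b \<in> Basis" for b
  proof -
    obtain h where h: "h \<in> vecs (Lp_space ?M \<infinity>)" "has_weak_partial S b ?w h" using wv(2)[OF b] by blast
    have ae: "AE x in ?M. \<bar>weak_partial S b ?w x\<bar> \<le> ?n h"
      using Linf_AE_le[OF h(1)] weak_partial_AE[OF S(1) b h(2)] by eventually_elim simp
    show ?thesis by (rule Linf_I(1)[OF weak_partial_measurable[OF S(1) b h(2)] ae Linf_nonneg[OF h(1) pos]])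
  qed
  have nw: "?n ?w + (\<Sum>b\<in>Basis. ?n (weak_partial S b ?w)) \<le> r"
    using w(2) unfolding Sobolev_def One_nat_def by simp
  show "weak_grad S ?w \<in> borel_measurable ?M"
    unfolding weak_grad_def[abs_def] using pv
    by (intro borel_measurable_sum borel_measurable_scaleR) (auto simp: Lp_space_def)
  have "AE x in ?M. \<forall>b\<in>Basis. \<bar>weak_partial S b ?w x\<bar> \<le> ?n (weak_partial S b ?w)"
    using Linf_AE_le[OF pv] by (intro AE_finite_allI) auto
  then show "AE x in ?M. norm (weak_grad S ?w x) \<le> r"
  proof eventually_elim
    case (elim x)
    have "norm (weak_grad S ?w x) \<le> (\<Sum>b\<in>Basis. norm (weak_partial S b ?w x *\<^sub>R b))"
      unfolding weak_grad_def by (rule norm_sum)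
    also have "\<dots> = (\<Sum>b\<in>Basis. \<bar>weak_partial S b ?w x\<bar>)" by (intro sum.cong) auto
    also have "\<dots> \<le> (\<Sum>b\<in>Basis. ?n (weak_partial S b ?w))" using elim by (intro sum_mono) auto
    also have "\<dots> \<le> r" using nw Linf_nonneg[OF wv(1) pos] by linarith
    finally show ?case .
  qed
qed

lemma lebesgue_measurable_reflect:
  fixes K :: "'a::euclidean_space \<Rightarrow> real"
  assumes "K \<in> borel_measurable lebesgue"
  shows "(\<lambda>y. K (x - y)) \<in> borel_measurable lebesgue"
proof -
  have "(\<lambda>y. x + (\<Sum>j\<in>Basis. (- 1 * (y \<bullet> j)) *\<^sub>R j)) \<in> lebesgue \<rightarrow>\<^sub>M lebesgue"
    by (rule lebesgue_affine_measurable[of "\<lambda>j. - 1"]) simp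
  moreover have "x + (\<Sum>j\<in>Basis. (- 1 * (y \<bullet> j)) *\<^sub>R j) = x - y" for y
    by (simp add: sum_negf euclidean_representation)
  ultimately have "(\<lambda>y. x - y) \<in> lebesgue \<rightarrow>\<^sub>M lebesgue" by simp
  from measurable_compose[OF this assms] show ?thesis .
qed

text \<open>Integrals of nonintegrable functions have the default value 0, so linearity of the
  convolution in its density requires integrability at each point; the kernel bound gives it for
  bounded densities.\<close>

lemma convol_bounded_integrable:
  assumes S: "open S" and K: "K \<in> borel_measurable lebesgue"
    and s: "(SUP x\<in>S. \<integral>\<^sup>+ y. ennreal \<bar>K (x - y)\<bar> \<partial>lebesgue_on S) < \<infinity>" and x: "x \<in> S"
    and \<rho>: "\<rho> \<in> borel_measurable (lebesgue_on S)" "\<And>y. \<bar>\<rho> y\<bar> \<le> B"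
  shows "integrable (lebesgue_on S) (\<lambda>y. K (x - y) * \<rho> y)"
proof -
  let ?M = "lebesgue_on S"
  have Km: "(\<lambda>y. K (x - y)) \<in> borel_measurable ?M"
    by (intro measurable_restrict_space1 lebesgue_measurable_reflect K)
  have "(\<integral>\<^sup>+ y. ennreal \<bar>K (x - y)\<bar> \<partial>?M) \<le> (SUP x\<in>S. \<integral>\<^sup>+ y. ennreal \<bar>K (x - y)\<bar> \<partial>?M)"
    using x by (intro SUP_upper)
  then have iK: "integrable ?M (\<lambda>y. K (x - y))"
    using Km s by (intro integrableI_bounded) auto
  show ?thesis by (rule integrable_mult_bounded[OF iK \<rho>])
qed

lemma convol_cong_AE:
  assumes S: "open S" and K: "K \<in> borel_measurable lebesgue"
    and \<rho>: "\<rho> \<in> borel_measurable (lebesgue_on S)" and ae: "AE y in lebesgue_on S. \<rho> y = \<rho>' y"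
  shows "convol K S \<rho> = convol K S \<rho>'"
proof
  fix x
  have Km: "(\<lambda>y. K (x - y)) \<in> borel_measurable (lebesgue_on S)"
    by (intro measurable_restrict_space1 lebesgue_measurable_reflect K)
  have \<rho>': "\<rho>' \<in> borel_measurable (lebesgue_on S)"
    using borel_measurable_lebesgue_on_AE[OF \<rho> _ ae] S by simp
  show "convol K S \<rho> x = convol K S \<rho>' x"
    unfolding convol_def
    by (rule integral_cong_AE[OF borel_measurable_times[OF Km \<rho>] borel_measurable_times[OF Km \<rho>']])
       (use ae in eventually_elim, simp)
qed

section \<open>Gradients of compositions and differences\<close>

lemma weak_grad_AE:
  assumes "open S" "\<And>b. b \<in> Basis \<Longrightarrow> has_weak_partial S b f (\<lambda>x. h x \<bullet> b)"
  shows "AE x in lebesgue_on S. weak_grad S f x = h x"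
proof -
  have "AE x in lebesgue_on S. \<forall>b\<in>Basis. h x \<bullet> b = weak_partial S b f x"
    using weak_partial_AE[OF assms(1) _ assms(2)] by (intro AE_finite_allI) auto
  then show ?thesis
  proof eventually_elim
    case (elim x)
    have "weak_grad S f x = (\<Sum>b\<in>Basis. (h x \<bullet> b) *\<^sub>R b)"
      unfolding weak_grad_def by (intro sum.cong refl) (simp add: elim)
    then show ?case by (simp add: euclidean_representation)
  qed
qed

lemma weak_grad_comp:
  assumes S: "open S" "bounded S" and F: "\<And>y. (F has_real_derivative F' y) (at y)"
    and F': "continuous_on UNIV F'" "\<And>y. \<bar>F' y\<bar> \<le> C" and f: "f \<in> vecs (H1 S)"
  shows "AE x in lebesgue_on S. weak_grad S (\<lambda>x. F (f x)) x = F' (f x) *\<^sub>R weak_grad S f x"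
proof (rule weak_grad_AE[OF S(1)])
  show "has_weak_partial S b (\<lambda>x. F (f x)) (\<lambda>x. (F' (f x) *\<^sub>R weak_grad S f x) \<bullet> b)" if "b \<in> Basis" for b
    using H1_comp(2)[OF S F F' f that] that by (simp add: weak_grad_inner)
qed

lemma weak_grad_diff:
  assumes S: "open S" and f: "f \<in> vecs (H1 S)" and h: "h \<in> vecs (H1 S)"
  shows "AE x in lebesgue_on S. weak_grad S (\<lambda>x. f x - h x) x = weak_grad S f x - weak_grad S h x"
proof (rule weak_grad_AE[OF S(1)])
  show "has_weak_partial S b (\<lambda>x. f x - h x) (\<lambda>x. (weak_grad S f x - weak_grad S h x) \<bullet> b)" if b: "b \<in> Basis" for b
    using has_weak_partial_linear[OF S b H1_weak_partial(1)[OF S b f] H1_weak_partial(1)[OF S b h], of 1 "-1"] b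
    by (simp add: inner_diff_left weak_grad_inner)
qed

lemma H1_diff_square_bound:
  assumes S: "open S" and f: "f \<in> vecs (H1 S)" and h: "h \<in> vecs (H1 S)"
  shows "integrable (lebesgue_on S) (\<lambda>x. (f x - h x)\<^sup>2)"
    "integrable (lebesgue_on S) (\<lambda>x. (norm (weak_grad S f x - weak_grad S h x))\<^sup>2)"
    "(LINT x|lebesgue_on S. (f x - h x)\<^sup>2) + (LINT x|lebesgue_on S. (norm (weak_grad S f x - weak_grad S h x))\<^sup>2)
      \<le> (nrm (H1 S) (\<lambda>x. f x - h x))\<^sup>2"
proof -
  let ?M = "lebesgue_on S"
  have d: "(\<lambda>x. f x - h x) \<in> vecs (H1 S)" by (rule seminormed.diff_in[OF H1_seminormed[OF S] f h])
  then show 1: "integrable ?M (\<lambda>x. (f x - h x)\<^sup>2)" by (simp add: mem_H1 mem_L2)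
  have "(\<lambda>x. weak_grad S f x - weak_grad S h x) \<in> vecs (Lp_space ?M 2)"
    by (rule seminormed.diff_in[OF L2_seminormed weak_grad_L2(1)[OF S f] weak_grad_L2(1)[OF S h]])
  then show 2: "integrable ?M (\<lambda>x. (norm (weak_grad S f x - weak_grad S h x))\<^sup>2)" by (simp add: mem_L2)
  have "(LINT x|?M. (norm (weak_grad S f x - weak_grad S h x))\<^sup>2) = (LINT x|?M. (norm (weak_grad S (\<lambda>x. f x - h x) x))\<^sup>2)"
  proof (rule integral_cong_AE)
    show "AE x in ?M. (norm (weak_grad S f x - weak_grad S h x))\<^sup>2 = (norm (weak_grad S (\<lambda>x. f x - h x) x))\<^sup>2"
      using weak_grad_diff[OF S f h] by eventually_elim simp
  qed (use 2 weak_grad_L2(1)[OF S d] in \<open>auto simp: mem_L2\<close>)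
  also have "\<dots> = (\<Sum>b\<in>Basis. (nrm (Lp_space ?M 2) (weak_partial S b (\<lambda>x. f x - h x)))\<^sup>2)"
    by (rule weak_grad_L2(2)[OF S d])
  finally show "(LINT x|?M. (f x - h x)\<^sup>2) + (LINT x|?M. (norm (weak_grad S f x - weak_grad S h x))\<^sup>2)
      \<le> (nrm (H1 S) (\<lambda>x. f x - h x))\<^sup>2"
    using L2_parallel_sum_le_H1[of S "\<lambda>x. f x - h x"] by (simp add: nrm_L2)
qed

subsection \<open>The energy estimate\<close>

text \<open>\<open>cut_logit\<close> and \<open>cut_mult\<close> extend F and F F' from [0, 1] to
  the whole line through the clamp. They have bounded continuous derivatives there, so the chain
  rule applies to every function in \<open>H1\<close>, also off [0, 1].\<close>

definition cut_logit :: "real \<Rightarrow> real \<Rightarrow> real" where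
  "cut_logit \<delta> s = logit_reg \<delta> (soft_clamp (\<delta> / 4) s)"

definition cut_logit' :: "real \<Rightarrow> real \<Rightarrow> real" where
  "cut_logit' \<delta> s = logit_reg' \<delta> (soft_clamp (\<delta> / 4) s) * soft_clamp' (\<delta> / 4) s"

definition cut_mult :: "real \<Rightarrow> real \<Rightarrow> real" where
  "cut_mult \<delta> s = energy_mult \<delta> (soft_clamp (\<delta> / 4) s)"

definition cut_mult' :: "real \<Rightarrow> real \<Rightarrow> real" where
  "cut_mult' \<delta> s = energy_mult' \<delta> (soft_clamp (\<delta> / 4) s) * soft_clamp' (\<delta> / 4) s"

lemma cut_id:
  assumes "0 \<le> s" "s \<le> 1"
  shows "cut_logit \<delta> s = logit_reg \<delta> s" "cut_logit' \<delta> s = logit_reg' \<delta> s"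
    "cut_mult \<delta> s = energy_mult \<delta> s" "cut_mult' \<delta> s = energy_mult' \<delta> s"
  using assms by (simp_all add: cut_logit_def cut_logit'_def cut_mult_def cut_mult'_def soft_clamp_id soft_clamp'_id)

lemma
  assumes "0 < \<delta>"
  shows cut_logit_deriv: "(cut_logit \<delta> has_real_derivative cut_logit' \<delta> s) (at s)"
    and cut_logit'_continuous: "continuous_on UNIV (cut_logit' \<delta>)"
    and cut_logit_bound: "\<exists>C. \<forall>s. \<bar>cut_logit \<delta> s\<bar> \<le> C \<and> \<bar>cut_logit' \<delta> s\<bar> \<le> C"
  unfolding cut_logit_def[abs_def] cut_logit'_def[abs_def]
  by (rule soft_clamp_extension[OF assms logit_reg_deriv logit_reg'_continuous[OF assms]]; assumption)+

lemma
  assumes "0 < \<delta>"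
  shows cut_mult_deriv: "(cut_mult \<delta> has_real_derivative cut_mult' \<delta> s) (at s)"
    and cut_mult'_continuous: "continuous_on UNIV (cut_mult' \<delta>)"
    and cut_mult_bound: "\<exists>C. \<forall>s. \<bar>cut_mult \<delta> s\<bar> \<le> C \<and> \<bar>cut_mult' \<delta> s\<bar> \<le> C"
  unfolding cut_mult_def[abs_def] cut_mult'_def[abs_def]
  by (rule soft_clamp_extension[OF assms energy_mult_deriv[OF _ _ assms] energy_mult'_continuous[OF assms]]; assumption)+

text \<open>\<open>f\<close> stands for u(t), from which the test function is built, and
  \<open>h\<close> for u(\<tau>), at which the equation is evaluated. The bound \<open>B\<close> of
  the multiplier depends on \<delta>, but it multiplies only the distance between \<open>h\<close>
  and \<open>f\<close>.\<close>

lemma energy_pairing_estimate: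
  assumes S: "open S" "bounded S" and d: "0 < \<delta>" "\<delta> \<le> 1 / 2"
    and f: "f \<in> vecs (H1 S)" "AE x in lebesgue_on S. 0 \<le> f x \<and> f x \<le> 1"
    and h: "h \<in> vecs (H1 S)" "AE x in lebesgue_on S. 0 \<le> h x \<and> h x \<le> 1"
    and W: "W \<in> borel_measurable (lebesgue_on S)" "AE x in lebesgue_on S. norm (W x) \<le> R" and R: "0 \<le> R"
    and gm: "(\<lambda>x. gt x (h x)) \<in> borel_measurable (lebesgue_on S)"
    and gb: "\<And>x s. x \<in> S \<Longrightarrow> 0 \<le> s \<Longrightarrow> s \<le> 1 \<Longrightarrow> - (L * s) \<le> gt x s \<and> gt x s \<le> L * (1 - s)"
    and gl: "\<And>x s1 s2. x \<in> S \<Longrightarrow> 0 \<le> s1 \<Longrightarrow> s1 \<le> 1 \<Longrightarrow> 0 \<le> s2 \<Longrightarrow> s2 \<le> 1 \<Longrightarrow> \<bar>gt x s1 - gt x s2\<bar> \<le> L * \<bar>s1 - s2\<bar>"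
    and L: "0 \<le> L" and B: "\<And>s. \<bar>cut_mult \<delta> s\<bar> \<le> B \<and> \<bar>cut_mult' \<delta> s\<bar> \<le> B" and k: "0 < k"
  defines "M \<equiv> lebesgue_on S"
  shows "(LINT x|M. gt x (h x) * cut_mult \<delta> (f x))
     - (LINT x|M. (mobility (h x) *\<^sub>R W x) \<bullet> weak_grad S (\<lambda>x. cut_mult \<delta> (f x)) x)
     - (LINT x|M. weak_grad S h x \<bullet> weak_grad S (\<lambda>x. cut_mult \<delta> (f x)) x)
     \<le> (2 * L + 4 * R\<^sup>2) * (measure M (space M) + (LINT x|M. (cut_logit \<delta> (f x))\<^sup>2))
       - 1 / 2 * (LINT x|M. (norm (weak_grad S (\<lambda>x. cut_logit \<delta> (f x)) x))\<^sup>2)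
       + k * (measure M (space M) + (LINT x|M. (norm (weak_grad S f x))\<^sup>2))
       + ((L * B)\<^sup>2 + (B * R)\<^sup>2 + B\<^sup>2) / k * (nrm (H1 S) (\<lambda>x. h x - f x))\<^sup>2"
proof -
  have Mf: "finite_measure M" unfolding M_def using S by (intro finite_measure_lebesgue_on) auto
  interpret finite_measure M by (rule Mf)
  let ?\<psi> = "\<lambda>x. cut_mult \<delta> (f x)" and ?F = "\<lambda>x. cut_logit \<delta> (f x)"
  obtain C where C: "\<And>s. \<bar>cut_logit \<delta> s\<bar> \<le> C" "\<And>s. \<bar>cut_logit' \<delta> s\<bar> \<le> C" using cut_logit_bound[OF d(1)] by blast
  have Bb: "\<And>s. \<bar>cut_mult \<delta> s\<bar> \<le> B" "\<And>s. \<bar>cut_mult' \<delta> s\<bar> \<le> B" using B by auto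
  note H\<psi> = H1_comp(1)[OF S cut_mult_deriv[OF d(1)] cut_mult'_continuous[OF d(1)] Bb(2) f(1)]
  note HF = H1_comp(1)[OF S cut_logit_deriv[OF d(1)] cut_logit'_continuous[OF d(1)] C(2) f(1)]
  have gr\<psi>: "AE x in M. weak_grad S ?\<psi> x = cut_mult' \<delta> (f x) *\<^sub>R weak_grad S f x"
    unfolding M_def by (rule weak_grad_comp[OF S cut_mult_deriv[OF d(1)] cut_mult'_continuous[OF d(1)] Bb(2) f(1)])
  have grF: "AE x in M. weak_grad S ?F x = cut_logit' \<delta> (f x) *\<^sub>R weak_grad S f x"
    unfolding M_def by (rule weak_grad_comp[OF S cut_logit_deriv[OF d(1)] cut_logit'_continuous[OF d(1)] C(2) f(1)])
  have fm[measurable]: "f \<in> borel_measurable M" "h \<in> borel_measurable M" "W \<in> borel_measurable M" "(\<lambda>x. gt x (h x)) \<in> borel_measurable M"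
    using f(1) h(1) W gm by (auto simp: mem_H1 mem_L2 M_def)
  have \<psi>m[measurable]: "?\<psi> \<in> borel_measurable M" "?F \<in> borel_measurable M"
    using H\<psi> HF by (auto simp: mem_H1 mem_L2 M_def)
  note gL = weak_grad_L2(1)[OF S(1), folded M_def]
  have gm[measurable]: "weak_grad S f \<in> borel_measurable M" "weak_grad S h \<in> borel_measurable M"
      "weak_grad S ?\<psi> \<in> borel_measurable M" "weak_grad S ?F \<in> borel_measurable M"
    using gL[OF f(1)] gL[OF h(1)] gL[OF H\<psi>] gL[OF HF] by (auto simp: mem_L2)
  have i2: "integrable M (\<lambda>x. (norm (weak_grad S f x))\<^sup>2)" "integrable M (\<lambda>x. (norm (weak_grad S h x))\<^sup>2)"
      "integrable M (\<lambda>x. (norm (weak_grad S ?\<psi> x))\<^sup>2)" "integrable M (\<lambda>x. (norm (weak_grad S ?F x))\<^sup>2)"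
    using gL[OF f(1)] gL[OF h(1)] gL[OF H\<psi>] gL[OF HF] by (auto simp: mem_L2)
  have mobm[measurable]: "(\<lambda>x. mobility (h x)) \<in> borel_measurable M" unfolding mobility_def by measurable
  have sp: "AE x in M. x \<in> S" using AE_space[of M] by eventually_elim (simp add: M_def)
  note f01 = f(2)[folded M_def] and h01 = h(2)[folded M_def] and WR = W(2)[folded M_def]
  have B0: "0 \<le> B" using Bb(1)[of 0] by linarith
  have j1: "integrable M (\<lambda>x. gt x (h x) * ?\<psi> x)"
  proof (rule Bochner_Integration.integrable_bound)
    show "integrable M (\<lambda>x. L * B)" by simp
    show "AE x in M. norm (gt x (h x) * ?\<psi> x) \<le> norm (L * B)"
      using sp h01
    proof eventually_elim
      case (elim x)
      have "L * h x \<le> L * 1" "L * (1 - h x) \<le> L * 1" using elim L by (auto intro: mult_left_mono simp del: mult_1_right mult.right_neutral)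
      then have "\<bar>gt x (h x)\<bar> \<le> L" using gb[of x "h x"] elim by auto
      then have "\<bar>gt x (h x)\<bar> * \<bar>?\<psi> x\<bar> \<le> L * B" using Bb(1) L by (intro mult_mono) auto
      then show ?case using L B0 by (simp add: abs_mult)
    qed
  qed measurable
  have j2: "integrable M (\<lambda>x. (mobility (h x) *\<^sub>R W x) \<bullet> weak_grad S ?\<psi> x)"
  proof (rule Bochner_Integration.integrable_bound)
    show "integrable M (\<lambda>x. R\<^sup>2 + (norm (weak_grad S ?\<psi> x))\<^sup>2)" using i2 by simp
    show "AE x in M. norm ((mobility (h x) *\<^sub>R W x) \<bullet> weak_grad S ?\<psi> x) \<le> norm (R\<^sup>2 + (norm (weak_grad S ?\<psi> x))\<^sup>2)"
      using h01 WR
    proof eventually_elim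
      case (elim x)
      have mob: "\<bar>mobility (h x)\<bar> \<le> 1" using elim by (auto simp: mobility_def abs_mult intro!: mult_le_one)
      have "norm ((mobility (h x) *\<^sub>R W x) \<bullet> weak_grad S ?\<psi> x) \<le> norm (mobility (h x) *\<^sub>R W x) * norm (weak_grad S ?\<psi> x)"
        unfolding real_norm_def by (rule Cauchy_Schwarz_ineq2)
      also have "norm (mobility (h x) *\<^sub>R W x) \<le> 1 * R"
        unfolding norm_scaleR using mob elim by (intro mult_mono) auto
      also have "1 * R * norm (weak_grad S ?\<psi> x) \<le> 1 * (norm (weak_grad S ?\<psi> x))\<^sup>2 + R\<^sup>2 / (4 * 1)"
        using young_eps[of 1 R "norm (weak_grad S ?\<psi> x)"] by simp
      also have "\<dots> \<le> norm (R\<^sup>2 + (norm (weak_grad S ?\<psi> x))\<^sup>2)" by simp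
      finally show ?case by (simp add: mult_right_mono)
    qed
  qed measurable
  have j3: "integrable M (\<lambda>x. weak_grad S h x \<bullet> weak_grad S ?\<psi> x)"
  proof (rule Bochner_Integration.integrable_bound)
    show "integrable M (\<lambda>x. (norm (weak_grad S h x))\<^sup>2 + (norm (weak_grad S ?\<psi> x))\<^sup>2)" using i2 by simp
    have "norm (weak_grad S h x \<bullet> weak_grad S ?\<psi> x) \<le> norm ((norm (weak_grad S h x))\<^sup>2 + (norm (weak_grad S ?\<psi> x))\<^sup>2)" for x
    proof -
      have "\<bar>weak_grad S h x \<bullet> weak_grad S ?\<psi> x\<bar> \<le> norm (weak_grad S h x) * norm (weak_grad S ?\<psi> x)" by (rule Cauchy_Schwarz_ineq2)
      also have "\<dots> \<le> 1 * (norm (weak_grad S ?\<psi> x))\<^sup>2 + (norm (weak_grad S h x))\<^sup>2 / (4 * 1)" by (rule young_eps) simp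
      also have "\<dots> \<le> (norm (weak_grad S h x))\<^sup>2 + (norm (weak_grad S ?\<psi> x))\<^sup>2"
        using zero_le_power2[of "norm (weak_grad S h x)"] by simp
      finally show ?thesis by simp
    qed
    then show "AE x in M. norm (weak_grad S h x \<bullet> weak_grad S ?\<psi> x) \<le> norm ((norm (weak_grad S h x))\<^sup>2 + (norm (weak_grad S ?\<psi> x))\<^sup>2)" by simp
  qed measurable
  have j4: "integrable M (\<lambda>x. (?F x)\<^sup>2)" using HF by (simp add: mem_H1 mem_L2 M_def)
  note hf = H1_diff_square_bound[OF S(1) h(1) f(1), folded M_def]
  let ?K = "((L * B)\<^sup>2 + (B * R)\<^sup>2 + B\<^sup>2) / k"
  have "(LINT x|M. gt x (h x) * ?\<psi> x) - (LINT x|M. (mobility (h x) *\<^sub>R W x) \<bullet> weak_grad S ?\<psi> x) - (LINT x|M. weak_grad S h x \<bullet> weak_grad S ?\<psi> x)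
     = (LINT x|M. gt x (h x) * ?\<psi> x - (mobility (h x) *\<^sub>R W x) \<bullet> weak_grad S ?\<psi> x - weak_grad S h x \<bullet> weak_grad S ?\<psi> x)"
    using j1 j2 j3 by simp
  also have "\<dots> \<le> (LINT x|M. (2 * L + 4 * R\<^sup>2) * (1 + (?F x)\<^sup>2) - 1 / 2 * (norm (weak_grad S ?F x))\<^sup>2
      + k * (1 + (norm (weak_grad S f x))\<^sup>2) + ?K * ((h x - f x)\<^sup>2 + (norm (weak_grad S h x - weak_grad S f x))\<^sup>2))"
  proof (rule integral_mono_AE)
    show "integrable M (\<lambda>x. gt x (h x) * ?\<psi> x - (mobility (h x) *\<^sub>R W x) \<bullet> weak_grad S ?\<psi> x - weak_grad S h x \<bullet> weak_grad S ?\<psi> x)"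
      using j1 j2 j3 by simp
    show "integrable M (\<lambda>x. (2 * L + 4 * R\<^sup>2) * (1 + (?F x)\<^sup>2) - 1 / 2 * (norm (weak_grad S ?F x))\<^sup>2
      + k * (1 + (norm (weak_grad S f x))\<^sup>2) + ?K * ((h x - f x)\<^sup>2 + (norm (weak_grad S h x - weak_grad S f x))\<^sup>2))"
      using j4 i2 hf by (intro Bochner_Integration.integrable_add Bochner_Integration.integrable_diff integrable_mult_right integrable_const)
    show "AE x in M. gt x (h x) * ?\<psi> x - (mobility (h x) *\<^sub>R W x) \<bullet> weak_grad S ?\<psi> x - weak_grad S h x \<bullet> weak_grad S ?\<psi> x
      \<le> (2 * L + 4 * R\<^sup>2) * (1 + (?F x)\<^sup>2) - 1 / 2 * (norm (weak_grad S ?F x))\<^sup>2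
      + k * (1 + (norm (weak_grad S f x))\<^sup>2) + ?K * ((h x - f x)\<^sup>2 + (norm (weak_grad S h x - weak_grad S f x))\<^sup>2)"
      using sp f01 h01 WR gr\<psi> grF
    proof eventually_elim
      case (elim x)
      have c: "cut_mult \<delta> (f x) = energy_mult \<delta> (f x)" "cut_mult' \<delta> (f x) = energy_mult' \<delta> (f x)"
        "cut_logit \<delta> (f x) = logit_reg \<delta> (f x)" "cut_logit' \<delta> (f x) = logit_reg' \<delta> (f x)"
        using cut_id[of "f x" \<delta>] elim by auto
      have M: "\<bar>energy_mult \<delta> (f x)\<bar> \<le> B" "energy_mult' \<delta> (f x) \<le> B" using Bb[of "f x"] c by auto
      have "gt x (h x) * energy_mult \<delta> (f x) - mobility (h x) * (W x \<bullet> (energy_mult' \<delta> (f x) *\<^sub>R weak_grad S f x))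
         - weak_grad S h x \<bullet> (energy_mult' \<delta> (f x) *\<^sub>R weak_grad S f x)
        \<le> (2 * L + 4 * R\<^sup>2) * (1 + (logit_reg \<delta> (f x))\<^sup>2) - 1 / 2 * (logit_reg' \<delta> (f x))\<^sup>2 * (norm (weak_grad S f x))\<^sup>2
          + k * (1 + (norm (weak_grad S f x))\<^sup>2) + ?K * ((h x - f x)\<^sup>2 + (norm (weak_grad S h x - weak_grad S f x))\<^sup>2)"
        using elim gb[of x "f x"] gl[of x "h x" "f x"]
        by (intro energy_pointwise[OF d _ _ _ _ _ _ _ L _ M k, where ga = "gt x (f x)"]) auto
      then show ?case using elim by (simp add: c power_mult_distrib mult.left_commute)
    qed
  qed
  also have "\<dots> = (2 * L + 4 * R\<^sup>2) * (measure M (space M) + (LINT x|M. (?F x)\<^sup>2)) - 1 / 2 * (LINT x|M. (norm (weak_grad S ?F x))\<^sup>2)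
      + k * (measure M (space M) + (LINT x|M. (norm (weak_grad S f x))\<^sup>2))
      + ?K * ((LINT x|M. (h x - f x)\<^sup>2) + (LINT x|M. (norm (weak_grad S h x - weak_grad S f x))\<^sup>2))"
    using j4 i2 hf(1,2) by simp
  also have "?K * ((LINT x|M. (h x - f x)\<^sup>2) + (LINT x|M. (norm (weak_grad S h x - weak_grad S f x))\<^sup>2)) \<le> ?K * (nrm (H1 S) (\<lambda>x. h x - f x))\<^sup>2"
    using hf(3) k by (intro mult_left_mono) auto
  finally show ?thesis by simp
qed

text \<open>g is controlled only for values in [0, 1], where v lies merely almost everywhere.
  Truncating v first allows composition with a continuous function, and completeness of Lebesgue
  measure removes the truncation.\<close>

lemma reaction_measurable:
  fixes S :: "'a::euclidean_space set" and g :: "'a \<Rightarrow> real \<Rightarrow> real \<Rightarrow> real"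
  assumes S: "open S" and g: "continuous_on (S \<times> {0..} \<times> {0..1}) (\<lambda>(x, t, s). g x t s)" and t: "0 \<le> t"
    and v: "v \<in> borel_measurable (lebesgue_on S)" "AE x in lebesgue_on S. 0 \<le> v x \<and> v x \<le> 1"
  shows "(\<lambda>x. g x t (v x)) \<in> borel_measurable (lebesgue_on S)"
proof -
  let ?M = "lebesgue_on S" and ?Q = "S \<times> {0..} \<times> {0..1} :: ('a \<times> real \<times> real) set"
  define c where "c x = max 0 (min 1 (v x))" for x
  have idm[measurable]: "(\<lambda>x. x) \<in> borel_measurable ?M"
    by (intro measurable_restrict_space1 borel_measurable_lebesgueI) simp
  have [measurable]: "c \<in> borel_measurable ?M" unfolding c_def using v(1) by measurable
  have "(\<lambda>x. (x, t, c x)) \<in> ?M \<rightarrow>\<^sub>M restrict_space borel ?Q"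
  proof (rule measurable_restrict_space2)
    show "(\<lambda>x. (x, t, c x)) \<in> space ?M \<rightarrow> ?Q" using t by (auto simp: c_def)
    show "(\<lambda>x. (x, t, c x)) \<in> borel_measurable ?M" by (intro borel_measurable_Pair) measurable
  qed
  moreover have "(\<lambda>(x, t, s). g x t s) \<in> borel_measurable (restrict_space borel ?Q)"
    by (rule borel_measurable_continuous_on_restrict[OF g])
  ultimately have "(\<lambda>x. case (x, t, c x) of (x, t, s) \<Rightarrow> g x t s) \<in> borel_measurable ?M"
    by (rule measurable_compose)
  then have m: "(\<lambda>x. g x t (c x)) \<in> borel_measurable ?M" by simp
  show ?thesis
  proof (rule borel_measurable_lebesgue_on_AE[OF m])
    show "AE x in ?M. g x t (c x) = g x t (v x)"
      using v(2) by eventually_elim (simp add: c_def)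
  qed (use S in simp)
qed

lemma tendsto_if_abs_diff_le:
  fixes f h :: "'a \<Rightarrow> real"
  assumes h: "(h \<longlongrightarrow> 0) F" and le: "\<forall>\<^sub>F s in F. \<bar>f s - l\<bar> \<le> h s * c"
  shows "(f \<longlongrightarrow> l) F"
proof (rule LIM_zero_cancel, rule tendsto_0_le[OF h, where K = "\<bar>c\<bar>"])
  show "\<forall>\<^sub>F s in F. norm (f s - l) \<le> norm (h s) * \<bar>c\<bar>"
    using le
  proof eventually_elim
    case (elim s)
    then show ?case using abs_ge_self[of "h s * c"] by (simp add: abs_mult)
  qed
qed

lemma weak_grad_energy_le_H1:
  assumes "open S" "f \<in> vecs (H1 S)"
  shows "(LINT x|lebesgue_on S. (norm (weak_grad S f x))\<^sup>2) \<le> (nrm (H1 S) f)\<^sup>2"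
  using weak_grad_L2(2)[OF assms] L2_parallel_sum_le_H1[of S f]
    zero_le_power2[of "nrm (Lp_space (lebesgue_on S) 2) f"] by linarith

lemma weak_grad_energy_comp_le:
  assumes S: "open S" "bounded S" and F: "\<And>y. (F has_real_derivative F' y) (at y)"
    and F': "continuous_on UNIV F'" "\<And>y. \<bar>F' y\<bar> \<le> C" and f: "f \<in> vecs (H1 S)"
  shows "(LINT x|lebesgue_on S. (norm (weak_grad S (\<lambda>x. F (f x)) x))\<^sup>2) \<le> C\<^sup>2 * (nrm (H1 S) f)\<^sup>2"
proof -
  let ?M = "lebesgue_on S"
  have i: "integrable ?M (\<lambda>x. (norm (weak_grad S f x))\<^sup>2)" "integrable ?M (\<lambda>x. (norm (weak_grad S (\<lambda>x. F (f x)) x))\<^sup>2)"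
    using weak_grad_L2(1)[OF S(1) f] weak_grad_L2(1)[OF S(1) H1_comp(1)[OF S F F' f]] by (auto simp: mem_L2)
  have "(LINT x|?M. (norm (weak_grad S (\<lambda>x. F (f x)) x))\<^sup>2) \<le> (LINT x|?M. C\<^sup>2 * (norm (weak_grad S f x))\<^sup>2)"
  proof (rule integral_mono_AE[OF i(2)])
    show "integrable ?M (\<lambda>x. C\<^sup>2 * (norm (weak_grad S f x))\<^sup>2)" using i(1) by simp
    show "AE x in ?M. (norm (weak_grad S (\<lambda>x. F (f x)) x))\<^sup>2 \<le> C\<^sup>2 * (norm (weak_grad S f x))\<^sup>2"
      using weak_grad_comp[OF S F F' f]
    proof eventually_elim
      case (elim x)
      have "\<bar>F' (f x)\<bar>\<^sup>2 \<le> C\<^sup>2" using F'(2) by (intro power_mono) auto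
      then show ?case using elim by (simp add: power_mult_distrib mult_right_mono)
    qed
  qed
  also have "\<dots> = C\<^sup>2 * (LINT x|?M. (norm (weak_grad S f x))\<^sup>2)" by simp
  also have "\<dots> \<le> C\<^sup>2 * (nrm (H1 S) f)\<^sup>2" using weak_grad_energy_le_H1[OF S(1) f] by (intro mult_left_mono) auto
  finally show ?thesis .
qed

section \<open>Measurability in time of compositions and gradient energies\<close>

lemma strongly_measurable_H1_comp:
  assumes S: "open S" "bounded S" and F: "\<And>y. (F has_real_derivative F' y) (at y)"
    and F': "continuous_on UNIV F'" "\<And>y. \<bar>F' y\<bar> \<le> C"
    and z: "strongly_measurable T (H1 S) z" "AE t in lebesgue_on {0<..<T}. z t \<in> vecs (H1 S)"
  shows "strongly_measurable T (H1 S) (\<lambda>t x. F (z t x))"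
proof (rule strongly_measurable_compose[OF z(1), where \<Psi> = "\<lambda>f x. F (f x)"])
  show "(\<lambda>x. F (f x)) \<in> vecs (H1 S)" if "f \<in> vecs (H1 S)" for f by (rule H1_comp(1)[OF S F F' that])
  show "AE t in lebesgue_on {0<..<T}. \<forall>f. (\<forall>n. f n \<in> vecs (H1 S)) \<longrightarrow> (\<lambda>n::nat. nrm (H1 S) (\<lambda>x. f n x - z t x)) \<longlonglongrightarrow> 0
        \<longrightarrow> (\<lambda>n. nrm (H1 S) (\<lambda>x. F (f n x) - F (z t x))) \<longlonglongrightarrow> 0"
    using z(2)
  proof eventually_elim
    case (elim t)
    show ?case using H1_comp_continuous[OF S F F' _ elim] by blast
  qed
qed

lemma strongly_measurable_weak_partial:
  fixes S :: "'a::euclidean_space set"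
  assumes S: "open S" and z: "strongly_measurable T (H1 S) z" "AE t in lebesgue_on {0<..<T}. z t \<in> vecs (H1 S)"
    and b: "b \<in> Basis"
  shows "strongly_measurable T (Lp_space (lebesgue_on S) 2) (\<lambda>t. weak_partial S b (z t))"
proof (rule strongly_measurable_compose[OF z(1)])
  let ?n = "nrm (Lp_space (lebesgue_on S) 2) :: ('a \<Rightarrow> real) \<Rightarrow> real"
  show "weak_partial S b f \<in> vecs (Lp_space (lebesgue_on S) 2)" if "f \<in> vecs (H1 S)" for f
    by (rule H1_weak_partial(2)[OF S b that])
  show "AE t in lebesgue_on {0<..<T}. \<forall>f. (\<forall>n. f n \<in> vecs (H1 S)) \<longrightarrow> (\<lambda>n::nat. nrm (H1 S) (\<lambda>x. f n x - z t x)) \<longlonglongrightarrow> 0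
        \<longrightarrow> (\<lambda>n. ?n (\<lambda>x. weak_partial S b (f n) x - weak_partial S b (z t) x)) \<longlonglongrightarrow> 0"
    using z(2)
  proof eventually_elim
    case (elim t)
    show ?case
    proof (intro allI impI)
      fix f :: "nat \<Rightarrow> 'a \<Rightarrow> real"
      assume f: "\<forall>n. f n \<in> vecs (H1 S)" and l: "(\<lambda>n. nrm (H1 S) (\<lambda>x. f n x - z t x)) \<longlonglongrightarrow> 0"
      have "?n (\<lambda>x. weak_partial S b (f n) x - weak_partial S b (z t) x) \<le> nrm (H1 S) (\<lambda>x. f n x - z t x)" for n
      proof -
        have "?n (\<lambda>x. weak_partial S b (f n) x - weak_partial S b (z t) x)
          \<le> (\<Sum>b\<in>Basis. ?n (\<lambda>x. weak_partial S b (f n) x - weak_partial S b (z t) x))"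
          using b by (intro member_le_sum) (auto simp: nrm_L2_nonneg)
        then show ?thesis
          using nrm_H1_diff[OF S, of "f n" "z t"] f elim nrm_L2_nonneg[of "lebesgue_on S" "\<lambda>x. f n x - z t x"] by simp
      qed
      then show "(\<lambda>n. ?n (\<lambda>x. weak_partial S b (f n) x - weak_partial S b (z t) x)) \<longlonglongrightarrow> 0"
        by (intro tendsto_sandwich[OF _ _ tendsto_const l]) (auto simp: nrm_L2_nonneg)
    qed
  qed
qed

lemma weak_grad_energy_measurable:
  fixes S :: "'a::euclidean_space set"
  assumes S: "open S" and z: "strongly_measurable T (H1 S) z" "AE t in lebesgue_on {0<..<T}. z t \<in> vecs (H1 S)"
  shows "(\<lambda>t. \<integral>x. (norm (weak_grad S (z t) x))\<^sup>2 \<partial>lebesgue_on S) \<in> borel_measurable (lebesgue_on {0<..<T})"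
proof -
  let ?n = "nrm (Lp_space (lebesgue_on S) 2) :: ('a \<Rightarrow> real) \<Rightarrow> real" and ?I = "lebesgue_on {0<..<T}"
  interpret L2: seminormed "Lp_space (lebesgue_on S) 2 :: ('a, real) fspace" by (rule L2_seminormed)
  have m: "(\<lambda>t. ?n (weak_partial S b (z t))) \<in> borel_measurable ?I" if b: "b \<in> Basis" for b
  proof (rule L2.strongly_measurable_nrm[OF strongly_measurable_weak_partial[OF S z b]])
    show "AE t in ?I. weak_partial S b (z t) \<in> vecs (Lp_space (lebesgue_on S) 2)"
      using z(2) by eventually_elim (rule H1_weak_partial(2)[OF S b])
  qed
  have "(\<lambda>t. \<Sum>b\<in>Basis. (?n (weak_partial S b (z t)))\<^sup>2) \<in> borel_measurable ?I"
    using m by (intro borel_measurable_sum borel_measurable_power) auto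
  then show ?thesis
  proof (rule borel_measurable_lebesgue_on_AE)
    show "AE t in ?I. (\<Sum>b\<in>Basis. (?n (weak_partial S b (z t)))\<^sup>2) = (LINT x|lebesgue_on S. (norm (weak_grad S (z t) x))\<^sup>2)"
      using z(2) by eventually_elim (simp add: weak_grad_L2(2)[OF S])
  qed simp
qed

text \<open>\<open>U\<close> is the \<open>L\<^sup>2\<close>-continuous representative of \<open>u\<close>, truncated to \<open>[0, 1]\<close> at every point, and \<open>W\<close>
  stands for \<open>\<nabla>w\<close>, of which only a bound matters here.\<close>

locale CH_solution =
  fixes S :: "'a::euclidean_space set" and T R L :: real and g :: "'a \<Rightarrow> real \<Rightarrow> real \<Rightarrow> real"
    and u0 :: "'a \<Rightarrow> real" and u :: "'a \<times> real \<Rightarrow> real" and U :: "real \<Rightarrow> 'a \<Rightarrow> real"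
    and W :: "real \<Rightarrow> 'a \<Rightarrow> 'a" and \<xi> :: "real \<Rightarrow> ('a \<Rightarrow> real) \<Rightarrow> real"
  assumes S: "open S" "bounded S" and T: "0 < T" and R: "0 \<le> R" and L: "0 < L"
    and g_cont: "continuous_on (S \<times> {0..} \<times> {0..1}) (\<lambda>(x, t, s). g x t s)"
    and g_lip: "\<And>x t s1 s2. x \<in> S \<Longrightarrow> 0 \<le> t \<Longrightarrow> 0 \<le> s1 \<Longrightarrow> s1 \<le> 1 \<Longrightarrow> 0 \<le> s2 \<Longrightarrow> s2 \<le> 1 \<Longrightarrow> \<bar>g x t s1 - g x t s2\<bar> \<le> L * \<bar>s1 - s2\<bar>"
    and g_sign: "\<And>x t. x \<in> S \<Longrightarrow> 0 \<le> t \<Longrightarrow> 0 \<le> g x t 0 \<and> g x t 1 \<le> 0"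
    and W: "AE t in lebesgue_on {0<..<T}. W t \<in> borel_measurable (lebesgue_on S) \<and> (AE x in lebesgue_on S. norm (W t x) \<le> R)"
    and u_meas: "strongly_measurable T (H1 S) (\<lambda>t x. u (x, t))"
    and u_H1: "AE t in lebesgue_on {0<..<T}. (\<lambda>x. u (x, t)) \<in> vecs (H1 S)"
    and u_int: "integrable (lebesgue_on {0<..<T}) (\<lambda>t. (nrm (H1 S) (\<lambda>x. u (x, t)))\<^sup>2)"
    and u01: "AE t in lebesgue_on {0<..<T}. AE x in lebesgue_on S. 0 \<le> u (x, t) \<and> u (x, t) \<le> 1"
    and U01: "\<And>t x. 0 \<le> U t x" "\<And>t x. U t x \<le> 1"
    and U_L2: "\<And>t. t \<in> {0..T} \<Longrightarrow> U t \<in> vecs (Lp_space (lebesgue_on S) 2)"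
    and U_cont: "\<And>t. t \<in> {0..T} \<Longrightarrow> ((\<lambda>s. nrm (Lp_space (lebesgue_on S) 2) (\<lambda>x. U s x - U t x)) \<longlongrightarrow> 0) (at t within {0..T})"
    and U_u: "AE t in lebesgue_on {0<..<T}. AE x in lebesgue_on S. U t x = u (x, t)"
    and U_0: "AE x in lebesgue_on S. U 0 x = u0 x"
    and \<xi>_meas: "strongly_measurable T (dual_space (H1 S)) \<xi>"
    and \<xi>_dual: "AE t in lebesgue_on {0<..<T}. \<xi> t \<in> vecs (dual_space (H1 S))"
    and \<xi>_int: "integrable (lebesgue_on {0<..<T}) (\<lambda>t. nrm (dual_space (H1 S)) (\<xi> t))"
    and \<xi>_deriv: "has_time_derivative S T (\<lambda>t x. u (x, t)) \<xi>"
    and weak_eq: "AE t in lebesgue_on {0<..<T}. \<forall>\<psi>\<in>vecs (H1 S).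
           \<xi> t \<psi> + (LINT x|lebesgue_on S. (mobility (u (x, t)) *\<^sub>R W t x) \<bullet> weak_grad S \<psi> x)
           + (LINT x|lebesgue_on S. weak_grad S (\<lambda>y. u (y, t)) x \<bullet> weak_grad S \<psi> x)
           = (LINT x|lebesgue_on S. g x t (u (x, t)) * \<psi> x)"
    and u0_01: "AE x in lebesgue_on S. 0 < u0 x \<and> u0 x < 1"
    and u0_L2: "(\<lambda>x. f_prime (u0 x)) \<in> vecs (Lp_space (lebesgue_on S) 2)"
begin

abbreviation "M \<equiv> lebesgue_on S"
abbreviation "I \<equiv> lebesgue_on {0<..<T}"
abbreviation "L2 \<equiv> (Lp_space M 2 :: ('a, real) fspace)"

sublocale H1: seminormed "H1 S" by (rule H1_seminormed[OF S(1)])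
sublocale L2: seminormed L2 by (rule L2_seminormed)
sublocale M: finite_measure M using S by (intro finite_measure_lebesgue_on) auto
sublocale I: finite_measure I by (intro finite_measure_lebesgue_on) auto

text \<open>Evaluating at \<psi> the simple functions that approximate \<xi> in the dual norm gives
  measurability; the dual norm of \<xi> times the norm of \<psi> is the majorant.\<close>

lemma \<xi>_pairing_integrable:
  assumes \<psi>: "\<psi> \<in> vecs (H1 S)"
  shows "integrable I (\<lambda>t. \<xi> t \<psi>)"
proof -
  let ?d = "nrm (dual_space (H1 S)) :: (('a \<Rightarrow> real) \<Rightarrow> real) \<Rightarrow> real"
  obtain s where s: "\<forall>n. simple_function I (s n) \<and> (\<forall>t\<in>{0<..<T}. s n t \<in> vecs (dual_space (H1 S)))"
      "AE t in I. (\<lambda>n::nat. ?d (\<lambda>x. s n t x - \<xi> t x)) \<longlonglongrightarrow> 0"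
    using \<xi>_meas unfolding strongly_measurable_def by blast
  have m: "(\<lambda>t. \<xi> t \<psi>) \<in> borel_measurable I"
  proof (rule AE_LIMSEQ_measurable)
    show "(\<lambda>t. s n t \<psi>) \<in> borel_measurable I" for n
    proof -
      have "simple_function I (s n)" using s(1) by blast
      from borel_measurable_simple_function[OF simple_function_compose[OF this, of "\<lambda>f. f \<psi>"]]
      show ?thesis by (simp add: comp_def)
    qed
    show "AE t in I. (\<lambda>n. s n t \<psi>) \<longlonglongrightarrow> \<xi> t \<psi>"
      using s(2) \<xi>_dual AE_space[of I]
    proof eventually_elim
      case (elim t)
      have t: "t \<in> {0<..<T}" using elim(3) by simp
      have "\<bar>s n t \<psi> - \<xi> t \<psi>\<bar> \<le> ?d (\<lambda>x. s n t x - \<xi> t x) * nrm (H1 S) \<psi>" for n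
        using s(1) t by (intro dual_bound[OF H1.seminormed_axioms dual_diff_in[OF _ elim(2)] \<psi>]) auto
      then show ?case by (intro tendsto_if_abs_diff_le[OF elim(1)] always_eventually allI)
    qed
  qed simp
  show ?thesis
  proof (rule Bochner_Integration.integrable_bound[OF _ m])
    show "integrable I (\<lambda>t. ?d (\<xi> t) * nrm (H1 S) \<psi>)" using \<xi>_int by simp
    show "AE t in I. norm (\<xi> t \<psi>) \<le> norm (?d (\<xi> t) * nrm (H1 S) \<psi>)"
      using \<xi>_dual
    proof eventually_elim
      case (elim t)
      show ?case using dual_bound[OF H1.seminormed_axioms elim \<psi>] by simp
    qed
  qed
qed

lemma U_pairing_continuous:
  assumes \<psi>: "\<psi> \<in> vecs L2"
  shows "continuous_on {0..T} (\<lambda>t. \<integral>x. U t x * \<psi> x \<partial>M)"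
  unfolding continuous_on
proof
  fix t assume t: "t \<in> {0..T}"
  have "\<bar>(LINT x|M. U s x * \<psi> x) - (LINT x|M. U t x * \<psi> x)\<bar> \<le> nrm L2 (\<lambda>x. U s x - U t x) * nrm L2 \<psi>" if s: "s \<in> {0..T}" for s
  proof -
    have "(LINT x|M. U s x * \<psi> x) - (LINT x|M. U t x * \<psi> x) = (LINT x|M. (U s x - U t x) * \<psi> x)"
      using L2_mult_integrable[OF U_L2[OF s] \<psi>] L2_mult_integrable[OF U_L2[OF t] \<psi>]
      by (simp add: left_diff_distrib)
    then show ?thesis using L2_Cauchy_Schwarz[OF L2.diff_in[OF U_L2[OF s] U_L2[OF t]] \<psi>] by simp
  qed
  then have "\<forall>\<^sub>F s in at t within {0..T}. \<bar>(LINT x|M. U s x * \<psi> x) - (LINT x|M. U t x * \<psi> x)\<bar>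
      \<le> nrm L2 (\<lambda>x. U s x - U t x) * nrm L2 \<psi>"
    by (simp add: eventually_at_filter)
  then show "((\<lambda>s. \<integral>x. U s x * \<psi> x \<partial>M) \<longlongrightarrow> (LINT x|M. U t x * \<psi> x)) (at t within {0..T})"
    by (rule tendsto_if_abs_diff_le[OF U_cont[OF t]])
qed

text \<open>Pairing with a fixed \<psi> turns the dual-valued time derivative into a scalar weak
  derivative on (0, T), to which the one-dimensional formula applies. \<open>U\<close> supplies the
  continuous representative, so the formula holds for every pair of times.\<close>

lemma pairing_difference:
  assumes \<psi>: "\<psi> \<in> vecs (H1 S)" and st: "0 < s" "s < t" "t < T"
  shows "(LINT x|M. U t x * \<psi> x) - (LINT x|M. U s x * \<psi> x) = (LINT \<tau>|lebesgue. indicator {s..t} \<tau> * \<xi> \<tau> \<psi>)"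
proof (rule weak_derivative_interval_difference[OF _ _ _ st])
  let ?p = "\<lambda>t. \<integral>x. u (x, t) * \<psi> x \<partial>M" and ?p' = "\<lambda>t. \<integral>x. U t x * \<psi> x \<partial>M"
  have \<psi>2: "\<psi> \<in> vecs L2" using \<psi> by (simp add: mem_H1)
  show c: "continuous_on {0<..<T} ?p'"
    by (rule continuous_on_subset[OF U_pairing_continuous[OF \<psi>2]]) auto
  show ae: "AE t in I. ?p t = ?p' t"
    using U_u AE_space[of I] u_H1
  proof eventually_elim
    case (elim t)
    have "U t \<in> vecs L2" "(\<lambda>x. u (x, t)) \<in> vecs L2" using elim U_L2[of t] by (auto simp: mem_H1)
    then have "(\<lambda>x. u (x, t) * \<psi> x) \<in> borel_measurable M" "(\<lambda>x. U t x * \<psi> x) \<in> borel_measurable M"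
      using \<psi>2 by (auto simp: mem_L2)
    then show ?case by (rule integral_cong_AE) (use elim(1) in eventually_elim, simp)
  qed
  have "continuous_on {0..T} ?p'" by (rule U_pairing_continuous[OF \<psi>2])
  then have "?p' absolutely_integrable_on {0..T}" by (rule absolutely_integrable_continuous_real)
  then have "?p' absolutely_integrable_on {0<..<T}" by (rule set_integrable_subset) auto
  then have i': "integrable I ?p'" by (simp add: set_integrable_def integrable_restrict_space)
  have "?p \<in> borel_measurable I"
    by (rule borel_measurable_lebesgue_on_AE[OF borel_measurable_integrable[OF i']]) (use ae in \<open>auto elim: eventually_mono\<close>)
  then have i: "integrable I ?p" using i' ae integrable_cong_AE by blast
  show "has_weak_partial {0<..<T} 1 ?p (\<lambda>t. \<xi> t \<psi>)"
    unfolding has_weak_partial_def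
  proof (intro conjI ballI)
    show "locally_integrable_on ?p {0<..<T}" "locally_integrable_on (\<lambda>t. \<xi> t \<psi>) {0<..<T}"
      using i \<xi>_pairing_integrable[OF \<psi>] by (auto intro: integrable_locally_integrable_on)
    fix \<phi> :: "real \<Rightarrow> real" assume \<phi>: "\<phi> \<in> test_functions {0<..<T}"
    have "frechet_derivative \<phi> (at t) 1 = deriv \<phi> t" for t
    proof -
      have "\<phi> differentiable (at t)"
        using test_function_has_derivative[OF \<phi>] by (auto simp: differentiable_def)
      then obtain D where D: "(\<phi> has_real_derivative D) (at t)" by (auto simp: real_differentiable_def)
      from frechet_derivative_eqI[OF this[unfolded has_field_derivative_def]] DERIV_imp_deriv[OF D]
      show ?thesis by simp
    qed
    then show "(LINT t|I. ?p t * frechet_derivative \<phi> (at t) 1) = - (LINT t|I. \<xi> t \<psi> * \<phi> t)"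
      using \<xi>_deriv \<phi> \<psi> unfolding has_time_derivative_def by simp
  qed
qed

lemma g_bounds:
  assumes "x \<in> S" "0 \<le> t" "0 \<le> s" "s \<le> 1"
  shows "- (L * s) \<le> g x t s \<and> g x t s \<le> L * (1 - s)"
  using g_lip[OF assms(1,2), of s 0] g_lip[OF assms(1,2), of s 1] g_sign[OF assms(1,2)] assms(3,4) by auto

text \<open>F and F' being bounded after the cut, F^2 is Lipschitz with constant 2 C^2; L2
  continuity of \<open>U\<close> therefore passes to the energy through the embedding of L2 into
  L1.\<close>

lemma cut_logit_U:
  assumes d: "0 < \<delta>"
  shows "t \<in> {0..T} \<Longrightarrow> integrable M (\<lambda>x. (cut_logit \<delta> (U t x))\<^sup>2)"
    and "continuous_on {0..T} (\<lambda>t. \<integral>x. (cut_logit \<delta> (U t x))\<^sup>2 \<partial>M)"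
proof -
  obtain C where C: "\<And>s. \<bar>cut_logit \<delta> s\<bar> \<le> C" "\<And>s. \<bar>cut_logit' \<delta> s\<bar> \<le> C" using cut_logit_bound[OF d] by blast
  have C0: "0 \<le> C" using C(1)[of 0] by linarith
  have cc: "continuous_on UNIV (cut_logit \<delta>)"
    using cut_logit_deriv[OF d] by (meson DERIV_isCont continuous_at_imp_continuous_on)
  have [measurable]: "cut_logit \<delta> \<in> borel_measurable borel" by (rule borel_measurable_continuous_onI[OF cc])
  have sq: "(cut_logit \<delta> s)\<^sup>2 \<le> C\<^sup>2" for s using C(1)[of s] by (metis abs_le_square_iff abs_of_nonneg C0)
  have i: "integrable M (\<lambda>x. (cut_logit \<delta> (U t x))\<^sup>2)" if t: "t \<in> {0..T}" for t
  proof (rule M.integrable_const_bound[where B = "C\<^sup>2"])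
    have [measurable]: "U t \<in> borel_measurable M" using U_L2[OF t] by (simp add: mem_L2)
    show "(\<lambda>x. (cut_logit \<delta> (U t x))\<^sup>2) \<in> borel_measurable M" by measurable
  qed (use sq in auto)
  then show "t \<in> {0..T} \<Longrightarrow> integrable M (\<lambda>x. (cut_logit \<delta> (U t x))\<^sup>2)" .
  have lip: "\<bar>(cut_logit \<delta> a)\<^sup>2 - (cut_logit \<delta> b)\<^sup>2\<bar> \<le> 2 * C\<^sup>2 * \<bar>a - b\<bar>" for a b
  proof -
    have "\<bar>(cut_logit \<delta> a)\<^sup>2 - (cut_logit \<delta> b)\<^sup>2\<bar> = \<bar>cut_logit \<delta> a + cut_logit \<delta> b\<bar> * \<bar>cut_logit \<delta> a - cut_logit \<delta> b\<bar>"
      by (simp add: abs_mult[symmetric] power2_eq_square algebra_simps)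
    also have "\<dots> \<le> (2 * C) * (C * \<bar>a - b\<bar>)"
    proof (rule mult_mono)
      show "\<bar>cut_logit \<delta> a + cut_logit \<delta> b\<bar> \<le> 2 * C" using C(1)[of a] C(1)[of b] by linarith
      show "\<bar>cut_logit \<delta> a - cut_logit \<delta> b\<bar> \<le> C * \<bar>a - b\<bar>"
        using real_lipschitz_of_deriv[OF cut_logit_deriv[OF d] C(2)] .
    qed (use C0 in auto)
    finally show ?thesis by (simp add: power2_eq_square)
  qed
  show "continuous_on {0..T} (\<lambda>t. \<integral>x. (cut_logit \<delta> (U t x))\<^sup>2 \<partial>M)"
    unfolding continuous_on
  proof
    fix t assume t: "t \<in> {0..T}"
    let ?B = "\<lambda>s. nrm L2 (\<lambda>x. U s x - U t x) * (2 * C\<^sup>2 * sqrt (measure M (space M)))"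
    have "\<bar>(LINT x|M. (cut_logit \<delta> (U s x))\<^sup>2) - (LINT x|M. (cut_logit \<delta> (U t x))\<^sup>2)\<bar> \<le> ?B s" if s: "s \<in> {0..T}" for s
    proof -
      note dL = L2.diff_in[OF U_L2[OF s] U_L2[OF t]]
      have "\<bar>(LINT x|M. (cut_logit \<delta> (U s x))\<^sup>2) - (LINT x|M. (cut_logit \<delta> (U t x))\<^sup>2)\<bar>
        = \<bar>\<integral>x. (cut_logit \<delta> (U s x))\<^sup>2 - (cut_logit \<delta> (U t x))\<^sup>2 \<partial>M\<bar>" using i[OF s] i[OF t] by simp
      also have "\<dots> \<le> (LINT x|M. \<bar>(cut_logit \<delta> (U s x))\<^sup>2 - (cut_logit \<delta> (U t x))\<^sup>2\<bar>)" by (rule integral_abs_bound)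
      also have "\<dots> \<le> (LINT x|M. 2 * C\<^sup>2 * \<bar>U s x - U t x\<bar>)"
        using lip i[OF s] i[OF t] L2_L1_bound(1)[OF M.finite_measure_axioms dL] by (intro integral_mono) auto
      also have "\<dots> = 2 * C\<^sup>2 * (LINT x|M. \<bar>U s x - U t x\<bar>)" by simp
      also have "\<dots> \<le> 2 * C\<^sup>2 * (sqrt (measure M (space M)) * nrm L2 (\<lambda>x. U s x - U t x))"
        using L2_L1_bound(2)[OF M.finite_measure_axioms dL] by (intro mult_left_mono) auto
      finally show ?thesis by (simp add: mult_ac)
    qed
    then have "\<forall>\<^sub>F s in at t within {0..T}. \<bar>(LINT x|M. (cut_logit \<delta> (U s x))\<^sup>2) - (LINT x|M. (cut_logit \<delta> (U t x))\<^sup>2)\<bar> \<le> ?B s"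
      by (simp add: eventually_at_filter)
    then show "((\<lambda>s. \<integral>x. (cut_logit \<delta> (U s x))\<^sup>2 \<partial>M) \<longlongrightarrow> (LINT x|M. (cut_logit \<delta> (U t x))\<^sup>2)) (at t within {0..T})"
      by (rule tendsto_if_abs_diff_le[OF U_cont[OF t]])
  qed
qed

end

lemma continuous_integrable_lebesgue_on_open:
  fixes f :: "real \<Rightarrow> real"
  assumes "continuous_on {a..b} f"
  shows "integrable (lebesgue_on {a<..<b}) f"
proof -
  have "f absolutely_integrable_on {a..b}" by (rule absolutely_integrable_continuous_real[OF assms])
  then have "f absolutely_integrable_on {a<..<b}" by (rule set_integrable_subset) auto
  then show ?thesis by (simp add: set_integrable_def integrable_restrict_space)
qed

lemma integral_indicator_lebesgue_on:
  fixes h :: "real \<Rightarrow> real"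
  assumes "A \<subseteq> S" "S \<in> sets lebesgue"
  shows "(LINT \<tau>|lebesgue_on S. indicator A \<tau> * h \<tau>) = (LINT \<tau>|lebesgue. indicator A \<tau> * h \<tau>)"
proof -
  have "(LINT \<tau>|lebesgue_on S. indicator A \<tau> * h \<tau>) = (LINT \<tau>|lebesgue. indicator S \<tau> *\<^sub>R (indicator A \<tau> * h \<tau>))"
    using assms(2) by (intro integral_restrict_space) auto
  also have "\<dots> = (LINT \<tau>|lebesgue. indicator A \<tau> * h \<tau>)"
    using assms(1) by (intro Bochner_Integration.integral_cong) (auto simp: indicator_def)
  finally show ?thesis .
qed

context CH_solution
begin

text \<open>The energy is built from the L2-continuous representative \<open>U\<close> and makes
  sense at every time, while the two gradient integrals use \<open>u\<close>, which lies in
  \<open>H1\<close> for almost every time only. The factor 1/2 is left out.\<close>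

definition "logit_energy \<delta> t = (LINT x|M. (cut_logit \<delta> (U t x))\<^sup>2)"
definition "dissipation \<delta> t = (LINT x|M. (norm (weak_grad S (\<lambda>x. cut_logit \<delta> (u (x, t))) x))\<^sup>2)"
definition "gradient_energy t = (LINT x|M. (norm (weak_grad S (\<lambda>x. u (x, t)) x))\<^sup>2)"

lemma u_measurable: "(\<lambda>x. u (x, t)) \<in> vecs (H1 S) \<Longrightarrow> (\<lambda>x. u (x, t)) \<in> borel_measurable M"
  by (simp add: mem_H1 mem_L2)

text \<open>The error has a part proportional to k, which stays, and a part of size 1/k times the
  squared distance of u(\<tau>) from u(t), which averaging will remove. So k can be sent to 0 only
  after the averaging.\<close>

lemma energy_increment:
  assumes d: "0 < \<delta>" "\<delta> \<le> 1 / 2" and B: "\<And>s. \<bar>cut_mult \<delta> s\<bar> \<le> B \<and> \<bar>cut_mult' \<delta> s\<bar> \<le> B" and k: "0 < k"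
  shows "AE t in I. \<forall>s. 0 < s \<and> s < t \<longrightarrow> logit_energy \<delta> t / 2 - logit_energy \<delta> s / 2
     \<le> (t - s) * ((2 * L + 4 * R\<^sup>2) * (measure M (space M) + logit_energy \<delta> t) - 1 / 2 * dissipation \<delta> t
          + k * (measure M (space M) + gradient_energy t))
       + ((L * B)\<^sup>2 + (B * R)\<^sup>2 + B\<^sup>2) / k * (LINT \<tau>|I. indicator {s..t} \<tau> * (nrm (H1 S) (\<lambda>x. u (x, \<tau>) - u (x, t)))\<^sup>2)"
  using u_H1 u01 U_u AE_space[of I]
proof eventually_elim
  case (elim t)
  define f where "f = (\<lambda>x. u (x, t))"
  define \<psi> where "\<psi> = (\<lambda>x. cut_mult \<delta> (f x))"
  define G where "G = (2 * L + 4 * R\<^sup>2) * (measure M (space M) + logit_energy \<delta> t) - 1 / 2 * dissipation \<delta> t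
          + k * (measure M (space M) + gradient_energy t)"
  define C where "C = ((L * B)\<^sup>2 + (B * R)\<^sup>2 + B\<^sup>2) / k"
  define q where "q = (\<lambda>\<tau>. (nrm (H1 S) (\<lambda>x. u (x, \<tau>) - f x))\<^sup>2)"
  have f: "f \<in> vecs (H1 S)" "AE x in M. 0 \<le> f x \<and> f x \<le> 1" "AE x in M. U t x = f x" and t: "0 < t" "t < T"
    using elim by (auto simp: f_def)
  have Bb: "\<And>s. \<bar>cut_mult' \<delta> s\<bar> \<le> B" using B by auto
  have \<psi>: "\<psi> \<in> vecs (H1 S)"
    unfolding \<psi>_def by (rule H1_comp(1)[OF S cut_mult_deriv[OF d(1)] cut_mult'_continuous[OF d(1)] Bb f(1)])
  then have \<psi>2: "\<psi> \<in> vecs L2" by (simp add: mem_H1)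
  have fm[measurable]: "f \<in> borel_measurable M" using f(1) by (simp add: mem_H1 mem_L2)
  have Um[measurable]: "U t \<in> borel_measurable M" using U_L2[of t] t by (simp add: mem_L2)
  have [measurable]: "cut_logit \<delta> \<in> borel_measurable borel"
    using cut_logit_deriv[OF d(1)] by (intro borel_measurable_continuous_onI) (meson DERIV_isCont continuous_at_imp_continuous_on)
  have Y: "(LINT x|M. (cut_logit \<delta> (f x))\<^sup>2) = logit_energy \<delta> t"
    unfolding logit_energy_def 
  proof (rule integral_cong_AE)
    show "AE x in M. (cut_logit \<delta> (f x))\<^sup>2 = (cut_logit \<delta> (U t x))\<^sup>2"
      using f(3) by eventually_elim simp
  qed measurable
  have ae: "AE \<tau> in I. \<xi> \<tau> \<psi> \<le> G + C * q \<tau>"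
    using u_H1 u01 W weak_eq AE_space[of I]
  proof eventually_elim
    case (elim \<tau>)
    have \<tau>: "0 \<le> \<tau>" using elim(5) by simp
    have gm: "(\<lambda>x. g x \<tau> (u (x, \<tau>))) \<in> borel_measurable M"
      by (rule reaction_measurable[OF S(1) g_cont \<tau> u_measurable[OF elim(1)] elim(2)])
    have "\<xi> \<tau> \<psi> = (LINT x|M. g x \<tau> (u (x, \<tau>)) * \<psi> x) - (LINT x|M. (mobility (u (x, \<tau>)) *\<^sub>R W \<tau> x) \<bullet> weak_grad S \<psi> x)
        - (LINT x|M. weak_grad S (\<lambda>y. u (y, \<tau>)) x \<bullet> weak_grad S \<psi> x)"
      using elim(4) \<psi> by (simp add: algebra_simps)
    also have "\<dots> \<le> (2 * L + 4 * R\<^sup>2) * (measure M (space M) + (LINT x|M. (cut_logit \<delta> (f x))\<^sup>2))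
       - 1 / 2 * (LINT x|M. (norm (weak_grad S (\<lambda>x. cut_logit \<delta> (f x)) x))\<^sup>2)
       + k * (measure M (space M) + (LINT x|M. (norm (weak_grad S f x))\<^sup>2))
       + ((L * B)\<^sup>2 + (B * R)\<^sup>2 + B\<^sup>2) / k * (nrm (H1 S) (\<lambda>x. u (x, \<tau>) - f x))\<^sup>2"
      unfolding \<psi>_def
    proof (rule energy_pairing_estimate[where gt = "\<lambda>x. g x \<tau>", OF S d f(1,2) elim(1,2) _ _ R gm _ _ _ B k])
      show "W \<tau> \<in> borel_measurable M" "AE x in M. norm (W \<tau> x) \<le> R" using elim(3) by auto
      show "- (L * s) \<le> g x \<tau> s \<and> g x \<tau> s \<le> L * (1 - s)" if "x \<in> S" "0 \<le> s" "s \<le> 1" for x s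
        by (rule g_bounds[OF that(1) \<tau> that(2,3)])
      show "\<bar>g x \<tau> s1 - g x \<tau> s2\<bar> \<le> L * \<bar>s1 - s2\<bar>" if "x \<in> S" "0 \<le> s1" "s1 \<le> 1" "0 \<le> s2" "s2 \<le> 1" for x s1 s2
        by (rule g_lip[OF that(1) \<tau> that(2-5)])
    qed (use L in simp)
    finally show ?case
      unfolding Y unfolding G_def C_def q_def dissipation_def gradient_energy_def f_def .
  qed
  have qi: "integrable I q"
  proof (rule Bochner_Integration.integrable_bound)
    show "integrable I (\<lambda>\<tau>. 2 * (nrm (H1 S) (\<lambda>x. u (x, \<tau>)))\<^sup>2 + 2 * (nrm (H1 S) f)\<^sup>2)" using u_int by simp
    show "q \<in> borel_measurable I"
      unfolding q_def by (intro borel_measurable_power H1.strongly_measurable_nrm_diff[OF u_meas u_H1 f(1)])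
    show "AE \<tau> in I. norm (q \<tau>) \<le> norm (2 * (nrm (H1 S) (\<lambda>x. u (x, \<tau>)))\<^sup>2 + 2 * (nrm (H1 S) f)\<^sup>2)"
      using u_H1
    proof eventually_elim
      case (elim \<tau>)
      let ?a = "nrm (H1 S) (\<lambda>x. u (x, \<tau>))" and ?b = "nrm (H1 S) f"
      have "q \<tau> \<le> (?a + ?b)\<^sup>2"
        unfolding q_def by (intro power_mono H1.nrm_diff_le[OF elim f(1)] H1.nrm_nonneg[OF H1.diff_in[OF elim f(1)]])
      also have "\<dots> \<le> 2 * ?a\<^sup>2 + 2 * ?b\<^sup>2" using zero_le_power2[of "?a - ?b"] by (simp add: power2_eq_square algebra_simps)
      finally show ?case by (simp add: q_def)
    qed
  qed
  have "logit_energy \<delta> t / 2 - logit_energy \<delta> s / 2 \<le> (t - s) * G + C * (LINT \<tau>|I. indicator {s..t} \<tau> * q \<tau>)"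
    if s: "0 < s" "s < t" for s
  proof -
    have tT: "t \<in> {0..T}" "s \<in> {0..T}" using t s by auto
    note iU = L2_mult_integrable[OF U_L2[OF tT(1)] \<psi>2] L2_mult_integrable[OF U_L2[OF tT(2)] \<psi>2]
    have sub: "{s..t} \<subseteq> {0<..<T}" using s t by auto
    have im: "integrable I (\<lambda>\<tau>. indicator {s..t} \<tau> * h \<tau>)" if "integrable I h" for h :: "real \<Rightarrow> real"
      by (rule integrable_indicator_mult[OF that]) simp
    have "logit_energy \<delta> t / 2 - logit_energy \<delta> s / 2 = (LINT x|M. (cut_logit \<delta> (U t x))\<^sup>2 / 2 - (cut_logit \<delta> (U s x))\<^sup>2 / 2)"
      unfolding logit_energy_def using cut_logit_U(1)[OF d(1) tT(1)] cut_logit_U(1)[OF d(1) tT(2)] by simp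
    \<comment> \<open>The tangent is taken at the later time t, so that the multiplier \<psi> is the
      same over the whole interval [s, t] and \<xi> can be integrated against it.\<close>
    also have "\<dots> \<le> (LINT x|M. U t x * \<psi> x - U s x * \<psi> x)"
    proof (rule integral_mono_AE)
      show "integrable M (\<lambda>x. (cut_logit \<delta> (U t x))\<^sup>2 / 2 - (cut_logit \<delta> (U s x))\<^sup>2 / 2)"
        using cut_logit_U(1)[OF d(1) tT(1)] cut_logit_U(1)[OF d(1) tT(2)] by simp
      show "integrable M (\<lambda>x. U t x * \<psi> x - U s x * \<psi> x)" using iU by simp
      show "AE x in M. (cut_logit \<delta> (U t x))\<^sup>2 / 2 - (cut_logit \<delta> (U s x))\<^sup>2 / 2 \<le> U t x * \<psi> x - U s x * \<psi> x"
        using f(3)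
      proof eventually_elim
        case (elim x)
        have "(logit_reg \<delta> (U t x))\<^sup>2 / 2 - (logit_reg \<delta> (U s x))\<^sup>2 / 2 \<le> energy_mult \<delta> (U t x) * (U t x - U s x)"
          by (rule logit_reg_square_convex[OF d(1) U01 U01])
        then show ?case
          using cut_id(1,3)[OF U01[of t x]] cut_id(1)[OF U01[of s x]] elim by (simp add: \<psi>_def algebra_simps)
      qed
    qed
    also have "\<dots> = (LINT x|M. U t x * \<psi> x) - (LINT x|M. U s x * \<psi> x)" using iU by simp
    also have "\<dots> = (LINT \<tau>|lebesgue. indicator {s..t} \<tau> * \<xi> \<tau> \<psi>)" by (rule pairing_difference[OF \<psi> s t(2)])
    also have "\<dots> = (LINT \<tau>|I. indicator {s..t} \<tau> * \<xi> \<tau> \<psi>)" by (rule integral_indicator_lebesgue_on[OF sub, symmetric]) simp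
    also have "\<dots> \<le> (LINT \<tau>|I. indicator {s..t} \<tau> * (G + C * q \<tau>))"
    proof (rule integral_mono_AE[OF im[OF \<xi>_pairing_integrable[OF \<psi>]] im])
      show "integrable I (\<lambda>\<tau>. G + C * q \<tau>)" using qi by simp
      show "AE \<tau> in I. indicator {s..t} \<tau> * \<xi> \<tau> \<psi> \<le> indicator {s..t} \<tau> * (G + C * q \<tau>)"
        using ae by eventually_elim (auto simp: indicator_def)
    qed
    also have "\<dots> = (LINT \<tau>|I. indicator {s..t} \<tau> * G + C * (indicator {s..t} \<tau> * q \<tau>))"
      by (simp add: algebra_simps)
    also have "\<dots> = (LINT \<tau>|I. indicator {s..t} \<tau> * G) + C * (LINT \<tau>|I. indicator {s..t} \<tau> * q \<tau>)"
      using im[OF qi] im[of "\<lambda>\<tau>. G"] by simp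
    also have "(LINT \<tau>|I. indicator {s..t} \<tau> * G) = (t - s) * G"
      using s by (subst integral_indicator_lebesgue_on[OF sub]) (auto simp: measure_def)
    finally show ?thesis by simp
  qed
  then show ?case unfolding G_def C_def q_def f_def by blast
qed

lemma dissipation_integrable:
  assumes d: "0 < \<delta>"
  shows "integrable I (dissipation \<delta>)" "0 \<le> dissipation \<delta> t"
proof -
  obtain C where C: "\<And>s. \<bar>cut_logit' \<delta> s\<bar> \<le> C" using cut_logit_bound[OF d] by blast
  show "0 \<le> dissipation \<delta> t" for t by (simp add: dissipation_def)
  note F = cut_logit_deriv[OF d] cut_logit'_continuous[OF d] C
  show "integrable I (dissipation \<delta>)"
  proof (rule Bochner_Integration.integrable_bound)
    show "integrable I (\<lambda>t. C\<^sup>2 * (nrm (H1 S) (\<lambda>x. u (x, t)))\<^sup>2)" using u_int by simp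
    show "dissipation \<delta> \<in> borel_measurable I"
      unfolding dissipation_def[abs_def]
    proof (rule weak_grad_energy_measurable[OF S(1) strongly_measurable_H1_comp[OF S F u_meas u_H1]])
      show "AE t in I. (\<lambda>x. cut_logit \<delta> (u (x, t))) \<in> vecs (H1 S)"
        using u_H1 by eventually_elim (rule H1_comp(1)[OF S F])
    qed
    show "AE t in I. norm (dissipation \<delta> t) \<le> norm (C\<^sup>2 * (nrm (H1 S) (\<lambda>x. u (x, t)))\<^sup>2)"
      using u_H1
    proof eventually_elim
      case (elim t)
      show ?case using weak_grad_energy_comp_le[OF S F elim] by (simp add: dissipation_def)
    qed
  qed
qed

lemma gradient_energy_integrable: "integrable I gradient_energy"
proof (rule Bochner_Integration.integrable_bound[OF u_int])
  show "gradient_energy \<in> borel_measurable I"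
    unfolding gradient_energy_def[abs_def] by (rule weak_grad_energy_measurable[OF S(1) u_meas u_H1])
  show "AE t in I. norm (gradient_energy t) \<le> norm ((nrm (H1 S) (\<lambda>x. u (x, t)))\<^sup>2)"
    using u_H1
  proof eventually_elim
    case (elim t)
    show ?case using weak_grad_energy_le_H1[OF S(1) elim] by (simp add: gradient_energy_def)
  qed
qed

lemma logit_energy_continuous: "0 < \<delta> \<Longrightarrow> continuous_on {0..T} (logit_energy \<delta>)"
  using cut_logit_U(2) unfolding logit_energy_def[abs_def] .

lemma logit_energy_nonneg: "0 \<le> logit_energy \<delta> t"
  by (simp add: logit_energy_def)

text \<open>For fixed \<delta> and k the mismatch is averaged away and an error k J remains, with J
  independent of k; the choice k = e / (|J| + 1) makes it at most e.\<close>

lemma energy_inequality: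
  assumes d: "0 < \<delta>" "\<delta> \<le> 1 / 2" and b: "0 < b" "b \<le> T"
  shows "logit_energy \<delta> b / 2 - logit_energy \<delta> 0 / 2
    \<le> (LINT t|I. indicator {0..b} t * ((2 * L + 4 * R\<^sup>2) * (measure M (space M) + logit_energy \<delta> t) - 1 / 2 * dissipation \<delta> t))"
    (is "_ \<le> (LINT t|I. _ * ?G t)")
proof (rule field_le_epsilon)
  fix e :: real assume e: "0 < e"
  let ?H = "\<lambda>t. measure M (space M) + gradient_energy t"
  obtain B where B: "\<And>s. \<bar>cut_mult \<delta> s\<bar> \<le> B \<and> \<bar>cut_mult' \<delta> s\<bar> \<le> B" using cut_mult_bound[OF d(1)] by blast
  have iY: "integrable I (logit_energy \<delta>)"
    by (rule continuous_integrable_lebesgue_on_open[OF logit_energy_continuous[OF d(1)]])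
  have iG: "integrable I ?G" using iY dissipation_integrable(1)[OF d(1)] by simp
  have iH: "integrable I ?H" using gradient_energy_integrable by simp
  have ind: "integrable I (\<lambda>\<tau>. indicator {0..b} \<tau> * h \<tau>)" if "integrable I h" for h :: "real \<Rightarrow> real"
    by (rule integrable_indicator_mult[OF that]) simp
  define J where "J = (LINT t|I. indicator {0..b} t * ?H t)"
  define k where "k = e / (\<bar>J\<bar> + 1)"
  have k: "0 < k" using e by (simp add: k_def)
  have "logit_energy \<delta> b / 2 - logit_energy \<delta> 0 / 2 \<le> (LINT t|I. indicator {0..b} t * (?G t + k * ?H t))"
  proof (rule H1.averaged_inequality[OF u_meas u_H1 u_int _ _ _ energy_increment[OF d B k] b])
    show "continuous_on {0..T} (\<lambda>t. logit_energy \<delta> t / 2)"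
      by (intro continuous_intros logit_energy_continuous[OF d(1)]) simp
    show "integrable I (\<lambda>t. ?G t + k * ?H t)"
      by (rule Bochner_Integration.integrable_add[OF iG integrable_mult_right[OF iH]])
    show "0 \<le> ((L * B)\<^sup>2 + (B * R)\<^sup>2 + B\<^sup>2) / k" using k by simp
  qed
  also have "\<dots> = (LINT t|I. indicator {0..b} t * ?G t + k * (indicator {0..b} t * ?H t))"
    by (intro Bochner_Integration.integral_cong refl) (simp add: distrib_left mult.left_commute)
  also have "\<dots> = (LINT t|I. indicator {0..b} t * ?G t) + k * J"
    unfolding J_def by (subst Bochner_Integration.integral_add) (use ind[OF iG] ind[OF iH] in auto)
  also have "k * J \<le> e"
  proof -
    have "k * J \<le> k * (\<bar>J\<bar> + 1)" using k by (intro mult_left_mono) auto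
    then show ?thesis by (simp add: k_def)
  qed
  finally show "logit_energy \<delta> b / 2 - logit_energy \<delta> 0 / 2 \<le> (LINT t|I. indicator {0..b} t * ?G t) + e" by simp
qed

lemma logit_energy_initial:
  assumes d: "0 < \<delta>"
  shows "logit_energy \<delta> 0 \<le> (LINT x|M. (f_prime (u0 x))\<^sup>2)"
  unfolding logit_energy_def
proof (rule integral_mono_AE)
  show "integrable M (\<lambda>x. (cut_logit \<delta> (U 0 x))\<^sup>2)" using T by (intro cut_logit_U(1)[OF d]) simp
  show "integrable M (\<lambda>x. (f_prime (u0 x))\<^sup>2)" using u0_L2 by (simp add: mem_L2)
  show "AE x in M. (cut_logit \<delta> (U 0 x))\<^sup>2 \<le> (f_prime (u0 x))\<^sup>2"
    using U_0 u0_01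
  proof eventually_elim
    case (elim x)
    then show ?case using abs_logit_reg_le[OF d, of "u0 x"] cut_id(1)[of "u0 x" \<delta>] by (simp add: abs_le_square_iff)
  qed
qed

lemma uniform_energy_bound:
  obtains E where "0 \<le> E" "\<And>\<delta> t. 0 < \<delta> \<Longrightarrow> \<delta> \<le> 1 / 2 \<Longrightarrow> t \<in> {0..T} \<Longrightarrow> logit_energy \<delta> t \<le> E"
    "\<And>\<delta>. 0 < \<delta> \<Longrightarrow> \<delta> \<le> 1 / 2 \<Longrightarrow> (LINT t|I. dissipation \<delta> t) \<le> E"
proof -
  define V where "V = measure M (space M)"
  define k where "k = 2 * L + 4 * R\<^sup>2"
  \<comment> \<open>Twice the energy inequality bounds the energy at b plus the dissipation by the
    initial energy plus 2 k times the integral of V and of the energy. \<open>A\<close> collects the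
    bound for the initial energy and the contribution of V; the rate 2 k reappears in the exponent
    of \<open>E\<close>.\<close>
  define A where "A = (LINT x|M. (f_prime (u0 x))\<^sup>2) + 2 * k * V * T"
  define E where "E = 2 * A * exp (2 * (2 * k) * T)"
  have V: "0 \<le> V" by (simp add: V_def)
  have k: "0 < k" using L by (simp add: k_def add_pos_nonneg)
  have A: "0 \<le> A" using V k T by (simp add: A_def)
  have E: "0 \<le> E" using A by (simp add: E_def)
  have I01: "measure I (space I) = T" using T by (simp add: measure_restrict_space)
  have ineq: "logit_energy \<delta> b + (LINT t|I. indicator {0..b} t * dissipation \<delta> t) \<le> A + 2 * k * integral {0..b} (logit_energy \<delta>)"
    if d: "0 < \<delta>" "\<delta> \<le> 1 / 2" and b: "0 < b" "b \<le> T" for \<delta> b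
  proof -
    let ?Y = "logit_energy \<delta>" and ?D = "dissipation \<delta>"
    have iY: "integrable I ?Y" by (rule continuous_integrable_lebesgue_on_open[OF logit_energy_continuous[OF d(1)]])
    have ind: "integrable I (\<lambda>\<tau>. indicator {0..b} \<tau> * h \<tau>)" if "integrable I h" for h :: "real \<Rightarrow> real"
      by (rule integrable_indicator_mult[OF that]) simp
    note iYb = ind[OF iY] and iDb = ind[OF dissipation_integrable(1)[OF d(1)]] and iVb = ind[OF I.integrable_const, of V]
    have "?Y b / 2 - ?Y 0 / 2 \<le> (LINT t|I. indicator {0..b} t * (k * (V + ?Y t) - 1 / 2 * ?D t))"
      using energy_inequality[OF d b] by (simp add: k_def V_def)
    also have "\<dots> = (LINT t|I. k * (indicator {0..b} t * V) + k * (indicator {0..b} t * ?Y t) - 1 / 2 * (indicator {0..b} t * ?D t))"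
      by (intro Bochner_Integration.integral_cong refl) (simp add: algebra_simps)
    also have "\<dots> = k * (LINT t|I. indicator {0..b} t * V) + k * (LINT t|I. indicator {0..b} t * ?Y t) - 1 / 2 * (LINT t|I. indicator {0..b} t * ?D t)"
      using iYb iDb iVb by simp
    finally have 1: "?Y b / 2 - ?Y 0 / 2 \<le> k * (LINT t|I. indicator {0..b} t * V) + k * (LINT t|I. indicator {0..b} t * ?Y t)
       - 1 / 2 * (LINT t|I. indicator {0..b} t * ?D t)" .
    have "(LINT t|I. indicator {0..b} t * V) \<le> (LINT t|I. V)"
      using iVb V by (intro integral_mono) (auto simp: indicator_def)
    then have 2: "k * (LINT t|I. indicator {0..b} t * V) \<le> k * (V * T)"
      using k I01 by (intro mult_left_mono) (auto simp: mult.commute)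
    have "(LINT t|I. indicator {0..b} t * ?Y t) \<le> integral {0..b} ?Y"
    proof -
      have cb: "continuous_on {0..b} ?Y" using b by (intro continuous_on_subset[OF logit_energy_continuous[OF d(1)]]) auto
      have ai: "?Y absolutely_integrable_on {0..b}" by (rule absolutely_integrable_continuous_real[OF cb])
      have "(LINT t|I. indicator {0..b} t * ?Y t) = (LINT t|lebesgue. indicator {0<..<T} t *\<^sub>R (indicator {0..b} t * ?Y t))"
        by (intro integral_restrict_space) auto
      also have "\<dots> \<le> (LINT t|lebesgue. indicator {0..b} t * ?Y t)"
      proof (rule integral_mono)
        show "integrable lebesgue (\<lambda>t. indicator {0..b} t * ?Y t)" using ai by (simp add: set_integrable_def)
        show "integrable lebesgue (\<lambda>t. indicator {0<..<T} t *\<^sub>R (indicator {0..b} t * ?Y t))"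
          using iYb by (simp add: integrable_restrict_space)
        show "indicator {0<..<T} t *\<^sub>R (indicator {0..b} t * ?Y t) \<le> indicator {0..b} t * ?Y t" for t
          using logit_energy_nonneg[of \<delta> t] by (auto simp: indicator_def)
      qed
      also have "\<dots> = integral {0..b} ?Y"
        using set_lebesgue_integral_eq_integral(2)[OF ai] by (simp add: set_lebesgue_integral_def)
      finally show ?thesis .
    qed
    then have 3: "k * (LINT t|I. indicator {0..b} t * ?Y t) \<le> k * integral {0..b} ?Y" using k by (intro mult_left_mono) auto
    show ?thesis using 1 2 3 logit_energy_initial[OF d(1)] by (simp add: A_def)
  qed
  have Db: "0 \<le> (LINT t|I. indicator {0..b} t * dissipation \<delta> t)" if "0 < \<delta>" for \<delta> b :: real
    using dissipation_integrable(2)[OF that] by (intro integral_nonneg_AE) auto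
  have yE: "logit_energy \<delta> t \<le> E" if d: "0 < \<delta>" "\<delta> \<le> 1 / 2" and t: "t \<in> {0..T}" for \<delta> t
    unfolding E_def
  proof (rule gronwall_bound[OF T logit_energy_continuous[OF d(1)] _ A logit_energy_nonneg _ t])
    show "0 < 2 * k" using k by simp
    show "logit_energy \<delta> b \<le> A + 2 * k * integral {0..b} (logit_energy \<delta>)" if "b \<in> {0..T}" for b
    proof (cases "b = 0")
      case True
      have "(LINT x|M. (f_prime (u0 x))\<^sup>2) \<le> A" using V k T by (simp add: A_def)
      with True show ?thesis using logit_energy_initial[OF d(1)] by simp
    next
      case False
      with that show ?thesis using ineq[OF d, of b] Db[OF d(1), of b] by simp
    qed
  qed
  have DE: "(LINT t|I. dissipation \<delta> t) \<le> A + 2 * k * (T * E)" if d: "0 < \<delta>" "\<delta> \<le> 1 / 2" for \<delta>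
  proof -
    have "(LINT t|I. dissipation \<delta> t) = (LINT t|I. indicator {0..T} t * dissipation \<delta> t)"
      by (intro Bochner_Integration.integral_cong) auto
    also have "\<dots> \<le> A + 2 * k * integral {0..T} (logit_energy \<delta>)"
      using ineq[OF d T order.refl] logit_energy_nonneg[of \<delta> T] by linarith
    also have "integral {0..T} (logit_energy \<delta>) \<le> integral {0..T} (\<lambda>t. E)"
      using yE[OF d] by (intro integral_le integrable_continuous_real logit_energy_continuous[OF d(1)]) auto
    also have "\<dots> = T * E" using T by simp
    finally show ?thesis using k by (simp add: mult_left_mono)
  qed
  show ?thesis
  proof (rule that[of "max E (A + 2 * k * (T * E))"])
    show "logit_energy \<delta> t \<le> max E (A + 2 * k * (T * E))" if "0 < \<delta>" "\<delta> \<le> 1 / 2" "t \<in> {0..T}" for \<delta> t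
      using yE[OF that] by simp
    show "(LINT t|I. dissipation \<delta> t) \<le> max E (A + 2 * k * (T * E))" if "0 < \<delta>" "\<delta> \<le> 1 / 2" for \<delta>
      using DE[OF that] by simp
  qed (use E in simp)
qed

end

subsection \<open>Passage to the limit\<close>

text \<open>The bound on the integrals passes to the integral of the lower limit. Hence the lower
  limit is finite almost everywhere, which rules out divergence, and where a limit exists it
  coincides with it.\<close>

lemma
  fixes h :: "nat \<Rightarrow> 'a \<Rightarrow> real"
  assumes i: "\<And>n. integrable M (h n)" and nn: "\<And>n x. 0 \<le> h n x" and E: "\<And>n. (LINT x|M. h n x) \<le> E"
  shows Fatou_not_at_top: "AE x in M. \<not> filterlim (\<lambda>n. h n x) at_top sequentially"
    and Fatou_limit: "h' \<in> borel_measurable M \<Longrightarrow> AE x in M. (\<lambda>n. h n x) \<longlonglongrightarrow> h' x \<Longrightarrow>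
      integrable M h' \<and> (LINT x|M. h' x) \<le> E"
proof -
  have [measurable]: "h n \<in> borel_measurable M" for n using i by auto
  have "0 \<le> (LINT x|M. h 0 x)" using nn by (intro integral_nonneg_AE) auto
  with E[of 0] have E0: "0 \<le> E" by linarith
  let ?l = "\<lambda>x. liminf (\<lambda>n. ennreal (h n x))"
  have le: "(\<integral>\<^sup>+x. ?l x \<partial>M) \<le> ennreal E"
  proof -
    have "(\<integral>\<^sup>+x. ?l x \<partial>M) \<le> liminf (\<lambda>n. \<integral>\<^sup>+x. ennreal (h n x) \<partial>M)" by (intro nn_integral_liminf) simp
    also have "\<dots> \<le> limsup (\<lambda>n. \<integral>\<^sup>+x. ennreal (h n x) \<partial>M)" by (rule Liminf_le_Limsup) simp
    also have "\<dots> \<le> ennreal E"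
    proof (intro Limsup_bounded always_eventually allI)
      fix n
      show "(\<integral>\<^sup>+x. ennreal (h n x) \<partial>M) \<le> ennreal E"
        using E[of n] nn by (subst nn_integral_eq_integral[OF i]) (auto intro: ennreal_leI)
    qed
    finally show ?thesis .
  qed
  have "AE x in M. ?l x \<noteq> \<infinity>"
  proof (rule nn_integral_PInf_AE)
    show "(\<integral>\<^sup>+x. ?l x \<partial>M) \<noteq> \<infinity>" using le by (auto simp: top_unique)
  qed simp
  then show "AE x in M. \<not> filterlim (\<lambda>n. h n x) at_top sequentially"
  proof eventually_elim
    case (elim x)
    show ?case
    proof
      assume f: "filterlim (\<lambda>n. h n x) at_top sequentially"
      obtain c where c: "?l x = ennreal c" "0 \<le> c" using elim by (cases "?l x") auto
      have "\<forall>\<^sub>F n in sequentially. c + 1 \<le> h n x" using f by (simp add: filterlim_at_top)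
      then have "\<forall>\<^sub>F n in sequentially. ennreal (c + 1) \<le> ennreal (h n x)" by eventually_elim (rule ennreal_leI)
      then have "ennreal (c + 1) \<le> ?l x" by (rule Liminf_bounded)
      then show False using c by (simp add: ennreal_le_iff)
    qed
  qed
  show "integrable M h' \<and> (LINT x|M. h' x) \<le> E"
    if [measurable]: "h' \<in> borel_measurable M" and l: "AE x in M. (\<lambda>n. h n x) \<longlonglongrightarrow> h' x"
  proof -
    have nn': "AE x in M. 0 \<le> h' x"
      using l by eventually_elim (rule LIMSEQ_le_const, use nn in auto)
    have "AE x in M. ?l x = ennreal (h' x)"
      using l
    proof eventually_elim
      case (elim x)
      show ?case by (intro lim_imp_Liminf tendsto_ennrealI elim) simp
    qed
    then have "(\<integral>\<^sup>+x. ennreal (h' x) \<partial>M) = (\<integral>\<^sup>+x. ?l x \<partial>M)" by (intro nn_integral_cong_AE) (auto elim: eventually_mono)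
    with le have le': "(\<integral>\<^sup>+x. ennreal (h' x) \<partial>M) \<le> ennreal E" by simp
    then have i': "integrable M h'"
      by (intro integrableI_nonneg[OF _ nn']) (auto simp: less_top[symmetric] top_unique)
    with le' have "ennreal (LINT x|M. h' x) \<le> ennreal E" by (subst (asm) nn_integral_eq_integral[OF i' nn'])
    with i' E0 show ?thesis by (simp add: ennreal_le_iff)
  qed
qed

lemma not_at_top_subsequence:
  fixes f :: "nat \<Rightarrow> real"
  assumes "\<not> filterlim f at_top sequentially"
  obtains B and r :: "nat \<Rightarrow> nat" where "strict_mono r" "\<forall>n. f (r n) \<le> B"
proof -
  obtain B where "\<not> (\<forall>\<^sub>F n in sequentially. B \<le> f n)" using assms by (auto simp: filterlim_at_top)
  then have "infinite {n. f n < B}"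
    unfolding INFM_nat[symmetric] cofinite_eq_sequentially[symmetric] eventually_cofinite
    by (simp add: not_le)
  then obtain r :: "nat \<Rightarrow> nat" where "strict_mono r" "\<forall>n. r n \<in> {n. f n < B}" by (rule infinite_enumerate[THEN exE]) auto
  then show ?thesis by (intro that[of r B]) (auto intro: less_imp_le)
qed

lemma L2_scaled_component:
  assumes "h \<in> vecs (Lp_space M 2)" "b \<in> Basis"
  shows "(\<lambda>x. h x \<bullet> b) \<in> vecs (Lp_space M 2)"
proof (rule L2_norm_mono(1)[OF assms(1)])
  show "(\<lambda>x. h x \<bullet> b) \<in> borel_measurable M" using assms(1) by (intro borel_measurable_inner) (auto simp: mem_L2)
qed (use Basis_le_norm[OF assms(2)] in simp)

text \<open>The regularized functions and gradients are dominated by f'(f) and by the gradient of f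
  divided by f (1 - f), both in L2 by hypothesis, and converge pointwise. Dominated convergence and
  the stability of weak derivatives under L1 limits identify the gradient.\<close>

lemma
  fixes S :: "'a::euclidean_space set"
  assumes S: "open S" "bounded S" and f: "f \<in> vecs (H1 S)" and f01: "AE x in lebesgue_on S. 0 < f x \<and> f x < 1"
    and F2: "(\<lambda>x. f_prime (f x)) \<in> vecs (Lp_space (lebesgue_on S) 2)"
    and G2: "(\<lambda>x. (1 / (f x * (1 - f x))) *\<^sub>R weak_grad S f x) \<in> vecs (Lp_space (lebesgue_on S) 2)"
  shows H1_f_prime: "(\<lambda>x. f_prime (f x)) \<in> vecs (H1 S)"
    and weak_grad_f_prime: "AE x in lebesgue_on S. weak_grad S (\<lambda>x. f_prime (f x)) x = (1 / (f x * (1 - f x))) *\<^sub>R weak_grad S f x"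
    and H1_cut_logit_tendsto: "(\<lambda>n. nrm (H1 S) (\<lambda>x. cut_logit (reg_seq n) (f x) - f_prime (f x))) \<longlonglongrightarrow> 0"
proof -
  let ?M = "lebesgue_on S"
  define h where "h x = (1 / (f x * (1 - f x))) *\<^sub>R weak_grad S f x" for x
  have Mf: "finite_measure ?M" using S by (intro finite_measure_lebesgue_on) auto
  have h2: "h \<in> vecs (Lp_space ?M 2)" using G2 unfolding h_def[abs_def] .
  have hb: "(\<lambda>x. h x \<bullet> b) \<in> vecs (Lp_space ?M 2)" if "b \<in> Basis" for b by (rule L2_scaled_component[OF h2 that])
  have C: "\<exists>C. \<forall>s. \<bar>cut_logit' (reg_seq n) s\<bar> \<le> C" for n using cut_logit_bound[OF reg_seq(1)] by blast
  have Fn: "(\<lambda>x. cut_logit (reg_seq n) (f x)) \<in> vecs (H1 S)"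
    and vn: "b \<in> Basis \<Longrightarrow> has_weak_partial S b (\<lambda>x. cut_logit (reg_seq n) (f x)) (\<lambda>x. cut_logit' (reg_seq n) (f x) * weak_partial S b f x)"
    and vn2: "b \<in> Basis \<Longrightarrow> (\<lambda>x. cut_logit' (reg_seq n) (f x) * weak_partial S b f x) \<in> vecs (Lp_space ?M 2)" for n b
  proof -
    obtain C where C: "\<And>s. \<bar>cut_logit' (reg_seq n) s\<bar> \<le> C" using C[of n] by blast
    note H = H1_comp[OF S cut_logit_deriv[OF reg_seq(1)] cut_logit'_continuous[OF reg_seq(1)] C f]
    show "(\<lambda>x. cut_logit (reg_seq n) (f x)) \<in> vecs (H1 S)" by (rule H(1))
    show "b \<in> Basis \<Longrightarrow> has_weak_partial S b (\<lambda>x. cut_logit (reg_seq n) (f x)) (\<lambda>x. cut_logit' (reg_seq n) (f x) * weak_partial S b f x)" by (rule H(2))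
    show "b \<in> Basis \<Longrightarrow> (\<lambda>x. cut_logit' (reg_seq n) (f x) * weak_partial S b f x) \<in> vecs (Lp_space ?M 2)" by (rule H(3))
  qed
  have u: "\<And>n. (\<lambda>x. cut_logit (reg_seq n) (f x)) \<in> vecs (Lp_space ?M 2)" using Fn by (simp add: mem_H1)
  have ul: "(\<lambda>n. nrm (Lp_space ?M 2) (\<lambda>x. cut_logit (reg_seq n) (f x) - f_prime (f x))) \<longlonglongrightarrow> 0"
  proof (rule L2_dominated_convergence(3)[OF F2])
    show "(\<lambda>x. cut_logit (reg_seq n) (f x)) \<in> borel_measurable ?M" for n using u by (simp add: mem_L2)
    show "(\<lambda>x. f_prime (f x)) \<in> borel_measurable ?M" using F2 by (simp add: mem_L2)
    show "AE x in ?M. norm (cut_logit (reg_seq n) (f x)) \<le> norm (f_prime (f x))" for n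
      using f01 by eventually_elim (use abs_logit_reg_le[OF reg_seq(1)] cut_id in simp)
    show "AE x in ?M. (\<lambda>n. cut_logit (reg_seq n) (f x)) \<longlonglongrightarrow> f_prime (f x)"
      using f01 by eventually_elim (use logit_reg_tendsto(1) cut_id in simp)
  qed
  have vl: "(\<lambda>n. nrm (Lp_space ?M 2) (\<lambda>x. cut_logit' (reg_seq n) (f x) * weak_partial S b f x - h x \<bullet> b)) \<longlonglongrightarrow> 0"
    if b: "b \<in> Basis" for b
  proof (rule L2_dominated_convergence(3)[OF hb[OF b]])
    show "(\<lambda>x. cut_logit' (reg_seq n) (f x) * weak_partial S b f x) \<in> borel_measurable ?M" for n
      using vn2[OF b] by (simp add: mem_L2)
    show "(\<lambda>x. h x \<bullet> b) \<in> borel_measurable ?M" using hb[OF b] by (simp add: mem_L2)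
    show "AE x in ?M. norm (cut_logit' (reg_seq n) (f x) * weak_partial S b f x) \<le> norm (h x \<bullet> b)" for n
      using f01
    proof eventually_elim
      case (elim x)
      have "\<bar>logit_reg' (reg_seq n) (f x)\<bar> \<le> \<bar>1 / (f x * (1 - f x))\<bar>"
        using logit_reg'_le[OF reg_seq(1), of "f x" n] logit_reg'_pos[OF reg_seq(1), of n "f x"] elim reg_seq(1)[of n] by simp
      from mult_right_mono[OF this abs_ge_zero[of "weak_partial S b f x"]]
      show ?case using elim cut_id(2)[of "f x"] b by (simp add: h_def weak_grad_inner abs_mult[symmetric])
    qed
    show "AE x in ?M. (\<lambda>n. cut_logit' (reg_seq n) (f x) * weak_partial S b f x) \<longlonglongrightarrow> h x \<bullet> b"
      using f01
    proof eventually_elim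
      case (elim x)
      have "(\<lambda>n. logit_reg' (reg_seq n) (f x) * weak_partial S b f x) \<longlonglongrightarrow> 1 / (f x * (1 - f x)) * weak_partial S b f x"
        using elim by (intro tendsto_mult logit_reg_tendsto(2) tendsto_const) auto
      then show ?case using elim cut_id(2)[of "f x"] b by (simp add: h_def weak_grad_inner)
    qed
  qed
  have w: "has_weak_partial S b (\<lambda>x. f_prime (f x)) (\<lambda>x. h x \<bullet> b)" if b: "b \<in> Basis" for b
    using L2_L1_bound(1)[OF Mf] u vn2[OF b] F2 hb[OF b] L2_tendsto_L1[OF Mf u F2 ul] L2_tendsto_L1[OF Mf vn2[OF b] hb[OF b] vl[OF b]]
    by (intro has_weak_partial_L1_limit[OF S(1) b vn[OF b]]) auto
  show H: "(\<lambda>x. f_prime (f x)) \<in> vecs (H1 S)"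
    unfolding mem_H1 using F2 w hb by blast
  show "AE x in ?M. weak_grad S (\<lambda>x. f_prime (f x)) x = (1 / (f x * (1 - f x))) *\<^sub>R weak_grad S f x"
    using weak_grad_AE[OF S(1) w] by (simp add: h_def)
  have e: "nrm (H1 S) (\<lambda>x. cut_logit (reg_seq n) (f x) - f_prime (f x))
     = nrm (Lp_space ?M 2) (\<lambda>x. cut_logit (reg_seq n) (f x) - f_prime (f x))
      + (\<Sum>b\<in>Basis. nrm (Lp_space ?M 2) (\<lambda>x. cut_logit' (reg_seq n) (f x) * weak_partial S b f x - h x \<bullet> b))" for n
  proof (rule nrm_H1_eq[OF S(1)])
    interpret L2: seminormed "Lp_space ?M 2 :: ('a, real) fspace" by (rule L2_seminormed)
    fix b :: 'a assume b: "b \<in> Basis"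
    show "has_weak_partial S b (\<lambda>x. cut_logit (reg_seq n) (f x) - f_prime (f x)) (\<lambda>x. cut_logit' (reg_seq n) (f x) * weak_partial S b f x - h x \<bullet> b)"
      using has_weak_partial_linear[OF S(1) b vn[OF b] w[OF b], of 1 n "-1"] by simp
    show "(\<lambda>x. cut_logit' (reg_seq n) (f x) * weak_partial S b f x - h x \<bullet> b) \<in> vecs (Lp_space ?M 2)"
      by (rule L2.diff_in[OF vn2[OF b] hb[OF b]])
  qed
  have "(\<lambda>n. nrm (Lp_space ?M 2) (\<lambda>x. cut_logit (reg_seq n) (f x) - f_prime (f x))
      + (\<Sum>b\<in>Basis. nrm (Lp_space ?M 2) (\<lambda>x. cut_logit' (reg_seq n) (f x) * weak_partial S b f x - h x \<bullet> b))) \<longlonglongrightarrow> 0 + (\<Sum>b\<in>(Basis :: 'a set). 0)"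
    by (intro tendsto_add ul tendsto_sum vl)
  then show "(\<lambda>n. nrm (H1 S) (\<lambda>x. cut_logit (reg_seq n) (f x) - f_prime (f x))) \<longlonglongrightarrow> 0" by (simp add: e)
qed

context CH_solution
begin

text \<open>The expected gradient f''(u) \<nabla>u of f'(u), with f''(s) = 1 / (s (1 - s)), written
  down before f'(u) is known to be weakly differentiable.\<close>

definition "singular_grad t x = (1 / (u (x, t) * (1 - u (x, t)))) *\<^sub>R weak_grad S (\<lambda>x. u (x, t)) x"

text \<open>At a point with value 0 or 1 the squares of the regularized logits diverge, which
  Fatou's lemma excludes almost everywhere; elsewhere they converge to the square of f'. The bound
  holds at every time, as the energy of \<open>U\<close> does.\<close>

lemma U_separated:
  assumes E: "\<And>n. logit_energy (reg_seq n) t \<le> E" and t: "t \<in> {0..T}"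
  shows "AE x in M. 0 < U t x \<and> U t x < 1"
    and "(\<lambda>x. f_prime (U t x)) \<in> vecs L2" "(nrm L2 (\<lambda>x. f_prime (U t x)))\<^sup>2 \<le> E"
proof -
  note i = cut_logit_U(1)[OF reg_seq(1) t]
  note F = Fatou_not_at_top[of M "\<lambda>n x. (cut_logit (reg_seq n) (U t x))\<^sup>2" E, OF i]
     Fatou_limit[of M "\<lambda>n x. (cut_logit (reg_seq n) (U t x))\<^sup>2" E, OF i]
  have E': "\<And>n. (LINT x|M. (cut_logit (reg_seq n) (U t x))\<^sup>2) \<le> E" using E by (simp add: logit_energy_def)
  have [measurable]: "U t \<in> borel_measurable M" using U_L2[OF t] by (simp add: mem_L2)
  have m: "(\<lambda>x. f_prime (U t x)) \<in> borel_measurable M" unfolding f_prime_def by measurable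
  show 01: "AE x in M. 0 < U t x \<and> U t x < 1"
    using F(1)[OF _ E', simplified]
  proof eventually_elim
    case (elim x)
    have "\<not> (U t x = 0 \<or> U t x = 1)"
    proof
      assume "U t x = 0 \<or> U t x = 1"
      from logit_reg_square_at_top[OF this] elim show False using cut_id(1)[OF U01] by simp
    qed
    then show ?case using U01[of t x] by (auto simp: less_le)
  qed
  have "integrable M (\<lambda>x. (f_prime (U t x))\<^sup>2) \<and> (LINT x|M. (f_prime (U t x))\<^sup>2) \<le> E"
  proof (rule F(2)[OF _ E'])
    show "(\<lambda>x. (f_prime (U t x))\<^sup>2) \<in> borel_measurable M" using m by measurable
    show "AE x in M. (\<lambda>n. (cut_logit (reg_seq n) (U t x))\<^sup>2) \<longlonglongrightarrow> (f_prime (U t x))\<^sup>2"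
      using 01
    proof eventually_elim
      case (elim x)
      show ?case using tendsto_power[OF logit_reg_tendsto(1)[of "U t x"], of 2] elim cut_id(1)[OF U01] by simp
    qed
  qed simp
  then show "(\<lambda>x. f_prime (U t x)) \<in> vecs L2" "(nrm L2 (\<lambda>x. f_prime (U t x)))\<^sup>2 \<le> E"
    using m by (auto simp: mem_L2 nrm_L2)
qed

text \<open>A bound along one subsequence suffices for Fatou's lemma to place the singular gradient
  in L2. Once it is there it dominates all the regularized gradients, and convergence of the full
  sequence follows.\<close>

lemma dissipation_limit:
  fixes r :: "nat \<Rightarrow> nat"
  assumes B: "\<And>n. dissipation (reg_seq (r n)) t \<le> B" and r: "strict_mono r"
    and H: "(\<lambda>x. u (x, t)) \<in> vecs (H1 S)" and f01: "AE x in M. 0 < u (x, t) \<and> u (x, t) < 1"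
  shows "singular_grad t \<in> vecs (Lp_space M 2)"
    and "(\<lambda>n. dissipation (reg_seq n) t) \<longlonglongrightarrow> (LINT x|M. (norm (singular_grad t x))\<^sup>2)"
proof -
  define f where "f = (\<lambda>x. u (x, t))"
  note H = H[folded f_def]
  have f01: "AE x in M. 0 < f x \<and> f x < 1" using f01 by (simp add: f_def)
  let ?G = "\<lambda>n. weak_grad S (\<lambda>x. cut_logit (reg_seq n) (f x))"
  have C: "\<exists>C. \<forall>s. \<bar>cut_logit' (reg_seq n) s\<bar> \<le> C" for n using cut_logit_bound[OF reg_seq(1)] by blast
  have G: "AE x in M. ?G n x = cut_logit' (reg_seq n) (f x) *\<^sub>R weak_grad S f x"
    and G2: "?G n \<in> vecs (Lp_space M 2)" for n
  proof -
    obtain C where C: "\<And>s. \<bar>cut_logit' (reg_seq n) s\<bar> \<le> C" using C[of n] by blast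
    show "AE x in M. ?G n x = cut_logit' (reg_seq n) (f x) *\<^sub>R weak_grad S f x"
      by (rule weak_grad_comp[OF S cut_logit_deriv[OF reg_seq(1)] cut_logit'_continuous[OF reg_seq(1)] C H])
    show "?G n \<in> vecs (Lp_space M 2)"
      by (rule weak_grad_L2(1)[OF S(1) H1_comp(1)[OF S cut_logit_deriv[OF reg_seq(1)] cut_logit'_continuous[OF reg_seq(1)] C H]])
  qed
  have Gm[measurable]: "?G n \<in> borel_measurable M" for n using G2 by (simp add: mem_L2)
  have s: "singular_grad t = (\<lambda>x. (1 / (f x * (1 - f x))) *\<^sub>R weak_grad S f x)"
    by (rule ext) (simp add: singular_grad_def f_def)
  have [measurable]: "f \<in> borel_measurable M" "weak_grad S f \<in> borel_measurable M"
    using H weak_grad_L2(1)[OF S(1) H] by (auto simp: mem_H1 mem_L2)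
  have m[measurable]: "singular_grad t \<in> borel_measurable M" unfolding s by measurable
  have all: "AE x in M. \<forall>n. ?G n x = cut_logit' (reg_seq n) (f x) *\<^sub>R weak_grad S f x"
    using G by (simp add: AE_all_countable)
  have lim: "AE x in M. (\<lambda>n. (norm (?G n x))\<^sup>2) \<longlonglongrightarrow> (norm (singular_grad t x))\<^sup>2"
    using all f01
  proof eventually_elim
    case (elim x)
    have "(\<lambda>n. (norm (logit_reg' (reg_seq n) (f x) *\<^sub>R weak_grad S f x))\<^sup>2) \<longlonglongrightarrow> (norm ((1 / (f x * (1 - f x))) *\<^sub>R weak_grad S f x))\<^sup>2"
      using elim(2) by (intro tendsto_intros logit_reg_tendsto(2)) auto
    then show ?case using elim cut_id(2)[of "f x"] by (simp add: s)
  qed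
  have iG: "integrable M (\<lambda>x. (norm (?G n x))\<^sup>2)" for n using G2 by (simp add: mem_L2)
  have "integrable M (\<lambda>x. (norm (singular_grad t x))\<^sup>2) \<and> (LINT x|M. (norm (singular_grad t x))\<^sup>2) \<le> B"
  proof (rule Fatou_limit[of M "\<lambda>n x. (norm (?G (r n) x))\<^sup>2"])
    show "integrable M (\<lambda>x. (norm (?G (r n) x))\<^sup>2)" for n by (rule iG)
    show "(LINT x|M. (norm (?G (r n) x))\<^sup>2) \<le> B" for n using B[of n] by (simp add: dissipation_def f_def)
    show "AE x in M. (\<lambda>n. (norm (?G (r n) x))\<^sup>2) \<longlonglongrightarrow> (norm (singular_grad t x))\<^sup>2"
      using lim
    proof eventually_elim
      case (elim x)
      from LIMSEQ_subseq_LIMSEQ[OF this r] show ?case by (simp add: comp_def)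
    qed
  qed simp_all
  then have i: "integrable M (\<lambda>x. (norm (singular_grad t x))\<^sup>2)" by simp
  with m show "singular_grad t \<in> vecs (Lp_space M 2)" by (simp add: mem_L2)
  have "(\<lambda>n. \<integral>x. (norm (?G n x))\<^sup>2 \<partial>M) \<longlonglongrightarrow> (LINT x|M. (norm (singular_grad t x))\<^sup>2)"
  proof (rule integral_dominated_convergence[OF _ _ i lim])
    show "AE x in M. norm ((norm (?G n x))\<^sup>2) \<le> (norm (singular_grad t x))\<^sup>2" for n
      using all f01
    proof eventually_elim
      case (elim x)
      have "\<bar>logit_reg' (reg_seq n) (f x)\<bar> \<le> \<bar>1 / (f x * (1 - f x))\<bar>"
        using logit_reg'_le[OF reg_seq(1), of "f x" n] logit_reg'_pos[OF reg_seq(1), of n "f x"] elim(2) reg_seq(1)[of n] by simp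
      then have "norm (logit_reg' (reg_seq n) (f x) *\<^sub>R weak_grad S f x) \<le> norm (singular_grad t x)"
        unfolding s norm_scaleR by (rule mult_right_mono) simp
      then show ?case using elim cut_id(2)[of "f x"] by (simp add: power_mono)
    qed
  qed simp_all
  then show "(\<lambda>n. dissipation (reg_seq n) t) \<longlonglongrightarrow> (LINT x|M. (norm (singular_grad t x))\<^sup>2)"
    by (simp add: dissipation_def f_def)
qed

lemma singular_energy:
  obtains E where "0 \<le> E" "AE t in I. (\<lambda>x. u (x, t)) \<in> vecs (H1 S) \<and> (AE x in M. 0 < u (x, t) \<and> u (x, t) < 1)
      \<and> (\<lambda>x. f_prime (u (x, t))) \<in> vecs L2 \<and> (nrm L2 (\<lambda>x. f_prime (u (x, t))))\<^sup>2 \<le> E \<and> singular_grad t \<in> vecs (Lp_space M 2)"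
    "integrable I (\<lambda>t. \<integral>x. (norm (singular_grad t x))\<^sup>2 \<partial>M)"
proof -
  obtain E where E: "0 \<le> E" "\<And>\<delta> t. 0 < \<delta> \<Longrightarrow> \<delta> \<le> 1 / 2 \<Longrightarrow> t \<in> {0..T} \<Longrightarrow> logit_energy \<delta> t \<le> E"
    "\<And>\<delta>. 0 < \<delta> \<Longrightarrow> \<delta> \<le> 1 / 2 \<Longrightarrow> (LINT t|I. dissipation \<delta> t) \<le> E"
    using uniform_energy_bound by blast
  have En: "\<And>n t. t \<in> {0..T} \<Longrightarrow> logit_energy (reg_seq n) t \<le> E" "\<And>n. (LINT t|I. dissipation (reg_seq n) t) \<le> E"
    using E(2,3) reg_seq by auto
  note iD = dissipation_integrable[OF reg_seq(1)]
  have g1: "AE t in I. (AE x in M. 0 < u (x, t) \<and> u (x, t) < 1)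
      \<and> (\<lambda>x. f_prime (u (x, t))) \<in> vecs L2 \<and> (nrm L2 (\<lambda>x. f_prime (u (x, t))))\<^sup>2 \<le> E"
    using U_u AE_space[of I] u_H1
  proof eventually_elim
    case (elim t)
    have t: "t \<in> {0..T}" using elim(2) by simp
    note s = U_separated[OF En(1)[OF t] t]
    have um[measurable]: "(\<lambda>x. u (x, t)) \<in> borel_measurable M" by (rule u_measurable[OF elim(3)])
    have m: "(\<lambda>x. f_prime (u (x, t))) \<in> borel_measurable M" unfolding f_prime_def by measurable
    have ae: "AE x in M. f_prime (U t x) = f_prime (u (x, t))" using elim(1) by eventually_elim simp
    have "AE x in M. 0 < u (x, t) \<and> u (x, t) < 1" using s(1) elim(1) by eventually_elim simp
    then show ?case using L2_cong_AE[OF s(2) m ae] s(3) by simp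
  qed
  have g2: "AE t in I. singular_grad t \<in> vecs (Lp_space M 2) \<and>
      (\<lambda>n. dissipation (reg_seq n) t) \<longlonglongrightarrow> (LINT x|M. (norm (singular_grad t x))\<^sup>2)"
    using Fatou_not_at_top[of I "\<lambda>n. dissipation (reg_seq n)", OF iD En(2)] g1 u_H1
  proof eventually_elim
    case (elim t)
    \<comment> \<open>Fatou's lemma in time excludes only divergence at almost every t, which leaves
      a bounded subsequence that depends on t.\<close>
    obtain B and r :: "nat \<Rightarrow> nat" where r: "strict_mono r" "\<forall>n. dissipation (reg_seq (r n)) t \<le> B"
      by (rule not_at_top_subsequence[OF elim(1)])
    show ?case using dissipation_limit[of r t B] r elim(2,3) by blast
  qed
  have "integrable I (\<lambda>t. \<integral>x. (norm (singular_grad t x))\<^sup>2 \<partial>M) \<and> (LINT t|I. (LINT x|M. (norm (singular_grad t x))\<^sup>2)) \<le> E"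
  proof (rule Fatou_limit[of I "\<lambda>n. dissipation (reg_seq n)", OF iD En(2)])
    show l: "AE t in I. (\<lambda>n. dissipation (reg_seq n) t) \<longlonglongrightarrow> (LINT x|M. (norm (singular_grad t x))\<^sup>2)"
      using g2 by eventually_elim simp
    show "(\<lambda>t. \<integral>x. (norm (singular_grad t x))\<^sup>2 \<partial>M) \<in> borel_measurable I"
      by (rule AE_LIMSEQ_measurable[OF borel_measurable_integrable[OF iD(1)] _ l]) simp
  qed
  then show ?thesis
  proof (intro that[OF E(1)])
    show "AE t in I. (\<lambda>x. u (x, t)) \<in> vecs (H1 S) \<and> (AE x in M. 0 < u (x, t) \<and> u (x, t) < 1)
      \<and> (\<lambda>x. f_prime (u (x, t))) \<in> vecs L2 \<and> (nrm L2 (\<lambda>x. f_prime (u (x, t))))\<^sup>2 \<le> E \<and> singular_grad t \<in> vecs (Lp_space M 2)"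
      using g1 g2 u_H1 by eventually_elim simp
  qed simp
qed

end

subsection \<open>Regularity of the chemical potential\<close>

locale CH_potential = CH_solution +
  fixes K :: "'a \<Rightarrow> real" and r :: real
  assumes K_meas: "K \<in> borel_measurable lebesgue"
    and K_int: "(SUP x\<in>S. \<integral>\<^sup>+ y. ennreal \<bar>K (x - y)\<bar> \<partial>lebesgue_on S) < \<infinity>"
    and r: "0 < r"
    and K_H1: "\<And>\<rho>. \<rho> \<in> vecs (Lp_space (lebesgue_on S) 2) \<Longrightarrow> convol K S \<rho> \<in> vecs (H1 S) \<and>
        nrm (H1 S) (convol K S \<rho>) \<le> r * nrm (Lp_space (lebesgue_on S) 2) \<rho>"
begin

text \<open>Strong measurability of w is derived from a map defined and continuous on all of
  \<open>H1\<close>, but the convolution is additive only for densities with integrable products.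
  The clamp makes the density bounded and leaves 1 - 2 u unchanged for u in [0, 1].\<close>

definition "clamp_density f x = 1 - 2 * soft_clamp 1 (f x)" for f :: "'a \<Rightarrow> real"
definition "clamp_convol f = convol K S (clamp_density f)"

lemma clamp_density_L2:
  assumes "f \<in> borel_measurable M"
  shows "clamp_density f \<in> borel_measurable M" "\<bar>clamp_density f x\<bar> \<le> 5" "clamp_density f \<in> vecs L2"
proof -
  have "continuous_on UNIV (soft_clamp 1)"
    using soft_clamp_deriv[of 1] by (intro continuous_at_imp_continuous_on ballI) (meson DERIV_isCont zero_less_one)
  then have [measurable]: "soft_clamp 1 \<in> borel_measurable borel" by (rule borel_measurable_continuous_onI)
  note [measurable] = assms
  show m: "clamp_density f \<in> borel_measurable M" unfolding clamp_density_def[abs_def] by measurable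
  \<comment> \<open>\<open>soft_clamp 1\<close> takes values in [-2, 3], so the density stays in
    [-5, 5].\<close>
  show b: "\<bar>clamp_density f x\<bar> \<le> 5" for x
    using soft_clamp_bounds[of 1 "f x"] by (simp add: clamp_density_def)
  show "clamp_density f \<in> vecs L2"
    by (rule L2_norm_mono(1)[OF L2_const[OF M.finite_measure_axioms, of 5] m]) (use b in simp)
qed

text \<open>The clamp is 1-Lipschitz and the factor 2 stems from the density 1 - 2 s; boundedness of
  both densities allows the convolutions to be subtracted.\<close>

lemma clamp_convol_diff:
  assumes f: "f \<in> vecs L2" and h: "h \<in> vecs L2"
  shows "(\<lambda>x. clamp_convol f x - clamp_convol h x) \<in> vecs (H1 S)"
    and "nrm (H1 S) (\<lambda>x. clamp_convol f x - clamp_convol h x) \<le> 2 * r * nrm L2 (\<lambda>x. f x - h x)"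
proof -
  have fm: "f \<in> borel_measurable M" "h \<in> borel_measurable M" using f h by (auto simp: mem_L2)
  note F = clamp_density_L2[OF fm(1)] and H = clamp_density_L2[OF fm(2)]
  let ?d = "\<lambda>x. clamp_density f x - clamp_density h x"
  have dL: "?d \<in> vecs L2" by (rule L2.diff_in[OF F(3) H(3)])
  have fh: "(\<lambda>x. 2 *\<^sub>R (f x - h x)) \<in> vecs L2" by (rule L2.scale_in[OF L2.diff_in[OF f h]])
  have ae: "AE x in M. convol K S ?d x = clamp_convol f x - clamp_convol h x"
  proof (rule AE_I2)
    fix x assume "x \<in> space M"
    then have x: "x \<in> S" by simp
    note i = convol_bounded_integrable[OF S(1) K_meas K_int x F(1,2)] convol_bounded_integrable[OF S(1) K_meas K_int x H(1,2)]
    show "convol K S ?d x = clamp_convol f x - clamp_convol h x"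
      using i by (simp add: clamp_convol_def convol_def right_diff_distrib)
  qed
  note c = H1_cong_AE[OF S(1) K_H1[OF dL, THEN conjunct1] ae]
  show "(\<lambda>x. clamp_convol f x - clamp_convol h x) \<in> vecs (H1 S)" by (rule c(1))
  have "nrm (H1 S) (\<lambda>x. clamp_convol f x - clamp_convol h x) \<le> r * nrm L2 ?d"
    using c(2) K_H1[OF dL] by simp
  also have "nrm L2 ?d \<le> nrm L2 (\<lambda>x. 2 *\<^sub>R (f x - h x))"
  proof (rule L2_norm_mono(2)[OF fh])
    show "?d \<in> borel_measurable M" using dL by (simp add: mem_L2)
    have lip: "\<bar>soft_clamp 1 a - soft_clamp 1 b\<bar> \<le> 1 * \<bar>a - b\<bar>" for a b
      using soft_clamp'_bounds[of 1] by (intro real_lipschitz_of_deriv[OF soft_clamp_deriv]) (auto simp: abs_of_pos)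
    show "AE x in M. norm (?d x) \<le> norm (2 *\<^sub>R (f x - h x))"
    proof (rule AE_I2)
      fix x
      have "?d x = - 2 * (soft_clamp 1 (f x) - soft_clamp 1 (h x))" by (simp add: clamp_density_def)
      then have "\<bar>?d x\<bar> = 2 * \<bar>soft_clamp 1 (f x) - soft_clamp 1 (h x)\<bar>" by (simp only: abs_mult)
      then show "norm (?d x) \<le> norm (2 *\<^sub>R (f x - h x))" using lip[of "f x" "h x"] unfolding norm_scaleR by simp
    qed
  qed
  also have "\<dots> = 2 * nrm L2 (\<lambda>x. f x - h x)" using L2.nrm_scale[OF L2.diff_in[OF f h], of 2] by simp
  finally show "nrm (H1 S) (\<lambda>x. clamp_convol f x - clamp_convol h x) \<le> 2 * r * nrm L2 (\<lambda>x. f x - h x)"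
    using r by (simp add: mult_ac)
qed

lemma nonlocal_w_eq:
  assumes "(\<lambda>x. u (x, t)) \<in> borel_measurable M" "AE x in M. 0 \<le> u (x, t) \<and> u (x, t) \<le> 1"
  shows "nonlocal_w K S u t = clamp_convol (\<lambda>x. u (x, t))"
proof -
  note m = clamp_density_L2(1)[OF assms(1)]
  have "AE x in M. clamp_density (\<lambda>x. u (x, t)) x = 1 - 2 * u (x, t)"
    using assms(2) by eventually_elim (simp add: clamp_density_def soft_clamp_id)
  from convol_cong_AE[OF S(1) K_meas m this] show ?thesis by (simp add: nonlocal_w_def clamp_convol_def)
qed

lemma clamp_convol_H1:
  assumes "f \<in> borel_measurable M"
  shows "clamp_convol f \<in> vecs (H1 S)" "nrm (H1 S) (clamp_convol f) \<le> r * nrm L2 (\<lambda>x. 5)"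
proof -
  note m = clamp_density_L2[OF assms]
  show "clamp_convol f \<in> vecs (H1 S)" using K_H1[OF m(3)] by (simp add: clamp_convol_def)
  have "nrm (H1 S) (clamp_convol f) \<le> r * nrm L2 (clamp_density f)" using K_H1[OF m(3)] by (simp add: clamp_convol_def)
  also have "\<dots> \<le> r * nrm L2 (\<lambda>x. 5)"
    using r m(2) by (intro mult_left_mono L2_norm_mono(2)[OF L2_const[OF M.finite_measure_axioms] m(1)]) auto
  finally show "nrm (H1 S) (clamp_convol f) \<le> r * nrm L2 (\<lambda>x. 5)" .
qed

text \<open>For each n this is a continuous map of \<open>H1\<close> into itself and so preserves
  strong measurability in time; the potential is its limit in \<open>H1\<close> at almost every
  time.\<close>

definition "potential_reg n f x = cut_logit (reg_seq n) (f x) + clamp_convol f x"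

lemma potential_reg_H1: "f \<in> vecs (H1 S) \<Longrightarrow> potential_reg n f \<in> vecs (H1 S)"
proof -
  assume f: "f \<in> vecs (H1 S)"
  obtain C where C: "\<And>s. \<bar>cut_logit' (reg_seq n) s\<bar> \<le> C" using cut_logit_bound[OF reg_seq(1)[of n]] by blast
  have "(\<lambda>x. cut_logit (reg_seq n) (f x)) \<in> vecs (H1 S)"
    by (rule H1_comp(1)[OF S cut_logit_deriv[OF reg_seq(1)] cut_logit'_continuous[OF reg_seq(1)] C f])
  moreover have "clamp_convol f \<in> vecs (H1 S)" using f by (intro clamp_convol_H1) (simp add: mem_H1 mem_L2)
  ultimately show ?thesis using H1.lin_in[of _ _ 1 1] by (fastforce simp: potential_reg_def[abs_def])
qed

lemma potential_reg_measurable: "strongly_measurable T (H1 S) (\<lambda>t. potential_reg n (\<lambda>x. u (x, t)))"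
proof (rule strongly_measurable_compose[OF u_meas potential_reg_H1])
  obtain C where C: "\<And>s. \<bar>cut_logit' (reg_seq n) s\<bar> \<le> C" using cut_logit_bound[OF reg_seq(1)[of n]] by blast
  note F = cut_logit_deriv[OF reg_seq(1), of n] cut_logit'_continuous[OF reg_seq(1), of n] C
  show "AE t in I. \<forall>f. (\<forall>k. f k \<in> vecs (H1 S)) \<longrightarrow> (\<lambda>k::nat. nrm (H1 S) (\<lambda>x. f k x - u (x, t))) \<longlonglongrightarrow> 0
      \<longrightarrow> (\<lambda>k. nrm (H1 S) (\<lambda>x. potential_reg n (f k) x - potential_reg n (\<lambda>x. u (x, t)) x)) \<longlonglongrightarrow> 0"
    using u_H1
  proof eventually_elim
    case (elim t)
    define h where "h = (\<lambda>x. u (x, t))"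
    have h: "h \<in> vecs (H1 S)" using elim by (simp add: h_def)
    show ?case
    proof (intro allI impI)
      fix f :: "nat \<Rightarrow> 'a \<Rightarrow> real"
      assume f0: "\<forall>k. f k \<in> vecs (H1 S)" and l0: "(\<lambda>k. nrm (H1 S) (\<lambda>x. f k x - u (x, t))) \<longlonglongrightarrow> 0"
      have f: "f k \<in> vecs (H1 S)" for k using f0 by simp
      have l: "(\<lambda>k. nrm (H1 S) (\<lambda>x. f k x - h x)) \<longlonglongrightarrow> 0" using l0 by (simp add: h_def)
      have fL: "f k \<in> vecs L2" "h \<in> vecs L2" for k using f h by (auto simp: mem_H1)
      have 1: "(\<lambda>k. nrm (H1 S) (\<lambda>x. cut_logit (reg_seq n) (f k x) - cut_logit (reg_seq n) (h x))) \<longlonglongrightarrow> 0"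
        by (rule H1_comp_continuous[OF S F f h l])
      let ?A = "\<lambda>k. nrm (H1 S) (\<lambda>x. cut_logit (reg_seq n) (f k x) - cut_logit (reg_seq n) (h x)) + nrm (H1 S) (\<lambda>x. f k x - h x) * (2 * r)"
      have "\<bar>nrm (H1 S) (\<lambda>x. potential_reg n (f k) x - potential_reg n h x) - 0\<bar> \<le> ?A k * 1" for k
      proof -
        note c = H1.diff_in[OF H1_comp(1)[OF S F f[of k]] H1_comp(1)[OF S F h]]
        note p = H1.diff_in[OF potential_reg_H1[OF f[of k], of n] potential_reg_H1[OF h, of n]]
        have "(\<lambda>x. potential_reg n (f k) x - potential_reg n h x) = (\<lambda>x. (cut_logit (reg_seq n) (f k x) - cut_logit (reg_seq n) (h x))
            + (clamp_convol (f k) x - clamp_convol h x))" by (rule ext) (simp add: potential_reg_def)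
        then have "nrm (H1 S) (\<lambda>x. potential_reg n (f k) x - potential_reg n h x)
            \<le> nrm (H1 S) (\<lambda>x. cut_logit (reg_seq n) (f k x) - cut_logit (reg_seq n) (h x))
              + nrm (H1 S) (\<lambda>x. clamp_convol (f k) x - clamp_convol h x)"
          using H1.nrm_add[OF c clamp_convol_diff(1)[OF fL]] by simp
        moreover have "nrm (H1 S) (\<lambda>x. clamp_convol (f k) x - clamp_convol h x) \<le> 2 * r * nrm L2 (\<lambda>x. f k x - h x)"
          by (rule clamp_convol_diff(2)[OF fL])
        moreover have "2 * r * nrm L2 (\<lambda>x. f k x - h x) \<le> 2 * r * nrm (H1 S) (\<lambda>x. f k x - h x)"
          using r by (intro mult_left_mono) (auto simp: nrm_H1 nrm_L2_nonneg sum_nonneg)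
        ultimately show ?thesis using H1.nrm_nonneg[OF p] by (simp add: mult_ac)
      qed
      then have le: "\<forall>\<^sub>F k in sequentially. \<bar>nrm (H1 S) (\<lambda>x. potential_reg n (f k) x - potential_reg n h x) - 0\<bar> \<le> ?A k * 1"
        by (intro always_eventually allI)
      have "?A \<longlonglongrightarrow> 0" using tendsto_add[OF 1 tendsto_mult_right[OF l, of "2 * r"]] by simp
      from tendsto_if_abs_diff_le[OF this le]
      have "(\<lambda>k. nrm (H1 S) (\<lambda>x. potential_reg n (f k) x - potential_reg n h x)) \<longlonglongrightarrow> 0" .
      then show "(\<lambda>k. nrm (H1 S) (\<lambda>x. potential_reg n (f k) x - potential_reg n (\<lambda>x. u (x, t)) x)) \<longlonglongrightarrow> 0"
        by (simp add: h_def)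
    qed
  qed
qed

text \<open>v is the sum of f'(u), in \<open>H1\<close> by the singular energy bounds, and of w,
  bounded in \<open>H1\<close> uniformly in time. The gradient estimate uses (a + b)^2 \<le> 2 a^2 +
  2 b^2, and \<open>E\<close> is the larger of the constants of the two estimates.\<close>

lemma potential_regularity:
  obtains E where "0 \<le> E" "AE t in I. (AE x in M. 0 < u (x, t) \<and> u (x, t) < 1) \<and> potential_v K S u t \<in> vecs (H1 S)
      \<and> nrm L2 (potential_v K S u t) \<le> E"
    "AE t in I. (nrm (Lp_space M 2) (weak_grad S (potential_v K S u t)))\<^sup>2 \<le> 2 * (LINT x|M. (norm (singular_grad t x))\<^sup>2) + E"
    "integrable I (\<lambda>t. \<integral>x. (norm (singular_grad t x))\<^sup>2 \<partial>M)" "strongly_measurable T (H1 S) (potential_v K S u)"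
proof -
  obtain E where E: "0 \<le> E" "AE t in I. (\<lambda>x. u (x, t)) \<in> vecs (H1 S) \<and> (AE x in M. 0 < u (x, t) \<and> u (x, t) < 1)
      \<and> (\<lambda>x. f_prime (u (x, t))) \<in> vecs L2 \<and> (nrm L2 (\<lambda>x. f_prime (u (x, t))))\<^sup>2 \<le> E \<and> singular_grad t \<in> vecs (Lp_space M 2)"
    "integrable I (\<lambda>t. \<integral>x. (norm (singular_grad t x))\<^sup>2 \<partial>M)"
    using singular_energy by blast
  define Q where "Q = r * nrm L2 (\<lambda>x. 5)"
  have Q: "0 \<le> Q" using r by (simp add: Q_def nrm_L2_nonneg)
  interpret V: seminormed "Lp_space M 2 :: ('a, 'a) fspace" by (rule L2_seminormed)
  let ?v = "potential_v K S u"
  have main: "AE t in I. (AE x in M. 0 < u (x, t) \<and> u (x, t) < 1) \<and> ?v t \<in> vecs (H1 S) \<and> nrm L2 (?v t) \<le> sqrt E + Q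
     \<and> (nrm (Lp_space M 2) (weak_grad S (?v t)))\<^sup>2 \<le> 2 * (LINT x|M. (norm (singular_grad t x))\<^sup>2) + 2 * Q\<^sup>2
     \<and> (\<lambda>n. nrm (H1 S) (\<lambda>x. potential_reg n (\<lambda>x. u (x, t)) x - ?v t x)) \<longlonglongrightarrow> 0"
    using E(2)
  proof eventually_elim
    case (elim t)
    define f where "f = (\<lambda>x. u (x, t))"
    have f: "f \<in> vecs (H1 S)" "AE x in M. 0 < f x \<and> f x < 1" "(\<lambda>x. f_prime (f x)) \<in> vecs L2"
      "(nrm L2 (\<lambda>x. f_prime (f x)))\<^sup>2 \<le> E" "singular_grad t \<in> vecs (Lp_space M 2)"
      using elim by (auto simp: f_def)
    have s: "singular_grad t = (\<lambda>x. (1 / (f x * (1 - f x))) *\<^sub>R weak_grad S f x)"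
      by (rule ext) (simp add: singular_grad_def f_def)
    note F = H1_f_prime[OF S f(1-3) f(5)[unfolded s]] weak_grad_f_prime[OF S f(1-3) f(5)[unfolded s]]
      H1_cut_logit_tendsto[OF S f(1-3) f(5)[unfolded s]]
    have fm: "f \<in> borel_measurable M" using f(1) by (simp add: mem_H1 mem_L2)
    have w: "nonlocal_w K S u t = clamp_convol f"
      unfolding f_def
    proof (rule nonlocal_w_eq)
      show "(\<lambda>x. u (x, t)) \<in> borel_measurable M" using fm by (simp add: f_def)
      show "AE x in M. 0 \<le> u (x, t) \<and> u (x, t) \<le> 1" using f(2) by eventually_elim (simp add: f_def)
    qed
    note c = clamp_convol_H1[OF fm, folded Q_def]
    have v: "?v t = (\<lambda>x. f_prime (f x) + clamp_convol f x)" by (rule ext) (simp add: potential_v_def w f_def)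
    have vH: "?v t \<in> vecs (H1 S)" using H1.lin_in[OF F(1) c(1), of 1 1] by (simp add: v)
    have cL: "clamp_convol f \<in> vecs L2" "nrm L2 (clamp_convol f) \<le> Q"
    proof -
      show "clamp_convol f \<in> vecs L2" using c(1) by (simp add: mem_H1)
      have "nrm L2 (clamp_convol f) \<le> nrm (H1 S) (clamp_convol f)" by (simp add: nrm_H1 nrm_L2_nonneg sum_nonneg)
      then show "nrm L2 (clamp_convol f) \<le> Q" using c(2) by linarith
    qed
    have "nrm L2 (?v t) \<le> nrm L2 (\<lambda>x. f_prime (f x)) + nrm L2 (clamp_convol f)"
      unfolding v by (rule L2.nrm_add[OF f(3) cL(1)])
    also have "nrm L2 (\<lambda>x. f_prime (f x)) \<le> sqrt E" using f(4) by (rule real_le_rsqrt)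
    finally have vn: "nrm L2 (?v t) \<le> sqrt E + Q" using cL(2) by simp
    have gm: "AE x in M. weak_grad S (?v t) x = singular_grad t x + weak_grad S (clamp_convol f) x"
    proof -
      have "AE x in M. weak_grad S (\<lambda>x. ?v t x - clamp_convol f x) x = weak_grad S (?v t) x - weak_grad S (clamp_convol f) x"
        by (rule weak_grad_diff[OF S(1) vH c(1)])
      moreover have "(\<lambda>x. ?v t x - clamp_convol f x) = (\<lambda>x. f_prime (f x))" by (simp add: v)
      ultimately have "AE x in M. weak_grad S (\<lambda>x. f_prime (f x)) x = weak_grad S (?v t) x - weak_grad S (clamp_convol f) x" by simp
      with F(2) show ?thesis by eventually_elim (simp only: s diff_eq_eq)
    qed
    have wL: "weak_grad S (clamp_convol f) \<in> vecs (Lp_space M 2)" by (rule weak_grad_L2(1)[OF S(1) c(1)])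
    have wn: "(nrm (Lp_space M 2) (weak_grad S (clamp_convol f)))\<^sup>2 \<le> Q\<^sup>2"
    proof -
      have "(nrm (Lp_space M 2) (weak_grad S (clamp_convol f)))\<^sup>2 = (LINT x|M. (norm (weak_grad S (clamp_convol f) x))\<^sup>2)"
        by (simp add: nrm_L2)
      also have "\<dots> \<le> (nrm (H1 S) (clamp_convol f))\<^sup>2" by (rule weak_grad_energy_le_H1[OF S(1) c(1)])
      also have "\<dots> \<le> Q\<^sup>2" using c(2) H1.nrm_nonneg[OF c(1)] by (intro power_mono)
      finally show ?thesis .
    qed
    let ?a = "nrm (Lp_space M 2) (singular_grad t)" and ?b = "nrm (Lp_space M 2) (weak_grad S (clamp_convol f))"
    have vg: "(nrm (Lp_space M 2) (weak_grad S (?v t)))\<^sup>2 \<le> 2 * (LINT x|M. (norm (singular_grad t x))\<^sup>2) + 2 * Q\<^sup>2"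
    proof -
      have m: "(\<lambda>x. singular_grad t x + weak_grad S (clamp_convol f) x) \<in> borel_measurable M"
        using f(5) wL by (auto simp: mem_L2)
      have "nrm (Lp_space M 2) (weak_grad S (?v t)) = nrm (Lp_space M 2) (\<lambda>x. singular_grad t x + weak_grad S (clamp_convol f) x)"
        by (rule L2_cong_AE(2)[OF weak_grad_L2(1)[OF S(1) vH] m gm, symmetric])
      also have "\<dots> \<le> ?a + ?b" by (rule V.nrm_add[OF f(5) wL])
      finally have "(nrm (Lp_space M 2) (weak_grad S (?v t)))\<^sup>2 \<le> (?a + ?b)\<^sup>2" by (intro power_mono nrm_L2_nonneg)
      also have "\<dots> \<le> 2 * ?a\<^sup>2 + 2 * ?b\<^sup>2" using zero_le_power2[of "?a - ?b"] by (simp add: power2_eq_square algebra_simps)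
      also have "?a\<^sup>2 = (LINT x|M. (norm (singular_grad t x))\<^sup>2)" by (simp add: nrm_L2)
      finally show ?thesis using wn by simp
    qed
    have "(\<lambda>x. potential_reg n f x - ?v t x) = (\<lambda>x. cut_logit (reg_seq n) (f x) - f_prime (f x))" for n
      by (rule ext) (simp add: potential_reg_def v)
    then have "(\<lambda>n. nrm (H1 S) (\<lambda>x. potential_reg n f x - ?v t x)) \<longlonglongrightarrow> 0" using F(3) by simp
    then show ?case using f(2) vH vn vg by (simp add: f_def)
  qed
  have m: "strongly_measurable T (H1 S) ?v"
  proof (rule H1.strongly_measurable_limit[OF T potential_reg_measurable])
    show "AE t in I. potential_reg k (\<lambda>x. u (x, t)) \<in> vecs (H1 S)" for k
      using u_H1 by eventually_elim (rule potential_reg_H1)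
    show "AE t in I. ?v t \<in> vecs (H1 S)" using main by eventually_elim simp
    show "AE t in I. (\<lambda>k. nrm (H1 S) (\<lambda>x. potential_reg k (\<lambda>x. u (x, t)) x - ?v t x)) \<longlonglongrightarrow> 0"
      using main by eventually_elim simp
  qed
  show ?thesis
  proof (rule that[OF _ _ _ E(3) m])
    show "0 \<le> max (sqrt E + Q) (2 * Q\<^sup>2)" by (simp add: le_max_iff_disj)
    show "AE t in I. (AE x in M. 0 < u (x, t) \<and> u (x, t) < 1) \<and> ?v t \<in> vecs (H1 S) \<and> nrm L2 (?v t) \<le> max (sqrt E + Q) (2 * Q\<^sup>2)"
      using main by eventually_elim auto
    show "AE t in I. (nrm (Lp_space M 2) (weak_grad S (?v t)))\<^sup>2 \<le> 2 * (LINT x|M. (norm (singular_grad t x))\<^sup>2) + max (sqrt E + Q) (2 * Q\<^sup>2)"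
      using main by eventually_elim auto
  qed
qed

lemma strongly_measurable_H1_L2:
  assumes z: "strongly_measurable T (H1 S) z" "AE t in I. z t \<in> vecs (H1 S)"
  shows "strongly_measurable T L2 z" "strongly_measurable T (Lp_space M 2) (\<lambda>t. weak_grad S (z t))"
proof -
  have n: "nrm L2 f \<le> nrm (H1 S) f" for f by (simp add: nrm_H1 nrm_L2_nonneg sum_nonneg)
  have "strongly_measurable T L2 (\<lambda>t. id (z t))"
  proof (rule strongly_measurable_compose[OF z(1)])
    show "id f \<in> vecs L2" if "f \<in> vecs (H1 S)" for f using that by (simp add: mem_H1)
    show "AE t in I. \<forall>f. (\<forall>n. f n \<in> vecs (H1 S)) \<longrightarrow> (\<lambda>n::nat. nrm (H1 S) (\<lambda>x. f n x - z t x)) \<longlonglongrightarrow> 0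
        \<longrightarrow> (\<lambda>n. nrm L2 (\<lambda>x. id (f n) x - id (z t) x)) \<longlonglongrightarrow> 0"
    proof (intro AE_I2 allI impI)
      fix t and f :: "nat \<Rightarrow> 'a \<Rightarrow> real"
      assume l: "(\<lambda>n. nrm (H1 S) (\<lambda>x. f n x - z t x)) \<longlonglongrightarrow> 0"
      show "(\<lambda>n. nrm L2 (\<lambda>x. id (f n) x - id (z t) x)) \<longlonglongrightarrow> 0"
        by (rule tendsto_if_abs_diff_le[OF l, of _ 0 1]) (use n in \<open>simp add: nrm_L2_nonneg\<close>)
    qed
  qed
  then show "strongly_measurable T L2 z" by simp
  show "strongly_measurable T (Lp_space M 2) (\<lambda>t. weak_grad S (z t))"
  proof (rule strongly_measurable_compose[OF z(1)])
    show "weak_grad S f \<in> vecs (Lp_space M 2)" if "f \<in> vecs (H1 S)" for f by (rule weak_grad_L2(1)[OF S(1) that])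
    show "AE t in I. \<forall>f. (\<forall>n. f n \<in> vecs (H1 S)) \<longrightarrow> (\<lambda>n::nat. nrm (H1 S) (\<lambda>x. f n x - z t x)) \<longlonglongrightarrow> 0
        \<longrightarrow> (\<lambda>n. nrm (Lp_space M 2) (\<lambda>x. weak_grad S (f n) x - weak_grad S (z t) x)) \<longlonglongrightarrow> 0"
      using z(2)
    proof eventually_elim
      case (elim t)
      show ?case
      proof (intro allI impI)
        fix f :: "nat \<Rightarrow> 'a \<Rightarrow> real"
        assume f: "\<forall>n. f n \<in> vecs (H1 S)" and l: "(\<lambda>n. nrm (H1 S) (\<lambda>x. f n x - z t x)) \<longlonglongrightarrow> 0"
        have "nrm (Lp_space M 2) (\<lambda>x. weak_grad S (f n) x - weak_grad S (z t) x) \<le> nrm (H1 S) (\<lambda>x. f n x - z t x)" for n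
        proof -
          have fn: "f n \<in> vecs (H1 S)" using f by simp
          note b = H1_diff_square_bound[OF S(1) fn elim]
          have "0 \<le> (LINT x|M. (f n x - z t x)\<^sup>2)" by simp
          with b(3) have "(LINT x|M. (norm (weak_grad S (f n) x - weak_grad S (z t) x))\<^sup>2) \<le> (nrm (H1 S) (\<lambda>x. f n x - z t x))\<^sup>2"
            by linarith
          then show ?thesis unfolding nrm_L2
            by (rule real_le_lsqrt[OF _ , rotated 1]) (simp add: H1.nrm_nonneg[OF H1.diff_in[OF fn elim]])
        qed
        then show "(\<lambda>n. nrm (Lp_space M 2) (\<lambda>x. weak_grad S (f n) x - weak_grad S (z t) x)) \<longlonglongrightarrow> 0"
          by (intro tendsto_if_abs_diff_le[OF l, of _ 0 1]) (simp add: nrm_L2_nonneg)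
      qed
    qed
  qed
qed

lemma potential_conclusion:
  "AE t in I. AE x in M. 0 < u (x, t) \<and> u (x, t) < 1"
  "potential_v K S u \<in> Bochner_Lp T \<infinity> L2"
  "AE t in I. weakly_differentiable S (potential_v K S u t)"
  "(\<lambda>t. weak_grad S (potential_v K S u t)) \<in> Bochner_Lp T 2 (Lp_space M 2)"
proof -
  let ?v = "potential_v K S u"
  obtain E where E: "0 \<le> E" "AE t in I. (AE x in M. 0 < u (x, t) \<and> u (x, t) < 1) \<and> ?v t \<in> vecs (H1 S) \<and> nrm L2 (?v t) \<le> E"
    "AE t in I. (nrm (Lp_space M 2) (weak_grad S (?v t)))\<^sup>2 \<le> 2 * (LINT x|M. (norm (singular_grad t x))\<^sup>2) + E"
    "integrable I (\<lambda>t. \<integral>x. (norm (singular_grad t x))\<^sup>2 \<partial>M)" "strongly_measurable T (H1 S) ?v"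
    by (rule potential_regularity)
  have H: "AE t in I. ?v t \<in> vecs (H1 S)" using E(2) by eventually_elim simp
  interpret V: seminormed "Lp_space M 2 :: ('a, 'a) fspace" by (rule L2_seminormed)
  note sm = strongly_measurable_H1_L2[OF E(5) H]
  have L: "AE t in I. ?v t \<in> vecs L2" using H by eventually_elim (simp add: mem_H1)
  have G: "AE t in I. weak_grad S (?v t) \<in> vecs (Lp_space M 2)" using H by eventually_elim (rule weak_grad_L2(1)[OF S(1)])
  show "AE t in I. AE x in M. 0 < u (x, t) \<and> u (x, t) < 1" using E(2) by eventually_elim simp
  have "(\<lambda>t. nrm L2 (?v t)) \<in> vecs (Lp_space I \<infinity>)"
  proof (rule Linf_I(1)[OF L2.strongly_measurable_nrm[OF sm(1) L] _ E(1)])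
    show "AE t in I. \<bar>nrm L2 (?v t)\<bar> \<le> E" using E(2) by eventually_elim (simp add: nrm_L2_nonneg)
  qed
  then show "?v \<in> Bochner_Lp T \<infinity> L2" using L sm(1) by (simp add: Bochner_Lp_def)
  show "AE t in I. weakly_differentiable S (?v t)"
    using H by eventually_elim (auto simp: weakly_differentiable_def mem_H1)
  let ?n = "\<lambda>t. nrm (Lp_space M 2) (weak_grad S (?v t))"
  have nm: "?n \<in> borel_measurable I" by (rule V.strongly_measurable_nrm[OF sm(2) G])
  have "integrable I (\<lambda>t. (?n t)\<^sup>2)"
  proof (rule Bochner_Integration.integrable_bound)
    show "integrable I (\<lambda>t. 2 * (LINT x|M. (norm (singular_grad t x))\<^sup>2) + E)" using E(4) by simp
    show "(\<lambda>t. (?n t)\<^sup>2) \<in> borel_measurable I" using nm by measurable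
    show "AE t in I. norm ((?n t)\<^sup>2) \<le> norm (2 * (LINT x|M. (norm (singular_grad t x))\<^sup>2) + E)"
      using E(3) by eventually_elim (use E(1) in simp)
  qed
  then have "?n \<in> vecs (Lp_space I 2)" using nm by (simp add: mem_L2)
  then show "(\<lambda>t. weak_grad S (?v t)) \<in> Bochner_Lp T 2 (Lp_space M 2)" using G sm(2) by (simp add: Bochner_Lp_def)
qed

end

theorem theorem9:
  fixes \<Omega> :: "(real ^ 'n) set" and T :: real
    and K :: "real ^ 'n \<Rightarrow> real"
    and g :: "real ^ 'n \<Rightarrow> real \<Rightarrow> real \<Rightarrow> real"
    and u0 :: "real ^ 'n \<Rightarrow> real"
    and u :: "(real ^ 'n) \<times> real \<Rightarrow> real"
  assumes "open \<Omega>" "connected \<Omega>" "\<Omega> \<noteq> {}" "bounded \<Omega>" "C11_boundary \<Omega>"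
    and "0 < T"
    and "K \<in> borel_measurable lebesgue"
    and "AE x in lebesgue. K x = K (- x)"
    and "(SUP x\<in>\<Omega>. \<integral>\<^sup>+ y. ennreal \<bar>K (x - y)\<bar> \<partial>lebesgue_on \<Omega>) < \<infinity>"
    and "\<And>p::ennreal. 1 \<le> p \<Longrightarrow> \<exists>r>0. \<forall>\<rho>\<in>vecs (Lp_space (lebesgue_on \<Omega>) p).
           convol K \<Omega> \<rho> \<in> vecs (Sobolev 1 p \<Omega>) \<and>
           nrm (Sobolev 1 p \<Omega>) (convol K \<Omega> \<rho>) \<le> r * nrm (Lp_space (lebesgue_on \<Omega>) p) \<rho>"
    and "\<exists>C>0. \<forall>\<rho>\<in>vecs (Sobolev 1 2 \<Omega>).
           convol K \<Omega> \<rho> \<in> vecs (Sobolev 2 2 \<Omega>) \<and>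
           nrm (Sobolev 2 2 \<Omega>) (convol K \<Omega> \<rho>) \<le> C * nrm (Sobolev 1 2 \<Omega>) \<rho>"
    and "continuous_on (\<Omega> \<times> {0..} \<times> {0..1}) (\<lambda>(x, t, s). g x t s)"
    and "\<exists>L>0. \<forall>x\<in>\<Omega>. \<forall>t\<ge>0. \<forall>s1\<in>{0..1}. \<forall>s2\<in>{0..1}.
           \<bar>g x t s1 - g x t s2\<bar> \<le> L * \<bar>s1 - s2\<bar>"
    and "\<forall>x\<in>\<Omega>. \<forall>t\<ge>0. g x t 0 \<ge> 0 \<and> 0 \<ge> g x t 1"
    and "u0 \<in> borel_measurable (lebesgue_on \<Omega>)"
    and "AE x in lebesgue_on \<Omega>. 0 \<le> u0 x \<and> u0 x \<le> 1"
    and "0 < mean_value \<Omega> u0" "mean_value \<Omega> u0 < 1"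
    and "AE x in lebesgue_on \<Omega>. 0 < u0 x \<and> u0 x < 1"
    and "(\<lambda>x. f_prime (u0 x)) \<in> vecs (Lp_space (lebesgue_on \<Omega>) 2)"
    and "weak_solution \<Omega> T K g u0 u"
  shows "(AE z in lebesgue_on (\<Omega> \<times> {0<..<T}). 0 < u z \<and> u z < 1) \<and>
    potential_v K \<Omega> u \<in> Bochner_Lp T \<infinity> (Lp_space (lebesgue_on \<Omega>) 2) \<and>
    (AE t in lebesgue_on {0<..<T}. weakly_differentiable \<Omega> (potential_v K \<Omega> u t)) \<and>
    (\<lambda>t. weak_grad \<Omega> (potential_v K \<Omega> u t)) \<in> Bochner_Lp T 2 (Lp_space (lebesgue_on \<Omega>) 2)"
proof -
  note a = assms
  let ?M = "lebesgue_on \<Omega>" and ?I = "lebesgue_on {0<..<T}"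
  let ?L2 = "Lp_space ?M 2 :: (real ^ 'n, real) fspace"
  interpret L2: seminormed ?L2 by (rule L2_seminormed)
  have Mf: "finite_measure ?M" using a(1,4) by (intro finite_measure_lebesgue_on) auto
  have If: "finite_measure ?I" by (intro finite_measure_lebesgue_on) auto
  \<comment> \<open>The exponent 2 controls w in \<open>H1\<close>; the exponent \<infinity> below
    bounds \<nabla>w pointwise.\<close>
  obtain r where r: "0 < r" "\<And>\<rho>. \<rho> \<in> vecs ?L2 \<Longrightarrow> convol K \<Omega> \<rho> \<in> vecs (H1 \<Omega>) \<and> nrm (H1 \<Omega>) (convol K \<Omega> \<rho>) \<le> r * nrm ?L2 \<rho>"
    using a(10)[of 2] by auto
  obtain R where R: "0 < R" "\<And>\<rho>. \<rho> \<in> vecs (Lp_space ?M \<infinity>) \<Longrightarrow> convol K \<Omega> \<rho> \<in> vecs (Sobolev 1 \<infinity> \<Omega>) \<and>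
       nrm (Sobolev 1 \<infinity> \<Omega>) (convol K \<Omega> \<rho>) \<le> R * nrm (Lp_space ?M \<infinity>) \<rho>"
    using a(10)[of \<infinity>] by auto
  obtain L where L: "0 < L" "\<forall>x\<in>\<Omega>. \<forall>t\<ge>0. \<forall>s1\<in>{0..1}. \<forall>s2\<in>{0..1}. \<bar>g x t s1 - g x t s2\<bar> \<le> L * \<bar>s1 - s2\<bar>"
    using a(13) by blast
  note w = a(21)[unfolded weak_solution_def]
  have um: "u \<in> borel_measurable (lebesgue_on (\<Omega> \<times> {0<..<T}))" using w by (rule conjunct1)
  have uB: "(\<lambda>t x. u (x, t)) \<in> Bochner_Lp T 2 (H1 \<Omega>)" using w by (elim conjE)
  have u01': "AE z in lebesgue_on (\<Omega> \<times> {0<..<T}). 0 \<le> u z \<and> u z \<le> 1" using w by (elim conjE)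
  have u01: "AE t in ?I. AE x in ?M. 0 \<le> u (x, t) \<and> u (x, t) \<le> 1" by (rule AE_lebesgue_on_slice[OF a(1) u01'])
  have u_H1: "AE t in ?I. (\<lambda>x. u (x, t)) \<in> vecs (H1 \<Omega>)" "strongly_measurable T (H1 \<Omega>) (\<lambda>t x. u (x, t))"
      "integrable ?I (\<lambda>t. (nrm (H1 \<Omega>) (\<lambda>x. u (x, t)))\<^sup>2)"
    using uB by (auto simp: Bochner_Lp_def mem_L2)
  obtain u' where u': "continuous_representative T ?L2 (\<lambda>t x. u (x, t)) u'" "AE x in ?M. u' 0 x = u0 x"
    using w by (elim conjE exE) blast
  obtain \<xi> where \<xi>: "\<xi> \<in> Bochner_Lp T 2 (dual_space (H1 \<Omega>))" "has_time_derivative \<Omega> T (\<lambda>t x. u (x, t)) \<xi>"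
    "AE t in ?I. \<forall>\<psi>\<in>vecs (H1 \<Omega>).
           \<xi> t \<psi>
           + (LINT x|lebesgue_on \<Omega>. (mobility (u (x, t)) *\<^sub>R weak_grad \<Omega> (nonlocal_w K \<Omega> u t) x)
                   \<bullet> weak_grad \<Omega> \<psi> x)
           + (LINT x|lebesgue_on \<Omega>. weak_grad \<Omega> (\<lambda>y. u (y, t)) x \<bullet> weak_grad \<Omega> \<psi> x)
           = (LINT x|lebesgue_on \<Omega>. g x t (u (x, t)) * \<psi> x)"
    using w by (elim conjE bexE)
  \<comment> \<open>Truncation is 1-Lipschitz, so it preserves L2 continuity in time, and it changes
    nothing where u lies in [0, 1]. The bounds then hold at every time and point, as the convexity
    inequality between two arbitrary times requires.\<close>
  define U where "U t x = max 0 (min 1 (u' t x))" for t x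
  have u'L: "u' t \<in> vecs ?L2" if "t \<in> {0..T}" for t
    using u'(1) that by (simp add: continuous_representative_def C_time_def)
  have UL: "U t \<in> vecs ?L2" if t: "t \<in> {0..T}" for t
  proof (rule L2_norm_mono(1)[OF u'L[OF t]])
    have [measurable]: "u' t \<in> borel_measurable ?M" using u'L[OF t] by (simp add: mem_L2)
    show "U t \<in> borel_measurable ?M" unfolding U_def[abs_def] by measurable
  qed (simp add: U_def)
  interpret CH_potential \<Omega> T R L g u0 u U "\<lambda>t. weak_grad \<Omega> (nonlocal_w K \<Omega> u t)" \<xi> K r
  proof
    show "open \<Omega>" "bounded \<Omega>" "0 < T" "0 \<le> R" "0 < L" "0 < r" "K \<in> borel_measurable lebesgue"
      "(SUP x\<in>\<Omega>. \<integral>\<^sup>+ y. ennreal \<bar>K (x - y)\<bar> \<partial>?M) < \<infinity>" "continuous_on (\<Omega> \<times> {0..} \<times> {0..1}) (\<lambda>(x, t, s). g x t s)"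
      using a r(1) R(1) L(1) by auto
    show "\<bar>g x t s1 - g x t s2\<bar> \<le> L * \<bar>s1 - s2\<bar>"
      if "x \<in> \<Omega>" "0 \<le> t" "0 \<le> s1" "s1 \<le> 1" "0 \<le> s2" "s2 \<le> 1" for x t s1 s2
      using L(2) that by auto
    show "0 \<le> g x t 0 \<and> g x t 1 \<le> 0" if "x \<in> \<Omega>" "0 \<le> t" for x t using a(14) that by auto
    show "AE t in ?I. weak_grad \<Omega> (nonlocal_w K \<Omega> u t) \<in> borel_measurable ?M \<and> (AE x in ?M. norm (weak_grad \<Omega> (nonlocal_w K \<Omega> u t) x) \<le> R)"
      using u01 u_H1(1)
    proof eventually_elim
      case (elim t)
      have [measurable]: "(\<lambda>x. u (x, t)) \<in> borel_measurable ?M" using elim(2) by (simp add: mem_H1 mem_L2)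
      have m: "(\<lambda>x. 1 - 2 * u (x, t)) \<in> borel_measurable ?M" by measurable
      have b: "AE x in ?M. \<bar>1 - 2 * u (x, t)\<bar> \<le> 1" using elim(1) by eventually_elim auto
      show ?case unfolding nonlocal_w_def
        using convolution_gradient_bound[OF a(1,3) R(2,1) m b] by blast
    qed
    show "0 \<le> U t x" "U t x \<le> 1" for t x by (auto simp: U_def)
    show "U t \<in> vecs ?L2" if "t \<in> {0..T}" for t by (rule UL[OF that])
    show "((\<lambda>s. nrm ?L2 (\<lambda>x. U s x - U t x)) \<longlongrightarrow> 0) (at t within {0..T})" if t: "t \<in> {0..T}" for t
    proof (rule tendsto_if_abs_diff_le[where c = 1])
      show "((\<lambda>s. nrm ?L2 (\<lambda>x. u' s x - u' t x)) \<longlongrightarrow> 0) (at t within {0..T})"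
        using u'(1) t by (simp add: continuous_representative_def C_time_def)
      have "nrm ?L2 (\<lambda>x. U s x - U t x) \<le> nrm ?L2 (\<lambda>x. u' s x - u' t x)" if s: "s \<in> {0..T}" for s
      proof (rule L2_norm_mono(2)[OF L2.diff_in[OF u'L[OF s] u'L[OF t]]])
        show "(\<lambda>x. U s x - U t x) \<in> borel_measurable ?M" using L2.diff_in[OF UL[OF s] UL[OF t]] by (simp add: mem_L2)
      qed (auto simp: U_def)
      then show "\<forall>\<^sub>F s in at t within {0..T}. \<bar>nrm ?L2 (\<lambda>x. U s x - U t x) - 0\<bar> \<le> nrm ?L2 (\<lambda>x. u' s x - u' t x) * 1"
        by (simp add: eventually_at_filter nrm_L2_nonneg)
    qed
    have "AE t in ?I. (\<lambda>x. u (x, t)) \<in> vecs ?L2 \<and> nrm ?L2 (\<lambda>x. u' t x - u (x, t)) = 0"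
      using u'(1) by (simp add: continuous_representative_def)
    then show "AE t in ?I. AE x in ?M. U t x = u (x, t)"
      using u01 AE_space[of ?I]
    proof eventually_elim
      case (elim t)
      have t: "t \<in> {0..T}" using elim(3) by simp
      have "(\<lambda>x. u' t x - u (x, t)) \<in> vecs ?L2" using elim(1) by (intro L2.diff_in u'L[OF t]) simp
      then have i: "integrable ?M (\<lambda>x. (u' t x - u (x, t))\<^sup>2)" by (simp add: mem_L2)
      have "(LINT x|?M. (u' t x - u (x, t))\<^sup>2) = 0" using elim(1) by (simp add: nrm_L2)
      then have "AE x in ?M. (u' t x - u (x, t))\<^sup>2 = 0"
        using integral_nonneg_eq_0_iff_AE[OF i] by simp
      with elim(2) show ?case by eventually_elim (simp add: U_def)
    qed
    show "AE x in ?M. U 0 x = u0 x" using u'(2) a(16) by eventually_elim (simp add: U_def)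
    show "strongly_measurable T (dual_space (H1 \<Omega>)) \<xi>" "AE t in ?I. \<xi> t \<in> vecs (dual_space (H1 \<Omega>))"
      using \<xi>(1) by (simp_all add: Bochner_Lp_def)
    have "(\<lambda>t. nrm (dual_space (H1 \<Omega>)) (\<xi> t)) \<in> vecs (Lp_space ?I 2)" using \<xi>(1) by (simp add: Bochner_Lp_def)
    then show "integrable ?I (\<lambda>t. nrm (dual_space (H1 \<Omega>)) (\<xi> t))" by (rule L2_L1_bound(1)[OF If])
  qed (fact u_H1 u01 \<xi>(2,3) a(19,20) r(2))+
  \<comment> \<open>The bounds are known on almost every time slice; joint measurability of u makes
    the exceptional set measurable, so they hold almost everywhere on the space-time
    cylinder.\<close>
  have "AE z in lebesgue_on (\<Omega> \<times> {0<..<T}). 0 < u z \<and> u z < 1"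
  proof (rule AE_lebesgue_on_from_slices[OF a(1) _ potential_conclusion(1)])
    have o: "\<Omega> \<times> {0<..<T} \<in> sets lebesgue" using a(1) by (simp add: open_Times)
    have "{z \<in> space (lebesgue_on (\<Omega> \<times> {0<..<T})). \<not> (0 < u z \<and> u z < 1)} \<in> sets (lebesgue_on (\<Omega> \<times> {0<..<T}))"
      using um by measurable
    with o show "{z \<in> \<Omega> \<times> {0<..<T}. \<not> (0 < u z \<and> u z < 1)} \<in> sets lebesgue" by (simp add: sets_restrict_space_iff)
  qed
  with potential_conclusion(2-4) show ?thesis by blast
qed

end
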